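(* Let $y$ be the output of the mean square asymptotically stable system $$dx(t)=[Ax(t)+Bu(t)]\,dt+\sum_{i=1}^q[N_ix(t)+M_iu(t)]\,dw_i(t),\quad x(0)=0,\qquad y(t)=Cx(t)+Du(t),\quad t\in[0,T].$$ Let $P$ and $Q$ be a reachability and an observability Gramian of this system (as defined in the context), and assume that the system has a balanced realization, i.e. there is an invertible $T_b\in\mathbb R^{n\times n}$ with $T_bPT_b^\top=T_b^{-\top}QT_b^{-1}=\Sigma=\mathrm{diag}(\sigma_1,\dots,\sigma_n)$ (this holds, e.g., if $Q>0$). Let $y_r$ be the output of the $r$-dimensional ($r<n$) reduced system $$dx_r(t)=[A_{11}x_r(t)+B_1u(t)]\,dt+\sum_{i=1}^q[N_{i,11}x_r(t)+M_{i,1}u(t)]\,dw_i(t),\quad x_r(0)=0,\qquad y_r(t)=C_1x_r(t)+Du(t),$$ obtained by truncating the balanced realization. Then, for all $u\in L^2_T$, $$\|y-y_r\|_{L^2_T}\le 2\gamma^{\frac12}\sum_{k=r+1}^n\sigma_k\,\|u\|_{L^2_T}.$$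
   Context: Setting: $(\Omega,\mathcal F,(\mathcal F_t),\mathbb P)$ is a filtered probability space with right-continuous and complete filtration; $w=(w_1,\dots,w_q)^\top$ is an $\mathbb R^q$-valued $(\mathcal F_t)$-adapted Wiener process whose increments $w(t+h)-w(t)$ are independent of $\mathcal F_t$, with covariance matrix $K=(k_{ij})_{i,j=1,\dots,q}$, i.e. $\mathbb E[w(t)w(t)^\top]=Kt$. The coefficients are $A,N_i\in\mathbb R^{n\times n}$, $B,M_i\in\mathbb R^{n\times m}$, $C\in\mathbb R^{p\times n}$, $D\in\mathbb R^{p\times m}$. $\|f\|_{L^2_T}^2=\mathbb E\int_0^T\|f(t)\|_2^2dt$; $u\in L^2_T$ means that $u$ is an $\mathbb R^m$-valued $(\mathcal F_t)$-adapted control with $\|u\|_{L^2_T}<\infty$. Mean square asymptotic stability means: for $u\equiv0$ and any initial state $x_0\in\mathbb R^n$, $\mathbb E\|x(t)\|_2^2\to0$ as $t\to\infty$. For symmetric matrices, $M_1\ge M_2$ ($M_1>M_2$) means $M_1-M_2$ is positive semidefinite (definite). Operators: $L(X)=A^\top X+XA+\sum_{i,j=1}^qN_i^\top XN_jk_{ij}$, $S(X)=XB+\sum_{i,j=1}^qN_i^\top XM_jk_{ij}$, $U(X)=\gamma I-\sum_{i,j=1}^qM_i^\top XM_jk_{ij}$, with a fixed $\gamma>0$. Reachability Gramian: a symmetric $P>0$ with $U(P^{-1})>0$ and $L(P^{-1})+S(P^{-1})U(P^{-1})^{-1}S(P^{-1})^\top\le0$. Observability Gramian: a symmetric $Q\ge0$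 with $L(Q)+C^\top C\le0$. The $\sigma_i=\sqrt{\lambda_i(PQ)}$ are the Hankel singular values, ordered so that $\Sigma_1=\mathrm{diag}(\sigma_1,\dots,\sigma_r)$ contains the large ones and $\mathrm{diag}(\sigma_{r+1},\dots,\sigma_n)$ the small ones. Reduced coefficients: $A_{11},N_{i,11}\in\mathbb R^{r\times r}$ are the upper left blocks of $T_bAT_b^{-1},T_bN_iT_b^{-1}$; $B_1,M_{i,1}\in\mathbb R^{r\times m}$ are the first $r$ rows of $T_bB,T_bM_i$; $C_1\in\mathbb R^{p\times r}$ is the first $r$ columns of $CT_b^{-1}$. *)

theory Defs
  imports
    "HOL-Probability.Probability"
    "Jordan_Normal_Form.Gauss_Jordan_Elimination"
    "Jordan_Normal_Form.Char_Poly"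
begin

text \<open>
  Vectors and matrices are those of Jordan_Normal_Form, so that the dimensions \<open>n, m, p, q, r\<close>
  are ordinary natural numbers.  Indices start at \<open>0\<close>: the \<open>n\<close> coordinates are \<open>0, \<dots>, n - 1\<close>.
\<close>

unbundle no vec_syntax
hide_const (open) Finite_Cartesian_Product.vec Finite_Cartesian_Product.mat
  Finite_Cartesian_Product.transpose Determinants.det

section \<open>Filtered probability spaces and Wiener processes\<close>

text \<open>Time is \<open>{0..}\<close>; the values of \<open>F\<close> at negative arguments are irrelevant.\<close>

locale filtered_probability_space = prob_space \<Omega> for \<Omega> :: "'w measure" +
  fixes F :: "real \<Rightarrow> 'w measure"
  assumes subalgebra: "0 \<le> t \<Longrightarrow> subalgebra \<Omega> (F t)"
    and filtration_mono: "0 \<le> s \<Longrightarrow> s \<le> t \<Longrightarrow> sets (F s) \<subseteq> sets (F t)"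
    and right_continuous: "0 \<le> t \<Longrightarrow> sets (F t) = (\<Inter>s\<in>{t<..}. sets (F s))"
    and complete: "X \<in> null_sets \<Omega> \<Longrightarrow> Y \<subseteq> X \<Longrightarrow> Y \<in> sets (F 0)"

text \<open>The centred normal law with variance \<open>v\<close>; \<open>v = 0\<close> (a Dirac measure) is allowed because \<open>K\<close>
  may be singular.\<close>

definition centred_normal :: "real \<Rightarrow> real measure" where
  "centred_normal v =
     (if v = 0 then return borel 0 else density lborel (\<lambda>x. ennreal (normal_density 0 (sqrt v) x)))"

text \<open>\<open>w i t \<omega>\<close> is the \<open>i\<close>-th component of \<open>w(t)\<close>.  Joint normality of the increments is expressed
  by the laws of all their linear combinations.\<close>

locale wiener_process = filtered_probability_space \<Omega> F
  for \<Omega> :: "'w measure" and F :: "real \<Rightarrow> 'w measure" +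
  fixes q :: nat and K :: "real mat" and w :: "nat \<Rightarrow> real \<Rightarrow> 'w \<Rightarrow> real"
  assumes K_carrier: "K \<in> carrier_mat q q"
    and adapted: "i < q \<Longrightarrow> 0 \<le> t \<Longrightarrow> w i t \<in> borel_measurable (F t)"
    and start: "i < q \<Longrightarrow> AE \<omega> in \<Omega>. w i 0 \<omega> = 0"
    and continuous_paths: "i < q \<Longrightarrow> AE \<omega> in \<Omega>. continuous_on {0..} (\<lambda>t. w i t \<omega>)"
    and independent_increments: "0 \<le> t \<Longrightarrow> 0 \<le> h \<Longrightarrow>
      indep_set (sets (F t))
        (sets (vimage_algebra (space \<Omega>) (\<lambda>\<omega>. \<lambda>i\<in>{..<q}. w i (t + h) \<omega> - w i t \<omega>)
          (\<Pi>\<^sub>M i\<in>{..<q}. borel)))"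
    and normal_increments: "0 \<le> t \<Longrightarrow> 0 \<le> h \<Longrightarrow>
      distr \<Omega> borel (\<lambda>\<omega>. \<Sum>i<q. a i * (w i (t + h) \<omega> - w i t \<omega>)) =
        centred_normal (h * (\<Sum>i<q. \<Sum>j<q. a i * K $$ (i, j) * a j))"
    and covariance: "i < q \<Longrightarrow> j < q \<Longrightarrow> 0 \<le> t \<Longrightarrow>
      has_bochner_integral \<Omega> (\<lambda>\<omega>. w i t \<omega> * w j t \<omega>) (K $$ (i, j) * t)"

section \<open>The space \<open>L\<^sup>2\<^sub>T\<close>\<close>

definition adapted_measurable ::
    "'w measure \<Rightarrow> (real \<Rightarrow> 'w measure) \<Rightarrow> real \<Rightarrow> (real \<Rightarrow> 'w \<Rightarrow> real) \<Rightarrow> bool" where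
  "adapted_measurable \<Omega> F T f \<longleftrightarrow>
     (\<lambda>(t, \<omega>). f t \<omega>) \<in> borel_measurable (restrict_space borel {0..T} \<Otimes>\<^sub>M \<Omega>) \<and>
     (\<forall>t\<in>{0..T}. f t \<in> borel_measurable (F t))"

definition ennreal_sqrt :: "ennreal \<Rightarrow> ennreal" where
  "ennreal_sqrt a = (if a = \<infinity> then \<infinity> else ennreal (sqrt (enn2real a)))"

text \<open>The norm takes the value \<open>\<infinity>\<close> on processes that are not square integrable.\<close>

definition L2T_norm :: "'w measure \<Rightarrow> real \<Rightarrow> (real \<Rightarrow> 'w \<Rightarrow> real vec) \<Rightarrow> ennreal" where
  "L2T_norm \<Omega> T f =
     ennreal_sqrt (\<integral>\<^sup>+\<omega>. (\<integral>\<^sup>+t\<in>{0..T}. ennreal (f t \<omega> \<bullet> f t \<omega>) \<partial>lborel) \<partial>\<Omega>)"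

definition L2T ::
    "'w measure \<Rightarrow> (real \<Rightarrow> 'w measure) \<Rightarrow> nat \<Rightarrow> real \<Rightarrow> (real \<Rightarrow> 'w \<Rightarrow> real vec) set" where
  "L2T \<Omega> F d T = {f.
     (\<forall>t\<in>{0..T}. \<forall>\<omega>\<in>space \<Omega>. f t \<omega> \<in> carrier_vec d) \<and>
     (\<forall>l<d. adapted_measurable \<Omega> F T (\<lambda>t \<omega>. f t \<omega> $ l)) \<and>
     L2T_norm \<Omega> T f < \<infinity>}"

section \<open>The Ito integral\<close>

text \<open>A simple process \<open>\<Sum>k<N. \<xi> k * indicator {\<tau> k<..\<tau> (k+1)}\<close> on \<open>[0, T]\<close> and its integral.\<close>

definition simple_process ::
    "'w measure \<Rightarrow> (real \<Rightarrow> 'w measure) \<Rightarrow> real \<Rightarrow> nat \<Rightarrow> (nat \<Rightarrow> real) \<Rightarrow> (nat \<Rightarrow> 'w \<Rightarrow> real) \<Rightarrow> bool"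
  where
  "simple_process \<Omega> F T N \<tau> \<xi> \<longleftrightarrow>
     0 \<le> \<tau> 0 \<and> (\<forall>k<N. \<tau> k \<le> \<tau> (Suc k)) \<and> \<tau> N \<le> T \<and>
     (\<forall>k<N. \<xi> k \<in> borel_measurable (F (\<tau> k)) \<and> (\<exists>c. \<forall>\<omega>\<in>space \<Omega>. \<bar>\<xi> k \<omega>\<bar> \<le> c))"

definition simple_value ::
    "nat \<Rightarrow> (nat \<Rightarrow> real) \<Rightarrow> (nat \<Rightarrow> 'w \<Rightarrow> real) \<Rightarrow> real \<Rightarrow> 'w \<Rightarrow> real" where
  "simple_value N \<tau> \<xi> t \<omega> = (\<Sum>k<N. \<xi> k \<omega> * indicator {\<tau> k<..\<tau> (Suc k)} t)"

definition simple_integral ::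
    "(real \<Rightarrow> 'w \<Rightarrow> real) \<Rightarrow> nat \<Rightarrow> (nat \<Rightarrow> real) \<Rightarrow> (nat \<Rightarrow> 'w \<Rightarrow> real) \<Rightarrow> 'w \<Rightarrow> real" where
  "simple_integral v N \<tau> \<xi> \<omega> = (\<Sum>k<N. \<xi> k \<omega> * (v (\<tau> (Suc k)) \<omega> - v (\<tau> k) \<omega>))"

text \<open>\<open>has_ito_integral \<Omega> F v T f I\<close>: the random variable \<open>I\<close> is (a version of) the integral of \<open>f\<close>
  with respect to \<open>v\<close> over \<open>[0, T]\<close>, i.e. the mean square limit of the integrals of simple
  processes that converge to \<open>f\<close> in mean square.\<close>

definition has_ito_integral ::
    "'w measure \<Rightarrow> (real \<Rightarrow> 'w measure) \<Rightarrow> (real \<Rightarrow> 'w \<Rightarrow> real) \<Rightarrow> real \<Rightarrow> (real \<Rightarrow> 'w \<Rightarrow> real) \<Rightarrow>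
     ('w \<Rightarrow> real) \<Rightarrow> bool" where
  "has_ito_integral \<Omega> F v T f I \<longleftrightarrow>
     adapted_measurable \<Omega> F T f \<and> I \<in> borel_measurable \<Omega> \<and>
     (\<exists>N \<tau> \<xi>.
        (\<forall>j. simple_process \<Omega> F T (N j) (\<tau> j) (\<xi> j)) \<and>
        (\<lambda>j. \<integral>\<^sup>+\<omega>. (\<integral>\<^sup>+t\<in>{0..T}.
            ennreal ((f t \<omega> - simple_value (N j) (\<tau> j) (\<xi> j) t \<omega>)\<^sup>2) \<partial>lborel) \<partial>\<Omega>)
          \<longlonglongrightarrow> 0 \<and>
        (\<lambda>j. \<integral>\<^sup>+\<omega>. ennreal ((I \<omega> - simple_integral v (N j) (\<tau> j) (\<xi> j) \<omega>)\<^sup>2) \<partial>\<Omega>)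
          \<longlonglongrightarrow> 0)"

section \<open>Linear stochastic systems\<close>

record stoch_sys =
  coeff_A :: "real mat"
  coeff_B :: "real mat"
  coeff_N :: "nat \<Rightarrow> real mat"
  coeff_M :: "nat \<Rightarrow> real mat"
  coeff_C :: "real mat"
  coeff_D :: "real mat"

definition sys_dims :: "nat \<Rightarrow> nat \<Rightarrow> nat \<Rightarrow> nat \<Rightarrow> stoch_sys \<Rightarrow> bool" where
  "sys_dims n m p q S \<longleftrightarrow>
     coeff_A S \<in> carrier_mat n n \<and> coeff_B S \<in> carrier_mat n m \<and>
     (\<forall>i<q. coeff_N S i \<in> carrier_mat n n \<and> coeff_M S i \<in> carrier_mat n m) \<and>
     coeff_C S \<in> carrier_mat p n \<and> coeff_D S \<in> carrier_mat p m"

text \<open>\<open>x\<close> solves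
  \<open>dx = (A x + B u) dt + \<Sum>i<q. (N\<^sub>i x + M\<^sub>i u) dw\<^sub>i\<close>, \<open>x(0) = x\<^sub>0\<close>, on \<open>[0, T]\<close>,
  in integrated form, coordinate by coordinate (\<open>d\<close> is the dimension of the state).\<close>

definition sde_solution ::
    "'w measure \<Rightarrow> (real \<Rightarrow> 'w measure) \<Rightarrow> nat \<Rightarrow> (nat \<Rightarrow> real \<Rightarrow> 'w \<Rightarrow> real) \<Rightarrow> nat \<Rightarrow> stoch_sys \<Rightarrow>
     real \<Rightarrow> real vec \<Rightarrow> (real \<Rightarrow> 'w \<Rightarrow> real vec) \<Rightarrow> (real \<Rightarrow> 'w \<Rightarrow> real vec) \<Rightarrow> bool" where
  "sde_solution \<Omega> F q w d S T x\<^sub>0 u x \<longleftrightarrow>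
     x \<in> L2T \<Omega> F d T \<and>
     (AE \<omega> in \<Omega>. \<forall>l<d. continuous_on {0..T} (\<lambda>t. x t \<omega> $ l)) \<and>
     (\<forall>t\<in>{0..T}. \<forall>l<d. \<exists>I.
        (\<forall>i<q. has_ito_integral \<Omega> F (w i) t
           (\<lambda>s \<omega>. (coeff_N S i *\<^sub>v x s \<omega> + coeff_M S i *\<^sub>v u s \<omega>) $ l) (I i)) \<and>
        (AE \<omega> in \<Omega>. x t \<omega> $ l =
           x\<^sub>0 $ l
           + (LINT s:{0..t}|lborel. (coeff_A S *\<^sub>v x s \<omega> + coeff_B S *\<^sub>v u s \<omega>) $ l)
           + (\<Sum>i<q. I i \<omega>)))"

definition sys_output ::
    "stoch_sys \<Rightarrow> (real \<Rightarrow> 'w \<Rightarrow> real vec) \<Rightarrow> (real \<Rightarrow> 'w \<Rightarrow> real vec) \<Rightarrow> real \<Rightarrow> 'w \<Rightarrow> real vec" where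
  "sys_output S u x t \<omega> = coeff_C S *\<^sub>v x t \<omega> + coeff_D S *\<^sub>v u t \<omega>"

definition ms_asymptotically_stable ::
    "'w measure \<Rightarrow> (real \<Rightarrow> 'w measure) \<Rightarrow> nat \<Rightarrow> (nat \<Rightarrow> real \<Rightarrow> 'w \<Rightarrow> real) \<Rightarrow> nat \<Rightarrow> nat \<Rightarrow>
     stoch_sys \<Rightarrow> bool" where
  "ms_asymptotically_stable \<Omega> F q w n m S \<longleftrightarrow>
     (\<forall>x\<^sub>0\<in>carrier_vec n. \<forall>x.
        (\<forall>T>0. sde_solution \<Omega> F q w n S T x\<^sub>0 (\<lambda>t \<omega>. 0\<^sub>v m) x) \<longrightarrow>
        ((\<lambda>t. \<integral>\<^sup>+\<omega>. ennreal (x t \<omega> \<bullet> x t \<omega>) \<partial>\<Omega>) \<longlongrightarrow> 0) at_top)"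

section \<open>Matrix inequalities and Gramians\<close>

definition loewner_le :: "nat \<Rightarrow> real mat \<Rightarrow> real mat \<Rightarrow> bool" where
  "loewner_le d X Y \<longleftrightarrow>
     X \<in> carrier_mat d d \<and> Y \<in> carrier_mat d d \<and> X\<^sup>T = X \<and> Y\<^sup>T = Y \<and>
     (\<forall>v\<in>carrier_vec d. 0 \<le> v \<bullet> ((Y - X) *\<^sub>v v))"

definition loewner_less :: "nat \<Rightarrow> real mat \<Rightarrow> real mat \<Rightarrow> bool" where
  "loewner_less d X Y \<longleftrightarrow>
     X \<in> carrier_mat d d \<and> Y \<in> carrier_mat d d \<and> X\<^sup>T = X \<and> Y\<^sup>T = Y \<and>
     (\<forall>v\<in>carrier_vec d. v \<noteq> 0\<^sub>v d \<longrightarrow> 0 < v \<bullet> ((Y - X) *\<^sub>v v))"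

text \<open>Only ever applied to matrices that are invertible under the assumptions in force.\<close>

abbreviation minv :: "real mat \<Rightarrow> real mat" where
  "minv X \<equiv> the (mat_inverse X)"

text \<open>The \<open>a \<times> b\<close> matrix \<open>\<Sum>i<q. \<Sum>j<q. G\<^sub>i\<^sup>T X H\<^sub>j k\<^sub>i\<^sub>j\<close>, written entrywise because matrices of
  unspecified dimension do not form a monoid under addition.\<close>

definition noise_sum ::
    "nat \<Rightarrow> real mat \<Rightarrow> nat \<Rightarrow> nat \<Rightarrow> (nat \<Rightarrow> real mat) \<Rightarrow> real mat \<Rightarrow> (nat \<Rightarrow> real mat) \<Rightarrow> real mat" where
  "noise_sum q K a b G X H =
     mat a b (\<lambda>(k, l). \<Sum>i<q. \<Sum>j<q. ((G i)\<^sup>T * X * H j) $$ (k, l) * K $$ (i, j))"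

definition op_L :: "nat \<Rightarrow> real mat \<Rightarrow> nat \<Rightarrow> stoch_sys \<Rightarrow> real mat \<Rightarrow> real mat" where
  "op_L q K n S X =
     (coeff_A S)\<^sup>T * X + X * coeff_A S + noise_sum q K n n (coeff_N S) X (coeff_N S)"

definition op_S :: "nat \<Rightarrow> real mat \<Rightarrow> nat \<Rightarrow> nat \<Rightarrow> stoch_sys \<Rightarrow> real mat \<Rightarrow> real mat" where
  "op_S q K n m S X = X * coeff_B S + noise_sum q K n m (coeff_N S) X (coeff_M S)"

definition op_U :: "nat \<Rightarrow> real mat \<Rightarrow> nat \<Rightarrow> real \<Rightarrow> stoch_sys \<Rightarrow> real mat \<Rightarrow> real mat" where
  "op_U q K m \<gamma> S X = \<gamma> \<cdot>\<^sub>m 1\<^sub>m m - noise_sum q K m m (coeff_M S) X (coeff_M S)"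

definition reachability_gramian ::
    "nat \<Rightarrow> real mat \<Rightarrow> nat \<Rightarrow> nat \<Rightarrow> real \<Rightarrow> stoch_sys \<Rightarrow> real mat \<Rightarrow> bool" where
  "reachability_gramian q K n m \<gamma> S P \<longleftrightarrow>
     loewner_less n (0\<^sub>m n n) P \<and>
     loewner_less m (0\<^sub>m m m) (op_U q K m \<gamma> S (minv P)) \<and>
     loewner_le n
       (op_L q K n S (minv P)
        + op_S q K n m S (minv P) * minv (op_U q K m \<gamma> S (minv P)) * (op_S q K n m S (minv P))\<^sup>T)
       (0\<^sub>m n n)"

definition observability_gramian ::
    "nat \<Rightarrow> real mat \<Rightarrow> nat \<Rightarrow> stoch_sys \<Rightarrow> real mat \<Rightarrow> bool" where
  "observability_gramian q K n S Q \<longleftrightarrow>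
     loewner_le n (0\<^sub>m n n) Q \<and>
     loewner_le n (op_L q K n S Q + (coeff_C S)\<^sup>T * coeff_C S) (0\<^sub>m n n)"

section \<open>Balanced truncation\<close>

text \<open>\<open>\<sigma> i = sqrt (\<mu> i)\<close>, where \<open>\<mu> 0, \<dots>, \<mu> (n - 1)\<close> are the eigenvalues of \<open>P Q\<close> with
  multiplicity, in some order.\<close>

definition hankel_singular_values ::
    "nat \<Rightarrow> real mat \<Rightarrow> real mat \<Rightarrow> (nat \<Rightarrow> real) \<Rightarrow> bool" where
  "hankel_singular_values n P Q \<sigma> \<longleftrightarrow>
     (\<exists>\<mu>. char_poly (P * Q) = (\<Prod>i<n. [:- \<mu> i, 1:]) \<and> (\<forall>i<n. \<sigma> i = sqrt (\<mu> i)))"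

definition balancing ::
    "nat \<Rightarrow> real mat \<Rightarrow> real mat \<Rightarrow> (nat \<Rightarrow> real) \<Rightarrow> real mat \<Rightarrow> bool" where
  "balancing n P Q \<sigma> Tb \<longleftrightarrow>
     Tb \<in> carrier_mat n n \<and> invertible_mat Tb \<and>
     Tb * P * Tb\<^sup>T = mat_diag n \<sigma> \<and> (minv Tb)\<^sup>T * Q * minv Tb = mat_diag n \<sigma>"

definition transform_sys :: "real mat \<Rightarrow> stoch_sys \<Rightarrow> stoch_sys" where
  "transform_sys Tb S =
     \<lparr> coeff_A = Tb * coeff_A S * minv Tb,
       coeff_B = Tb * coeff_B S,
       coeff_N = (\<lambda>i. Tb * coeff_N S i * minv Tb),
       coeff_M = (\<lambda>i. Tb * coeff_M S i),
       coeff_C = coeff_C S * minv Tb,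
       coeff_D = coeff_D S \<rparr>"

definition upper_left :: "nat \<Rightarrow> nat \<Rightarrow> real mat \<Rightarrow> real mat" where
  "upper_left a b X = mat a b (\<lambda>(i, j). X $$ (i, j))"

definition truncate_sys :: "nat \<Rightarrow> nat \<Rightarrow> nat \<Rightarrow> stoch_sys \<Rightarrow> stoch_sys" where
  "truncate_sys r m p S =
     \<lparr> coeff_A = upper_left r r (coeff_A S),
       coeff_B = upper_left r m (coeff_B S),
       coeff_N = (\<lambda>i. upper_left r r (coeff_N S i)),
       coeff_M = (\<lambda>i. upper_left r m (coeff_M S i)),
       coeff_C = upper_left p r (coeff_C S),
       coeff_D = coeff_D S \<rparr>"

end

theory Submission
  imports Defs
begin

text \<open>
  Balanced truncation removes the coordinates \<open>n - 1, \<dots>, r\<close> one after the other.  Let \<open>z\<close> and \<open>y\<close> be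
  the states of the balanced system truncated to \<open>k + 1\<close> and to \<open>k\<close> coordinates, with the same input
  \<open>u\<close>, and append a zero to \<open>y\<close>.  Then
  \<open>(z - y)\<^sup>T \<Sigma> (z - y) + \<sigma>\<^sub>k\<^sup>2 (z + y)\<^sup>T \<Sigma>\<^sup>-\<^sup>1 (z + y)\<close>
  is a storage function for this pair: its mean grows at a rate of at most
  \<open>4 \<gamma> \<sigma>\<^sub>k\<^sup>2 E|u|\<^sup>2 - E|y\<^sub>k\<^sub>+\<^sub>1 - y\<^sub>k|\<^sup>2\<close>, where \<open>y\<^sub>k\<close> is the output at level \<open>k\<close>.  Indeed \<open>z - y\<close> follows the
  dynamics of level \<open>k + 1\<close> with input \<open>0\<close>, to which the observability inequality applies, and
  \<open>z + y\<close> those with input \<open>2 u\<close>, to which the reachability inequality applies, except for a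
  correction in coordinate \<open>k\<close>.  There both weights equal \<open>\<sigma>\<^sub>k\<close>; the drift corrections cancel and
  the noise corrections have the right sign by the parallelogram law (\<open>storage_dissipation\<close>).
  The Gramian inequalities pass from one level to the next because truncation only drops
  nonnegative noise terms (\<open>reach_truncated\<close>, \<open>obs_truncated\<close>).  Adding up the levels gives
  the factor \<open>2 \<gamma>\<^sup>1\<^sup>/\<^sup>2 \<Sum>\<sigma>\<^sub>k\<close>.

  The two given processes solve their equations at levels \<open>n\<close> and \<open>r\<close>.  Instead of constructing solutions at the
  levels in between, the argument runs on a time grid of mesh \<open>h\<close>.  On it the intermediate levels
  are explicit Euler schemes, driven by what the increments of the full solution leave after its own
  Euler increments are subtracted (\<open>euler_step\<close>).  A discrete form of Ito's formula
  (\<open>second_moment_step_perturbed\<close>) gives the growth bound for the storage function up to relative errors of order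
  \<open>sqrt h\<close>; a discrete Gronwall inequality sums over the grid (\<open>stage_gap\<close>), the levels are combined by a
  weighted Cauchy-Schwarz inequality (\<open>output_error_window\<close>), and \<open>h\<close> tends to \<open>0\<close>
  (\<open>output_error_bound\<close>).

  Only second moments occur.  They rest on two properties of the stochastic integral over a time
  window \<open>(a, b]\<close>: the isometry for several correlated integrators (\<open>ito_isometry\<close>) and
  orthogonality to the past of \<open>a\<close> (\<open>ito_orthogonal\<close>).
\<close>

unbundle no inner_syntax

section \<open>Mean square calculus\<close>

lemma square_add_le: "(a + b)\<^sup>2 \<le> 2 * a\<^sup>2 + 2 * (b::real)\<^sup>2"
  using sum_squares_ge_zero[of "a - b" 0] by (simp add: power2_eq_square algebra_simps)

definition sq_int :: "'a measure \<Rightarrow> ('a \<Rightarrow> real) \<Rightarrow> bool" where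
  "sq_int M f \<longleftrightarrow> f \<in> borel_measurable M \<and> integrable M (\<lambda>x. (f x)\<^sup>2)"

lemma sq_int_measurable [measurable_dest]: "sq_int M f \<Longrightarrow> f \<in> borel_measurable M"
  by (simp add: sq_int_def)

lemma sq_int_integrable: "sq_int M f \<Longrightarrow> integrable M (\<lambda>x. (f x)\<^sup>2)"
  by (simp add: sq_int_def)

lemma sq_int_iff_nn_integral:
  assumes "f \<in> borel_measurable M"
  shows "sq_int M f \<longleftrightarrow> (\<integral>\<^sup>+x. ennreal ((f x)\<^sup>2) \<partial>M) < \<infinity>"
  using assms by (auto simp: sq_int_def integrable_iff_bounded)

lemma sq_int_dominated:
  assumes [measurable]: "f \<in> borel_measurable M" and "integrable M g"
    and "\<And>x. x \<in> space M \<Longrightarrow> (f x)\<^sup>2 \<le> g x"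
  shows "sq_int M f"
  unfolding sq_int_def
  by (auto intro!: Bochner_Integration.integrable_bound[OF assms(2)] AE_I2 order_trans[OF assms(3) abs_ge_self])

lemma integrable_sq_int_mult:
  assumes f: "sq_int M f" and g: "sq_int M g"
  shows "integrable M (\<lambda>x. f x * g x)"
proof (rule Bochner_Integration.integrable_bound)
  show "integrable M (\<lambda>x. (f x)\<^sup>2 + (g x)\<^sup>2)"
    using f g by (simp add: sq_int_def)
  show "(\<lambda>x. f x * g x) \<in> borel_measurable M"
    using f g by (intro borel_measurable_times) (simp_all add: sq_int_def)
  have "\<bar>f x * g x\<bar> \<le> (f x)\<^sup>2 + (g x)\<^sup>2" for x
  proof -
    have "0 \<le> (\<bar>f x\<bar> - \<bar>g x\<bar>)\<^sup>2" by simp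
    then have "2 * (\<bar>f x\<bar> * \<bar>g x\<bar>) \<le> (f x)\<^sup>2 + (g x)\<^sup>2" by (simp add: power2_diff mult.assoc)
    then show ?thesis by (simp add: abs_mult) (smt (verit) mult_nonneg_nonneg abs_ge_zero)
  qed
  then show "AE x in M. norm (f x * g x) \<le> norm ((f x)\<^sup>2 + (g x)\<^sup>2)" by simp
qed

lemma sq_int_add:
  assumes f: "sq_int M f" and g: "sq_int M g"
  shows "sq_int M (\<lambda>x. f x + g x)"
proof -
  have "(\<lambda>x. (f x + g x)\<^sup>2) = (\<lambda>x. (f x)\<^sup>2 + (g x)\<^sup>2 + 2 * (f x * g x))"
    by (auto simp: power2_sum)
  then show ?thesis
    using f g integrable_sq_int_mult[OF f g] unfolding sq_int_def by (intro conjI) (auto intro: borel_measurable_add)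
qed

lemma sq_int_cmult: "sq_int M f \<Longrightarrow> sq_int M (\<lambda>x. c * f x)"
  by (auto simp: sq_int_def power_mult_distrib intro!: borel_measurable_times)

lemma sq_int_diff: "sq_int M f \<Longrightarrow> sq_int M g \<Longrightarrow> sq_int M (\<lambda>x. f x - g x)"
  using sq_int_add[of M f "\<lambda>x. (-1) * g x"] sq_int_cmult[of M g "-1"] by simp

lemma sq_int_zero [simp]: "sq_int M (\<lambda>x. 0)"
  by (simp add: sq_int_def)

lemma sq_int_sum: "(\<And>i. i \<in> I \<Longrightarrow> sq_int M (f i)) \<Longrightarrow> sq_int M (\<lambda>x. \<Sum>i\<in>I. f i x)"
  by (induction I rule: infinite_finite_induct) (auto intro: sq_int_add)

lemma sq_int_cong_AE:
  assumes "sq_int M f" "g \<in> borel_measurable M" "AE x in M. g x = f x"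
  shows "sq_int M g"
proof -
  have "integrable M (\<lambda>x. (g x)\<^sup>2) \<longleftrightarrow> integrable M (\<lambda>x. (f x)\<^sup>2)"
    using assms by (intro integrable_cong_AE) (auto simp: sq_int_def)
  then show ?thesis using assms by (simp add: sq_int_def)
qed

text \<open>
  The quadratic form \<open>(s, t) \<mapsto> \<integral>(s f + t g)\<^sup>2\<close> is nonnegative, so its discriminant is not positive.
\<close>

lemma Cauchy_Schwarz_integral:
  assumes f: "sq_int M f" and g: "sq_int M g"
  shows "(\<integral>x. f x * g x \<partial>M)\<^sup>2 \<le> (\<integral>x. (f x)\<^sup>2 \<partial>M) * (\<integral>x. (g x)\<^sup>2 \<partial>M)"
proof -
  define a where "a = (\<integral>x. (f x)\<^sup>2 \<partial>M)"
  define b where "b = (\<integral>x. f x * g x \<partial>M)"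
  define c where "c = (\<integral>x. (g x)\<^sup>2 \<partial>M)"
  have quad: "0 \<le> a * s\<^sup>2 + 2 * (s * t) * b + c * t\<^sup>2" for s t
  proof -
    have "0 \<le> (\<integral>x. (s * f x + t * g x)\<^sup>2 \<partial>M)" by simp
    also have "(\<lambda>x. (s * f x + t * g x)\<^sup>2) = (\<lambda>x. s\<^sup>2 * (f x)\<^sup>2 + 2 * (s * t) * (f x * g x) + t\<^sup>2 * (g x)\<^sup>2)"
      by (auto simp: power2_sum power_mult_distrib)
    also have "(\<integral>x. s\<^sup>2 * (f x)\<^sup>2 + 2 * (s * t) * (f x * g x) + t\<^sup>2 * (g x)\<^sup>2 \<partial>M) = s\<^sup>2 * a + 2 * (s * t) * b + t\<^sup>2 * c"
      using sq_int_integrable[OF f] sq_int_integrable[OF g] integrable_sq_int_mult[OF f g]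
      by (simp add: a_def b_def c_def)
    finally show ?thesis by (simp add: mult.commute)
  qed
  have nn: "0 \<le> a" "0 \<le> c" by (simp_all add: a_def c_def)
  have "b\<^sup>2 \<le> a * c"
  proof (cases "a = 0")
    case True
    have "b = 0"
    proof (rule ccontr)
      assume "b \<noteq> 0"
      with quad[of "- (c + 1) / (2 * b)" 1] True show False by (simp add: field_simps)
    qed
    then show ?thesis using nn by simp
  next
    case False
    with nn have "0 < a" by simp
    have "0 \<le> a * b\<^sup>2 + 2 * (b * (- a)) * b + c * a\<^sup>2" using quad[of b "- a"] by simp
    also have "\<dots> = a * (a * c - b\<^sup>2)" by (simp add: power2_eq_square algebra_simps)
    finally show ?thesis using \<open>0 < a\<close> by (simp add: zero_le_mult_iff)
  qed
  then show ?thesis by (simp add: a_def b_def c_def)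
qed

abbreviation mean_square_lim :: "'a measure \<Rightarrow> ('a \<Rightarrow> real) \<Rightarrow> (nat \<Rightarrow> 'a \<Rightarrow> real) \<Rightarrow> bool" where
  "mean_square_lim M f fn \<equiv> (\<lambda>n. \<integral>\<^sup>+x. ennreal ((f x - fn n x)\<^sup>2) \<partial>M) \<longlonglongrightarrow> 0"

lemma sq_int_limit:
  assumes f: "f \<in> borel_measurable M" and fn: "\<And>n. sq_int M (fn n)"
    and lim: "mean_square_lim M f fn"
  shows "sq_int M f"
proof -
  have "eventually (\<lambda>n. (\<integral>\<^sup>+x. ennreal ((f x - fn n x)\<^sup>2) \<partial>M) < 1) sequentially"
    by (rule order_tendstoD(2)[OF lim]) simp
  then obtain n where "(\<integral>\<^sup>+x. ennreal ((f x - fn n x)\<^sup>2) \<partial>M) < 1"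
    by (auto simp: eventually_sequentially)
  then have "sq_int M (\<lambda>x. f x - fn n x)"
    using f sq_int_measurable[OF fn]
    by (subst sq_int_iff_nn_integral) (auto intro: order_less_trans)
  from sq_int_add[OF this fn[of n]] show ?thesis by simp
qed

lemma mean_square_limitD:
  assumes f: "sq_int M f" and fn: "\<And>n. sq_int M (fn n)"
    and lim: "mean_square_lim M f fn"
  shows "(\<lambda>n. \<integral>x. (f x - fn n x)\<^sup>2 \<partial>M) \<longlonglongrightarrow> 0"
proof -
  have "(\<integral>\<^sup>+x. ennreal ((f x - fn n x)\<^sup>2) \<partial>M) = ennreal (\<integral>x. (f x - fn n x)\<^sup>2 \<partial>M)" for n
    by (rule nn_integral_eq_integral[OF sq_int_integrable[OF sq_int_diff[OF f fn]]]) simp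
  then show ?thesis using lim ennreal_tendsto_0_iff[of "\<lambda>n. \<integral>x. (f x - fn n x)\<^sup>2 \<partial>M"] by auto
qed

lemma tendsto_integral_mult_0:
  assumes f: "\<And>n. sq_int M (f n)" and g: "\<And>n. sq_int M (g n)"
    and bnd: "\<And>n. (\<integral>x. (f n x)\<^sup>2 \<partial>M) \<le> c"
    and lim: "(\<lambda>n. \<integral>x. (g n x)\<^sup>2 \<partial>M) \<longlonglongrightarrow> 0"
  shows "(\<lambda>n. \<integral>x. f n x * g n x \<partial>M) \<longlonglongrightarrow> 0"
proof -
  have "(\<lambda>n. (\<integral>x. f n x * g n x \<partial>M)\<^sup>2) \<longlonglongrightarrow> 0"
  proof (rule tendsto_sandwich[OF _ _ tendsto_const])
    show "(\<lambda>n. c * (\<integral>x. (g n x)\<^sup>2 \<partial>M)) \<longlonglongrightarrow> 0"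
      using tendsto_mult_left[OF lim, of c] by simp
    show "\<forall>\<^sub>F n in sequentially. (\<integral>x. f n x * g n x \<partial>M)\<^sup>2 \<le> c * (\<integral>x. (g n x)\<^sup>2 \<partial>M)"
      by (auto intro!: always_eventually order_trans[OF Cauchy_Schwarz_integral[OF f g]] mult_right_mono bnd)
  qed auto
  then have "(\<lambda>n. sqrt ((\<integral>x. f n x * g n x \<partial>M)\<^sup>2)) \<longlonglongrightarrow> sqrt 0" by (rule tendsto_real_sqrt)
  then show ?thesis by (simp add: tendsto_rabs_zero_iff)
qed

text \<open>
  Inner products are continuous in mean square.  All limit passages below, in \<open>\<Omega>\<close> as well as in time and
  \<open>\<Omega>\<close> together, are instances.
\<close>

lemma tendsto_integral_mult:
  assumes f: "sq_int M f" and fn: "\<And>n. sq_int M (fn n)"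
    and f_lim: "mean_square_lim M f fn"
    and g: "sq_int M g" and gn: "\<And>n. sq_int M (gn n)"
    and g_lim: "mean_square_lim M g gn"
  shows "(\<lambda>n. \<integral>x. fn n x * gn n x \<partial>M) \<longlonglongrightarrow> (\<integral>x. f x * g x \<partial>M)"
proof -
  note fl = mean_square_limitD[OF f fn f_lim] and gl = mean_square_limitD[OF g gn g_lim]
  note df = sq_int_diff[OF f fn] and dg = sq_int_diff[OF g gn]
  have 1: "(\<lambda>n. \<integral>x. f x * (g x - gn n x) \<partial>M) \<longlonglongrightarrow> 0"
    by (rule tendsto_integral_mult_0[OF f dg order_refl gl])
  have 2: "(\<lambda>n. \<integral>x. g x * (f x - fn n x) \<partial>M) \<longlonglongrightarrow> 0"
    by (rule tendsto_integral_mult_0[OF g df order_refl fl])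
  obtain c where c: "\<And>n. (\<integral>x. (f x - fn n x)\<^sup>2 \<partial>M) \<le> c"
    using convergent_imp_Bseq[OF convergentI[OF fl]] by (force simp: Bseq_def abs_le_iff)
  have 3: "(\<lambda>n. \<integral>x. (f x - fn n x) * (g x - gn n x) \<partial>M) \<longlonglongrightarrow> 0"
    by (rule tendsto_integral_mult_0[OF df dg c gl])
  have eq: "(\<integral>x. fn n x * gn n x \<partial>M) = (\<integral>x. f x * g x \<partial>M) - (\<integral>x. f x * (g x - gn n x) \<partial>M)
      - (\<integral>x. g x * (f x - fn n x) \<partial>M) + (\<integral>x. (f x - fn n x) * (g x - gn n x) \<partial>M)" for n
  proof -
    have "(\<lambda>x. fn n x * gn n x) = (\<lambda>x. f x * g x - f x * (g x - gn n x) - g x * (f x - fn n x)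
        + (f x - fn n x) * (g x - gn n x))"
      by (auto simp: algebra_simps)
    moreover have "integrable M (\<lambda>x. f x * g x)" "integrable M (\<lambda>x. f x * (g x - gn n x))"
      "integrable M (\<lambda>x. g x * (f x - fn n x))" "integrable M (\<lambda>x. (f x - fn n x) * (g x - gn n x))"
      by (intro integrable_sq_int_mult f g df dg)+
    ultimately show ?thesis by (simp only:) simp
  qed
  show ?thesis unfolding eq
    using tendsto_add[OF tendsto_diff[OF tendsto_diff[OF tendsto_const[of "\<integral>x. f x * g x \<partial>M"] 1] 2] 3] by simp
qed

lemma mean_square_limit_add:
  assumes [measurable]: "f \<in> borel_measurable M" "g \<in> borel_measurable M"
     "\<And>n. fn n \<in> borel_measurable M" "\<And>n. gn n \<in> borel_measurable M"
    and f_lim: "mean_square_lim M f fn"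
    and g_lim: "mean_square_lim M g gn"
  shows "(\<lambda>n. \<integral>\<^sup>+x. ennreal ((f x + g x - (fn n x + gn n x))\<^sup>2) \<partial>M) \<longlonglongrightarrow> 0"
proof (rule tendsto_sandwich[OF _ _ tendsto_const])
  have "(\<integral>\<^sup>+x. ennreal ((f x + g x - (fn n x + gn n x))\<^sup>2) \<partial>M)
     \<le> 2 * (\<integral>\<^sup>+x. ennreal ((f x - fn n x)\<^sup>2) \<partial>M) + 2 * (\<integral>\<^sup>+x. ennreal ((g x - gn n x)\<^sup>2) \<partial>M)" for n
  proof -
    have "(\<integral>\<^sup>+x. ennreal ((f x + g x - (fn n x + gn n x))\<^sup>2) \<partial>M)
      \<le> (\<integral>\<^sup>+x. 2 * ennreal ((f x - fn n x)\<^sup>2) + 2 * ennreal ((g x - gn n x)\<^sup>2) \<partial>M)"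
    proof (rule nn_integral_mono)
      fix x
      have "ennreal ((f x + g x - (fn n x + gn n x))\<^sup>2) \<le> ennreal (2 * (f x - fn n x)\<^sup>2 + 2 * (g x - gn n x)\<^sup>2)"
        using square_add_le[of "f x - fn n x" "g x - gn n x"] by (intro ennreal_leI) (simp add: algebra_simps)
      also have "\<dots> = 2 * ennreal ((f x - fn n x)\<^sup>2) + 2 * ennreal ((g x - gn n x)\<^sup>2)"
        by (simp add: ennreal_plus ennreal_mult'')
      finally show "ennreal ((f x + g x - (fn n x + gn n x))\<^sup>2)
        \<le> 2 * ennreal ((f x - fn n x)\<^sup>2) + 2 * ennreal ((g x - gn n x)\<^sup>2)" .
    qed
    also have "\<dots> = 2 * (\<integral>\<^sup>+x. ennreal ((f x - fn n x)\<^sup>2) \<partial>M) + 2 * (\<integral>\<^sup>+x. ennreal ((g x - gn n x)\<^sup>2) \<partial>M)"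
      by (simp add: nn_integral_add nn_integral_cmult)
    finally show ?thesis .
  qed
  then show "\<forall>\<^sub>F n in sequentially. (\<integral>\<^sup>+x. ennreal ((f x + g x - (fn n x + gn n x))\<^sup>2) \<partial>M)
     \<le> 2 * (\<integral>\<^sup>+x. ennreal ((f x - fn n x)\<^sup>2) \<partial>M) + 2 * (\<integral>\<^sup>+x. ennreal ((g x - gn n x)\<^sup>2) \<partial>M)"
    by simp
  have "(\<lambda>n. 2 * (\<integral>\<^sup>+x. ennreal ((f x - fn n x)\<^sup>2) \<partial>M) + 2 * (\<integral>\<^sup>+x. ennreal ((g x - gn n x)\<^sup>2) \<partial>M)) \<longlonglongrightarrow> 2 * 0 + 2 * 0"
    by (intro tendsto_add ennreal_tendsto_cmult f_lim g_lim) auto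
  then show "(\<lambda>n. 2 * (\<integral>\<^sup>+x. ennreal ((f x - fn n x)\<^sup>2) \<partial>M) + 2 * (\<integral>\<^sup>+x. ennreal ((g x - gn n x)\<^sup>2) \<partial>M)) \<longlonglongrightarrow> 0"
    by simp
qed auto

lemma mean_square_limit_cmult:
  assumes [measurable]: "f \<in> borel_measurable M" "\<And>n. fn n \<in> borel_measurable M"
    and f_lim: "mean_square_lim M f fn"
  shows "(\<lambda>n. \<integral>\<^sup>+x. ennreal ((c * f x - c * fn n x)\<^sup>2) \<partial>M) \<longlonglongrightarrow> 0"
proof -
  have "(\<integral>\<^sup>+x. ennreal ((c * f x - c * fn n x)\<^sup>2) \<partial>M) = ennreal (c\<^sup>2) * (\<integral>\<^sup>+x. ennreal ((f x - fn n x)\<^sup>2) \<partial>M)" for n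
  proof -
    have "ennreal ((c * f x - c * fn n x)\<^sup>2) = ennreal (c\<^sup>2) * ennreal ((f x - fn n x)\<^sup>2)" for x
      by (simp flip: right_diff_distrib add: power_mult_distrib ennreal_mult')
    then show ?thesis by (simp add: nn_integral_cmult)
  qed
  moreover have "(\<lambda>n. ennreal (c\<^sup>2) * (\<integral>\<^sup>+x. ennreal ((f x - fn n x)\<^sup>2) \<partial>M)) \<longlonglongrightarrow> ennreal (c\<^sup>2) * 0"
    by (intro ennreal_tendsto_cmult f_lim) auto
  ultimately show ?thesis by simp
qed

section \<open>Increments of the Wiener process\<close>

lemma centred_normal_moments:
  assumes "0 \<le> v"
  shows "integrable (centred_normal v) (\<lambda>x. x\<^sup>2)" "(\<integral>x. x\<^sup>2 \<partial>centred_normal v) = v"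
    and "integrable (centred_normal v) (\<lambda>x. x)" "(\<integral>x. x \<partial>centred_normal v) = 0"
proof -
  have "integrable (centred_normal v) (\<lambda>x. x\<^sup>2) \<and> (\<integral>x. x\<^sup>2 \<partial>centred_normal v) = v \<and>
     integrable (centred_normal v) (\<lambda>x. x) \<and> (\<integral>x. x \<partial>centred_normal v) = 0"
  proof (cases "v = 0")
    case True
    have int: "integrable (return borel (0::real)) f" if "f \<in> borel_measurable borel" for f :: "real \<Rightarrow> real"
      using that unfolding integrable_iff_bounded by (subst nn_integral_return) auto
    have c: "centred_normal v = return borel 0" using True by (simp add: centred_normal_def)
    have r2: "(\<integral>x. x\<^sup>2 \<partial>return borel (0::real)) = 0\<^sup>2"
      by (rule integral_return) simp_all
    have r1: "(\<integral>x. x \<partial>return borel (0::real)) = 0"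
      by (rule integral_return) simp_all
    have i: "integrable (return borel (0::real)) (\<lambda>x. x\<^sup>2)" "integrable (return borel (0::real)) (\<lambda>x. x)"
      by (rule int, measurable)+
    from i r1 r2 True show ?thesis unfolding c by (metis power_zero_numeral)
  next
    case False
    with assms have v: "0 < v" by simp
    then have *: "centred_normal v = density lborel (\<lambda>x. ennreal (normal_density 0 (sqrt v) x))"
      by (simp add: centred_normal_def)
    have 2: "has_bochner_integral lborel (\<lambda>x. normal_density 0 (sqrt v) x * x\<^sup>2) v"
      using normal_moment_even[of "sqrt v" 0 1] v by (simp add: fact_2 power2_eq_square mult_ac)
    have 1: "has_bochner_integral lborel (\<lambda>x. normal_density 0 (sqrt v) x * x) 0"
      using normal_moment_odd[of "sqrt v" 0 0] v by simp
    show ?thesis unfolding *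
      using 1 2 by (auto simp: integrable_density integral_density has_bochner_integral_iff)
  qed
  then show "integrable (centred_normal v) (\<lambda>x. x\<^sup>2)" "(\<integral>x. x\<^sup>2 \<partial>centred_normal v) = v"
    "integrable (centred_normal v) (\<lambda>x. x)" "(\<integral>x. x \<partial>centred_normal v) = 0" by auto
qed

context wiener_process
begin

text \<open>
  The rate at which \<open>\<Sum>i<q. \<integral> b\<^sub>i dw\<^sub>i\<close> accumulates variance.
\<close>

definition noise_form :: "(nat \<Rightarrow> real) \<Rightarrow> real" where
  "noise_form b = (\<Sum>i<q. \<Sum>j<q. K $$ (i, j) * (b i * b j))"

lemma space_F: "0 \<le> t \<Longrightarrow> space (F t) = space \<Omega>"
  using subalgebra[of t] by (simp add: subalgebra_def)

lemma measurable_F_imp_measurable: "0 \<le> t \<Longrightarrow> X \<in> borel_measurable (F t) \<Longrightarrow> X \<in> borel_measurable \<Omega>"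
  using subalgebra[of t] measurable_from_subalg by blast

lemma measurable_F_mono:
  assumes "0 \<le> s" "s \<le> t" "X \<in> borel_measurable (F s)"
  shows "X \<in> borel_measurable (F t)"
proof -
  have "subalgebra (F t) (F s)"
    using assms filtration_mono[of s t] by (simp add: subalgebra_def space_F)
  with assms(3) show ?thesis using measurable_from_subalg by blast
qed

lemma K_symmetric:
  assumes "i < q" "j < q"
  shows "K $$ (i, j) = K $$ (j, i)"
proof -
  have "has_bochner_integral \<Omega> (\<lambda>\<omega>. w i 1 \<omega> * w j 1 \<omega>) (K $$ (i, j) * 1)"
    "has_bochner_integral \<Omega> (\<lambda>\<omega>. w i 1 \<omega> * w j 1 \<omega>) (K $$ (j, i) * 1)"
    using covariance[of i j 1] covariance[of j i 1] assms by (simp_all add: mult.commute)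
  then show ?thesis by (auto dest: has_bochner_integral_eq)
qed

text \<open>
  \<open>noise_form b\<close> is the second moment of \<open>\<Sum>i<q. b\<^sub>i w\<^sub>i(1)\<close>.
\<close>

lemma noise_form_nonneg: "0 \<le> noise_form b"
proof -
  have "has_bochner_integral \<Omega> (\<lambda>\<omega>. \<Sum>i<q. \<Sum>j<q. (w i 1 \<omega> * w j 1 \<omega>) * (b i * b j))
    (\<Sum>i<q. \<Sum>j<q. (K $$ (i, j) * 1) * (b i * b j))"
    by (intro has_bochner_integral_sum has_bochner_integral_mult_left covariance) auto
  then have "noise_form b = (\<integral>\<omega>. (\<Sum>i<q. \<Sum>j<q. (w i 1 \<omega> * w j 1 \<omega>) * (b i * b j)) \<partial>\<Omega>)"
    by (simp add: noise_form_def has_bochner_integral_iff)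
  also have "(\<lambda>\<omega>. \<Sum>i<q. \<Sum>j<q. (w i 1 \<omega> * w j 1 \<omega>) * (b i * b j)) = (\<lambda>\<omega>. (\<Sum>i<q. w i 1 \<omega> * b i)\<^sup>2)"
    by (auto simp: power2_eq_square sum_product intro!: sum.cong)
  finally show ?thesis by simp
qed

lemma noise_form_alt: "(\<Sum>i<q. \<Sum>j<q. b i * K $$ (i, j) * b j) = noise_form b"
  by (simp add: noise_form_def mult_ac)

definition incr :: "nat \<Rightarrow> real \<Rightarrow> real \<Rightarrow> 'w \<Rightarrow> real" where
  "incr i s t \<omega> = w i t \<omega> - w i s \<omega>"

lemma incr_measurable_F:
  "i < q \<Longrightarrow> 0 \<le> s \<Longrightarrow> s \<le> t \<Longrightarrow> incr i s t \<in> borel_measurable (F t)"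
  unfolding incr_def[abs_def] using adapted[of i t] measurable_F_mono[of s t "w i s"] adapted[of i s]
  by (intro borel_measurable_diff) auto

lemma incr_measurable:
  "i < q \<Longrightarrow> 0 \<le> s \<Longrightarrow> s \<le> t \<Longrightarrow> incr i s t \<in> borel_measurable \<Omega>"
  using incr_measurable_F measurable_F_imp_measurable[of t] by auto

lemma incr_combination_moments:
  assumes "0 \<le> s" "s \<le> t"
  shows "integrable \<Omega> (\<lambda>\<omega>. (\<Sum>i<q. a i * incr i s t \<omega>)\<^sup>2)"
    and "(\<integral>\<omega>. (\<Sum>i<q. a i * incr i s t \<omega>)\<^sup>2 \<partial>\<Omega>) = (t - s) * noise_form a"
    and "integrable \<Omega> (\<lambda>\<omega>. \<Sum>i<q. a i * incr i s t \<omega>)"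
    and "(\<integral>\<omega>. (\<Sum>i<q. a i * incr i s t \<omega>) \<partial>\<Omega>) = 0"
proof -
  let ?Y = "\<lambda>\<omega>. \<Sum>i<q. a i * incr i s t \<omega>"
  have Y [measurable]: "?Y \<in> borel_measurable \<Omega>"
    using incr_measurable assms by (auto intro!: borel_measurable_sum borel_measurable_times)
  have d: "distr \<Omega> borel ?Y = centred_normal ((t - s) * noise_form a)"
    using normal_increments[of s "t - s" a] assms by (simp add: incr_def noise_form_alt)
  have nn: "0 \<le> (t - s) * noise_form a" using assms noise_form_nonneg by simp
  note m = centred_normal_moments[OF nn, folded d]
  show "integrable \<Omega> (\<lambda>\<omega>. (?Y \<omega>)\<^sup>2)" using m(1) by (simp add: integrable_distr_eq)
  show "(\<integral>\<omega>. (?Y \<omega>)\<^sup>2 \<partial>\<Omega>) = (t - s) * noise_form a" using m(2) by (simp add: integral_distr)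
  show "integrable \<Omega> ?Y" using m(3) by (simp add: integrable_distr_eq)
  show "(\<integral>\<omega>. ?Y \<omega> \<partial>\<Omega>) = 0" using m(4) by (simp add: integral_distr)
qed

text \<open>
  Mixed moments of two components follow from the scalar laws of \<open>\<Sum>a\<^sub>i w\<^sub>i\<close> by polarization.
\<close>

lemma incr_moments:
  assumes st: "0 \<le> s" "s \<le> t" and ij: "i < q" "j < q"
  shows "sq_int \<Omega> (incr i s t)" and "(\<integral>\<omega>. incr i s t \<omega> \<partial>\<Omega>) = 0"
    and "(\<integral>\<omega>. incr i s t \<omega> * incr j s t \<omega> \<partial>\<Omega>) = (t - s) * K $$ (i, j)"
proof -
  have sel: "(\<Sum>k<q. (if k = l then 1 else 0) * f k) = f l" if "l < q" for f :: "nat \<Rightarrow> real" and l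
    using that by (simp add: if_distrib[of "\<lambda>x. x * _"] cong: if_cong)
  have sq: "sq_int \<Omega> (incr l s t)" if "l < q" for l
    using incr_combination_moments(1)[OF st, of "\<lambda>k. if k = l then 1 else 0"] that incr_measurable[OF that st]
    by (simp add: sel sq_int_def)
  show "sq_int \<Omega> (incr i s t)" using sq ij by simp
  show "(\<integral>\<omega>. incr i s t \<omega> \<partial>\<Omega>) = 0"
    using incr_combination_moments(4)[OF st, of "\<lambda>k. if k = i then 1 else 0"] ij by (simp add: sel)
  let ?a = "\<lambda>k. (if k = i then 1 else 0) + (if k = j then 1 else 0) :: real"
  let ?b = "\<lambda>k. (if k = i then 1 else 0) - (if k = j then 1 else 0) :: real"
  have s1: "(\<Sum>k<q. ?a k * f k) = f i + f j" "(\<Sum>k<q. ?b k * f k) = f i - f j" for f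
    using ij by (simp_all add: distrib_right left_diff_distrib sum.distrib sum_subtractf sel)
  have fold: "noise_form b = (\<Sum>k<q. b k * (\<Sum>l<q. b l * K $$ (k, l)))" for b
    by (simp add: noise_form_def sum_distrib_left mult_ac)
  have nf: "noise_form ?a - noise_form ?b = 4 * K $$ (i, j)"
    unfolding fold s1 using K_symmetric[of i j] ij by simp
  have "(\<lambda>\<omega>. 4 * (incr i s t \<omega> * incr j s t \<omega>)) =
     (\<lambda>\<omega>. (\<Sum>k<q. ?a k * incr k s t \<omega>)\<^sup>2 - (\<Sum>k<q. ?b k * incr k s t \<omega>)\<^sup>2)"
    unfolding s1 by (auto simp: power2_eq_square algebra_simps)
  then have "(\<integral>\<omega>. 4 * (incr i s t \<omega> * incr j s t \<omega>) \<partial>\<Omega>) = (t - s) * noise_form ?a - (t - s) * noise_form ?b"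
    using incr_combination_moments[OF st, of ?a] incr_combination_moments[OF st, of ?b] by simp
  then show "(\<integral>\<omega>. incr i s t \<omega> * incr j s t \<omega> \<partial>\<Omega>) = (t - s) * K $$ (i, j)"
    using nf by (simp flip: right_diff_distrib)
qed

text \<open>
  Independence of \<open>\<sigma>\<close>-algebras in the form needed for expectations to factor.
\<close>

lemma indep_past_incr:
  assumes st: "0 \<le> s" "s \<le> t" and X: "X \<in> borel_measurable (F s)"
    and g [measurable]: "g \<in> borel_measurable (\<Pi>\<^sub>M i\<in>{..<q}. borel)"
  shows "indep_var borel X borel (\<lambda>\<omega>. g (\<lambda>i\<in>{..<q}. incr i s t \<omega>))"
proof -
  let ?D = "\<lambda>\<omega>. \<lambda>i\<in>{..<q}. incr i s t \<omega>"
  let ?V = "vimage_algebra (space \<Omega>) ?D (\<Pi>\<^sub>M i\<in>{..<q}. borel)"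
  have D [measurable]: "?D \<in> measurable \<Omega> (\<Pi>\<^sub>M i\<in>{..<q}. borel)"
    using incr_measurable[OF _ st] by (intro measurable_restrict) auto
  have X' [measurable]: "X \<in> borel_measurable \<Omega>" using measurable_F_imp_measurable X st by blast
  have ind: "indep_set (sets (F s)) (sets ?V)"
    using independent_increments[of s "t - s"] st by (simp add: incr_def)
  have DV: "?D \<in> measurable ?V (\<Pi>\<^sub>M i\<in>{..<q}. borel)"
    by (rule measurable_vimage_algebra1) (auto simp: space_PiM)
  have gV: "(\<lambda>\<omega>. g (?D \<omega>)) \<in> borel_measurable ?V"
    using measurable_compose[OF DV g] .
  have "sigma_sets (space \<Omega>) {X -` A \<inter> space \<Omega> |A. A \<in> sets borel} \<subseteq> sets (F s)"
    using sets.sigma_sets_subset[of "{X -` A \<inter> space \<Omega> |A. A \<in> sets borel}" "F s"] measurable_sets[OF X] space_F[of s] st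
    by auto
  moreover have "sigma_sets (space \<Omega>) {(\<lambda>\<omega>. g (?D \<omega>)) -` A \<inter> space \<Omega> |A. A \<in> sets borel} \<subseteq> sets ?V"
    using sets.sigma_sets_subset[of "{(\<lambda>\<omega>. g (?D \<omega>)) -` A \<inter> space \<Omega> |A. A \<in> sets borel}" ?V] measurable_sets[OF gV]
    by auto
  ultimately have "indep_set (sigma_sets (space \<Omega>) {X -` A \<inter> space \<Omega> |A. A \<in> sets borel})
      (sigma_sets (space \<Omega>) {(\<lambda>\<omega>. g (?D \<omega>)) -` A \<inter> space \<Omega> |A. A \<in> sets borel})"
    using ind unfolding indep_set_def
    by (rule_tac indep_sets_mono_sets) (auto split: bool.split)
  then show ?thesis unfolding indep_var_eq by auto
qed

text \<open>
  The random variables that are known at time \<open>t\<close> and may multiply later increments.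
\<close>

definition past :: "real \<Rightarrow> ('w \<Rightarrow> real) \<Rightarrow> bool" where
  "past t X \<longleftrightarrow> X \<in> borel_measurable (F t) \<and> sq_int \<Omega> X"

lemma past_sq_int: "past t X \<Longrightarrow> sq_int \<Omega> X"
  by (simp add: past_def)

lemma past_mono: "0 \<le> s \<Longrightarrow> s \<le> t \<Longrightarrow> past s X \<Longrightarrow> past t X"
  using measurable_F_mono by (auto simp: past_def)

lemma past_add: "past t X \<Longrightarrow> past t Y \<Longrightarrow> past t (\<lambda>\<omega>. X \<omega> + Y \<omega>)"
  by (auto simp: past_def intro: sq_int_add borel_measurable_add)

lemma past_diff: "past t X \<Longrightarrow> past t Y \<Longrightarrow> past t (\<lambda>\<omega>. X \<omega> - Y \<omega>)"
  by (auto simp: past_def intro: sq_int_diff borel_measurable_diff)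

lemma past_cmult: "past t X \<Longrightarrow> past t (\<lambda>\<omega>. c * X \<omega>)"
  by (auto simp: past_def intro!: sq_int_cmult borel_measurable_times)

lemma past_sum: "(\<And>i. i \<in> I \<Longrightarrow> past t (f i)) \<Longrightarrow> past t (\<lambda>\<omega>. \<Sum>i\<in>I. f i \<omega>)"
  by (auto simp: past_def intro!: sq_int_sum borel_measurable_sum)

text \<open>
  \<open>X\<^sup>2\<close> and the squared increment are independent and integrable, hence so is their product; this is
  why coefficients of increments may be unbounded.
\<close>

lemma past_mult_incr:
  assumes st: "0 \<le> s" "s \<le> t" and i: "i < q" and X: "past s X"
  shows "past t (\<lambda>\<omega>. X \<omega> * incr i s t \<omega>)"
proof -
  have Xs: "X \<in> borel_measurable (F s)" using X by (simp add: past_def)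
  have "indep_var borel (\<lambda>\<omega>. (X \<omega>)\<^sup>2) borel (\<lambda>\<omega>. (\<lambda>f. (f i)\<^sup>2) (\<lambda>i\<in>{..<q}. incr i s t \<omega>))"
    using i Xs by (intro indep_past_incr[OF st]) (auto intro!: borel_measurable_power)
  then have "integrable \<Omega> (\<lambda>\<omega>. (X \<omega>)\<^sup>2 * (incr i s t \<omega>)\<^sup>2)"
    using indep_var_integrable[of "\<lambda>\<omega>. (X \<omega>)\<^sup>2" "\<lambda>\<omega>. (incr i s t \<omega>)\<^sup>2"] i X incr_moments(1)[OF st i i]
    by (simp add: past_def sq_int_def)
  moreover have "(\<lambda>\<omega>. X \<omega> * incr i s t \<omega>) \<in> borel_measurable (F t)"
    using Xs st incr_measurable_F[OF i st] measurable_F_mono[OF st] by (intro borel_measurable_times) auto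
  ultimately show ?thesis
    using st measurable_F_imp_measurable[of t] by (auto simp: past_def sq_int_def power_mult_distrib)
qed

lemma expectation_past_mult_incr:
  assumes st: "0 \<le> s" "s \<le> t" and i: "i < q" and X: "past s X" and Y: "past s Y"
  shows "(\<integral>\<omega>. Y \<omega> * (X \<omega> * incr i s t \<omega>) \<partial>\<Omega>) = 0"
proof -
  have "indep_var borel (\<lambda>\<omega>. Y \<omega> * X \<omega>) borel (\<lambda>\<omega>. (\<lambda>f. f i) (\<lambda>i\<in>{..<q}. incr i s t \<omega>))"
    using i X Y by (intro indep_past_incr[OF st]) (auto simp: past_def intro!: borel_measurable_times)
  then have "(\<integral>\<omega>. (Y \<omega> * X \<omega>) * incr i s t \<omega> \<partial>\<Omega>) = (\<integral>\<omega>. Y \<omega> * X \<omega> \<partial>\<Omega>) * (\<integral>\<omega>. incr i s t \<omega> \<partial>\<Omega>)"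
    using indep_var_lebesgue_integral[of "\<lambda>\<omega>. Y \<omega> * X \<omega>" "incr i s t"] i
      integrable_sq_int_mult[OF past_sq_int[OF Y] past_sq_int[OF X]]
      integrable_sq_int_mult[OF incr_moments(1)[OF st i i], of "\<lambda>_. 1"]
    by (simp add: sq_int_def)
  then show ?thesis using incr_moments(2)[OF st i i] by (simp add: mult.assoc)
qed

lemma expectation_past_mult_incr2:
  assumes st: "0 \<le> s" "s \<le> t" and i: "i < q" and j: "j < q" and X: "past s X" and Y: "past s Y"
  shows "(\<integral>\<omega>. (X \<omega> * incr i s t \<omega>) * (Y \<omega> * incr j s t \<omega>) \<partial>\<Omega>)
    = K $$ (i, j) * ((t - s) * (\<integral>\<omega>. X \<omega> * Y \<omega> \<partial>\<Omega>))"
proof -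
  have "indep_var borel (\<lambda>\<omega>. X \<omega> * Y \<omega>) borel (\<lambda>\<omega>. (\<lambda>f. f i * f j) (\<lambda>i\<in>{..<q}. incr i s t \<omega>))"
    using i j X Y by (intro indep_past_incr[OF st]) (auto simp: past_def intro!: borel_measurable_times)
  then have "(\<integral>\<omega>. (X \<omega> * Y \<omega>) * (incr i s t \<omega> * incr j s t \<omega>) \<partial>\<Omega>)
     = (\<integral>\<omega>. X \<omega> * Y \<omega> \<partial>\<Omega>) * (\<integral>\<omega>. incr i s t \<omega> * incr j s t \<omega> \<partial>\<Omega>)"
    using indep_var_lebesgue_integral[of "\<lambda>\<omega>. X \<omega> * Y \<omega>" "\<lambda>\<omega>. incr i s t \<omega> * incr j s t \<omega>"] i j
      integrable_sq_int_mult[OF past_sq_int[OF X] past_sq_int[OF Y]]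
      integrable_sq_int_mult[OF incr_moments(1)[OF st i i] incr_moments(1)[OF st j j]]
    by simp
  then show ?thesis using incr_moments(3)[OF st i j] by (simp add: mult_ac)
qed

end

section \<open>Elementary integrands on a time window\<close>

context wiener_process
begin

lemma pair_lborel: "pair_sigma_finite (lborel :: real measure) \<Omega>"
  by unfold_locales

lemma integral_product:
  assumes f: "integrable lborel (f :: real \<Rightarrow> real)" and g: "integrable \<Omega> (g :: 'w \<Rightarrow> real)"
  shows "integrable (lborel \<Otimes>\<^sub>M \<Omega>) (\<lambda>z. f (fst z) * g (snd z))"
    and "(\<integral>z. f (fst z) * g (snd z) \<partial>(lborel \<Otimes>\<^sub>M \<Omega>)) = (\<integral>t. f t \<partial>lborel) * (\<integral>\<omega>. g \<omega> \<partial>\<Omega>)"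
proof -
  interpret P: pair_sigma_finite "lborel :: real measure" \<Omega> by (rule pair_lborel)
  have [measurable]: "f \<in> borel_measurable borel" "g \<in> borel_measurable \<Omega>" using f g by auto
  show *: "integrable (lborel \<Otimes>\<^sub>M \<Omega>) (\<lambda>z. f (fst z) * g (snd z))"
    using f g by (intro P.Fubini_integrable) (auto simp: abs_mult)
  from P.integral_fst'[OF this] show "(\<integral>z. f (fst z) * g (snd z) \<partial>(lborel \<Otimes>\<^sub>M \<Omega>)) = (\<integral>t. f t \<partial>lborel) * (\<integral>\<omega>. g \<omega> \<partial>\<Omega>)"
    by simp
qed

text \<open>
  Lebesgue measure on the window \<open>(a, b]\<close> times \<open>\<Omega>\<close>.  It is a density on the whole product space,
  so that all windows share one \<open>\<sigma>\<close>-algebra; it excludes \<open>a\<close>, as simple processes do, so that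
  consecutive windows are disjoint.
\<close>

definition win :: "real \<Rightarrow> real \<Rightarrow> (real \<times> 'w) measure" where
  "win a b = density (lborel \<Otimes>\<^sub>M \<Omega>) (\<lambda>z. ennreal (indicator {a<..b} (fst z)))"

lemma measurable_win [simp]: "borel_measurable (win a b) = borel_measurable (lborel \<Otimes>\<^sub>M \<Omega>)"
  unfolding win_def by (rule measurable_cong_sets) simp_all

lemma space_win [simp]: "space (win a b) = UNIV \<times> space \<Omega>"
  by (simp add: win_def space_pair_measure)

lemma sets_win [simp, measurable_cong]: "sets (win a b) = sets (lborel \<Otimes>\<^sub>M \<Omega>)"
  by (simp add: win_def)

lemma integral_win:
  fixes f :: "real \<times> 'w \<Rightarrow> real"
  assumes [measurable]: "f \<in> borel_measurable (lborel \<Otimes>\<^sub>M \<Omega>)"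
  shows "(\<integral>z. f z \<partial>win a b) = (\<integral>z. indicator {a<..b} (fst z) * f z \<partial>(lborel \<Otimes>\<^sub>M \<Omega>))"
  unfolding win_def by (subst integral_density) auto

lemma integrable_win:
  fixes f :: "real \<times> 'w \<Rightarrow> real"
  assumes [measurable]: "f \<in> borel_measurable (lborel \<Otimes>\<^sub>M \<Omega>)"
  shows "integrable (win a b) f \<longleftrightarrow> integrable (lborel \<Otimes>\<^sub>M \<Omega>) (\<lambda>z. indicator {a<..b} (fst z) * f z)"
  unfolding win_def by (subst integrable_density) auto

lemma nn_integral_win:
  assumes [measurable]: "f \<in> borel_measurable (lborel \<Otimes>\<^sub>M \<Omega>)"
  shows "(\<integral>\<^sup>+z. f z \<partial>win a b) = (\<integral>\<^sup>+z. indicator {a<..b} (fst z) * f z \<partial>(lborel \<Otimes>\<^sub>M \<Omega>))"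
  unfolding win_def by (subst nn_integral_density) (auto intro!: nn_integral_cong simp: indicator_def)

lemma nn_integral_win_iterated:
  assumes [measurable]: "f \<in> borel_measurable (lborel \<Otimes>\<^sub>M \<Omega>)"
  shows "(\<integral>\<^sup>+z. f z \<partial>win a b) = (\<integral>\<^sup>+\<omega>. (\<integral>\<^sup>+t\<in>{a..b}. f (t, \<omega>) \<partial>lborel) \<partial>\<Omega>)"
proof -
  interpret P: pair_sigma_finite "lborel :: real measure" \<Omega> by (rule pair_lborel)
  have "(\<integral>\<^sup>+z. f z \<partial>win a b) = (\<integral>\<^sup>+\<omega>. (\<integral>\<^sup>+t. indicator {a<..b} t * f (t, \<omega>) \<partial>lborel) \<partial>\<Omega>)"
    by (subst nn_integral_win, simp, subst P.nn_integral_snd[symmetric]) simp_all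
  also have "\<dots> = (\<integral>\<^sup>+\<omega>. (\<integral>\<^sup>+t\<in>{a..b}. f (t, \<omega>) \<partial>lborel) \<partial>\<Omega>)"
  proof -
    have "AE t in lborel. indicator {a<..b} t * f (t, \<omega>) = f (t, \<omega>) * indicator {a..b} t" for \<omega>
      using AE_lborel_singleton[of a] by eventually_elim (auto simp: indicator_def)
    then show ?thesis by (auto intro!: nn_integral_cong nn_integral_cong_AE)
  qed
  finally show ?thesis .
qed

lemma AE_win_iff_indicator:
  "(\<And>z. fst z \<in> {a<..b} \<Longrightarrow> snd z \<in> space \<Omega> \<Longrightarrow> P z) \<Longrightarrow> AE z in win a b. P z"
  unfolding win_def by (subst AE_density) (auto simp: indicator_def space_pair_measure intro!: AE_I2)

lemma win_mono:
  assumes [measurable]: "f \<in> borel_measurable (lborel \<Otimes>\<^sub>M \<Omega>)" and "a \<le> a'" "b' \<le> b"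
  shows "(\<integral>\<^sup>+z. f z \<partial>win a' b') \<le> (\<integral>\<^sup>+z. f z \<partial>win a b)"
  unfolding nn_integral_win[OF assms(1)]
  using assms by (intro nn_integral_mono) (auto simp: indicator_def)

lemma sq_int_win_mono:
  assumes "sq_int (win a b) f" "a \<le> a'" "b' \<le> b"
  shows "sq_int (win a' b') f"
proof -
  have f [measurable]: "f \<in> borel_measurable (lborel \<Otimes>\<^sub>M \<Omega>)" using assms(1) by (simp add: sq_int_def)
  have "(\<integral>\<^sup>+z. ennreal ((f z)\<^sup>2) \<partial>win a' b') \<le> (\<integral>\<^sup>+z. ennreal ((f z)\<^sup>2) \<partial>win a b)"
    by (rule win_mono) (use assms in auto)
  also have "\<dots> < \<infinity>" using assms(1) sq_int_iff_nn_integral[of f "win a b"] f by simp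
  finally show ?thesis using sq_int_iff_nn_integral[of f "win a' b'"] f by simp
qed

lemma integral_win_const:
  assumes "integrable \<Omega> (Z :: 'w \<Rightarrow> real)" "a \<le> b"
  shows "integrable (win a b) (\<lambda>z. Z (snd z))"
    and "(\<integral>z. Z (snd z) \<partial>win a b) = (b - a) * (\<integral>\<omega>. Z \<omega> \<partial>\<Omega>)"
proof -
  have [measurable]: "Z \<in> borel_measurable \<Omega>" using assms by auto
  have i: "integrable lborel (indicator {a<..b} :: real \<Rightarrow> real)"
    using assms by (auto intro!: integrable_real_indicator)
  show "integrable (win a b) (\<lambda>z. Z (snd z))"
    using integral_product(1)[OF i assms(1)] by (subst integrable_win) auto
  show "(\<integral>z. Z (snd z) \<partial>win a b) = (b - a) * (\<integral>\<omega>. Z \<omega> \<partial>\<Omega>)"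
    using integral_product(2)[OF i assms(1)] assms(2) by (subst integral_win) auto
qed

lemma sq_int_win_const:
  assumes "sq_int \<Omega> Z" "a \<le> b"
  shows "sq_int (win a b) (\<lambda>z. Z (snd z))"
proof -
  have "Z \<in> borel_measurable \<Omega>" using assms by (simp add: sq_int_def)
  then have "(\<lambda>z. Z (snd z)) \<in> borel_measurable (lborel \<Otimes>\<^sub>M \<Omega>)" by measurable
  then show ?thesis
    using integral_win_const(1)[OF sq_int_integrable[OF assms(1)] assms(2)] by (simp add: sq_int_def)
qed

lemma integral_win_combine:
  fixes f :: "real \<times> 'w \<Rightarrow> real"
  assumes "a \<le> b" "b \<le> c" and f: "integrable (win a b) f" "integrable (win b c) f"
  shows "integrable (win a c) f" "(\<integral>z. f z \<partial>win a c) = (\<integral>z. f z \<partial>win a b) + (\<integral>z. f z \<partial>win b c)"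
proof -
  have [measurable]: "f \<in> borel_measurable (lborel \<Otimes>\<^sub>M \<Omega>)"
    using borel_measurable_integrable[OF f(1)] by simp
  have *: "(\<lambda>z. indicator {a<..c} (fst z) * f z) =
    (\<lambda>z. indicator {a<..b} (fst z) * f z + indicator {b<..c} (fst z) * f z)"
    using assms(1,2) by (auto simp: indicator_def fun_eq_iff)
  show "integrable (win a c) f" "(\<integral>z. f z \<partial>win a c) = (\<integral>z. f z \<partial>win a b) + (\<integral>z. f z \<partial>win b c)"
    using f by (simp_all add: integral_win integrable_win *)
qed

text \<open>
  A term \<open>(i, s, t, \<xi>)\<close> stands for \<open>\<xi>\<close> times the indicator of \<open>(s, t]\<close> in component \<open>i\<close> of a vector-valued
  integrand.  Lists of terms need no common partition, so sums are concatenations, and one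
  list serves all components of the Wiener process, so that their correlation enters through the
  isometry alone.
\<close>

type_synonym 'v elementary = "(nat \<times> real \<times> real \<times> ('v \<Rightarrow> real)) list"

fun elem_ok :: "real \<Rightarrow> real \<Rightarrow> nat \<times> real \<times> real \<times> ('w \<Rightarrow> real) \<Rightarrow> bool" where
  "elem_ok a b (i, s, t, \<xi>) \<longleftrightarrow> i < q \<and> a \<le> s \<and> s \<le> t \<and> t \<le> b \<and> past s \<xi>"

fun term_val :: "nat \<times> real \<times> real \<times> ('w \<Rightarrow> real) \<Rightarrow> nat \<Rightarrow> real \<times> 'w \<Rightarrow> real" where
  "term_val (i, s, t, \<xi>) k z = (if k = i then \<xi> (snd z) * indicator {s<..t} (fst z) else 0)"

fun term_int :: "nat \<times> real \<times> real \<times> ('w \<Rightarrow> real) \<Rightarrow> 'w \<Rightarrow> real" where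
  "term_int (i, s, t, \<xi>) \<omega> = \<xi> \<omega> * incr i s t \<omega>"

definition el_val :: "'w elementary \<Rightarrow> nat \<Rightarrow> real \<times> 'w \<Rightarrow> real" where
  "el_val es k z = (\<Sum>e\<leftarrow>es. term_val e k z)"

definition el_int :: "'w elementary \<Rightarrow> 'w \<Rightarrow> real" where
  "el_int es \<omega> = (\<Sum>e\<leftarrow>es. term_int e \<omega>)"

lemma el_simps [simp]:
  "el_val [] k z = 0" "el_val (e # es) k z = term_val e k z + el_val es k z"
  "el_val (es @ es') k z = el_val es k z + el_val es' k z"
  "el_int [] \<omega> = 0" "el_int (e # es) \<omega> = term_int e \<omega> + el_int es \<omega>"
  "el_int (es @ es') \<omega> = el_int es \<omega> + el_int es' \<omega>"
  by (simp_all add: el_val_def el_int_def)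

lemma sq_int_term_val:
  assumes "elem_ok a b e"
  shows "sq_int (win a b) (term_val e k)"
proof (cases e)
  case (fields i s t \<xi>)
  with assms have \<xi>: "sq_int \<Omega> \<xi>" and ab: "a \<le> b" by (auto dest: past_sq_int)
  note [measurable] = sq_int_measurable[OF \<xi>]
  have m: "term_val e k \<in> borel_measurable (lborel \<Otimes>\<^sub>M \<Omega>)"
    unfolding fields term_val.simps[abs_def] by measurable
  show ?thesis
    by (rule sq_int_dominated[where g="\<lambda>z. (\<xi> (snd z))\<^sup>2"])
       (use m sq_int_integrable[OF sq_int_win_const[OF \<xi> ab]] in \<open>auto simp: fields indicator_def\<close>)
qed

lemma past_term_int:
  assumes "elem_ok a b e" "0 \<le> a"
  shows "past b (term_int e)"
proof (cases e)
  case (fields i s t \<xi>)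
  with assms have "past t (\<lambda>\<omega>. \<xi> \<omega> * incr i s t \<omega>)" "0 \<le> t" "t \<le> b" by (auto intro: past_mult_incr)
  then show ?thesis using past_mono unfolding fields term_int.simps[abs_def] by blast
qed

lemma sq_int_el_val: "list_all (elem_ok a b) es \<Longrightarrow> sq_int (win a b) (el_val es k)"
  by (induction es) (auto simp: el_val_def[abs_def] intro: sq_int_add sq_int_term_val)

lemma past_el_int: "list_all (elem_ok a b) es \<Longrightarrow> 0 \<le> a \<Longrightarrow> past b (el_int es)"
proof (induction es)
  case Nil
  then show ?case by (simp add: el_int_def[abs_def] past_def)
next
  case (Cons e es)
  then have "past b (\<lambda>\<omega>. term_int e \<omega> + el_int es \<omega>)" by (intro past_add past_term_int) auto
  then show ?case by (simp add: el_int_def[abs_def])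
qed

lemma expectation_past_term_int:
  assumes "elem_ok a b e" "0 \<le> a" "past a Z"
  shows "(\<integral>\<omega>. Z \<omega> * term_int e \<omega> \<partial>\<Omega>) = 0"
proof (cases e)
  case (fields i s t \<xi>)
  with assms have "past s Z" by (auto intro: past_mono)
  with assms fields show ?thesis by (simp add: expectation_past_mult_incr)
qed

lemma expectation_past_el_int:
  assumes "list_all (elem_ok a b) es" "0 \<le> a" "past a Z"
  shows "(\<integral>\<omega>. Z \<omega> * el_int es \<omega> \<partial>\<Omega>) = 0"
  using assms(1)
proof (induction es)
  case (Cons e es)
  then have "integrable \<Omega> (\<lambda>\<omega>. Z \<omega> * term_int e \<omega>)" "integrable \<Omega> (\<lambda>\<omega>. Z \<omega> * el_int es \<omega>)"
    using assms by (auto intro!: integrable_sq_int_mult past_sq_int past_term_int past_el_int)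
  with Cons show ?case using assms expectation_past_term_int[of a b e Z] by (simp add: distrib_left)
qed simp

lemma integral_term_val_mult:
  assumes e: "elem_ok a b (i, s, t, \<xi>)" "elem_ok a b (j, s', t', \<eta>)"
  shows "(\<integral>z. term_val (i, s, t, \<xi>) i z * term_val (j, s', t', \<eta>) j z \<partial>win a b)
    = max 0 (min t t' - max s s') * (\<integral>\<omega>. \<xi> \<omega> * \<eta> \<omega> \<partial>\<Omega>)"
proof -
  have sq: "sq_int \<Omega> \<xi>" "sq_int \<Omega> \<eta>" using e by (auto dest: past_sq_int)
  note [measurable] = sq_int_measurable[OF sq(1)] sq_int_measurable[OF sq(2)]
  let ?f = "\<lambda>r::real. indicator {max s s'<..min t t'} r :: real"
  have "(\<integral>z. term_val (i, s, t, \<xi>) i z * term_val (j, s', t', \<eta>) j z \<partial>win a b)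
    = (\<integral>z. ?f (fst z) * (\<xi> (snd z) * \<eta> (snd z)) \<partial>(lborel \<Otimes>\<^sub>M \<Omega>))"
    using e by (subst integral_win) (auto intro!: Bochner_Integration.integral_cong simp: indicator_def)
  also have "\<dots> = (\<integral>r. ?f r \<partial>lborel) * (\<integral>\<omega>. \<xi> \<omega> * \<eta> \<omega> \<partial>\<Omega>)"
    by (intro integral_product(2) integrable_sq_int_mult sq)
       (cases "max s s' \<le> min t t'", auto intro!: integrable_real_indicator)
  also have "(\<integral>r. ?f r \<partial>lborel) = max 0 (min t t' - max s s')"
    by (cases "max s s' \<le> min t t'") (auto simp: max_def min_def)
  finally show ?thesis .
qed

text \<open>
  Both increments are cut at \<open>s'\<close> and at \<open>min t t'\<close>.  In every product of parts over disjoint intervals the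
  later increment is centred and independent of the other factors, so only the
  common interval contributes.
\<close>

lemma expectation_term_int_mult_ordered:
  assumes a: "0 \<le> a" and e: "elem_ok a b (i, s, t, \<xi>)" "elem_ok a b (j, s', t', \<eta>)" and ss': "s \<le> s'"
  shows "(\<integral>\<omega>. (\<xi> \<omega> * incr i s t \<omega>) * (\<eta> \<omega> * incr j s' t' \<omega>) \<partial>\<Omega>)
    = K $$ (i, j) * (max 0 (min t t' - s') * (\<integral>\<omega>. \<xi> \<omega> * \<eta> \<omega> \<partial>\<Omega>))"
proof -
  have st: "0 \<le> s" "s \<le> t" "0 \<le> s'" "s' \<le> t'" and ij: "i < q" "j < q"
    and \<xi>: "past s \<xi>" and \<eta>: "past s' \<eta>"
    using a e by auto
  have \<xi>': "past s' \<xi>" using past_mono[OF st(1) ss' \<xi>] .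
  show ?thesis
  proof (cases "t \<le> s'")
    case True
    have "past s' (\<lambda>\<omega>. \<xi> \<omega> * incr i s t \<omega>)"
      using past_mono[OF _ True past_mult_incr[OF st(1,2) ij(1) \<xi>]] st by simp
    from expectation_past_mult_incr[OF st(3,4) ij(2) \<eta> this] True show ?thesis by simp
  next
    case False
    define m where "m = min t t'"
    have m: "s' \<le> m" "m \<le> t" "m \<le> t'" "0 \<le> m" using False st by (auto simp: m_def)
    have p1: "past s' (\<lambda>\<omega>. \<xi> \<omega> * incr i s s' \<omega>)" by (rule past_mult_incr[OF st(1) ss' ij(1) \<xi>])
    have pi: "past m (\<lambda>\<omega>. \<xi> \<omega> * incr i s' m \<omega>)" by (rule past_mult_incr[OF st(3) m(1) ij(1) \<xi>'])
    have pj: "past m (\<lambda>\<omega>. \<eta> \<omega> * incr j s' m \<omega>)" by (rule past_mult_incr[OF st(3) m(1) ij(2) \<eta>])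
    have p2: "past t (\<lambda>\<omega>. \<xi> \<omega> * incr i m t \<omega>)"
      by (rule past_mult_incr[OF m(4,2) ij(1) past_mono[OF st(3) m(1) \<xi>']])
    have p3: "past t' (\<lambda>\<omega>. \<eta> \<omega> * incr j m t' \<omega>)"
      by (rule past_mult_incr[OF m(4,3) ij(2) past_mono[OF st(3) m(1) \<eta>]])
    have p4: "past t' (\<lambda>\<omega>. \<eta> \<omega> * incr j s' t' \<omega>)" by (rule past_mult_incr[OF st(3,4) ij(2) \<eta>])
    have E1: "(\<integral>\<omega>. (\<xi> \<omega> * incr i s s' \<omega>) * (\<eta> \<omega> * incr j s' t' \<omega>) \<partial>\<Omega>) = 0"
      by (rule expectation_past_mult_incr[OF st(3,4) ij(2) \<eta> p1])
    have E2: "(\<integral>\<omega>. (\<xi> \<omega> * incr i s' m \<omega>) * (\<eta> \<omega> * incr j s' m \<omega>) \<partial>\<Omega>)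
       = K $$ (i, j) * ((m - s') * (\<integral>\<omega>. \<xi> \<omega> * \<eta> \<omega> \<partial>\<Omega>))"
      by (rule expectation_past_mult_incr2[OF st(3) m(1) ij \<xi>' \<eta>])
    have E3: "(\<integral>\<omega>. (\<xi> \<omega> * incr i s' m \<omega>) * (\<eta> \<omega> * incr j m t' \<omega>) \<partial>\<Omega>) = 0"
      by (rule expectation_past_mult_incr[OF m(4,3) ij(2) past_mono[OF st(3) m(1) \<eta>] pi])
    have E4: "(\<integral>\<omega>. (\<eta> \<omega> * incr j s' m \<omega>) * (\<xi> \<omega> * incr i m t \<omega>) \<partial>\<Omega>) = 0"
      by (rule expectation_past_mult_incr[OF m(4,2) ij(1) past_mono[OF st(3) m(1) \<xi>'] pj])
    have E5: "(\<integral>\<omega>. (\<xi> \<omega> * incr i m t \<omega>) * (\<eta> \<omega> * incr j m t' \<omega>) \<partial>\<Omega>) = 0"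
    proof (cases "t \<le> t'")
      case True
      then have "m = t" by (simp add: m_def)
      then show ?thesis by (simp add: incr_def)
    next
      case False
      then have "m = t'" by (simp add: m_def)
      then show ?thesis by (simp add: incr_def)
    qed
    note sq = p1[THEN past_sq_int] pi[THEN past_sq_int] pj[THEN past_sq_int] p2[THEN past_sq_int]
      p3[THEN past_sq_int] p4[THEN past_sq_int]
    have "(\<lambda>\<omega>. (\<xi> \<omega> * incr i s t \<omega>) * (\<eta> \<omega> * incr j s' t' \<omega>)) =
      (\<lambda>\<omega>. (\<xi> \<omega> * incr i s s' \<omega>) * (\<eta> \<omega> * incr j s' t' \<omega>)
        + (\<xi> \<omega> * incr i s' m \<omega>) * (\<eta> \<omega> * incr j s' m \<omega>)
        + (\<xi> \<omega> * incr i s' m \<omega>) * (\<eta> \<omega> * incr j m t' \<omega>)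
        + (\<eta> \<omega> * incr j s' m \<omega>) * (\<xi> \<omega> * incr i m t \<omega>)
        + (\<xi> \<omega> * incr i m t \<omega>) * (\<eta> \<omega> * incr j m t' \<omega>))"
      by (auto simp: incr_def algebra_simps)
    then have "(\<integral>\<omega>. (\<xi> \<omega> * incr i s t \<omega>) * (\<eta> \<omega> * incr j s' t' \<omega>) \<partial>\<Omega>)
       = K $$ (i, j) * ((m - s') * (\<integral>\<omega>. \<xi> \<omega> * \<eta> \<omega> \<partial>\<Omega>))"
      by (simp only:) (simp add: integrable_sq_int_mult sq E1 E2 E3 E4 E5)
    then show ?thesis using m by (simp add: m_def)
  qed
qed

lemma expectation_term_int_mult:
  assumes a: "0 \<le> a" and e: "elem_ok a b (i, s, t, \<xi>)" "elem_ok a b (j, s', t', \<eta>)"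
  shows "(\<integral>\<omega>. term_int (i, s, t, \<xi>) \<omega> * term_int (j, s', t', \<eta>) \<omega> \<partial>\<Omega>)
    = K $$ (i, j) * (\<integral>z. term_val (i, s, t, \<xi>) i z * term_val (j, s', t', \<eta>) j z \<partial>win a b)"
proof (cases "s \<le> s'")
  case True
  then show ?thesis
    unfolding integral_term_val_mult[OF e] using expectation_term_int_mult_ordered[OF a e True] by (simp add: max_absorb2)
next
  case False
  then have "s' \<le> s" by simp
  moreover have "K $$ (i, j) = K $$ (j, i)" using e by (intro K_symmetric) auto
  ultimately show ?thesis
    unfolding integral_term_val_mult[OF e] using expectation_term_int_mult_ordered[OF a e(2,1)]
    by (simp add: max_absorb1 mult_ac min.commute)
qed

lemma expectation_term_int_mult':
  assumes a: "0 \<le> a" and e: "elem_ok a b e" "elem_ok a b e'"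
  shows "(\<integral>\<omega>. term_int e \<omega> * term_int e' \<omega> \<partial>\<Omega>)
    = (\<Sum>k<q. \<Sum>l<q. K $$ (k, l) * (\<integral>z. term_val e k z * term_val e' l z \<partial>win a b))"
proof -
  obtain i s t \<xi> j s' t' \<eta> where ee: "e = (i, s, t, \<xi>)" "e' = (j, s', t', \<eta>)"
    by (cases e, cases e') auto
  have ij: "i < q" "j < q" using e ee by auto
  have "(\<Sum>k<q. \<Sum>l<q. K $$ (k, l) * (\<integral>z. term_val e k z * term_val e' l z \<partial>win a b))
    = (\<Sum>k<q. \<Sum>l<q. if k = i then (if l = j then K $$ (i, j) * (\<integral>z. term_val e i z * term_val e' j z \<partial>win a b) else 0) else 0)"
    by (intro sum.cong refl) (auto simp: ee)
  also have "\<dots> = (\<Sum>k<q. if k = i then K $$ (i, j) * (\<integral>z. term_val e i z * term_val e' j z \<partial>win a b) else 0)"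
    using ij by (intro sum.cong refl) (auto simp: sum.delta)
  also have "\<dots> = K $$ (i, j) * (\<integral>z. term_val e i z * term_val e' j z \<partial>win a b)"
    using ij by (simp add: sum.delta)
  also have "\<dots> = (\<integral>\<omega>. term_int e \<omega> * term_int e' \<omega> \<partial>\<Omega>)"
    unfolding ee by (rule expectation_term_int_mult[OF a e[unfolded ee], symmetric])
  finally show ?thesis by (rule sym)
qed

text \<open>
  Both sides are bilinear in the lists of terms.
\<close>

lemma el_int_isometry:
  assumes a: "0 \<le> a" and es: "list_all (elem_ok a b) es" and es': "list_all (elem_ok a b) es'"
  shows "(\<integral>\<omega>. el_int es \<omega> * el_int es' \<omega> \<partial>\<Omega>)
    = (\<Sum>k<q. \<Sum>l<q. K $$ (k, l) * (\<integral>z. el_val es k z * el_val es' l z \<partial>win a b))"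
  using es
proof (induction es)
  case (Cons e es)
  then have e: "elem_ok a b e" and es: "list_all (elem_ok a b) es" by auto
  note IH = Cons.IH[OF es]
  have 1: "(\<integral>\<omega>. term_int e \<omega> * el_int es' \<omega> \<partial>\<Omega>)
    = (\<Sum>k<q. \<Sum>l<q. K $$ (k, l) * (\<integral>z. term_val e k z * el_val es' l z \<partial>win a b))"
    using es'
  proof (induction es')
    case (Cons e' es')
    then have e': "elem_ok a b e'" and es': "list_all (elem_ok a b) es'" by auto
    have "integrable \<Omega> (\<lambda>\<omega>. term_int e \<omega> * term_int e' \<omega>)" "integrable \<Omega> (\<lambda>\<omega>. term_int e \<omega> * el_int es' \<omega>)"
      "integrable (win a b) (\<lambda>z. term_val e k z * term_val e' l z)"
      "integrable (win a b) (\<lambda>z. term_val e k z * el_val es' l z)" for k l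
      using e e' es' a
      by (auto intro!: integrable_sq_int_mult past_sq_int past_term_int past_el_int sq_int_term_val sq_int_el_val)
    then show ?case
      by (simp add: distrib_left sum.distrib expectation_term_int_mult'[OF a e e'] Cons.IH[OF es'])
  qed simp
  have "integrable \<Omega> (\<lambda>\<omega>. term_int e \<omega> * el_int es' \<omega>)" "integrable \<Omega> (\<lambda>\<omega>. el_int es \<omega> * el_int es' \<omega>)"
      "integrable (win a b) (\<lambda>z. term_val e k z * el_val es' l z)"
      "integrable (win a b) (\<lambda>z. el_val es k z * el_val es' l z)" for k l
      using e es es' a
      by (auto intro!: integrable_sq_int_mult past_sq_int past_term_int past_el_int sq_int_term_val sq_int_el_val)
  then show ?case
    by (simp add: distrib_left distrib_right sum.distrib 1 IH)
qed simp

end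

section \<open>The stochastic integral over a time window\<close>

lemma mean_square_limitI:
  assumes d: "\<And>n. sq_int M (\<lambda>x. f x - fn n x)"
    and lim: "(\<lambda>n. \<integral>x. (f x - fn n x)\<^sup>2 \<partial>M) \<longlonglongrightarrow> 0"
  shows "mean_square_lim M f fn"
proof -
  have "(\<integral>\<^sup>+x. ennreal ((f x - fn n x)\<^sup>2) \<partial>M) = ennreal (\<integral>x. (f x - fn n x)\<^sup>2 \<partial>M)" for n
    by (rule nn_integral_eq_integral[OF sq_int_integrable[OF d]]) simp
  then show ?thesis using lim ennreal_tendsto_0_iff[of "\<lambda>n. \<integral>x. (f x - fn n x)\<^sup>2 \<partial>M"] by simp
qed

context wiener_process
begin

text \<open>
  The integral over \<open>(a, b]\<close> of \<open>f\<close> with respect to the whole Wiener process, \<open>f i\<close> being integrated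
  against \<open>w i\<close>; a mean square limit of elementary integrals.
\<close>

definition ito :: "real \<Rightarrow> real \<Rightarrow> (nat \<Rightarrow> real \<times> 'w \<Rightarrow> real) \<Rightarrow> ('w \<Rightarrow> real) \<Rightarrow> bool" where
  "ito a b f I \<longleftrightarrow> I \<in> borel_measurable \<Omega> \<and> (\<forall>i<q. f i \<in> borel_measurable (lborel \<Otimes>\<^sub>M \<Omega>)) \<and>
     (\<exists>es. (\<forall>n. list_all (elem_ok a b) (es n)) \<and>
       (\<forall>i<q. mean_square_lim (win a b) (f i) (\<lambda>n. el_val (es n) i)) \<and>
       mean_square_lim \<Omega> I (\<lambda>n. el_int (es n)))"

lemma itoE:
  assumes "ito a b f I" "0 \<le> a"
  obtains es where "\<And>n. list_all (elem_ok a b) (es n)"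
    "\<And>i. i < q \<Longrightarrow> mean_square_lim (win a b) (f i) (\<lambda>n. el_val (es n) i)"
    "mean_square_lim \<Omega> I (\<lambda>n. el_int (es n))"
    "\<And>n i. sq_int (win a b) (el_val (es n) i)" "\<And>n. sq_int \<Omega> (el_int (es n))"
    "\<And>i. i < q \<Longrightarrow> sq_int (win a b) (f i)" "sq_int \<Omega> I"
proof -
  obtain es where es: "\<And>n. list_all (elem_ok a b) (es n)"
    and f: "\<And>i. i < q \<Longrightarrow> mean_square_lim (win a b) (f i) (\<lambda>n. el_val (es n) i)"
    and I: "mean_square_lim \<Omega> I (\<lambda>n. el_int (es n))"
    using assms unfolding ito_def by blast
  have v: "\<And>n i. sq_int (win a b) (el_val (es n) i)" using es by (auto intro: sq_int_el_val)
  have i: "\<And>n. sq_int \<Omega> (el_int (es n))" using es assms(2) by (auto intro: past_sq_int past_el_int)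
  have "\<And>i. i < q \<Longrightarrow> sq_int (win a b) (f i)"
    using assms(1) by (intro sq_int_limit[OF _ v f]) (auto simp: ito_def)
  moreover have "sq_int \<Omega> I"
    using assms(1) by (intro sq_int_limit[OF _ i I]) (auto simp: ito_def)
  ultimately show ?thesis using that[OF es f I v i] by blast
qed

lemma ito_sq_int:
  assumes "ito a b f I" "0 \<le> a"
  shows "sq_int \<Omega> I" and "i < q \<Longrightarrow> sq_int (win a b) (f i)"
  by (rule itoE[OF assms], assumption)+

lemma integrable_noise_form:
  assumes f: "\<And>i. i < q \<Longrightarrow> sq_int M (f i)"
  shows "integrable M (\<lambda>z. noise_form (\<lambda>i. f i z))"
    and "(\<integral>z. noise_form (\<lambda>i. f i z) \<partial>M) = (\<Sum>k<q. \<Sum>l<q. K $$ (k, l) * (\<integral>z. f k z * f l z \<partial>M))"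
proof -
  have *: "integrable M (\<lambda>z. K $$ (k, l) * (f k z * f l z))" if "k < q" "l < q" for k l
    using integrable_sq_int_mult[OF f[OF that(1)] f[OF that(2)]] by simp
  show "integrable M (\<lambda>z. noise_form (\<lambda>i. f i z))"
    unfolding noise_form_def by (intro Bochner_Integration.integrable_sum *) auto
  show "(\<integral>z. noise_form (\<lambda>i. f i z) \<partial>M) = (\<Sum>k<q. \<Sum>l<q. K $$ (k, l) * (\<integral>z. f k z * f l z \<partial>M))"
    unfolding noise_form_def
    by (subst Bochner_Integration.integral_sum, (intro Bochner_Integration.integrable_sum *; simp),
        intro sum.cong refl, subst Bochner_Integration.integral_sum, rule *, simp, simp) simp_all
qed

lemma ito_isometry:
  assumes "ito a b f I" "0 \<le> a"
  shows "(\<integral>\<omega>. (I \<omega>)\<^sup>2 \<partial>\<Omega>) = (\<integral>z. noise_form (\<lambda>i. f i z) \<partial>win a b)"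
proof -
  obtain es where es: "\<And>n. list_all (elem_ok a b) (es n)"
    and f: "\<And>i. i < q \<Longrightarrow> mean_square_lim (win a b) (f i) (\<lambda>n. el_val (es n) i)"
    and I: "mean_square_lim \<Omega> I (\<lambda>n. el_int (es n))"
    and v: "\<And>n i. sq_int (win a b) (el_val (es n) i)" and i: "\<And>n. sq_int \<Omega> (el_int (es n))"
    and sf: "\<And>i. i < q \<Longrightarrow> sq_int (win a b) (f i)" and sI: "sq_int \<Omega> I"
    by (rule itoE[OF assms]) blast
  have "(\<lambda>n. \<integral>\<omega>. el_int (es n) \<omega> * el_int (es n) \<omega> \<partial>\<Omega>) \<longlonglongrightarrow> (\<integral>\<omega>. I \<omega> * I \<omega> \<partial>\<Omega>)"
    by (rule tendsto_integral_mult[OF sI i I sI i I])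
  moreover have "(\<lambda>n. \<integral>\<omega>. el_int (es n) \<omega> * el_int (es n) \<omega> \<partial>\<Omega>)
    \<longlonglongrightarrow> (\<Sum>k<q. \<Sum>l<q. K $$ (k, l) * (\<integral>z. f k z * f l z \<partial>win a b))"
    unfolding el_int_isometry[OF assms(2) es es]
    by (intro tendsto_sum tendsto_mult tendsto_const tendsto_integral_mult sf v f) auto
  ultimately have "(\<integral>\<omega>. I \<omega> * I \<omega> \<partial>\<Omega>) = (\<Sum>k<q. \<Sum>l<q. K $$ (k, l) * (\<integral>z. f k z * f l z \<partial>win a b))"
    by (rule LIMSEQ_unique)
  then show ?thesis by (simp add: integrable_noise_form(2)[OF sf] power2_eq_square)
qed

text \<open>
  Every increment in an approximating elementary integral starts at or after \<open>a\<close>.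
\<close>

lemma ito_orthogonal:
  assumes "ito a b f I" "0 \<le> a" and Z: "past a Z"
  shows "(\<integral>\<omega>. Z \<omega> * I \<omega> \<partial>\<Omega>) = 0"
proof -
  obtain es where es: "\<And>n. list_all (elem_ok a b) (es n)"
    and I: "mean_square_lim \<Omega> I (\<lambda>n. el_int (es n))"
    and i: "\<And>n. sq_int \<Omega> (el_int (es n))" and sI: "sq_int \<Omega> I"
    by (rule itoE[OF assms(1,2)]) blast
  have "(\<lambda>n. \<integral>\<omega>. Z \<omega> * el_int (es n) \<omega> \<partial>\<Omega>) \<longlonglongrightarrow> (\<integral>\<omega>. Z \<omega> * I \<omega> \<partial>\<Omega>)"
    by (rule tendsto_integral_mult[OF past_sq_int[OF Z] past_sq_int[OF Z] _ sI i I]) simp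
  moreover have "(\<integral>\<omega>. Z \<omega> * el_int (es n) \<omega> \<partial>\<Omega>) = 0" for n
    by (rule expectation_past_el_int[OF es assms(2) Z])
  ultimately show ?thesis by (simp add: LIMSEQ_const_iff)
qed

lemma ito_add:
  assumes f: "ito a b f I" and g: "ito a b g J" and "0 \<le> a"
  shows "ito a b (\<lambda>i z. f i z + g i z) (\<lambda>\<omega>. I \<omega> + J \<omega>)"
proof -
  obtain es where es: "\<And>n. list_all (elem_ok a b) (es n)"
    and f1: "\<And>i. i < q \<Longrightarrow> mean_square_lim (win a b) (f i) (\<lambda>n. el_val (es n) i)"
    and I1: "mean_square_lim \<Omega> I (\<lambda>n. el_int (es n))"
    and v1: "\<And>n i. sq_int (win a b) (el_val (es n) i)" and i1: "\<And>n. sq_int \<Omega> (el_int (es n))"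
    and sf: "\<And>i. i < q \<Longrightarrow> sq_int (win a b) (f i)" and sI: "sq_int \<Omega> I"
    by (rule itoE[OF assms(1,3)]) blast
  obtain es' where es': "\<And>n. list_all (elem_ok a b) (es' n)"
    and f2: "\<And>i. i < q \<Longrightarrow> mean_square_lim (win a b) (g i) (\<lambda>n. el_val (es' n) i)"
    and I2: "mean_square_lim \<Omega> J (\<lambda>n. el_int (es' n))"
    and v2: "\<And>n i. sq_int (win a b) (el_val (es' n) i)" and i2: "\<And>n. sq_int \<Omega> (el_int (es' n))"
    and sg: "\<And>i. i < q \<Longrightarrow> sq_int (win a b) (g i)" and sJ: "sq_int \<Omega> J"
    by (rule itoE[OF assms(2,3)]) blast
  note m = sq_int_measurable
  have "(\<lambda>n. \<integral>\<^sup>+z. ennreal ((f i z + g i z - el_val (es n @ es' n) i z)\<^sup>2) \<partial>win a b) \<longlonglongrightarrow> 0" if "i < q" for i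
    using mean_square_limit_add[OF m[OF sf[OF that]] m[OF sg[OF that]] m[OF v1] m[OF v2] f1[OF that] f2[OF that]]
    by simp
  moreover have "(\<lambda>n. \<integral>\<^sup>+\<omega>. ennreal ((I \<omega> + J \<omega> - el_int (es n @ es' n) \<omega>)\<^sup>2) \<partial>\<Omega>) \<longlonglongrightarrow> 0"
    using mean_square_limit_add[OF m[OF sI] m[OF sJ] m[OF i1] m[OF i2] I1 I2] by simp
  moreover have "\<forall>n. list_all (elem_ok a b) (es n @ es' n)" using es es' by simp
  ultimately show ?thesis
    using f g unfolding ito_def by (intro conjI exI[of _ "\<lambda>n. es n @ es' n"]) (auto intro: borel_measurable_add)
qed

fun scale_term :: "real \<Rightarrow> nat \<times> real \<times> real \<times> ('w \<Rightarrow> real) \<Rightarrow> nat \<times> real \<times> real \<times> ('w \<Rightarrow> real)" where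
  "scale_term c (i, s, t, \<xi>) = (i, s, t, \<lambda>\<omega>. c * \<xi> \<omega>)"

lemma scale_term:
  "elem_ok a b e \<Longrightarrow> elem_ok a b (scale_term c e)"
  "term_val (scale_term c e) k z = c * term_val e k z"
  "term_int (scale_term c e) \<omega> = c * term_int e \<omega>"
  by (cases e; auto intro: past_cmult)+

lemma scale_el:
  "list_all (elem_ok a b) es \<Longrightarrow> list_all (elem_ok a b) (map (scale_term c) es)"
  "el_val (map (scale_term c) es) k z = c * el_val es k z"
  "el_int (map (scale_term c) es) \<omega> = c * el_int es \<omega>"
  by (induction es) (auto simp: scale_term distrib_left)

lemma ito_cmult:
  assumes f: "ito a b f I" and "0 \<le> a"
  shows "ito a b (\<lambda>i z. c * f i z) (\<lambda>\<omega>. c * I \<omega>)"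
proof -
  obtain es where es: "\<And>n. list_all (elem_ok a b) (es n)"
    and f1: "\<And>i. i < q \<Longrightarrow> mean_square_lim (win a b) (f i) (\<lambda>n. el_val (es n) i)"
    and I1: "mean_square_lim \<Omega> I (\<lambda>n. el_int (es n))"
    and v1: "\<And>n i. sq_int (win a b) (el_val (es n) i)" and i1: "\<And>n. sq_int \<Omega> (el_int (es n))"
    and sf: "\<And>i. i < q \<Longrightarrow> sq_int (win a b) (f i)" and sI: "sq_int \<Omega> I"
    by (rule itoE[OF assms]) blast
  note m = sq_int_measurable
  have "(\<lambda>n. \<integral>\<^sup>+z. ennreal ((c * f i z - el_val (map (scale_term c) (es n)) i z)\<^sup>2) \<partial>win a b) \<longlonglongrightarrow> 0" if "i < q" for i
    unfolding scale_el by (rule mean_square_limit_cmult[OF m[OF sf[OF that]] m[OF v1] f1[OF that]])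
  moreover have "(\<lambda>n. \<integral>\<^sup>+\<omega>. ennreal ((c * I \<omega> - el_int (map (scale_term c) (es n)) \<omega>)\<^sup>2) \<partial>\<Omega>) \<longlonglongrightarrow> 0"
    unfolding scale_el by (rule mean_square_limit_cmult[OF m[OF sI] m[OF i1] I1])
  moreover have "\<forall>n. list_all (elem_ok a b) (map (scale_term c) (es n))" using es scale_el(1) by blast
  ultimately show ?thesis
    using f unfolding ito_def
    by (intro conjI exI[of _ "\<lambda>n. map (scale_term c) (es n)"]) (auto intro!: borel_measurable_times)
qed

lemma ito_elementary:
  assumes es: "list_all (elem_ok a b) es" and a: "0 \<le> a"
    and f [measurable]: "\<And>i. i < q \<Longrightarrow> f i \<in> borel_measurable (lborel \<Otimes>\<^sub>M \<Omega>)"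
    and eq: "\<And>i z. i < q \<Longrightarrow> a < fst z \<Longrightarrow> fst z \<le> b \<Longrightarrow> f i z = el_val es i z"
  shows "ito a b f (el_int es)"
proof -
  have "(\<integral>\<^sup>+z. ennreal ((f i z - el_val es i z)\<^sup>2) \<partial>win a b) = 0" if "i < q" for i
  proof -
    have "AE z in win a b. ennreal ((f i z - el_val es i z)\<^sup>2) = 0"
      by (rule AE_win_iff_indicator) (use eq[OF that] in auto)
    then have "(\<integral>\<^sup>+z. ennreal ((f i z - el_val es i z)\<^sup>2) \<partial>win a b) = (\<integral>\<^sup>+z. 0 \<partial>win a b)"
      by (rule nn_integral_cong_AE)
    then show ?thesis by simp
  qed
  then show ?thesis
    unfolding ito_def using es sq_int_measurable[OF past_sq_int[OF past_el_int[OF es a]]]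
    by (intro conjI exI[of _ "\<lambda>_. es"]) (auto simp: f)
qed

lemma ito_zero: "0 \<le> a \<Longrightarrow> ito a b (\<lambda>i z. 0) (\<lambda>\<omega>. 0)"
  using ito_elementary[of a b "[]" "\<lambda>i z. 0"] by (simp add: el_int_def[abs_def])

lemma ito_sum:
  assumes "\<And>k. k \<in> I \<Longrightarrow> ito a b (f k) (J k)" "0 \<le> a"
  shows "ito a b (\<lambda>i z. \<Sum>k\<in>I. f k i z) (\<lambda>\<omega>. \<Sum>k\<in>I. J k \<omega>)"
  using assms by (induction I rule: infinite_finite_induct) (auto intro: ito_zero ito_add)

lemma ito_const:
  assumes \<xi>: "\<And>i. i < q \<Longrightarrow> past a (\<xi> i)" and ab: "0 \<le> a" "a \<le> b"
  shows "ito a b (\<lambda>i z. \<xi> i (snd z)) (\<lambda>\<omega>. \<Sum>i<q. \<xi> i \<omega> * incr i a b \<omega>)"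
proof -
  let ?es = "map (\<lambda>i. (i, a, b, \<xi> i)) [0..<q]"
  have int: "el_int ?es = (\<lambda>\<omega>. \<Sum>i<q. \<xi> i \<omega> * incr i a b \<omega>)"
    by (auto simp: el_int_def comp_def interv_sum_list_conv_sum_set_nat atLeast0LessThan)
  have val: "el_val ?es i z = \<xi> i (snd z)" if "i < q" "a < fst z" "fst z \<le> b" for i z
    using that by (auto simp: el_val_def comp_def interv_sum_list_conv_sum_set_nat atLeast0LessThan
      if_distrib[of "\<lambda>x. x * _"] sum.delta cong: if_cong)
  have "ito a b (\<lambda>i z. \<xi> i (snd z)) (el_int ?es)"
  proof (rule ito_elementary)
    fix i assume "i < q"
    from sq_int_measurable[OF past_sq_int[OF \<xi>[OF this]]]
    show "(\<lambda>z. \<xi> i (snd z)) \<in> borel_measurable (lborel \<Otimes>\<^sub>M \<Omega>)" by measurable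
  qed (use \<xi> ab val in \<open>auto simp: list_all_iff\<close>)
  then show ?thesis by (simp add: int)
qed

lemma ito_cong:
  assumes f: "ito a b f I"
    and g: "\<And>i. i < q \<Longrightarrow> g i \<in> borel_measurable (lborel \<Otimes>\<^sub>M \<Omega>)"
    and eq: "\<And>i z. i < q \<Longrightarrow> a < fst z \<Longrightarrow> fst z \<le> b \<Longrightarrow> snd z \<in> space \<Omega> \<Longrightarrow> g i z = f i z"
  shows "ito a b g I"
proof -
  have "(\<integral>\<^sup>+z. ennreal ((g i z - h z)\<^sup>2) \<partial>win a b) = (\<integral>\<^sup>+z. ennreal ((f i z - h z)\<^sup>2) \<partial>win a b)" if "i < q" for i h
    by (rule nn_integral_cong_AE, rule AE_win_iff_indicator) (simp add: eq that)
  then show ?thesis using f g unfolding ito_def by simp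
qed

fun before :: "real \<Rightarrow> nat \<times> real \<times> real \<times> ('w \<Rightarrow> real) \<Rightarrow> 'w elementary" where
  "before c (i, s, t, \<xi>) = (if s \<le> c then [(i, s, min t c, \<xi>)] else [])"

fun after :: "real \<Rightarrow> nat \<times> real \<times> real \<times> ('w \<Rightarrow> real) \<Rightarrow> 'w elementary" where
  "after c (i, s, t, \<xi>) = (if c \<le> t then [(i, max s c, t, \<xi>)] else [])"

lemma split_term:
  assumes "elem_ok a b e" "0 \<le> a" "a \<le> c" "c \<le> b"
  shows "list_all (elem_ok a c) (before c e)" "list_all (elem_ok c b) (after c e)"
    "term_int e \<omega> = el_int (before c e) \<omega> + el_int (after c e) \<omega>"
    "fst z \<le> c \<Longrightarrow> el_val (before c e) k z = term_val e k z"
    "c < fst z \<Longrightarrow> el_val (after c e) k z = term_val e k z"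
proof -
  obtain i s t \<xi> where e: "e = (i, s, t, \<xi>)" by (cases e)
  have f: "i < q" "a \<le> s" "s \<le> t" "t \<le> b" "past s \<xi>" using assms(1) by (auto simp: e)
  have "past (max s c) \<xi>" using past_mono[of s "max s c" \<xi>] f assms by simp
  then show "list_all (elem_ok c b) (after c e)" using f by (simp add: e)
  show "list_all (elem_ok a c) (before c e)" using f by (simp add: e)
  show "term_int e \<omega> = el_int (before c e) \<omega> + el_int (after c e) \<omega>"
    using f by (simp add: e incr_def max_def min_def right_diff_distrib)
  show "fst z \<le> c \<Longrightarrow> el_val (before c e) k z = term_val e k z"
    "c < fst z \<Longrightarrow> el_val (after c e) k z = term_val e k z"
    using f by (simp_all add: e indicator_def)
qed

lemma split_el:
  assumes "list_all (elem_ok a b) es" "0 \<le> a" "a \<le> c" "c \<le> b"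
  shows "list_all (elem_ok a c) (concat (map (before c) es))" "list_all (elem_ok c b) (concat (map (after c) es))"
    "el_int es \<omega> = el_int (concat (map (before c) es)) \<omega> + el_int (concat (map (after c) es)) \<omega>"
    "fst z \<le> c \<Longrightarrow> el_val (concat (map (before c) es)) k z = el_val es k z"
    "c < fst z \<Longrightarrow> el_val (concat (map (after c) es)) k z = el_val es k z"
  using assms(1) by (induction es) (auto simp: split_term[OF _ assms(2-4)])

text \<open>
  The approximations of \<open>I\<close> and of \<open>J\<close> are unrelated, so they cannot be subtracted term by term.  Those of \<open>I\<close> are
  cut at \<open>a\<close>.  Their parts before \<open>a\<close> and the approximations of \<open>J\<close> have the same limit integrand,
  hence, by the isometry, integrals with the same limit \<open>J\<close>; the parts after \<open>a\<close>
  therefore approximate \<open>I - J\<close>.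
\<close>

lemma ito_window:
  assumes fb: "ito 0 b f I" and fa: "ito 0 a f J" and ab: "0 \<le> a" "a \<le> b"
  shows "ito a b f (\<lambda>\<omega>. I \<omega> - J \<omega>)"
proof -
  obtain es where es: "\<And>n. list_all (elem_ok 0 b) (es n)"
    and f1: "\<And>i. i < q \<Longrightarrow> mean_square_lim (win 0 b) (f i) (\<lambda>n. el_val (es n) i)"
    and I1: "mean_square_lim \<Omega> I (\<lambda>n. el_int (es n))"
    and v1: "\<And>n i. sq_int (win 0 b) (el_val (es n) i)" and i1: "\<And>n. sq_int \<Omega> (el_int (es n))"
    and sf: "\<And>i. i < q \<Longrightarrow> sq_int (win 0 b) (f i)" and sI: "sq_int \<Omega> I"
    by (rule itoE[OF fb order_refl]) blast
  obtain es' where es': "\<And>n. list_all (elem_ok 0 a) (es' n)"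
    and f2: "\<And>i. i < q \<Longrightarrow> mean_square_lim (win 0 a) (f i) (\<lambda>n. el_val (es' n) i)"
    and I2: "mean_square_lim \<Omega> J (\<lambda>n. el_int (es' n))"
    and v2: "\<And>n i. sq_int (win 0 a) (el_val (es' n) i)" and i2: "\<And>n. sq_int \<Omega> (el_int (es' n))"
    and sf2: "\<And>i. i < q \<Longrightarrow> sq_int (win 0 a) (f i)" and sJ: "sq_int \<Omega> J"
    by (rule itoE[OF fa order_refl]) blast
  define lo where "lo n = concat (map (before a) (es n))" for n
  define hi where "hi n = concat (map (after a) (es n))" for n
  note sp = split_el[OF es order_refl ab, folded lo_def hi_def]
  \<comment> \<open>the integrand of \<open>d n\<close> tends to \<open>0\<close> on \<open>(0, a]\<close>, so its integral does, too\<close>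
  define d where "d n = lo n @ map (scale_term (-1)) (es' n)" for n
  have d: "list_all (elem_ok 0 a) (d n)" for n using sp(1) es' scale_el(1) by (simp add: d_def)
  have sd: "sq_int (win 0 a) (el_val (d n) i)" "sq_int \<Omega> (el_int (d n))" for n i
    using d by (auto intro: sq_int_el_val past_sq_int past_el_int)
  note m = sq_int_measurable
  have hi_lim: "mean_square_lim (win a b) (f i) (\<lambda>n. el_val (hi n) i)" if "i < q" for i
  proof (rule tendsto_sandwich[OF _ _ tendsto_const f1[OF that]])
    have "(\<integral>\<^sup>+z. ennreal ((f i z - el_val (hi n) i z)\<^sup>2) \<partial>win a b) \<le> (\<integral>\<^sup>+z. ennreal ((f i z - el_val (es n) i z)\<^sup>2) \<partial>win 0 b)" for n
    proof -
      have "(\<integral>\<^sup>+z. ennreal ((f i z - el_val (hi n) i z)\<^sup>2) \<partial>win a b) = (\<integral>\<^sup>+z. ennreal ((f i z - el_val (es n) i z)\<^sup>2) \<partial>win a b)"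
        by (rule nn_integral_cong_AE, rule AE_win_iff_indicator) (simp add: sp(5))
      also have "\<dots> \<le> (\<integral>\<^sup>+z. ennreal ((f i z - el_val (es n) i z)\<^sup>2) \<partial>win 0 b)"
        using m[OF sf[OF that]] m[OF v1] ab by (intro win_mono) auto
      finally show ?thesis .
    qed
    then show "\<forall>\<^sub>F n in sequentially. (\<integral>\<^sup>+z. ennreal ((f i z - el_val (hi n) i z)\<^sup>2) \<partial>win a b)
      \<le> (\<integral>\<^sup>+z. ennreal ((f i z - el_val (es n) i z)\<^sup>2) \<partial>win 0 b)" by simp
  qed simp
  have lo_lim: "mean_square_lim (win 0 a) (f i) (\<lambda>n. el_val (lo n) i)" if "i < q" for i
  proof (rule tendsto_sandwich[OF _ _ tendsto_const f1[OF that]])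
    have "(\<integral>\<^sup>+z. ennreal ((f i z - el_val (lo n) i z)\<^sup>2) \<partial>win 0 a) \<le> (\<integral>\<^sup>+z. ennreal ((f i z - el_val (es n) i z)\<^sup>2) \<partial>win 0 b)" for n
    proof -
      have "(\<integral>\<^sup>+z. ennreal ((f i z - el_val (lo n) i z)\<^sup>2) \<partial>win 0 a) = (\<integral>\<^sup>+z. ennreal ((f i z - el_val (es n) i z)\<^sup>2) \<partial>win 0 a)"
        by (rule nn_integral_cong_AE, rule AE_win_iff_indicator) (simp add: sp(4))
      also have "\<dots> \<le> (\<integral>\<^sup>+z. ennreal ((f i z - el_val (es n) i z)\<^sup>2) \<partial>win 0 b)"
        using m[OF sf[OF that]] m[OF v1] ab by (intro win_mono) auto
      finally show ?thesis .
    qed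
    then show "\<forall>\<^sub>F n in sequentially. (\<integral>\<^sup>+z. ennreal ((f i z - el_val (lo n) i z)\<^sup>2) \<partial>win 0 a)
      \<le> (\<integral>\<^sup>+z. ennreal ((f i z - el_val (es n) i z)\<^sup>2) \<partial>win 0 b)" by simp
  qed simp
  have slo: "sq_int (win 0 a) (el_val (lo n) i)" for n i using sp(1) by (rule sq_int_el_val)
  have d_lim: "(\<lambda>n. \<integral>\<^sup>+z. ennreal ((0 - el_val (d n) i z)\<^sup>2) \<partial>win 0 a) \<longlonglongrightarrow> 0" if "i < q" for i
    using mean_square_limit_add[OF m[OF sf2[OF that]] m[OF sq_int_cmult[OF sf2[OF that], of "-1"]]
       m[OF slo] m[OF sq_int_cmult[OF v2, of "-1"]] lo_lim[OF that]
       mean_square_limit_cmult[OF m[OF sf2[OF that]] m[OF v2] f2[OF that], of "-1"]]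
    by (simp add: d_def scale_el)
  have "(\<lambda>n. \<Sum>k<q. \<Sum>l<q. K $$ (k, l) * (\<integral>z. el_val (d n) k z * el_val (d n) l z \<partial>win 0 a))
     \<longlonglongrightarrow> (\<Sum>k<q. \<Sum>l<q. K $$ (k, l) * (\<integral>z. 0 * 0 \<partial>win 0 a))"
    by (intro tendsto_sum tendsto_mult tendsto_const tendsto_integral_mult d_lim sd sq_int_zero) auto
  then have "(\<lambda>n. \<integral>\<omega>. (0 - el_int (d n) \<omega>)\<^sup>2 \<partial>\<Omega>) \<longlonglongrightarrow> 0"
    using el_int_isometry[OF order_refl d d] by (simp add: power2_eq_square)
  then have D: "(\<lambda>n. \<integral>\<^sup>+\<omega>. ennreal ((0 - el_int (d n) \<omega>)\<^sup>2) \<partial>\<Omega>) \<longlonglongrightarrow> 0"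
    by (rule mean_square_limitI[rotated]) (intro sq_int_diff sd sq_int_zero)
  have IJ: "(\<lambda>n. \<integral>\<^sup>+\<omega>. ennreal ((I \<omega> + (-1) * J \<omega> - (el_int (es n) \<omega> + (-1) * el_int (es' n) \<omega>))\<^sup>2) \<partial>\<Omega>) \<longlonglongrightarrow> 0"
    using mean_square_limit_add[OF m[OF sI] m[OF sq_int_cmult[OF sJ, of "-1"]] m[OF i1] m[OF sq_int_cmult[OF i2, of "-1"]]
       I1 mean_square_limit_cmult[OF m[OF sJ] m[OF i2] I2, of "-1"]] .
  have nd: "(\<lambda>n. \<integral>\<^sup>+\<omega>. ennreal ((-1 * 0 - (-1) * el_int (d n) \<omega>)\<^sup>2) \<partial>\<Omega>) \<longlonglongrightarrow> 0"
    by (rule mean_square_limit_cmult[OF _ m[OF sd(2)] D]) simp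
  have "(\<lambda>n. \<integral>\<^sup>+\<omega>. ennreal ((I \<omega> - J \<omega> - el_int (hi n) \<omega>)\<^sup>2) \<partial>\<Omega>) \<longlonglongrightarrow> 0"
  proof -
    have "(\<lambda>n. \<integral>\<^sup>+\<omega>. ennreal (((I \<omega> + (-1) * J \<omega>) + (-1 * 0) -
         ((el_int (es n) \<omega> + (-1) * el_int (es' n) \<omega>) + (-1) * el_int (d n) \<omega>))\<^sup>2) \<partial>\<Omega>) \<longlonglongrightarrow> 0"
      by (rule mean_square_limit_add[OF _ _ _ _ IJ nd])
        (intro borel_measurable_add borel_measurable_times borel_measurable_const m[OF sI] m[OF sJ] m[OF i1] m[OF i2] m[OF sd(2)])+
    moreover have "((I \<omega> + (-1) * J \<omega>) + (-1 * 0) - ((el_int (es n) \<omega> + (-1) * el_int (es' n) \<omega>) + (-1) * el_int (d n) \<omega>))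
       = I \<omega> - J \<omega> - el_int (hi n) \<omega>" for n \<omega>
      using sp(3)[of n \<omega>] by (simp add: d_def scale_el)
    ultimately show ?thesis by (simp only:)
  qed
  then show ?thesis
    using fb fa hi_lim sp(2) unfolding ito_def by (intro conjI exI[of _ hi]) (auto intro: borel_measurable_diff)
qed

lemma ito_of_has_ito_integral:
  assumes h: "has_ito_integral \<Omega> F (w i) t f I" and i: "i < q" and t: "0 \<le> t"
    and g [measurable]: "g \<in> borel_measurable (lborel \<Otimes>\<^sub>M \<Omega>)"
    and eq: "\<And>s \<omega>. 0 \<le> s \<Longrightarrow> s \<le> t \<Longrightarrow> \<omega> \<in> space \<Omega> \<Longrightarrow> g (s, \<omega>) = f s \<omega>"
  shows "ito 0 t (\<lambda>k z. if k = i then g z else 0) I"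
proof -
  obtain N \<tau> \<xi> where sp: "\<And>j. simple_process \<Omega> F t (N j) (\<tau> j) (\<xi> j)"
    and f: "(\<lambda>j. \<integral>\<^sup>+\<omega>. (\<integral>\<^sup>+s\<in>{0..t}. ennreal ((f s \<omega> - simple_value (N j) (\<tau> j) (\<xi> j) s \<omega>)\<^sup>2) \<partial>lborel) \<partial>\<Omega>) \<longlonglongrightarrow> 0"
    and I: "(\<lambda>j. \<integral>\<^sup>+\<omega>. ennreal ((I \<omega> - simple_integral (w i) (N j) (\<tau> j) (\<xi> j) \<omega>)\<^sup>2) \<partial>\<Omega>) \<longlonglongrightarrow> 0"
    using h unfolding has_ito_integral_def by blast
  define es where "es j = map (\<lambda>k. (i, \<tau> j k, \<tau> j (Suc k), \<xi> j k)) [0..<N j]" for j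
  have int: "el_int (es j) \<omega> = simple_integral (w i) (N j) (\<tau> j) (\<xi> j) \<omega>" for j \<omega>
    by (simp add: es_def el_int_def comp_def interv_sum_list_conv_sum_set_nat atLeast0LessThan simple_integral_def incr_def)
  have val: "el_val (es j) k z = (if k = i then simple_value (N j) (\<tau> j) (\<xi> j) (fst z) (snd z) else 0)" for j k z
    by (auto simp: es_def el_val_def comp_def interv_sum_list_conv_sum_set_nat atLeast0LessThan simple_value_def)
  have ok: "list_all (elem_ok 0 t) (es j)" for j
  proof -
    have step: "\<tau> j k \<le> \<tau> j (Suc k)" if "k < N j" for k using sp[of j] that by (auto simp: simple_process_def)
    have lo: "0 \<le> \<tau> j k" if "k \<le> N j" for k
      using that
    proof (induction k)
      case 0
      then show ?case using sp[of j] by (auto simp: simple_process_def)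
    next
      case (Suc k)
      then show ?case using step[of k] by auto
    qed
    have hi: "\<tau> j k \<le> t" if "k \<le> N j" for k
      using that
    proof (induction k rule: inc_induct)
      case base
      then show ?case using sp[of j] by (auto simp: simple_process_def)
    next
      case (step k)
      then show ?case using \<open>\<And>k. k < N j \<Longrightarrow> \<tau> j k \<le> \<tau> j (Suc k)\<close>[of k] by auto
    qed
    have "past (\<tau> j k) (\<xi> j k)" if k: "k < N j" for k
    proof -
      obtain c where c: "\<And>\<omega>. \<omega> \<in> space \<Omega> \<Longrightarrow> \<bar>\<xi> j k \<omega>\<bar> \<le> c" and m: "\<xi> j k \<in> borel_measurable (F (\<tau> j k))"
        using sp[of j] k unfolding simple_process_def by blast
      have m': "\<xi> j k \<in> borel_measurable \<Omega>" using measurable_F_imp_measurable[OF lo m] k by simp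
      have "sq_int \<Omega> (\<xi> j k)"
        by (rule sq_int_dominated[OF m', of "\<lambda>_. c\<^sup>2"]) (auto dest: c intro: abs_le_square_iff[THEN iffD1] simp: abs_le_square_iff[symmetric])
      with m show ?thesis by (simp add: past_def)
    qed
    then show ?thesis using i step lo hi by (auto simp: es_def list_all_iff)
  qed
  have [measurable]: "el_val (es j) k \<in> borel_measurable (lborel \<Otimes>\<^sub>M \<Omega>)" for j k
    using sq_int_measurable[OF sq_int_el_val[OF ok]] by simp
  have "(\<lambda>n. \<integral>\<^sup>+z. ennreal (((if k = i then g z else 0) - el_val (es n) k z)\<^sup>2) \<partial>win 0 t) \<longlonglongrightarrow> 0" if "k < q" for k
  proof (cases "k = i")
    case True
    have "(\<integral>\<^sup>+z. ennreal ((g z - el_val (es n) i z)\<^sup>2) \<partial>win 0 t) =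
       (\<integral>\<^sup>+\<omega>. (\<integral>\<^sup>+s\<in>{0..t}. ennreal ((f s \<omega> - simple_value (N n) (\<tau> n) (\<xi> n) s \<omega>)\<^sup>2) \<partial>lborel) \<partial>\<Omega>)" for n
    proof -
      have "(\<lambda>z. ennreal ((g z - el_val (es n) i z)\<^sup>2)) \<in> borel_measurable (lborel \<Otimes>\<^sub>M \<Omega>)" by measurable
      from nn_integral_win_iterated[OF this, of 0 t] show ?thesis
        by (auto intro!: nn_integral_cong simp: val eq indicator_def)
    qed
    with f True show ?thesis by simp
  qed (simp add: val)
  then show ?thesis
    unfolding ito_def using ok h I
    by (intro conjI exI[of _ es]) (auto simp: int has_ito_integral_def)
qed

end

section \<open>One time step of a second moment\<close>

text \<open>
  Bounds between quadratic forms in states and inputs whose constants matter only through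
  their independence of the grid.
\<close>

definition dominated :: "('a \<Rightarrow> real) \<Rightarrow> ('a \<Rightarrow> real) \<Rightarrow> bool" where
  "dominated r f \<longleftrightarrow> (\<exists>c\<ge>0. \<forall>x. f x \<le> c * r x)"

lemma dominated_base: "(\<And>x. f x \<le> r x) \<Longrightarrow> dominated r f"
  unfolding dominated_def by (intro exI[of _ 1]) simp

lemma dominated_add:
  assumes "dominated r f" "dominated r g"
  shows "dominated r (\<lambda>x. f x + g x)"
proof -
  from assms obtain c d where "c \<ge> 0" "\<And>x. f x \<le> c * r x" "d \<ge> 0" "\<And>x. g x \<le> d * r x"
    unfolding dominated_def by blast
  then show ?thesis unfolding dominated_def
    by (intro exI[of _ "c + d"]) (auto simp: distrib_right intro: add_mono)
qed

lemma dominated_cmult: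
  assumes "dominated r f" "0 \<le> a"
  shows "dominated r (\<lambda>x. a * f x)"
proof -
  from assms obtain c where "c \<ge> 0" "\<And>x. f x \<le> c * r x"
    unfolding dominated_def by blast
  then show ?thesis unfolding dominated_def using assms(2)
    by (intro exI[of _ "a * c"]) (auto simp: mult.assoc intro: mult_left_mono)
qed

lemma dominated_mono: "dominated r g \<Longrightarrow> (\<And>x. f x \<le> g x) \<Longrightarrow> dominated r f"
  unfolding dominated_def by (meson order_trans)

lemma dominated_zero: "dominated r (\<lambda>x. 0)"
  unfolding dominated_def by (intro exI[of _ 0]) simp

lemma dominated_sum: "(\<And>i. i \<in> I \<Longrightarrow> dominated r (f i)) \<Longrightarrow> dominated r (\<lambda>x. \<Sum>i\<in>I. f i x)"
  by (induction I rule: infinite_finite_induct) (auto intro: dominated_add dominated_zero)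

lemma dominated_square_add:
  assumes "dominated r (\<lambda>x. (f x)\<^sup>2)" "dominated r (\<lambda>x. (g x)\<^sup>2)"
  shows "dominated r (\<lambda>x. (f x + g x)\<^sup>2)"
  by (rule dominated_mono[OF dominated_add[OF dominated_cmult[OF assms(1), of 2] dominated_cmult[OF assms(2), of 2]]])
     (simp_all add: square_add_le)

lemma dominated_square_cmult: "dominated r (\<lambda>x. (f x)\<^sup>2) \<Longrightarrow> dominated r (\<lambda>x. (a * f x)\<^sup>2)"
  by (simp add: power_mult_distrib dominated_cmult)

lemma dominated_square_diff:
  assumes "dominated r (\<lambda>x. (f x)\<^sup>2)" "dominated r (\<lambda>x. (g x)\<^sup>2)"
  shows "dominated r (\<lambda>x. (f x - g x)\<^sup>2)"
  using dominated_square_add[OF assms(1) dominated_square_cmult[OF assms(2), of "-1"]] by simp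

lemma dominated_square_sum:
  "(\<And>i. i \<in> I \<Longrightarrow> dominated r (\<lambda>x. (f i x)\<^sup>2)) \<Longrightarrow> dominated r (\<lambda>x. (\<Sum>i\<in>I. f i x)\<^sup>2)"
  by (induction I rule: infinite_finite_induct) (auto intro: dominated_square_add dominated_zero)

context wiener_process
begin

lemma noise_form_combination:
  "noise_form (\<lambda>i. x * b i + y * d i) = x\<^sup>2 * noise_form b
     + x * y * (\<Sum>i<q. \<Sum>j<q. K $$ (i, j) * (b i * d j + d i * b j)) + y\<^sup>2 * noise_form d"
  unfolding noise_form_def sum_distrib_left sum.distrib[symmetric]
  by (intro sum.cong refl) (simp add: power2_eq_square algebra_simps)

text \<open>
  Expand \<open>noise_form (\<theta> b - d) \<ge> 0\<close>.
\<close>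

lemma noise_form_add_le:
  assumes "0 < \<theta>"
  shows "noise_form (\<lambda>i. b i + d i) \<le> (1 + \<theta>) * noise_form b + (1 + 1 / \<theta>) * noise_form d"
proof -
  define c where "c = (\<Sum>i<q. \<Sum>j<q. K $$ (i, j) * (b i * d j + d i * b j))"
  have "0 \<le> noise_form (\<lambda>i. \<theta> * b i + (-1) * d i)" by (rule noise_form_nonneg)
  then have "\<theta> * c \<le> \<theta>\<^sup>2 * noise_form b + noise_form d"
    unfolding noise_form_combination c_def[symmetric] by simp
  then have "c \<le> \<theta> * noise_form b + noise_form d / \<theta>"
    using assms by (simp add: field_simps power2_eq_square)
  moreover have "noise_form (\<lambda>i. b i + d i) = noise_form b + c + noise_form d"
    using noise_form_combination[of 1 b 1 d] by (simp add: c_def)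
  ultimately show ?thesis by (simp add: algebra_simps)
qed

lemma noise_form_parallelogram:
  "noise_form (\<lambda>i. b i + d i) + noise_form (\<lambda>i. b i - d i) = 2 * noise_form b + 2 * noise_form d"
  using noise_form_combination[of 1 b 1 d] noise_form_combination[of 1 b "-1" d] by simp

lemma dominated_noise_form:
  assumes "\<And>i. i < q \<Longrightarrow> dominated r (\<lambda>x. (b i x)\<^sup>2)"
  shows "dominated r (\<lambda>x. noise_form (\<lambda>i. b i x))"
proof (rule dominated_mono)
  show "dominated r (\<lambda>x. \<Sum>i<q. \<Sum>j<q. \<bar>K $$ (i, j)\<bar> * ((b i x)\<^sup>2 + (b j x)\<^sup>2))"
    using assms by (intro dominated_sum dominated_cmult dominated_add) auto
  fix x
  have "k * (s * t) \<le> \<bar>k\<bar> * (s\<^sup>2 + t\<^sup>2)" for k s t :: real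
  proof -
    have "0 \<le> (\<bar>s\<bar> - \<bar>t\<bar>)\<^sup>2" by simp
    then have "2 * (\<bar>s\<bar> * \<bar>t\<bar>) \<le> s\<^sup>2 + t\<^sup>2" by (simp add: power2_diff mult.assoc)
    moreover have "0 \<le> \<bar>s\<bar> * \<bar>t\<bar>" by simp
    ultimately have "\<bar>s * t\<bar> \<le> s\<^sup>2 + t\<^sup>2" unfolding abs_mult by linarith
    then have "\<bar>k\<bar> * \<bar>s * t\<bar> \<le> \<bar>k\<bar> * (s\<^sup>2 + t\<^sup>2)" by (rule mult_left_mono) simp
    moreover have "k * (s * t) \<le> \<bar>k\<bar> * \<bar>s * t\<bar>" by (metis abs_ge_self abs_mult)
    ultimately show ?thesis by linarith
  qed
  then show "noise_form (\<lambda>i. b i x) \<le> (\<Sum>i<q. \<Sum>j<q. \<bar>K $$ (i, j)\<bar> * ((b i x)\<^sup>2 + (b j x)\<^sup>2))"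
    unfolding noise_form_def by (intro sum_mono)
qed

definition drift :: "real \<Rightarrow> real \<Rightarrow> (real \<times> 'w \<Rightarrow> real) \<Rightarrow> 'w \<Rightarrow> real" where
  "drift a b f \<omega> = (LINT s:{a..b}|lborel. f (s, \<omega>))"

lemma integrable_win_sq_int:
  assumes "sq_int (win a b) f" "a \<le> b"
  shows "integrable (win a b) f"
proof -
  have "sq_int \<Omega> (\<lambda>_. 1)" by (simp add: sq_int_def)
  from integrable_sq_int_mult[OF assms(1) sq_int_win_const[OF this assms(2)]] show ?thesis by simp
qed

text \<open>
  The Cauchy-Schwarz inequality along each path, and Fubini's theorem.
\<close>

lemma drift_bounds:
  assumes f: "sq_int (win a b) f" and ab: "a \<le> b"
  shows "sq_int \<Omega> (drift a b f)"
    and "(\<integral>\<omega>. (drift a b f \<omega>)\<^sup>2 \<partial>\<Omega>) \<le> (b - a) * (\<integral>z. (f z)\<^sup>2 \<partial>win a b)"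
    and "sq_int \<Omega> Z \<Longrightarrow> (\<integral>\<omega>. Z \<omega> * drift a b f \<omega> \<partial>\<Omega>) = (\<integral>z. Z (snd z) * f z \<partial>win a b)"
proof -
  interpret P: pair_sigma_finite "lborel :: real measure" \<Omega> by (rule pair_lborel)
  have fm [measurable]: "f \<in> borel_measurable (lborel \<Otimes>\<^sub>M \<Omega>)" using f by (simp add: sq_int_def)
  define g where "g s \<omega> = indicator {a<..b} s * f (s, \<omega>)" for s \<omega>
  have D: "drift a b f \<omega> = (\<integral>s. g s \<omega> \<partial>lborel)" if "\<omega> \<in> space \<Omega>" for \<omega>
  proof -
    have "AE s in lborel. indicator {a..b} s * f (s, \<omega>) = g s \<omega>"
      using AE_lborel_singleton[of a] by eventually_elim (auto simp: indicator_def g_def)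
    then show ?thesis unfolding drift_def set_lebesgue_integral_def real_scaleR_def
      using that by (intro integral_cong_AE) (auto simp: g_def[abs_def])
  qed
  have ig: "integrable (lborel \<Otimes>\<^sub>M \<Omega>) (case_prod g)"
    using integrable_win_sq_int[OF f ab] by (simp add: integrable_win g_def case_prod_unfold)
  have ig2: "integrable (lborel \<Otimes>\<^sub>M \<Omega>) (\<lambda>(s, \<omega>). indicator {a<..b} s * (f (s, \<omega>))\<^sup>2)"
    using sq_int_integrable[OF f] by (simp add: integrable_win case_prod_unfold)
  have Dm [measurable]: "drift a b f \<in> borel_measurable \<Omega>"
    using borel_measurable_integrable[OF P.integrable_snd[OF ig]] D by (simp cong: measurable_cong)
  have AEb: "AE \<omega> in \<Omega>. (drift a b f \<omega>)\<^sup>2 \<le> (b - a) * (\<integral>s. indicator {a<..b} s * (f (s, \<omega>))\<^sup>2 \<partial>lborel)"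
    using P.AE_integrable_snd[OF ig2] AE_space
  proof eventually_elim
    case (elim \<omega>)
    have [measurable]: "(\<lambda>s. f (s, \<omega>)) \<in> borel_measurable borel" using elim by measurable
    have sq: "(indicator {a<..b} s * f (s, \<omega>))\<^sup>2 = indicator {a<..b} s * (f (s, \<omega>))\<^sup>2" for s
      by (auto simp: indicator_def)
    have i: "sq_int lborel (indicator {a<..b} :: real \<Rightarrow> real)"
    proof -
      have "(\<lambda>s. (indicator {a<..b} s)\<^sup>2) = (indicator {a<..b} :: real \<Rightarrow> real)"
        by (auto simp: indicator_def)
      then show ?thesis using ab by (auto simp: sq_int_def intro!: integrable_real_indicator)
    qed
    have "sq_int lborel (\<lambda>s. indicator {a<..b} s * f (s, \<omega>))"
      using elim by (auto simp: sq_int_def sq)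
    from Cauchy_Schwarz_integral[OF i this]
    have "(\<integral>s. indicator {a<..b} s * (indicator {a<..b} s * f (s, \<omega>)) \<partial>lborel)\<^sup>2
      \<le> (\<integral>s. (indicator {a<..b} s)\<^sup>2 \<partial>lborel) * (\<integral>s. indicator {a<..b} s * (f (s, \<omega>))\<^sup>2 \<partial>lborel)"
      by (simp add: sq)
    moreover have "(\<lambda>s. indicator {a<..b} s * (indicator {a<..b} s * f (s, \<omega>))) = (\<lambda>s. g s \<omega>)"
      by (auto simp: g_def indicator_def)
    moreover have "(\<lambda>s. (indicator {a<..b} s)\<^sup>2) = (indicator {a<..b} :: real \<Rightarrow> real)"
      by (auto simp: indicator_def)
    ultimately show ?case using ab by (simp add: D elim(2))
  qed
  have i2: "integrable \<Omega> (\<lambda>\<omega>. (b - a) * (\<integral>s. indicator {a<..b} s * (f (s, \<omega>))\<^sup>2 \<partial>lborel))"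
    using P.integrable_snd[OF ig2] by simp
  show D2: "sq_int \<Omega> (drift a b f)"
    unfolding sq_int_def
    by (intro conjI Dm Bochner_Integration.integrable_bound[OF i2])
      (use AEb in \<open>auto elim!: eventually_mono\<close>)
  have "(\<integral>\<omega>. (drift a b f \<omega>)\<^sup>2 \<partial>\<Omega>) \<le> (\<integral>\<omega>. (b - a) * (\<integral>s. indicator {a<..b} s * (f (s, \<omega>))\<^sup>2 \<partial>lborel) \<partial>\<Omega>)"
    by (intro integral_mono_AE sq_int_integrable[OF D2] i2 AEb)
  also have "\<dots> = (b - a) * (\<integral>z. (f z)\<^sup>2 \<partial>win a b)"
    using P.integral_snd[OF ig2] by (simp add: integral_win case_prod_unfold)
  finally show "(\<integral>\<omega>. (drift a b f \<omega>)\<^sup>2 \<partial>\<Omega>) \<le> (b - a) * (\<integral>z. (f z)\<^sup>2 \<partial>win a b)" .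
  assume Z: "sq_int \<Omega> Z"
  note [measurable] = sq_int_measurable[OF Z]
  have iZ: "integrable (lborel \<Otimes>\<^sub>M \<Omega>) (\<lambda>(s, \<omega>). Z \<omega> * g s \<omega>)"
    using integrable_sq_int_mult[OF sq_int_win_const[OF Z ab] f]
    by (simp add: integrable_win g_def case_prod_unfold mult_ac)
  have "(\<integral>z. Z (snd z) * f z \<partial>win a b) = (\<integral>(s, \<omega>). Z \<omega> * g s \<omega> \<partial>(lborel \<Otimes>\<^sub>M \<Omega>))"
    by (simp add: integral_win g_def case_prod_unfold mult_ac)
  also have "\<dots> = (\<integral>\<omega>. (\<integral>s. Z \<omega> * g s \<omega> \<partial>lborel) \<partial>\<Omega>)" by (rule P.integral_snd[OF iZ, symmetric])
  also have "\<dots> = (\<integral>\<omega>. Z \<omega> * drift a b f \<omega> \<partial>\<Omega>)"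
    by (intro Bochner_Integration.integral_cong refl) (simp add: D)
  finally show "(\<integral>\<omega>. Z \<omega> * drift a b f \<omega> \<partial>\<Omega>) = (\<integral>z. Z (snd z) * f z \<partial>win a b)" by simp
qed

lemma AE_set_integrable:
  assumes f: "sq_int (win a b) f" and ab: "a \<le> b"
  shows "AE \<omega> in \<Omega>. set_integrable lborel {a..b} (\<lambda>s. f (s, \<omega>))"
proof -
  interpret P: pair_sigma_finite "lborel :: real measure" \<Omega> by (rule pair_lborel)
  have [measurable]: "f \<in> borel_measurable (lborel \<Otimes>\<^sub>M \<Omega>)" using f by (simp add: sq_int_def)
  have ig: "integrable (lborel \<Otimes>\<^sub>M \<Omega>) (\<lambda>(s, \<omega>). indicator {a<..b} s * f (s, \<omega>))"
    using integrable_win_sq_int[OF f ab] by (simp add: integrable_win case_prod_unfold)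
  show ?thesis using P.AE_integrable_snd[OF ig] AE_space
  proof eventually_elim
    case (elim \<omega>)
    have "AE s in lborel. indicator {a..b} s * f (s, \<omega>) = indicator {a<..b} s * f (s, \<omega>)"
      using AE_lborel_singleton[of a] by eventually_elim (auto simp: indicator_def)
    then show ?case unfolding set_integrable_def real_scaleR_def
      using elim by (subst integrable_cong_AE) auto
  qed
qed

lemma drift_add:
  assumes "sq_int (win a b) f" "sq_int (win a b) g" and ab: "a \<le> b"
  shows "AE \<omega> in \<Omega>. drift a b (\<lambda>z. f z + g z) \<omega> = drift a b f \<omega> + drift a b g \<omega>"
  using AE_set_integrable[OF assms(1) ab] AE_set_integrable[OF assms(2) ab]
  by eventually_elim (simp add: drift_def)

lemma drift_split:
  assumes f: "sq_int (win a b) f" "sq_int (win b c) f" and abc: "a \<le> b" "b \<le> c"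
  shows "AE \<omega> in \<Omega>. drift a c f \<omega> = drift a b f \<omega> + drift b c f \<omega>"
  using AE_set_integrable[OF f(1) abc(1)] AE_set_integrable[OF f(2) abc(2)]
proof eventually_elim
  case (elim \<omega>)
  have "AE s in lborel. \<not> (s \<in> {a..b} \<and> s \<in> {b..c})"
    using AE_lborel_singleton[of b] by eventually_elim auto
  from set_integral_Un_AE[OF this _ _ elim] show ?case
    using abc by (simp add: drift_def ivl_disj_un_two_touch)
qed

lemma drift_sum:
  assumes "finite I" "\<And>k. k \<in> I \<Longrightarrow> sq_int (win a b) (f k)" and ab: "a \<le> b"
  shows "AE \<omega> in \<Omega>. drift a b (\<lambda>z. \<Sum>k\<in>I. f k z) \<omega> = (\<Sum>k\<in>I. drift a b (f k) \<omega>)"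
  using assms(1,2)
proof (induction I rule: finite_induct)
  case empty
  show ?case by (simp add: drift_def)
next
  case (insert k I)
  then have "AE \<omega> in \<Omega>. drift a b (\<lambda>z. f k z + (\<Sum>k\<in>I. f k z)) \<omega> = drift a b (f k) \<omega> + drift a b (\<lambda>z. \<Sum>k\<in>I. f k z) \<omega>"
    by (intro drift_add sq_int_sum ab) auto
  moreover have "AE \<omega> in \<Omega>. drift a b (\<lambda>z. \<Sum>k\<in>I. f k z) \<omega> = (\<Sum>k\<in>I. drift a b (f k) \<omega>)"
    using insert by auto
  ultimately show ?case by eventually_elim (simp add: insert.hyps)
qed

lemma drift_cmult: "drift a b (\<lambda>z. c * f z) \<omega> = c * drift a b f \<omega>"
  by (simp add: drift_def)

text \<open>
  Ito's formula for \<open>Z\<^sup>2\<close> over one step, as an inequality.  The stochastic integral is orthogonal to \<open>Z\<close> and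
  contributes its quadratic variation.  What Ito's formula does not have is the square of the
  drift increment, of order \<open>b - a\<close>, and its product with the stochastic integral, which Young's
  inequality distributes with parameter \<open>\<theta>\<close>; \<open>\<theta>\<close> plays the role of \<open>sqrt (b - a)\<close>.
\<close>

lemma second_moment_step:
  assumes ab: "0 \<le> a" "a \<le> b" and Z: "past a Z" and I: "ito a b \<beta> I" and \<alpha>: "sq_int (win a b) \<alpha>"
    and Z': "AE \<omega> in \<Omega>. Z' \<omega> = Z \<omega> + drift a b \<alpha> \<omega> + I \<omega>" and Z'm: "Z' \<in> borel_measurable \<Omega>"
    and \<theta>: "0 < \<theta>" "b - a \<le> \<theta>\<^sup>2"
  shows "(\<integral>\<omega>. (Z' \<omega>)\<^sup>2 \<partial>\<Omega>) \<le> (\<integral>\<omega>. (Z \<omega>)\<^sup>2 \<partial>\<Omega>)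
    + (\<integral>z. 2 * (Z (snd z) * \<alpha> z) + (1 + \<theta>) * noise_form (\<lambda>i. \<beta> i z) + (\<theta>\<^sup>2 + \<theta>) * (\<alpha> z)\<^sup>2 \<partial>win a b)"
proof -
  let ?D = "drift a b \<alpha>"
  have sZ: "sq_int \<Omega> Z" using Z by (rule past_sq_int)
  have sI: "sq_int \<Omega> I" and s\<beta>: "\<And>i. i < q \<Longrightarrow> sq_int (win a b) (\<beta> i)" using ito_sq_int[OF I ab(1)] by auto
  note D = drift_bounds[OF \<alpha> ab(2)]
  have sq: "integrable \<Omega> (\<lambda>\<omega>. (Z \<omega>)\<^sup>2)" "integrable \<Omega> (\<lambda>\<omega>. (?D \<omega>)\<^sup>2)" "integrable \<Omega> (\<lambda>\<omega>. (I \<omega>)\<^sup>2)"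
    "integrable \<Omega> (\<lambda>\<omega>. Z \<omega> * ?D \<omega>)" "integrable \<Omega> (\<lambda>\<omega>. Z \<omega> * I \<omega>)"
    by (intro sq_int_integrable integrable_sq_int_mult sZ sI D(1))+
  have pw: "(x + d + i)\<^sup>2 \<le> x\<^sup>2 + (1 + 1 / \<theta>) * d\<^sup>2 + (1 + \<theta>) * i\<^sup>2 + 2 * (x * d) + 2 * (x * i)" for x d i :: real
  proof -
    have "0 \<le> (d - \<theta> * i)\<^sup>2 / \<theta>" using \<theta> by simp
    then have "2 * (d * i) \<le> d\<^sup>2 / \<theta> + \<theta> * i\<^sup>2"
      using \<theta> by (simp add: power2_diff field_simps power2_eq_square)
    then show ?thesis by (simp add: power2_eq_square algebra_simps)
  qed
  have sZ': "sq_int \<Omega> Z'"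
    by (rule sq_int_cong_AE[OF sq_int_add[OF sq_int_add[OF sZ D(1)] sI] Z'm Z'])
  have "(\<integral>\<omega>. (Z' \<omega>)\<^sup>2 \<partial>\<Omega>) \<le> (\<integral>\<omega>. (Z \<omega>)\<^sup>2 + (1 + 1 / \<theta>) * (?D \<omega>)\<^sup>2 + (1 + \<theta>) * (I \<omega>)\<^sup>2
      + 2 * (Z \<omega> * ?D \<omega>) + 2 * (Z \<omega> * I \<omega>) \<partial>\<Omega>)"
    using Z' sq by (intro integral_mono_AE sq_int_integrable[OF sZ']) (auto elim!: eventually_mono intro: pw)
  also have "\<dots> = (\<integral>\<omega>. (Z \<omega>)\<^sup>2 \<partial>\<Omega>) + (1 + 1 / \<theta>) * (\<integral>\<omega>. (?D \<omega>)\<^sup>2 \<partial>\<Omega>) + (1 + \<theta>) * (\<integral>\<omega>. (I \<omega>)\<^sup>2 \<partial>\<Omega>)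
      + 2 * (\<integral>\<omega>. Z \<omega> * ?D \<omega> \<partial>\<Omega>) + 2 * (\<integral>\<omega>. Z \<omega> * I \<omega> \<partial>\<Omega>)"
    using sq by simp
  also have "\<dots> = (\<integral>\<omega>. (Z \<omega>)\<^sup>2 \<partial>\<Omega>) + (1 + 1 / \<theta>) * (\<integral>\<omega>. (?D \<omega>)\<^sup>2 \<partial>\<Omega>)
      + (1 + \<theta>) * (\<integral>z. noise_form (\<lambda>i. \<beta> i z) \<partial>win a b) + 2 * (\<integral>z. Z (snd z) * \<alpha> z \<partial>win a b)"
    by (simp add: ito_isometry[OF I ab(1)] ito_orthogonal[OF I ab(1) Z] D(3)[OF sZ])
  also have "(1 + 1 / \<theta>) * (\<integral>\<omega>. (?D \<omega>)\<^sup>2 \<partial>\<Omega>) \<le> (\<theta>\<^sup>2 + \<theta>) * (\<integral>z. (\<alpha> z)\<^sup>2 \<partial>win a b)"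
  proof -
    have "(1 + 1 / \<theta>) * (\<integral>\<omega>. (?D \<omega>)\<^sup>2 \<partial>\<Omega>) \<le> (1 + 1 / \<theta>) * (\<theta>\<^sup>2 * (\<integral>z. (\<alpha> z)\<^sup>2 \<partial>win a b))"
      using \<theta> by (intro mult_left_mono order_trans[OF D(2)] mult_right_mono) auto
    also have "\<dots> = (\<theta>\<^sup>2 + \<theta>) * (\<integral>z. (\<alpha> z)\<^sup>2 \<partial>win a b)"
      using \<theta> by (simp add: field_simps power2_eq_square)
    finally show ?thesis .
  qed
  finally have *: "(\<integral>\<omega>. (Z' \<omega>)\<^sup>2 \<partial>\<Omega>) \<le> (\<integral>\<omega>. (Z \<omega>)\<^sup>2 \<partial>\<Omega>) + (\<theta>\<^sup>2 + \<theta>) * (\<integral>z. (\<alpha> z)\<^sup>2 \<partial>win a b)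
      + (1 + \<theta>) * (\<integral>z. noise_form (\<lambda>i. \<beta> i z) \<partial>win a b) + 2 * (\<integral>z. Z (snd z) * \<alpha> z \<partial>win a b)" by simp
  have "(\<integral>z. 2 * (Z (snd z) * \<alpha> z) + (1 + \<theta>) * noise_form (\<lambda>i. \<beta> i z) + (\<theta>\<^sup>2 + \<theta>) * (\<alpha> z)\<^sup>2 \<partial>win a b)
    = 2 * (\<integral>z. Z (snd z) * \<alpha> z \<partial>win a b) + (1 + \<theta>) * (\<integral>z. noise_form (\<lambda>i. \<beta> i z) \<partial>win a b)
      + (\<theta>\<^sup>2 + \<theta>) * (\<integral>z. (\<alpha> z)\<^sup>2 \<partial>win a b)"
    using integrable_sq_int_mult[OF sq_int_win_const[OF sZ ab(2)] \<alpha>] integrable_noise_form(1)[of "win a b" \<beta>] s\<beta> sq_int_integrable[OF \<alpha>]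
    by simp
  with * show ?thesis by simp
qed

text \<open>
  Perturbations \<open>\<alpha>'\<close> and \<open>\<beta>'\<close> of the coefficients cost their squares times \<open>1 / \<theta>\<close>, while the remaining
  errors carry the factor \<open>\<theta>\<close>.  If \<open>\<theta> = sqrt h\<close> and the perturbations are of order \<open>h\<close> in
  mean square, everything except Ito's term vanishes with \<open>h\<close>.
\<close>

lemma second_moment_step_perturbed:
  assumes ab: "0 \<le> a" "a \<le> b" and Z: "past a Z"
    and I: "ito a b (\<lambda>i z. \<beta> i z + \<beta>' i z) I"
    and \<alpha>: "sq_int (win a b) \<alpha>" and \<alpha>': "sq_int (win a b) \<alpha>'"
    and \<beta>: "\<And>i. i < q \<Longrightarrow> sq_int (win a b) (\<beta> i)" and \<beta>': "\<And>i. i < q \<Longrightarrow> sq_int (win a b) (\<beta>' i)"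
    and Z': "AE \<omega> in \<Omega>. Z' \<omega> = Z \<omega> + drift a b (\<lambda>z. \<alpha> z + \<alpha>' z) \<omega> + I \<omega>" and Z'm: "Z' \<in> borel_measurable \<Omega>"
    and \<theta>: "0 < \<theta>" "b - a \<le> \<theta>\<^sup>2" "\<theta> \<le> 1"
  shows "(\<integral>\<omega>. (Z' \<omega>)\<^sup>2 \<partial>\<Omega>) \<le> (\<integral>\<omega>. (Z \<omega>)\<^sup>2 \<partial>\<Omega>)
    + (\<integral>z. (2 * (Z (snd z) * \<alpha> z) + noise_form (\<lambda>i. \<beta> i z))
        + 4 * \<theta> * ((Z (snd z))\<^sup>2 + (\<alpha> z)\<^sup>2 + noise_form (\<lambda>i. \<beta> i z))
        + 5 / \<theta> * ((\<alpha>' z)\<^sup>2 + noise_form (\<lambda>i. \<beta>' i z)) \<partial>win a b)"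
proof -
  have sZ: "sq_int (win a b) (\<lambda>z. Z (snd z))" using sq_int_win_const[OF past_sq_int[OF Z] ab(2)] .
  have pw: "2 * (x * (s + s')) + (1 + \<theta>) * noise_form (\<lambda>i. b i + b' i) + (\<theta>\<^sup>2 + \<theta>) * (s + s')\<^sup>2
    \<le> (2 * (x * s) + noise_form b) + 4 * \<theta> * (x\<^sup>2 + s\<^sup>2 + noise_form b) + 5 / \<theta> * (s'\<^sup>2 + noise_form b')"
    for x s s' b b'
  proof -
    have 1: "2 * (x * s') \<le> \<theta> * x\<^sup>2 + s'\<^sup>2 / \<theta>"
    proof -
      have "0 \<le> (s' - \<theta> * x)\<^sup>2 / \<theta>" using \<theta> by simp
      then show ?thesis using \<theta> by (simp add: power2_diff field_simps power2_eq_square)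
    qed
    have t2: "\<theta>\<^sup>2 \<le> \<theta>" using \<theta> by (simp add: power2_eq_square mult_left_le)
    have "(1 + \<theta>) * noise_form (\<lambda>i. b i + b' i) \<le> (1 + \<theta>) * ((1 + \<theta>) * noise_form b + (1 + 1 / \<theta>) * noise_form b')"
      using \<theta> by (intro mult_left_mono noise_form_add_le) auto
    also have "\<dots> = (1 + \<theta>)\<^sup>2 * noise_form b + ((1 + \<theta>)\<^sup>2 / \<theta>) * noise_form b'"
      using \<theta> by (simp add: field_simps power2_eq_square)
    also have "\<dots> \<le> (1 + 3 * \<theta>) * noise_form b + (4 / \<theta>) * noise_form b'"
    proof -
      have "(1 + \<theta>)\<^sup>2 = 1 + 2 * \<theta> + \<theta>\<^sup>2" by (simp add: power2_eq_square algebra_simps)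
      then have "(1 + \<theta>)\<^sup>2 \<le> 1 + 3 * \<theta>" "(1 + \<theta>)\<^sup>2 \<le> 4" using t2 \<theta> by auto
      then show ?thesis
        using \<theta> by (intro add_mono mult_right_mono noise_form_nonneg divide_right_mono) auto
    qed
    finally have 2: "(1 + \<theta>) * noise_form (\<lambda>i. b i + b' i) \<le> (1 + 3 * \<theta>) * noise_form b + (4 / \<theta>) * noise_form b'" .
    have "(\<theta>\<^sup>2 + \<theta>) * (s + s')\<^sup>2 \<le> (2 * \<theta>) * (2 * s\<^sup>2 + 2 * s'\<^sup>2)"
      using \<theta> t2 by (intro mult_mono square_add_le) auto
    also have "\<dots> \<le> 4 * \<theta> * s\<^sup>2 + (4 / \<theta>) * s'\<^sup>2"
    proof -
      have "\<theta> \<le> 1 / \<theta>" using \<theta> t2 by (simp add: pos_le_divide_eq flip: power2_eq_square)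
      then have "\<theta> * s'\<^sup>2 \<le> 1 / \<theta> * s'\<^sup>2" by (intro mult_right_mono) auto
      then show ?thesis by (simp add: algebra_simps)
    qed
    finally have 3: "(\<theta>\<^sup>2 + \<theta>) * (s + s')\<^sup>2 \<le> 4 * \<theta> * s\<^sup>2 + (4 / \<theta>) * s'\<^sup>2" .
    have 4: "0 \<le> \<theta> * noise_form b" "0 \<le> noise_form b' / \<theta>" "0 \<le> \<theta> * x\<^sup>2" "0 \<le> s'\<^sup>2 / \<theta>"
      using \<theta> noise_form_nonneg by auto
    have e: "5 / \<theta> * (s'\<^sup>2 + noise_form b') = 5 * (s'\<^sup>2 / \<theta>) + 5 * (noise_form b' / \<theta>)"
      "4 / \<theta> * s'\<^sup>2 = 4 * (s'\<^sup>2 / \<theta>)" "4 / \<theta> * noise_form b' = 4 * (noise_form b' / \<theta>)"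
      "4 * \<theta> * (x\<^sup>2 + s\<^sup>2 + noise_form b) = 4 * (\<theta> * x\<^sup>2) + 4 * (\<theta> * s\<^sup>2) + 4 * (\<theta> * noise_form b)"
      "(1 + 3 * \<theta>) * noise_form b = noise_form b + 3 * (\<theta> * noise_form b)"
      "4 * \<theta> * s\<^sup>2 = 4 * (\<theta> * s\<^sup>2)" "2 * (x * (s + s')) = 2 * (x * s) + 2 * (x * s')"
      by (simp_all add: algebra_simps add_divide_distrib)
    show ?thesis using 1 2 3 4 unfolding e by linarith
  qed
  have i: "integrable (win a b) (\<lambda>z. Z (snd z) * (\<alpha> z + \<alpha>' z))" "integrable (win a b) (\<lambda>z. Z (snd z) * \<alpha> z)"
    "integrable (win a b) (\<lambda>z. (\<alpha> z + \<alpha>' z)\<^sup>2)" "integrable (win a b) (\<lambda>z. (\<alpha> z)\<^sup>2)" "integrable (win a b) (\<lambda>z. (\<alpha>' z)\<^sup>2)"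
    "integrable (win a b) (\<lambda>z. (Z (snd z))\<^sup>2)"
    "integrable (win a b) (\<lambda>z. noise_form (\<lambda>i. \<beta> i z + \<beta>' i z))" "integrable (win a b) (\<lambda>z. noise_form (\<lambda>i. \<beta> i z))"
    "integrable (win a b) (\<lambda>z. noise_form (\<lambda>i. \<beta>' i z))"
    using sZ \<alpha> \<alpha>' \<beta> \<beta>'
    by (auto intro!: sq_int_integrable integrable_sq_int_mult sq_int_add integrable_noise_form(1))
  have "(\<integral>z. 2 * (Z (snd z) * (\<alpha> z + \<alpha>' z)) + (1 + \<theta>) * noise_form (\<lambda>i. \<beta> i z + \<beta>' i z) + (\<theta>\<^sup>2 + \<theta>) * (\<alpha> z + \<alpha>' z)\<^sup>2 \<partial>win a b)
    \<le> (\<integral>z. (2 * (Z (snd z) * \<alpha> z) + noise_form (\<lambda>i. \<beta> i z))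
        + 4 * \<theta> * ((Z (snd z))\<^sup>2 + (\<alpha> z)\<^sup>2 + noise_form (\<lambda>i. \<beta> i z))
        + 5 / \<theta> * ((\<alpha>' z)\<^sup>2 + noise_form (\<lambda>i. \<beta>' i z)) \<partial>win a b)"
    by (rule integral_mono[OF _ _ pw]) (simp_all add: i)
  with second_moment_step[OF ab Z I sq_int_add[OF \<alpha> \<alpha>'] Z' Z'm \<theta>(1,2)] show ?thesis by simp
qed

end

section \<open>Dynamics of solutions\<close>

context wiener_process
begin

text \<open>
  Continuation by \<open>0\<close> outside \<open>[0, T]\<close> makes a process measurable on the whole time axis.
\<close>

definition ext :: "real \<Rightarrow> (real \<Rightarrow> 'w \<Rightarrow> real) \<Rightarrow> real \<times> 'w \<Rightarrow> real" where
  "ext T f z = (if 0 \<le> fst z \<and> fst z \<le> T then f (fst z) (snd z) else 0)"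

lemma ext_measurable:
  assumes "(\<lambda>(t, \<omega>). f t \<omega>) \<in> borel_measurable (restrict_space borel {0..T} \<Otimes>\<^sub>M \<Omega>)"
  shows "ext T f \<in> borel_measurable (lborel \<Otimes>\<^sub>M \<Omega>)"
proof -
  let ?A = "{z :: real \<times> 'w. 0 \<le> fst z \<and> fst z \<le> T}"
  have A: "?A \<inter> space (lborel \<Otimes>\<^sub>M \<Omega>) \<in> sets (lborel \<Otimes>\<^sub>M \<Omega>)"
  proof -
    have "{z \<in> space (lborel \<Otimes>\<^sub>M \<Omega>). 0 \<le> fst z \<and> fst z \<le> T} \<in> sets (lborel \<Otimes>\<^sub>M \<Omega>)" by measurable
    then show ?thesis by (simp add: Int_def conj_commute)
  qed
  have "(\<lambda>z. (fst z, snd z)) \<in> measurable (restrict_space (lborel \<Otimes>\<^sub>M \<Omega>) ?A) (restrict_space borel {0..T} \<Otimes>\<^sub>M \<Omega>)"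
  proof (rule measurable_Pair)
    show "fst \<in> measurable (restrict_space (lborel \<Otimes>\<^sub>M \<Omega>) ?A) (restrict_space borel {0..T})"
    proof (rule measurable_restrict_space2)
      have "fst \<in> measurable (lborel \<Otimes>\<^sub>M \<Omega>) borel" by measurable
      then show "fst \<in> measurable (restrict_space (lborel \<Otimes>\<^sub>M \<Omega>) ?A) borel" by (rule measurable_restrict_space1)
    qed (auto simp: space_restrict_space)
    show "snd \<in> measurable (restrict_space (lborel \<Otimes>\<^sub>M \<Omega>) ?A) \<Omega>"
      by (rule measurable_restrict_space1) measurable
  qed
  from measurable_compose[OF this assms]
  have "(\<lambda>z. f (fst z) (snd z)) \<in> borel_measurable (restrict_space (lborel \<Otimes>\<^sub>M \<Omega>) ?A)" by (simp add: case_prod_unfold)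
  then have "(\<lambda>z. if z \<in> ?A then f (fst z) (snd z) else 0) \<in> borel_measurable (lborel \<Otimes>\<^sub>M \<Omega>)"
    by (subst measurable_restrict_space_iff[OF A, symmetric]) auto
  then show ?thesis by (simp add: ext_def[abs_def])
qed

lemma L2T_sq_int:
  assumes f: "f \<in> L2T \<Omega> F d T" and c: "c < d"
  shows "sq_int (win 0 T) (ext T (\<lambda>t \<omega>. f t \<omega> $ c))"
proof -
  have m [measurable]: "ext T (\<lambda>t \<omega>. f t \<omega> $ c) \<in> borel_measurable (lborel \<Otimes>\<^sub>M \<Omega>)"
    using f c by (intro ext_measurable) (auto simp: L2T_def adapted_measurable_def)
  have carr: "f t \<omega> \<in> carrier_vec d" if "0 \<le> t" "t \<le> T" "\<omega> \<in> space \<Omega>" for t \<omega>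
    using f that by (auto simp: L2T_def)
  have "(\<integral>\<^sup>+z. ennreal ((ext T (\<lambda>t \<omega>. f t \<omega> $ c) z)\<^sup>2) \<partial>win 0 T)
    = (\<integral>\<^sup>+\<omega>. (\<integral>\<^sup>+t\<in>{0..T}. ennreal ((ext T (\<lambda>t \<omega>. f t \<omega> $ c) (t, \<omega>))\<^sup>2) \<partial>lborel) \<partial>\<Omega>)"
    by (rule nn_integral_win_iterated) measurable
  also have "\<dots> \<le> (\<integral>\<^sup>+\<omega>. (\<integral>\<^sup>+t\<in>{0..T}. ennreal (f t \<omega> \<bullet> f t \<omega>) \<partial>lborel) \<partial>\<Omega>)"
  proof (intro nn_integral_mono)
    fix \<omega> t assume \<omega>: "\<omega> \<in> space \<Omega>"
    have "(f t \<omega> $ c)\<^sup>2 \<le> f t \<omega> \<bullet> f t \<omega>" if t: "0 \<le> t" "t \<le> T"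
    proof -
      have "f t \<omega> \<bullet> f t \<omega> = (\<Sum>i\<in>{0..<d}. (f t \<omega> $ i)\<^sup>2)"
        using carr[OF t \<omega>] by (simp add: scalar_prod_def power2_eq_square)
      then show ?thesis using c by (auto intro: member_le_sum)
    qed
    then show "ennreal ((ext T (\<lambda>t \<omega>. f t \<omega> $ c) (t, \<omega>))\<^sup>2) * indicator {0..T} t \<le> ennreal (f t \<omega> \<bullet> f t \<omega>) * indicator {0..T} t"
      by (auto simp: ext_def indicator_def intro: ennreal_leI)
  qed
  also have "\<dots> < \<infinity>"
    using f unfolding L2T_def L2T_norm_def ennreal_sqrt_def by (auto simp: less_top split: if_splits)
  finally show ?thesis by (subst sq_int_iff_nn_integral) auto
qed

text \<open>
  \<open>dX = R dt + \<Sum>i<q. V\<^sub>i dw\<^sub>i\<close> with \<open>X(0) = 0\<close>, stated through the increments of \<open>X\<close> over all windows.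
\<close>

definition ito_dynamics :: "real \<Rightarrow> nat \<Rightarrow> (nat \<Rightarrow> real \<times> 'w \<Rightarrow> real) \<Rightarrow>
    (real \<times> 'w \<Rightarrow> nat \<Rightarrow> real) \<Rightarrow> (real \<times> 'w \<Rightarrow> nat \<Rightarrow> nat \<Rightarrow> real) \<Rightarrow> bool" where
  "ito_dynamics T d X R V \<longleftrightarrow>
     (\<forall>c<d. sq_int (win 0 T) (X c)) \<and>
     (\<forall>c<d. \<forall>t. 0 \<le> t \<longrightarrow> t \<le> T \<longrightarrow> (\<lambda>\<omega>. X c (t, \<omega>)) \<in> borel_measurable (F t)) \<and>
     (\<forall>c<d. AE \<omega> in \<Omega>. X c (0, \<omega>) = 0) \<and>
     (\<forall>l<d. \<forall>a b. 0 \<le> a \<longrightarrow> a \<le> b \<longrightarrow> b \<le> T \<longrightarrow>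
        (\<exists>I. ito a b (\<lambda>i z. V z i l) I \<and>
          (AE \<omega> in \<Omega>. X l (b, \<omega>) = X l (a, \<omega>) + drift a b (\<lambda>z. R z l) \<omega> + I \<omega>)))"

lemma ito_dynamics_transform:
  assumes X: "ito_dynamics T d X R V" and R: "\<And>l. l < d \<Longrightarrow> sq_int (win 0 T) (\<lambda>z. R z l)"
  shows "ito_dynamics T d (\<lambda>l z. \<Sum>k<d. G l k * X k z) (\<lambda>z l. \<Sum>k<d. G l k * R z k) (\<lambda>z i l. \<Sum>k<d. G l k * V z i k)"
  unfolding ito_dynamics_def
proof (intro conjI allI impI)
  fix c assume c: "c < d"
  show "sq_int (win 0 T) (\<lambda>z. \<Sum>k<d. G c k * X k z)"
    using X by (intro sq_int_sum sq_int_cmult) (auto simp: ito_dynamics_def)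
  show "(\<lambda>\<omega>. \<Sum>k<d. G c k * X k (t, \<omega>)) \<in> borel_measurable (F t)" if "0 \<le> t" "t \<le> T" for t
    using X that by (intro borel_measurable_sum borel_measurable_times borel_measurable_const) (auto simp: ito_dynamics_def)
  have "AE \<omega> in \<Omega>. \<forall>k\<in>{..<d}. X k (0, \<omega>) = 0"
    using X by (intro AE_finite_allI) (auto simp: ito_dynamics_def)
  then show "AE \<omega> in \<Omega>. (\<Sum>k<d. G c k * X k (0, \<omega>)) = 0" by eventually_elim simp
next
  fix l a b assume l: "l < d" and ab: "0 \<le> a" "a \<le> b" "b \<le> T"
  have "\<forall>k\<in>{..<d}. \<exists>I. ito a b (\<lambda>i z. V z i k) I \<and>
          (AE \<omega> in \<Omega>. X k (b, \<omega>) = X k (a, \<omega>) + drift a b (\<lambda>z. R z k) \<omega> + I \<omega>)"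
    using X ab by (auto simp: ito_dynamics_def)
  from bchoice[OF this] obtain I where I: "\<And>k. k < d \<Longrightarrow> ito a b (\<lambda>i z. V z i k) (I k)"
    and eq: "\<And>k. k < d \<Longrightarrow> AE \<omega> in \<Omega>. X k (b, \<omega>) = X k (a, \<omega>) + drift a b (\<lambda>z. R z k) \<omega> + I k \<omega>"
    by auto
  have sR: "sq_int (win a b) (\<lambda>z. R z k)" if "k < d" for k
    using sq_int_win_mono[OF R[OF that]] ab by simp
  have ito: "ito a b (\<lambda>i z. \<Sum>k<d. G l k * V z i k) (\<lambda>\<omega>. \<Sum>k<d. G l k * I k \<omega>)"
    by (intro ito_sum ito_cmult I ab) auto
  have D: "AE \<omega> in \<Omega>. drift a b (\<lambda>z. \<Sum>k<d. G l k * R z k) \<omega> = (\<Sum>k<d. drift a b (\<lambda>z. G l k * R z k) \<omega>)"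
    by (intro drift_sum sq_int_cmult sR ab) auto
  have "AE \<omega> in \<Omega>. \<forall>k\<in>{..<d}. X k (b, \<omega>) = X k (a, \<omega>) + drift a b (\<lambda>z. R z k) \<omega> + I k \<omega>"
    using eq by (intro AE_finite_allI) auto
  with D have "AE \<omega> in \<Omega>. (\<Sum>k<d. G l k * X k (b, \<omega>)) = (\<Sum>k<d. G l k * X k (a, \<omega>))
     + drift a b (\<lambda>z. \<Sum>k<d. G l k * R z k) \<omega> + (\<Sum>k<d. G l k * I k \<omega>)"
    by eventually_elim (simp add: drift_cmult distrib_left sum.distrib)
  with ito show "\<exists>I. ito a b (\<lambda>i z. \<Sum>k<d. G l k * V z i k) I \<and> (AE \<omega> in \<Omega>. (\<Sum>k<d. G l k * X k (b, \<omega>)) = (\<Sum>k<d. G l k * X k (a, \<omega>))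
     + drift a b (\<lambda>z. \<Sum>k<d. G l k * R z k) \<omega> + I \<omega>)" by blast
qed

lemma ito_dynamics_cong:
  assumes X: "ito_dynamics T d X R V"
    and R: "\<And>z l. l < d \<Longrightarrow> R' z l = R z l" and V: "\<And>z i l. i < q \<Longrightarrow> l < d \<Longrightarrow> V' z i l = V z i l"
  shows "ito_dynamics T d X R' V'"
proof -
  have "ito a b (\<lambda>i z. V' z i l) I" if "ito a b (\<lambda>i z. V z i l) I" "l < d" for a b l I
    by (rule ito_cong[OF that(1)]) (use that in \<open>auto simp: V ito_def\<close>)
  note V_eq = this
  have R_eq: "(\<lambda>z. R' z l) = (\<lambda>z. R z l)" if "l < d" for l using R[OF that] by auto
  show ?thesis
    unfolding ito_dynamics_def
  proof (intro conjI allI impI)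
    fix l a b assume l: "l < d" and ab: "0 \<le> a" "a \<le> b" "b \<le> T"
    obtain I where "ito a b (\<lambda>i z. V z i l) I"
      "AE \<omega> in \<Omega>. X l (b, \<omega>) = X l (a, \<omega>) + drift a b (\<lambda>z. R z l) \<omega> + I \<omega>"
      using X l ab unfolding ito_dynamics_def by blast
    then show "\<exists>I. ito a b (\<lambda>i z. V' z i l) I \<and> (AE \<omega> in \<Omega>. X l (b, \<omega>) = X l (a, \<omega>) + drift a b (\<lambda>z. R' z l) \<omega> + I \<omega>)"
      using V_eq[OF _ l] unfolding R_eq[OF l] by blast
  qed (use X in \<open>simp_all add: ito_dynamics_def\<close>)
qed

lemma mat_vec_index:
  "G \<in> carrier_mat d e \<Longrightarrow> v \<in> carrier_vec e \<Longrightarrow> l < d \<Longrightarrow> (G *\<^sub>v v) $ l = (\<Sum>c<e. G $$ (l, c) * v $ c)"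
  by (simp add: scalar_prod_def lessThan_atLeast0)

text \<open>
  The increment over \<open>(a, b]\<close> is the difference of the integrated equations at \<open>b\<close> and at \<open>a\<close>.
\<close>

lemma sde_dynamics:
  assumes x: "sde_solution \<Omega> F q w d S T (0\<^sub>v d) u x" and u: "u \<in> L2T \<Omega> F m T" and T: "0 < T"
    and A: "coeff_A S \<in> carrier_mat d d" and B: "coeff_B S \<in> carrier_mat d m"
    and N: "\<And>i. i < q \<Longrightarrow> coeff_N S i \<in> carrier_mat d d" and M: "\<And>i. i < q \<Longrightarrow> coeff_M S i \<in> carrier_mat d m"
  shows "ito_dynamics T d (\<lambda>c. ext T (\<lambda>t \<omega>. x t \<omega> $ c))
    (\<lambda>z l. (\<Sum>c<d. coeff_A S $$ (l, c) * ext T (\<lambda>t \<omega>. x t \<omega> $ c) z) + (\<Sum>c<m. coeff_B S $$ (l, c) * ext T (\<lambda>t \<omega>. u t \<omega> $ c) z))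
    (\<lambda>z i l. (\<Sum>c<d. coeff_N S i $$ (l, c) * ext T (\<lambda>t \<omega>. x t \<omega> $ c) z) + (\<Sum>c<m. coeff_M S i $$ (l, c) * ext T (\<lambda>t \<omega>. u t \<omega> $ c) z))"
proof -
  let ?X = "\<lambda>c. ext T (\<lambda>t \<omega>. x t \<omega> $ c)" and ?U = "\<lambda>c. ext T (\<lambda>t \<omega>. u t \<omega> $ c)"
  let ?R = "\<lambda>z l. (\<Sum>c<d. coeff_A S $$ (l, c) * ?X c z) + (\<Sum>c<m. coeff_B S $$ (l, c) * ?U c z)"
  let ?V = "\<lambda>z i l. (\<Sum>c<d. coeff_N S i $$ (l, c) * ?X c z) + (\<Sum>c<m. coeff_M S i $$ (l, c) * ?U c z)"
  have xL: "x \<in> L2T \<Omega> F d T" using x by (simp add: sde_solution_def)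
  have cx: "x t \<omega> \<in> carrier_vec d" and cu: "u t \<omega> \<in> carrier_vec m"
    if "0 \<le> t" "t \<le> T" "\<omega> \<in> space \<Omega>" for t \<omega>
    using xL u that by (auto simp: L2T_def)
  have sX: "sq_int (win 0 T) (?X c)" if "c < d" for c by (rule L2T_sq_int[OF xL that])
  have sU: "sq_int (win 0 T) (?U c)" if "c < m" for c by (rule L2T_sq_int[OF u that])
  have sR: "sq_int (win 0 T) (\<lambda>z. ?R z l)" for l
    by (intro sq_int_add sq_int_sum sq_int_cmult sX sU) auto
  have mV: "(\<lambda>z. ?V z i l) \<in> borel_measurable (lborel \<Otimes>\<^sub>M \<Omega>)" for i l
    using sq_int_measurable[OF sX] sq_int_measurable[OF sU]
    by (intro borel_measurable_add borel_measurable_sum borel_measurable_times borel_measurable_const) auto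
  have R: "(coeff_A S *\<^sub>v x t \<omega> + coeff_B S *\<^sub>v u t \<omega>) $ l = ?R (t, \<omega>) l"
    if t: "0 \<le> t" "t \<le> T" "\<omega> \<in> space \<Omega>" and l: "l < d" for t \<omega> l
    using A B l t mat_vec_index[OF A cx[OF t] l] mat_vec_index[OF B cu[OF t] l] by (simp add: ext_def)
  have V: "(coeff_N S i *\<^sub>v x t \<omega> + coeff_M S i *\<^sub>v u t \<omega>) $ l = ?V (t, \<omega>) i l"
    if t: "0 \<le> t" "t \<le> T" "\<omega> \<in> space \<Omega>" and l: "l < d" and i: "i < q" for t \<omega> l i
    using N[OF i] M[OF i] l t mat_vec_index[OF N[OF i] cx[OF t] l] mat_vec_index[OF M[OF i] cu[OF t] l] by (simp add: ext_def)
  have from_0: "\<exists>I. ito 0 t (\<lambda>i z. ?V z i l) I \<and> (AE \<omega> in \<Omega>. ?X l (t, \<omega>) = drift 0 t (\<lambda>z. ?R z l) \<omega> + I \<omega>)"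
    if t: "0 \<le> t" "t \<le> T" and l: "l < d" for t l
  proof -
    have "\<exists>I. (\<forall>i<q. has_ito_integral \<Omega> F (w i) t
           (\<lambda>s \<omega>. (coeff_N S i *\<^sub>v x s \<omega> + coeff_M S i *\<^sub>v u s \<omega>) $ l) (I i)) \<and>
        (AE \<omega> in \<Omega>. x t \<omega> $ l = 0\<^sub>v d $ l
           + (LINT s:{0..t}|lborel. (coeff_A S *\<^sub>v x s \<omega> + coeff_B S *\<^sub>v u s \<omega>) $ l)
           + (\<Sum>i<q. I i \<omega>))"
      using x t l unfolding sde_solution_def by (meson atLeastAtMost_iff)
    then obtain I where I: "\<And>i. i < q \<Longrightarrow> has_ito_integral \<Omega> F (w i) t
           (\<lambda>s \<omega>. (coeff_N S i *\<^sub>v x s \<omega> + coeff_M S i *\<^sub>v u s \<omega>) $ l) (I i)"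
      and eq: "AE \<omega> in \<Omega>. x t \<omega> $ l = 0\<^sub>v d $ l
           + (LINT s:{0..t}|lborel. (coeff_A S *\<^sub>v x s \<omega> + coeff_B S *\<^sub>v u s \<omega>) $ l)
           + (\<Sum>i<q. I i \<omega>)" by blast
    have "ito 0 t (\<lambda>k z. \<Sum>i<q. if k = i then ?V z i l else 0) (\<lambda>\<omega>. \<Sum>i<q. I i \<omega>)"
    proof (rule ito_sum[OF _ order_refl])
      fix i assume "i \<in> {..<q}"
      then have i: "i < q" by simp
      show "ito 0 t (\<lambda>k z. if k = i then ?V z i l else 0) (I i)"
        using t l i by (intro ito_of_has_ito_integral[OF I[OF i] i t(1) mV] V[symmetric]) auto
    qed
    then have "ito 0 t (\<lambda>i z. ?V z i l) (\<lambda>\<omega>. \<Sum>i<q. I i \<omega>)"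
      by (rule ito_cong) (use mV in \<open>auto simp: sum.delta\<close>)
    moreover have "AE \<omega> in \<Omega>. ?X l (t, \<omega>) = drift 0 t (\<lambda>z. ?R z l) \<omega> + (\<Sum>i<q. I i \<omega>)"
      using eq AE_space
    proof eventually_elim
      case (elim \<omega>)
      have "(LINT s:{0..t}|lborel. (coeff_A S *\<^sub>v x s \<omega> + coeff_B S *\<^sub>v u s \<omega>) $ l) = drift 0 t (\<lambda>z. ?R z l) \<omega>"
        unfolding drift_def using t l elim(2) by (intro set_lebesgue_integral_cong) (auto intro!: R)
      with elim(1) t l show ?case by (simp add: ext_def)
    qed
    ultimately show ?thesis by blast
  qed
  show ?thesis
    unfolding ito_dynamics_def
  proof (intro conjI allI impI)
    fix c assume c: "c < d"
    show "sq_int (win 0 T) (?X c)" by (rule sX[OF c])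
    show "(\<lambda>\<omega>. ?X c (t, \<omega>)) \<in> borel_measurable (F t)" if "0 \<le> t" "t \<le> T" for t
      using xL c that by (simp add: ext_def L2T_def adapted_measurable_def)
    obtain I where I: "ito 0 0 (\<lambda>i z. ?V z i c) I" and eq: "AE \<omega> in \<Omega>. ?X c (0, \<omega>) = drift 0 0 (\<lambda>z. ?R z c) \<omega> + I \<omega>"
      using from_0[of 0 c] T c by auto
    have sI: "sq_int \<Omega> I" by (rule ito_sq_int(1)[OF I order_refl])
    have sVi: "sq_int (win 0 0) (\<lambda>z. ?V z i c)" if "i < q" for i by (rule ito_sq_int(2)[OF I order_refl that])
    have "(\<integral>\<omega>. (I \<omega>)\<^sup>2 \<partial>\<Omega>) = (\<integral>z. noise_form (\<lambda>i. ?V z i c) \<partial>win 0 0)" by (rule ito_isometry[OF I order_refl])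
    also have "\<dots> = 0"
      using borel_measurable_integrable[OF integrable_noise_form(1)[of "win 0 0" "\<lambda>i z. ?V z i c", OF sVi]]
      by (simp add: integral_win)
    finally have "AE \<omega> in \<Omega>. (I \<omega>)\<^sup>2 = 0"
      using integral_nonneg_eq_0_iff_AE[OF sq_int_integrable[OF sI]] by simp
    have d0: "drift 0 0 (\<lambda>z. ?R z c) \<omega> = 0" for \<omega>
    proof -
      have "AE s in lborel. s \<notin> {0..0::real}" using AE_lborel_singleton[of "0::real"] by eventually_elim simp
      then have "AE s in lborel. indicator {0..0} s *\<^sub>R ?R (s, \<omega>) c = 0" by eventually_elim simp
      then show ?thesis unfolding drift_def set_lebesgue_integral_def by (rule integral_eq_zero_AE)
    qed
    show "AE \<omega> in \<Omega>. ?X c (0, \<omega>) = 0"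
      using \<open>AE \<omega> in \<Omega>. (I \<omega>)\<^sup>2 = 0\<close> eq by eventually_elim (simp add: d0)
  next
    fix l a b assume l: "l < d" and ab: "0 \<le> a" "a \<le> b" "b \<le> T"
    obtain I where I: "ito 0 b (\<lambda>i z. ?V z i l) I" and Ieq: "AE \<omega> in \<Omega>. ?X l (b, \<omega>) = drift 0 b (\<lambda>z. ?R z l) \<omega> + I \<omega>"
      using from_0[of b l] ab l by auto
    obtain J where J: "ito 0 a (\<lambda>i z. ?V z i l) J" and Jeq: "AE \<omega> in \<Omega>. ?X l (a, \<omega>) = drift 0 a (\<lambda>z. ?R z l) \<omega> + J \<omega>"
      using from_0[of a l] ab l by auto
    have "AE \<omega> in \<Omega>. drift 0 b (\<lambda>z. ?R z l) \<omega> = drift 0 a (\<lambda>z. ?R z l) \<omega> + drift a b (\<lambda>z. ?R z l) \<omega>"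
      using ab by (intro drift_split sq_int_win_mono[OF sR]) auto
    with Ieq Jeq have "AE \<omega> in \<Omega>. ?X l (b, \<omega>) = ?X l (a, \<omega>) + drift a b (\<lambda>z. ?R z l) \<omega> + (I \<omega> - J \<omega>)"
      by eventually_elim simp
    with ito_window[OF I J ab(1,2)]
    show "\<exists>I. ito a b (\<lambda>i z. ?V z i l) I \<and> (AE \<omega> in \<Omega>. ?X l (b, \<omega>) = ?X l (a, \<omega>) + drift a b (\<lambda>z. ?R z l) \<omega> + I \<omega>)"
      by blast
  qed
qed

lemma L2T_norm_eq:
  assumes E: "integrable (win 0 T) E" "\<And>z. 0 \<le> E z"
    and eq: "\<And>t \<omega>. 0 \<le> t \<Longrightarrow> t \<le> T \<Longrightarrow> \<omega> \<in> space \<Omega> \<Longrightarrow> g t \<omega> \<bullet> g t \<omega> = E (t, \<omega>)"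
  shows "L2T_norm \<Omega> T g = ennreal (sqrt (\<integral>z. E z \<partial>win 0 T))"
proof -
  have [measurable]: "E \<in> borel_measurable (lborel \<Otimes>\<^sub>M \<Omega>)" using borel_measurable_integrable[OF E(1)] by simp
  have "(\<integral>\<^sup>+\<omega>. (\<integral>\<^sup>+t\<in>{0..T}. ennreal (g t \<omega> \<bullet> g t \<omega>) \<partial>lborel) \<partial>\<Omega>)
    = (\<integral>\<^sup>+\<omega>. (\<integral>\<^sup>+t\<in>{0..T}. ennreal (E (t, \<omega>)) \<partial>lborel) \<partial>\<Omega>)"
    by (intro nn_integral_cong) (auto simp: indicator_def eq)
  also have "\<dots> = (\<integral>\<^sup>+z. ennreal (E z) \<partial>win 0 T)"
    by (rule nn_integral_win_iterated[symmetric]) measurable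
  also have "\<dots> = ennreal (\<integral>z. E z \<partial>win 0 T)"
    by (rule nn_integral_eq_integral[OF E(1)]) (simp add: E(2))
  finally show ?thesis
    using E(2) by (simp add: L2T_norm_def ennreal_sqrt_def Bochner_Integration.integral_nonneg)
qed

end

section \<open>Discrete schemes for the truncated systems\<close>

text \<open>
  Coefficients are functions of indices: the system truncated to \<open>d\<close> coordinates then has the
  same coefficients, with all indices restricted to be less than \<open>d\<close>.
\<close>

locale linear_system = wiener_process \<Omega> F q K w
  for \<Omega> :: "'w measure" and F :: "real \<Rightarrow> 'w measure" and q :: nat and K :: "real mat"
    and w :: "nat \<Rightarrow> real \<Rightarrow> 'w \<Rightarrow> real" +
  fixes n m :: nat and A B :: "nat \<Rightarrow> nat \<Rightarrow> real" and N M :: "nat \<Rightarrow> nat \<Rightarrow> nat \<Rightarrow> real"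
    and T :: real and U :: "nat \<Rightarrow> real \<times> 'w \<Rightarrow> real"
  assumes T_pos: "0 < T" and U_sq_int: "c < m \<Longrightarrow> sq_int (win 0 T) (U c)"
begin

definition rate :: "nat \<Rightarrow> (nat \<Rightarrow> real) \<Rightarrow> (nat \<Rightarrow> real) \<Rightarrow> nat \<Rightarrow> real" where
  "rate d z v l = (\<Sum>c<d. A l c * z c) + (\<Sum>c<m. B l c * v c)"

definition vol :: "nat \<Rightarrow> (nat \<Rightarrow> real) \<Rightarrow> (nat \<Rightarrow> real) \<Rightarrow> nat \<Rightarrow> nat \<Rightarrow> real" where
  "vol d z v i l = (\<Sum>c<d. N i l c * z c) + (\<Sum>c<m. M i l c * v c)"

definition solution :: "nat \<Rightarrow> (nat \<Rightarrow> real \<times> 'w \<Rightarrow> real) \<Rightarrow> bool" where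
  solution_eq: "solution d X \<longleftrightarrow>
     ito_dynamics T d X (\<lambda>z. rate d (\<lambda>c. X c z) (\<lambda>c. U c z)) (\<lambda>z. vol d (\<lambda>c. X c z) (\<lambda>c. U c z))"

lemmas solution_def = solution_eq[unfolded ito_dynamics_def]

lemma U_sq_int_win: "c < m \<Longrightarrow> 0 \<le> a \<Longrightarrow> b \<le> T \<Longrightarrow> sq_int (win a b) (U c)"
  using sq_int_win_mono[OF U_sq_int] by simp

lemma sq_int_rate:
  assumes "\<And>c. c < d \<Longrightarrow> sq_int W (X c)" "\<And>c. c < m \<Longrightarrow> sq_int W (V c)"
  shows "sq_int W (\<lambda>z. rate d (\<lambda>c. X c z) (\<lambda>c. V c z) l)"
  unfolding rate_def using assms by (intro sq_int_add sq_int_sum sq_int_cmult) auto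

lemma sq_int_vol:
  assumes "\<And>c. c < d \<Longrightarrow> sq_int W (X c)" "\<And>c. c < m \<Longrightarrow> sq_int W (V c)"
  shows "sq_int W (\<lambda>z. vol d (\<lambda>c. X c z) (\<lambda>c. V c z) i l)"
  unfolding vol_def using assms by (intro sq_int_add sq_int_sum sq_int_cmult) auto

lemma solution_sq_int:
  assumes "solution d X" "c < d" "0 \<le> a" "b \<le> T"
  shows "sq_int (win a b) (X c)"
  using assms sq_int_win_mono[of 0 T "X c" a b] by (simp add: solution_def)

lemma solution_step:
  assumes "solution d X" "l < d" "0 \<le> a" "a \<le> b" "b \<le> T"
  obtains I where "ito a b (\<lambda>i z. vol d (\<lambda>c. X c z) (\<lambda>c. U c z) i l) I"
    "AE \<omega> in \<Omega>. X l (b, \<omega>) = X l (a, \<omega>) + drift a b (\<lambda>z. rate d (\<lambda>c. X c z) (\<lambda>c. U c z) l) \<omega> + I \<omega>"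
  using assms unfolding solution_def by blast

lemma solution_past:
  assumes X: "solution d X" and l: "l < d" and t: "0 \<le> t" "t \<le> T"
  shows "past t (\<lambda>\<omega>. X l (t, \<omega>))"
proof -
  have m: "(\<lambda>\<omega>. X l (t, \<omega>)) \<in> borel_measurable (F t)" and z: "AE \<omega> in \<Omega>. X l (0, \<omega>) = 0"
    using X l t by (auto simp: solution_def)
  obtain I where I: "ito 0 t (\<lambda>i z. vol d (\<lambda>c. X c z) (\<lambda>c. U c z) i l) I"
    and eq: "AE \<omega> in \<Omega>. X l (t, \<omega>) = X l (0, \<omega>) + drift 0 t (\<lambda>z. rate d (\<lambda>c. X c z) (\<lambda>c. U c z) l) \<omega> + I \<omega>"
    by (rule solution_step[OF X l order_refl t])
  have "sq_int \<Omega> (drift 0 t (\<lambda>z. rate d (\<lambda>c. X c z) (\<lambda>c. U c z) l))"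
    using t solution_sq_int[OF X] U_sq_int_win by (intro drift_bounds(1) sq_int_rate) auto
  from sq_int_add[OF this ito_sq_int(1)[OF I order_refl]]
  have "sq_int \<Omega> (\<lambda>\<omega>. X l (t, \<omega>))"
    using measurable_F_imp_measurable[OF t(1) m] by (rule sq_int_cong_AE) (use eq z in \<open>eventually_elim, simp\<close>)
  with m show ?thesis by (simp add: past_def)
qed

definition energy :: "real \<Rightarrow> real \<Rightarrow> nat \<Rightarrow> (nat \<Rightarrow> real \<times> 'w \<Rightarrow> real) \<Rightarrow> real" where
  "energy a b d X = (\<integral>z. (\<Sum>c<d. (X c z)\<^sup>2) + (\<Sum>c<m. (U c z)\<^sup>2) \<partial>win a b)"

lemma integral_win_mono:
  fixes f :: "real \<times> 'w \<Rightarrow> real"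
  assumes f: "integrable (win a b) f" and "\<And>z. 0 \<le> f z" and ab: "a \<le> a'" "b' \<le> b"
  shows "integrable (win a' b') f" "(\<integral>z. f z \<partial>win a' b') \<le> (\<integral>z. f z \<partial>win a b)"
proof -
  have [measurable]: "f \<in> borel_measurable (lborel \<Otimes>\<^sub>M \<Omega>)" using borel_measurable_integrable[OF f] by simp
  have i: "integrable (lborel \<Otimes>\<^sub>M \<Omega>) (\<lambda>z. indicator {a<..b} (fst z) * f z)"
    using f by (simp add: integrable_win)
  have "integrable (lborel \<Otimes>\<^sub>M \<Omega>) (\<lambda>z. indicator {a'<..b'} (fst z) * f z)"
    by (rule Bochner_Integration.integrable_bound[OF i]) (use assms in \<open>auto simp: indicator_def\<close>)
  then show "integrable (win a' b') f" by (simp add: integrable_win)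
  show "(\<integral>z. f z \<partial>win a' b') \<le> (\<integral>z. f z \<partial>win a b)"
    unfolding integral_win[OF \<open>f \<in> _\<close>] by (intro integral_mono i \<open>integrable _ (\<lambda>z. indicator {a'<..b'} (fst z) * f z)\<close>)
      (use assms in \<open>auto simp: indicator_def\<close>)
qed

lemma integral_win_time_bound:
  assumes f: "sq_int (win a b) f" and ab: "a \<le> b"
    and bnd: "\<And>s. a \<le> s \<Longrightarrow> s \<le> b \<Longrightarrow> (\<integral>\<omega>. (f (s, \<omega>))\<^sup>2 \<partial>\<Omega>) \<le> c"
  shows "(\<integral>z. (f z)\<^sup>2 \<partial>win a b) \<le> (b - a) * c"
proof -
  interpret P: pair_sigma_finite "lborel :: real measure" \<Omega> by (rule pair_lborel)
  have [measurable]: "f \<in> borel_measurable (lborel \<Otimes>\<^sub>M \<Omega>)" using f by (simp add: sq_int_def)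
  have i: "integrable (lborel \<Otimes>\<^sub>M \<Omega>) (\<lambda>z. indicator {a<..b} (fst z) * (f z)\<^sup>2)"
    using sq_int_integrable[OF f] by (simp add: integrable_win)
  have "(\<integral>z. (f z)\<^sup>2 \<partial>win a b) = (\<integral>s. indicator {a<..b} s * (\<integral>\<omega>. (f (s, \<omega>))\<^sup>2 \<partial>\<Omega>) \<partial>lborel)"
    using P.integral_fst'[OF i] by (simp add: integral_win)
  also have "\<dots> \<le> (\<integral>s. indicator {a<..b} s * c \<partial>lborel)"
  proof (rule integral_mono)
    show "integrable lborel (\<lambda>s. indicator {a<..b} s * (\<integral>\<omega>. (f (s, \<omega>))\<^sup>2 \<partial>\<Omega>))"
      using P.integrable_fst'[OF i] by simp
    show "integrable lborel (\<lambda>s. indicator {a<..b} s * c)"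
      using ab by (intro integrable_mult_left integrable_real_indicator) auto
  qed (use bnd in \<open>auto simp: indicator_def\<close>)
  also have "\<dots> = (b - a) * c" using ab by simp
  finally show ?thesis .
qed

text \<open>
  By the isometry and the bound on the drift, \<open>E(X(s) - X(a))\<^sup>2\<close> is at most a multiple of the energy in
  \<open>(a, b]\<close> for each \<open>s\<close> in the window; integration over \<open>s\<close> gives the additional factor \<open>b - a\<close>.
\<close>

lemma solution_increment_bound:
  assumes X: "solution d X" and l: "l < d"
  shows "\<exists>c\<ge>0. \<forall>a b. 0 \<le> a \<longrightarrow> a \<le> b \<longrightarrow> b \<le> T \<longrightarrow>
    sq_int (win a b) (\<lambda>z. X l z - X l (a, snd z)) \<and>
    (\<integral>z. (X l z - X l (a, snd z))\<^sup>2 \<partial>win a b) \<le> c * (b - a) * energy a b d X"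
proof -
  let ?r = "\<lambda>x. (\<Sum>c<d. (fst x c)\<^sup>2) + (\<Sum>c<m. (snd x c)\<^sup>2)"
  let ?f = "\<lambda>x. 2 * T * (rate d (fst x) (snd x) l)\<^sup>2 + 2 * noise_form (\<lambda>i. vol d (fst x) (snd x) i l)"
  have base: "dominated ?r (\<lambda>x. (fst x c)\<^sup>2)" if "c < d" for c
    using that by (intro dominated_base) (auto intro!: add_increasing2 sum_nonneg member_le_sum[of c _ "\<lambda>c. (fst _ c)\<^sup>2"])
  have base2: "dominated ?r (\<lambda>x. (snd x c)\<^sup>2)" if "c < m" for c
    using that by (intro dominated_base) (auto intro!: add_increasing sum_nonneg member_le_sum[of c _ "\<lambda>c. (snd _ c)\<^sup>2"])
  have "dominated ?r ?f"
    unfolding rate_def vol_def using T_pos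
    by (intro dominated_add[of ?r "\<lambda>x. 2 * T * _ x"] dominated_cmult dominated_noise_form dominated_square_add dominated_square_sum
        dominated_square_cmult base base2) auto
  then obtain c where c: "0 \<le> c" "\<And>x. ?f x \<le> c * ?r x" unfolding dominated_def by blast
  have "sq_int (win a b) (\<lambda>z. X l z - X l (a, snd z)) \<and>
    (\<integral>z. (X l z - X l (a, snd z))\<^sup>2 \<partial>win a b) \<le> c * (b - a) * energy a b d X"
    if ab: "0 \<le> a" "a \<le> b" "b \<le> T" for a b
  proof
    have sX: "sq_int (win a b) (X c)" if "c < d" for c using solution_sq_int[OF X that] ab by simp
    have sU: "sq_int (win a b) (U c)" if "c < m" for c using U_sq_int_win[OF that] ab by simp
    have Xa: "sq_int \<Omega> (\<lambda>\<omega>. X l (a, \<omega>))" using solution_past[OF X l] ab by (simp add: past_def)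
    show s: "sq_int (win a b) (\<lambda>z. X l z - X l (a, snd z))"
      using sX[OF l] sq_int_win_const[OF Xa ab(2)] by (rule sq_int_diff)
    let ?R = "\<lambda>z. rate d (\<lambda>c. X c z) (\<lambda>c. U c z) l"
    let ?V = "\<lambda>i z. vol d (\<lambda>c. X c z) (\<lambda>c. U c z) i l"
    have sR: "sq_int (win a b) ?R" by (rule sq_int_rate[OF sX sU])
    have sV: "sq_int (win a b) (?V i)" for i by (rule sq_int_vol[OF sX sU])
    have "(\<integral>\<omega>. (X l (s, \<omega>) - X l (a, \<omega>))\<^sup>2 \<partial>\<Omega>) \<le> c * energy a b d X" if as: "a \<le> s" "s \<le> b" for s
    proof -
      obtain I where I: "ito a s ?V I"
        and eq: "AE \<omega> in \<Omega>. X l (s, \<omega>) = X l (a, \<omega>) + drift a s ?R \<omega> + I \<omega>"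
        by (rule solution_step[OF X l ab(1) as(1) order_trans[OF as(2) ab(3)]])
      have sR': "sq_int (win a s) ?R" using sq_int_win_mono[OF sR] as by simp
      note D = drift_bounds[OF sR' as(1)]
      have sI: "sq_int \<Omega> I" by (rule ito_sq_int(1)[OF I ab(1)])
      have Xs: "sq_int \<Omega> (\<lambda>\<omega>. X l (s, \<omega>))" using solution_past[OF X l] ab as by (simp add: past_def)
      have iV: "integrable (win a s) (\<lambda>z. noise_form (\<lambda>i. ?V i z))"
        using sq_int_win_mono[OF sV] as by (intro integrable_noise_form(1)) auto
      have "(\<integral>\<omega>. (X l (s, \<omega>) - X l (a, \<omega>))\<^sup>2 \<partial>\<Omega>) \<le> (\<integral>\<omega>. 2 * (drift a s ?R \<omega>)\<^sup>2 + 2 * (I \<omega>)\<^sup>2 \<partial>\<Omega>)"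
        using eq sq_int_integrable[OF sI] sq_int_integrable[OF D(1)]
        by (intro integral_mono_AE sq_int_integrable[OF sq_int_diff[OF Xs Xa]])
          (auto elim!: eventually_mono intro: square_add_le)
      also have "\<dots> = 2 * (\<integral>\<omega>. (drift a s ?R \<omega>)\<^sup>2 \<partial>\<Omega>) + 2 * (\<integral>z. noise_form (\<lambda>i. ?V i z) \<partial>win a s)"
        using sq_int_integrable[OF sI] sq_int_integrable[OF D(1)] by (simp add: ito_isometry[OF I ab(1)])
      also have "\<dots> \<le> 2 * (T * (\<integral>z. (?R z)\<^sup>2 \<partial>win a s)) + 2 * (\<integral>z. noise_form (\<lambda>i. ?V i z) \<partial>win a s)"
        using ab as by (intro add_mono mult_left_mono order_trans[OF D(2)] mult_right_mono) auto
      also have "\<dots> = (\<integral>z. 2 * T * (?R z)\<^sup>2 + 2 * noise_form (\<lambda>i. ?V i z) \<partial>win a s)"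
        using sq_int_integrable[OF sR'] iV by simp
      also have "\<dots> \<le> (\<integral>z. 2 * T * (?R z)\<^sup>2 + 2 * noise_form (\<lambda>i. ?V i z) \<partial>win a b)"
      proof (rule integral_win_mono(2)[OF _ _ order_refl as(2)])
        show "integrable (win a b) (\<lambda>z. 2 * T * (?R z)\<^sup>2 + 2 * noise_form (\<lambda>i. ?V i z))"
          using sq_int_integrable[OF sR] integrable_noise_form(1)[of "win a b" ?V, OF sV] by simp
        show "0 \<le> 2 * T * (?R z)\<^sup>2 + 2 * noise_form (\<lambda>i. ?V i z)" for z
          using T_pos noise_form_nonneg by (intro add_nonneg_nonneg mult_nonneg_nonneg) auto
      qed
      also have "\<dots> \<le> (\<integral>z. c * ((\<Sum>c<d. (X c z)\<^sup>2) + (\<Sum>c<m. (U c z)\<^sup>2)) \<partial>win a b)"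
      proof (rule integral_mono)
        show "integrable (win a b) (\<lambda>z. 2 * T * (?R z)\<^sup>2 + 2 * noise_form (\<lambda>i. ?V i z))"
          using sq_int_integrable[OF sR] integrable_noise_form(1)[of "win a b" ?V, OF sV] by simp
        show "integrable (win a b) (\<lambda>z. c * ((\<Sum>c<d. (X c z)\<^sup>2) + (\<Sum>c<m. (U c z)\<^sup>2)))"
          using sX sU by (auto intro!: integrable_mult_right Bochner_Integration.integrable_add Bochner_Integration.integrable_sum sq_int_integrable)
        fix z
        show "2 * T * (?R z)\<^sup>2 + 2 * noise_form (\<lambda>i. ?V i z) \<le> c * ((\<Sum>c<d. (X c z)\<^sup>2) + (\<Sum>c<m. (U c z)\<^sup>2))"
          using c(2)[of "(\<lambda>c. X c z, \<lambda>c. U c z)"] by simp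
      qed
      also have "\<dots> = c * energy a b d X" by (simp add: energy_def)
      finally show ?thesis .
    qed
    from integral_win_time_bound[OF s ab(2), of "c * energy a b d X"] this
    show "(\<integral>z. (X l z - X l (a, snd z))\<^sup>2 \<partial>win a b) \<le> c * (b - a) * energy a b d X"
      by (simp add: mult_ac)
  qed
  with c(1) show ?thesis by blast
qed

text \<open>
  A step of a scheme at level \<open>d\<close>: the state is frozen at its value \<open>Z\<close> at time \<open>a\<close>, the input acts exactly,
  and the consequences of freezing are collected in an error \<open>e\<close> of the state to which the
  coefficients apply.  The sum over \<open>e\<close> has \<open>n\<close> terms at every level, because the errors of the Euler
  schemes below come from the full state.
\<close>

definition grid_step :: "nat \<Rightarrow> real \<Rightarrow> real \<Rightarrow> (nat \<Rightarrow> real \<times> 'w \<Rightarrow> real) \<Rightarrow> (nat \<Rightarrow> 'w \<Rightarrow> real) \<Rightarrow>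
    (nat \<Rightarrow> 'w \<Rightarrow> real) \<Rightarrow> bool" where
  "grid_step d a b e Z Z' \<longleftrightarrow>
     (\<forall>c<n. sq_int (win a b) (e c)) \<and> (\<forall>l<d. past a (Z l) \<and> past b (Z' l)) \<and>
     (\<forall>l<d. \<exists>I. ito a b (\<lambda>i z. vol d (\<lambda>c. Z c (snd z)) (\<lambda>c. U c z) i l + (\<Sum>c<n. N i l c * e c z)) I \<and>
       (AE \<omega> in \<Omega>. Z' l \<omega> = Z l \<omega>
          + drift a b (\<lambda>z. rate d (\<lambda>c. Z c (snd z)) (\<lambda>c. U c z) l + (\<Sum>c<n. A l c * e c z)) \<omega> + I \<omega>))"

text \<open>
  A solution sampled at the grid points is such a scheme; its error is its deviation from the last sample.
\<close>

lemma grid_step_solution: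
  assumes X: "solution d X" and d: "d \<le> n" and ab: "0 \<le> a" "a \<le> b" "b \<le> T"
  shows "grid_step d a b (\<lambda>c z. if c < d then X c z - X c (a, snd z) else 0) (\<lambda>l \<omega>. X l (a, \<omega>)) (\<lambda>l \<omega>. X l (b, \<omega>))"
proof -
  let ?e = "\<lambda>c z. if c < d then X c z - X c (a, snd z) else 0"
  have Xa: "past a (\<lambda>\<omega>. X l (a, \<omega>))" "past b (\<lambda>\<omega>. X l (b, \<omega>))" if "l < d" for l
    using solution_past[OF X that] ab by auto
  have se: "sq_int (win a b) (?e c)" for c
    using sq_int_diff[OF solution_sq_int[OF X _ ab(1,3), of c] sq_int_win_const[OF past_sq_int[OF Xa(1)] ab(2)]] by (cases "c < d") auto
  have split: "(\<Sum>c<d. g c * X c z) = (\<Sum>c<d. g c * X c (a, snd z)) + (\<Sum>c<n. g c * ?e c z)" for g z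
  proof -
    have "(\<Sum>c<n. g c * ?e c z) = (\<Sum>c<d. g c * ?e c z)"
      using d by (intro sum.mono_neutral_right) auto
    then show ?thesis by (simp add: right_diff_distrib sum_subtractf)
  qed
  have vr: "vol d (\<lambda>c. X c (a, snd z)) v i l + (\<Sum>c<n. N i l c * ?e c z) = vol d (\<lambda>c. X c z) v i l"
    "rate d (\<lambda>c. X c (a, snd z)) v l + (\<Sum>c<n. A l c * ?e c z) = rate d (\<lambda>c. X c z) v l" for z v i l
    using split[of "N i l" z] split[of "A l" z] by (simp_all add: vol_def rate_def)
  have "\<exists>I. ito a b (\<lambda>i z. vol d (\<lambda>c. X c (a, snd z)) (\<lambda>c. U c z) i l + (\<Sum>c<n. N i l c * ?e c z)) I \<and>
       (AE \<omega> in \<Omega>. X l (b, \<omega>) = X l (a, \<omega>)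
          + drift a b (\<lambda>z. rate d (\<lambda>c. X c (a, snd z)) (\<lambda>c. U c z) l + (\<Sum>c<n. A l c * ?e c z)) \<omega> + I \<omega>)"
    if "l < d" for l
    unfolding vr using solution_step[OF X that ab] by blast
  then show ?thesis unfolding grid_step_def using se Xa by blast
qed

text \<open>
  The Euler step at level \<open>d\<close> for the state \<open>Z\<close>, driven by the increment of \<open>X\<close> minus the Euler increment
  of \<open>X\<close>.  This residual equals the contribution of the input up to the errors caused by the
  variation of \<open>X\<close> within the step, and it is known at time \<open>b\<close> since \<open>X\<close> is adapted, so that
  it can stand in for the integrals of the input.
\<close>

definition euler_step :: "(nat \<Rightarrow> real \<times> 'w \<Rightarrow> real) \<Rightarrow> nat \<Rightarrow> real \<Rightarrow> real \<Rightarrow> (nat \<Rightarrow> 'w \<Rightarrow> real) \<Rightarrow> nat \<Rightarrow> 'w \<Rightarrow> real" where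
  "euler_step X d a b Z l \<omega> = Z l \<omega> + (X l (b, \<omega>) - X l (a, \<omega>))
     + (b - a) * ((\<Sum>c<d. A l c * Z c \<omega>) - (\<Sum>c<n. A l c * X c (a, \<omega>)))
     + (\<Sum>i<q. ((\<Sum>c<d. N i l c * Z c \<omega>) - (\<Sum>c<n. N i l c * X c (a, \<omega>))) * incr i a b \<omega>)"

lemma drift_const: "a \<le> b \<Longrightarrow> drift a b (\<lambda>z. W (snd z)) \<omega> = (b - a) * W \<omega>"
  by (simp add: drift_def set_lebesgue_integral_def)

lemma grid_step_euler:
  assumes X: "solution n X" and d: "d \<le> n" and ab: "0 \<le> a" "a \<le> b" "b \<le> T"
    and Z: "\<And>l. l < d \<Longrightarrow> past a (Z l)"
  shows "grid_step d a b (\<lambda>c z. X c z - X c (a, snd z)) Z (euler_step X d a b Z)"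
proof -
  let ?e = "\<lambda>c z. X c z - X c (a, snd z)"
  have Xa: "past a (\<lambda>\<omega>. X l (a, \<omega>))" "past b (\<lambda>\<omega>. X l (b, \<omega>))" if "l < n" for l
    using solution_past[OF X that] ab by auto
  have sX: "sq_int (win a b) (X c)" if "c < n" for c using solution_sq_int[OF X that] ab by simp
  have sU: "sq_int (win a b) (U c)" if "c < m" for c using U_sq_int_win[OF that] ab by simp
  have se: "sq_int (win a b) (?e c)" if "c < n" for c
    using sq_int_diff[OF sX[OF that] sq_int_win_const[OF past_sq_int[OF Xa(1)[OF that]] ab(2)]] .
  define G where "G g \<omega> = (\<Sum>c<d. g c * Z c \<omega>) - (\<Sum>c<n. g c * X c (a, \<omega>))" for g :: "nat \<Rightarrow> real" and \<omega>
  have G: "past a (G g)" for g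
    unfolding G_def[abs_def] using Z Xa(1) by (intro past_diff past_sum past_cmult) auto
  have \<phi>: "euler_step X d a b Z l = (\<lambda>\<omega>. Z l \<omega> + (X l (b, \<omega>) - X l (a, \<omega>)) + (b - a) * G (A l) \<omega> + (\<Sum>i<q. G (N i l) \<omega> * incr i a b \<omega>))" for l
    by (auto simp: euler_step_def G_def)
  have pe: "past b (euler_step X d a b Z l)" if "l < d" for l
  proof -
    have "l < n" using that d by simp
    note pm = past_mono[OF ab(1,2)]
    show ?thesis unfolding \<phi>
      by (intro past_add past_diff past_cmult past_sum past_mult_incr pm G Z Xa \<open>l < n\<close> that ab) auto
  qed
  have "\<exists>I. ito a b (\<lambda>i z. vol d (\<lambda>c. Z c (snd z)) (\<lambda>c. U c z) i l + (\<Sum>c<n. N i l c * ?e c z)) I \<and>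
       (AE \<omega> in \<Omega>. euler_step X d a b Z l \<omega> = Z l \<omega>
          + drift a b (\<lambda>z. rate d (\<lambda>c. Z c (snd z)) (\<lambda>c. U c z) l + (\<Sum>c<n. A l c * ?e c z)) \<omega> + I \<omega>)"
    if l: "l < d" for l
  proof -
    have ln: "l < n" using l d by simp
    let ?R = "\<lambda>z. rate n (\<lambda>c. X c z) (\<lambda>c. U c z) l"
    obtain I where I: "ito a b (\<lambda>i z. vol n (\<lambda>c. X c z) (\<lambda>c. U c z) i l) I"
        and eq: "AE \<omega> in \<Omega>. X l (b, \<omega>) = X l (a, \<omega>) + drift a b ?R \<omega> + I \<omega>"
      by (rule solution_step[OF X ln ab])
    have "ito a b (\<lambda>i z. G (N i l) (snd z)) (\<lambda>\<omega>. \<Sum>i<q. G (N i l) \<omega> * incr i a b \<omega>)"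
      by (rule ito_const[OF G ab(1,2)])
    from ito_add[OF I this ab(1)]
    have ito: "ito a b (\<lambda>i z. vol n (\<lambda>c. X c z) (\<lambda>c. U c z) i l + G (N i l) (snd z))
      (\<lambda>\<omega>. I \<omega> + (\<Sum>i<q. G (N i l) \<omega> * incr i a b \<omega>))" .
    have v: "vol n (\<lambda>c. X c z) (\<lambda>c. U c z) i l + G (N i l) (snd z)
       = vol d (\<lambda>c. Z c (snd z)) (\<lambda>c. U c z) i l + (\<Sum>c<n. N i l c * ?e c z)" for i z
      by (simp add: vol_def G_def right_diff_distrib sum_subtractf)
    have r: "rate d (\<lambda>c. Z c (snd z)) (\<lambda>c. U c z) l + (\<Sum>c<n. A l c * ?e c z) = ?R z + G (A l) (snd z)" for z
      by (simp add: rate_def G_def right_diff_distrib sum_subtractf)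
    have "AE \<omega> in \<Omega>. drift a b (\<lambda>z. ?R z + G (A l) (snd z)) \<omega> = drift a b ?R \<omega> + drift a b (\<lambda>z. G (A l) (snd z)) \<omega>"
      using sq_int_win_const[OF past_sq_int[OF G] ab(2)]
      by (intro drift_add sq_int_rate sX sU ab) auto
    with eq have "AE \<omega> in \<Omega>. euler_step X d a b Z l \<omega> = Z l \<omega>
          + drift a b (\<lambda>z. ?R z + G (A l) (snd z)) \<omega> + (I \<omega> + (\<Sum>i<q. G (N i l) \<omega> * incr i a b \<omega>))"
      by eventually_elim (simp add: \<phi> drift_const ab)
    with ito show ?thesis unfolding v r by blast
  qed
  then show ?thesis unfolding grid_step_def using se Z pe by blast
qed

lemma euler_step_solution:
  assumes "\<And>l \<omega>. l < n \<Longrightarrow> Z l \<omega> = X l (a, \<omega>)" "l < n"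
  shows "euler_step X n a b Z l \<omega> = X l (b, \<omega>)"
  using assms by (simp add: euler_step_def)

end

section \<open>Dissipation for two neighbouring levels\<close>

definition pad :: "nat \<Rightarrow> (nat \<Rightarrow> real) \<Rightarrow> nat \<Rightarrow> real" where
  "pad k y l = (if l < k then y l else 0)"

lemma sum_pad: "k \<le> n \<Longrightarrow> (\<Sum>c<n. g c * pad k y c) = (\<Sum>c<k. g c * y c)"
proof -
  assume "k \<le> n"
  then have "(\<Sum>c<n. g c * pad k y c) = (\<Sum>c<k. g c * pad k y c)"
    by (intro sum.mono_neutral_right) (auto simp: pad_def)
  also have "\<dots> = (\<Sum>c<k. g c * y c)" by (intro sum.cong) (auto simp: pad_def)
  finally show ?thesis .
qed

text \<open>
  \<open>reach\<close> and \<open>obs\<close> are the Gramian inequalities in balanced coordinates, where both Gramians are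
  \<open>\<Sigma>\<close>; in \<open>reach\<close> the Schur complement has been undone, so that it is a quadratic inequality in
  state and input jointly.
\<close>

locale balanced_system = linear_system \<Omega> F q K w n m A B N M T U
  for \<Omega> :: "'w measure" and F :: "real \<Rightarrow> 'w measure" and q :: nat and K :: "real mat"
    and w :: "nat \<Rightarrow> real \<Rightarrow> 'w \<Rightarrow> real" and n m :: nat and A B :: "nat \<Rightarrow> nat \<Rightarrow> real"
    and N M :: "nat \<Rightarrow> nat \<Rightarrow> nat \<Rightarrow> real" and T :: real and U :: "nat \<Rightarrow> real \<times> 'w \<Rightarrow> real" +
  fixes p :: nat and C :: "nat \<Rightarrow> nat \<Rightarrow> real" and \<sigma> :: "nat \<Rightarrow> real" and \<gamma> :: real
  assumes \<sigma>_pos: "l < n \<Longrightarrow> 0 < \<sigma> l" and \<gamma>_nonneg: "0 \<le> \<gamma>"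
    and reach: "(\<Sum>l<n. 1 / \<sigma> l * (2 * (z l * rate n z v l) + noise_form (\<lambda>i. vol n z v i l)))
      \<le> \<gamma> * (\<Sum>c<m. (v c)\<^sup>2)"
    and obs: "(\<Sum>l<n. \<sigma> l * (2 * (z l * rate n z (\<lambda>_. 0) l) + noise_form (\<lambda>i. vol n z (\<lambda>_. 0) i l)))
      + (\<Sum>s<p. (\<Sum>c<n. C s c * z c)\<^sup>2) \<le> 0"
begin

lemma rate_pad: "k \<le> d \<Longrightarrow> rate d (pad k z) v l = rate k z v l"
  by (simp add: rate_def sum_pad)

lemma vol_pad: "k \<le> d \<Longrightarrow> vol d (pad k z) v i l = vol k z v i l"
  by (simp add: vol_def sum_pad)

text \<open>
  For a state that vanishes from coordinate \<open>k\<close> on, the left-hand side of \<open>reach\<close> differs from the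
  truncated one by the noise terms of the rows from \<open>k\<close> on, which are nonnegative.
\<close>

lemma reach_truncated:
  assumes k: "k \<le> n"
  shows "(\<Sum>l<k. 1 / \<sigma> l * (2 * (z l * rate k z v l) + noise_form (\<lambda>i. vol k z v i l)))
      \<le> \<gamma> * (\<Sum>c<m. (v c)\<^sup>2)"
proof -
  have "(\<Sum>l<k. 1 / \<sigma> l * (2 * (z l * rate k z v l) + noise_form (\<lambda>i. vol k z v i l)))
    = (\<Sum>l<k. 1 / \<sigma> l * (2 * (pad k z l * rate k z v l) + noise_form (\<lambda>i. vol k z v i l)))"
    by (intro sum.cong) (auto simp: pad_def)
  also have "\<dots> \<le> (\<Sum>l<n. 1 / \<sigma> l * (2 * (pad k z l * rate k z v l) + noise_form (\<lambda>i. vol k z v i l)))"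
    using k noise_form_nonneg \<sigma>_pos
    by (intro sum_mono2) (auto simp: pad_def intro!: divide_nonneg_nonneg less_imp_le[OF \<sigma>_pos])
  also have "\<dots> \<le> \<gamma> * (\<Sum>c<m. (v c)\<^sup>2)"
    using reach[of "pad k z" v] k by (simp add: rate_pad vol_pad)
  finally show ?thesis .
qed

lemma obs_truncated:
  assumes k: "k \<le> n"
  shows "(\<Sum>l<k. \<sigma> l * (2 * (z l * rate k z (\<lambda>_. 0) l) + noise_form (\<lambda>i. vol k z (\<lambda>_. 0) i l)))
      + (\<Sum>s<p. (\<Sum>c<k. C s c * z c)\<^sup>2) \<le> 0"
proof -
  have "(\<Sum>l<k. \<sigma> l * (2 * (z l * rate k z (\<lambda>_. 0) l) + noise_form (\<lambda>i. vol k z (\<lambda>_. 0) i l)))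
    = (\<Sum>l<k. \<sigma> l * (2 * (pad k z l * rate k z (\<lambda>_. 0) l) + noise_form (\<lambda>i. vol k z (\<lambda>_. 0) i l)))"
    by (intro sum.cong) (auto simp: pad_def)
  also have "\<dots> \<le> (\<Sum>l<n. \<sigma> l * (2 * (pad k z l * rate k z (\<lambda>_. 0) l) + noise_form (\<lambda>i. vol k z (\<lambda>_. 0) i l)))"
    using k noise_form_nonneg \<sigma>_pos
    by (intro sum_mono2) (auto simp: pad_def intro!: mult_nonneg_nonneg less_imp_le[OF \<sigma>_pos])
  finally show ?thesis
    using obs[of "pad k z"] k by (simp add: rate_pad vol_pad sum_pad)
qed

text \<open>
  The storage function of the pair of levels \<open>k + 1\<close> (state \<open>z\<close>) and \<open>k\<close> (state \<open>y\<close>): \<open>\<Sigma>\<close> weighs the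
  difference and \<open>\<sigma>\<^sub>k\<^sup>2 \<Sigma>\<^sup>-\<^sup>1\<close> the sum.  At \<open>l = k\<close> the two weights coincide.
\<close>

definition storage :: "nat \<Rightarrow> (nat \<Rightarrow> real) \<Rightarrow> (nat \<Rightarrow> real) \<Rightarrow> real" where
  "storage k z y = (\<Sum>l<Suc k. \<sigma> l * (z l + (-1) * pad k y l)\<^sup>2 + (\<sigma> k)\<^sup>2 / \<sigma> l * (z l + 1 * pad k y l)\<^sup>2)"

definition gap :: "nat \<Rightarrow> (nat \<Rightarrow> real) \<Rightarrow> (nat \<Rightarrow> real) \<Rightarrow> real" where
  "gap k z y = (\<Sum>s<p. ((\<Sum>c<Suc k. C s c * z c) - (\<Sum>c<k. C s c * y c))\<^sup>2)"

text \<open>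
  The rate of change that Ito's formula gives for the square of coordinate \<open>l\<close> of \<open>z + s y\<close>.
\<close>

definition gain :: "real \<Rightarrow> nat \<Rightarrow> (nat \<Rightarrow> real) \<Rightarrow> (nat \<Rightarrow> real) \<Rightarrow> (nat \<Rightarrow> real) \<Rightarrow> nat \<Rightarrow> real" where
  "gain s k z y v l = 2 * ((z l + s * pad k y l) * (rate (Suc k) z v l + s * pad k (rate k y v) l))
     + noise_form (\<lambda>i. vol (Suc k) z v i l + s * pad k (vol k y v i) l)"

text \<open>
  Were the padded \<open>y\<close> subject to the dynamics of level \<open>k + 1\<close> in all coordinates, \<open>z - y\<close> would have input
  \<open>0\<close> and \<open>z + y\<close> input \<open>2 v\<close>, and \<open>obs\<close> and \<open>\<sigma>\<^sub>k\<^sup>2\<close> times \<open>reach\<close> would give the claim.  But its last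
  coordinate stays \<open>0\<close>.  Passing to the fictitious dynamics changes the terms with \<open>l = k\<close>, where both weights are
  \<open>\<sigma>\<^sub>k\<close>: the changes of the drift cancel between \<open>z - y\<close> and \<open>z + y\<close>, and those of
  the noise add up to a nonnegative amount by the parallelogram law.
\<close>

lemma storage_dissipation:
  assumes k: "k < n"
  shows "(\<Sum>l<Suc k. \<sigma> l * gain (-1) k z y v l + (\<sigma> k)\<^sup>2 / \<sigma> l * gain 1 k z y v l)
    \<le> 4 * \<gamma> * (\<sigma> k)\<^sup>2 * (\<Sum>c<m. (v c)\<^sup>2) - gap k z y"
proof -
  define zm zp where "zm c = z c - pad k y c" and "zp c = z c + pad k y c" for c
  let ?G = "\<lambda>s l. 2 * ((z l + s * pad k y l) * (rate (Suc k) z v l + s * rate k y v l))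
     + noise_form (\<lambda>i. vol (Suc k) z v i l + s * vol k y v i l)"
  have rm: "rate (Suc k) zm (\<lambda>_. 0) l = rate (Suc k) z v l + (-1) * rate k y v l"
    "vol (Suc k) zm (\<lambda>_. 0) i l = vol (Suc k) z v i l + (-1) * vol k y v i l"
    "rate (Suc k) zp (\<lambda>c. 2 * v c) l = rate (Suc k) z v l + 1 * rate k y v l"
    "vol (Suc k) zp (\<lambda>c. 2 * v c) i l = vol (Suc k) z v i l + 1 * vol k y v i l" for l i
    using sum_pad[of k "Suc k" "A l" y] sum_pad[of k "Suc k" "N i l" y]
    by (simp_all add: rate_def vol_def zm_def zp_def right_diff_distrib distrib_left sum_subtractf sum.distrib
        sum_distrib_left[symmetric] mult.left_commute[of _ 2] del: sum.lessThan_Suc)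
  \<comment> \<open>\<open>?G\<close> is \<open>gain\<close> for the fictitious dynamics, in which \<open>y\<close> has rates at \<open>l = k\<close> as well\<close>
  have "\<sigma> l * gain (-1) k z y v l + (\<sigma> k)\<^sup>2 / \<sigma> l * gain 1 k z y v l
    \<le> \<sigma> l * ?G (-1) l + (\<sigma> k)\<^sup>2 / \<sigma> l * ?G 1 l" if "l < Suc k" for l
  proof (cases "l < k")
    case True
    then show ?thesis by (simp add: gain_def pad_def)
  next
    case False
    with that have l: "l = k" by simp
    have pos: "0 < \<sigma> k" using \<sigma>_pos[OF k] .
    then have q: "(\<sigma> k)\<^sup>2 / \<sigma> k = \<sigma> k" by (simp add: power2_eq_square)
    let ?b = "\<lambda>i. vol (Suc k) z v i k" and ?d = "\<lambda>i. vol k y v i k"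
    have g: "gain s k z y v k = 2 * (z k * rate (Suc k) z v k) + noise_form ?b" for s
      by (simp add: gain_def pad_def)
    have G: "?G s k = 2 * (z k * (rate (Suc k) z v k + s * rate k y v k)) + noise_form (\<lambda>i. ?b i + s * ?d i)" for s
      by (simp add: pad_def)
    have "gain (-1) k z y v k + gain 1 k z y v k \<le> ?G (-1) k + ?G 1 k"
      unfolding g G using noise_form_parallelogram[of ?b ?d] noise_form_nonneg[of ?d]
      by (simp add: algebra_simps)
    then have "\<sigma> k * (gain (-1) k z y v k + gain 1 k z y v k) \<le> \<sigma> k * (?G (-1) k + ?G 1 k)"
      using pos by (intro mult_left_mono) auto
    then show ?thesis unfolding l q by (simp only: distrib_left)
  qed
  then have "(\<Sum>l<Suc k. \<sigma> l * gain (-1) k z y v l + (\<sigma> k)\<^sup>2 / \<sigma> l * gain 1 k z y v l)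
    \<le> (\<Sum>l<Suc k. \<sigma> l * ?G (-1) l + (\<sigma> k)\<^sup>2 / \<sigma> l * ?G 1 l)"
    by (intro sum_mono) auto
  also have "\<dots> = (\<Sum>l<Suc k. \<sigma> l * (2 * (zm l * rate (Suc k) zm (\<lambda>_. 0) l) + noise_form (\<lambda>i. vol (Suc k) zm (\<lambda>_. 0) i l)))
     + (\<sigma> k)\<^sup>2 * (\<Sum>l<Suc k. 1 / \<sigma> l * (2 * (zp l * rate (Suc k) zp (\<lambda>c. 2 * v c) l)
        + noise_form (\<lambda>i. vol (Suc k) zp (\<lambda>c. 2 * v c) i l)))"
    unfolding rm sum.distrib[symmetric] sum_distrib_left
    by (intro sum.cong refl) (simp add: zm_def zp_def)
  also have "\<dots> \<le> - (\<Sum>s<p. (\<Sum>c<Suc k. C s c * zm c)\<^sup>2) + (\<sigma> k)\<^sup>2 * (\<gamma> * (\<Sum>c<m. (2 * v c)\<^sup>2))"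
    using obs_truncated[of "Suc k" zm] reach_truncated[of "Suc k" zp "\<lambda>c. 2 * v c"] k
    by (intro add_mono mult_left_mono) auto
  also have "\<dots> = 4 * \<gamma> * (\<sigma> k)\<^sup>2 * (\<Sum>c<m. (v c)\<^sup>2) - gap k z y"
    using sum_pad[of k "Suc k" _ y]
    by (simp add: gap_def zm_def right_diff_distrib sum_subtractf power_mult_distrib sum_distrib_left[symmetric]
        del: sum.lessThan_Suc)
  finally show ?thesis .
qed

definition err :: "(nat \<Rightarrow> real) \<Rightarrow> nat \<Rightarrow> real" where
  "err e l = (\<Sum>c<n. A l c * e c)"

definition nerr :: "(nat \<Rightarrow> real) \<Rightarrow> nat \<Rightarrow> nat \<Rightarrow> real" where
  "nerr e i l = (\<Sum>c<n. N i l c * e c)"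

text \<open>
  The terms that carry the factor \<open>\<theta>\<close> in the perturbed step.
\<close>

definition excess :: "real \<Rightarrow> nat \<Rightarrow> (nat \<Rightarrow> real) \<Rightarrow> (nat \<Rightarrow> real) \<Rightarrow> (nat \<Rightarrow> real) \<Rightarrow> nat \<Rightarrow> real" where
  "excess s k z y v l = (z l + s * pad k y l)\<^sup>2 + (rate (Suc k) z v l + s * pad k (rate k y v) l)\<^sup>2
     + noise_form (\<lambda>i. vol (Suc k) z v i l + s * pad k (vol k y v i) l)"

text \<open>
  The terms that carry the factor \<open>1 / \<theta>\<close> in the perturbed step.
\<close>

definition defect :: "real \<Rightarrow> nat \<Rightarrow> (nat \<Rightarrow> real) \<Rightarrow> (nat \<Rightarrow> real) \<Rightarrow> nat \<Rightarrow> real" where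
  "defect s k e e' l = (err e l + s * pad k (err e') l)\<^sup>2 + noise_form (\<lambda>i. nerr e i l + s * pad k (nerr e' i) l)"

lemma dominated_pad_square:
  "(l < k \<Longrightarrow> dominated r (\<lambda>x. (f x l)\<^sup>2)) \<Longrightarrow> dominated r (\<lambda>x. (pad k (f x) l)\<^sup>2)"
  by (cases "l < k") (simp_all add: pad_def dominated_zero)

text \<open>
  \<open>z\<close> and \<open>y\<close> are half the sum and half the difference of \<open>z + y\<close> and \<open>z - y\<close>, and \<open>storage\<close> controls both of these
  because all \<open>\<sigma> l\<close> are positive.
\<close>

lemma excess_bound:
  assumes k: "k < n"
  shows "\<exists>c\<ge>0. \<forall>z y v. (\<Sum>l<Suc k. \<sigma> l * excess (-1) k z y v l + (\<sigma> k)\<^sup>2 / \<sigma> l * excess 1 k z y v l)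
    \<le> c * (storage k z y + (\<Sum>c<m. (v c)\<^sup>2))"
proof -
  let ?r = "\<lambda>x. storage k (fst x) (fst (snd x)) + (\<Sum>c<m. (snd (snd x) c)\<^sup>2)"
  have \<sigma>: "0 < \<sigma> l" if "l \<le> k" for l using \<sigma>_pos that k by simp
  have w: "0 \<le> \<sigma> l" "0 \<le> (\<sigma> k)\<^sup>2 / \<sigma> l" if "l \<le> k" for l using \<sigma>[OF that] by auto
  have st: "0 \<le> storage k z y" for z y
    unfolding storage_def using w by (intro sum_nonneg add_nonneg_nonneg mult_nonneg_nonneg) auto
  have tm: "\<sigma> l * (z l + (-1) * pad k y l)\<^sup>2 + (\<sigma> k)\<^sup>2 / \<sigma> l * (z l + 1 * pad k y l)\<^sup>2 \<le> storage k z y"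
    if "l \<le> k" for l z y
    unfolding storage_def using w that
    by (intro member_le_sum[of l "{..<Suc k}" "\<lambda>l. \<sigma> l * (z l + (-1) * pad k y l)\<^sup>2 + (\<sigma> k)\<^sup>2 / \<sigma> l * (z l + 1 * pad k y l)\<^sup>2"])
       (auto intro!: add_nonneg_nonneg mult_nonneg_nonneg simp del: times_divide_eq_left)
  have dm: "dominated ?r (\<lambda>x. (fst x l + (-1) * pad k (fst (snd x)) l)\<^sup>2)" if "l \<le> k" for l
  proof (rule dominated_mono)
    show "dominated ?r (\<lambda>x. 1 / \<sigma> l * ?r x)"
      using \<sigma>[OF that] by (intro dominated_cmult dominated_base) auto
    fix x :: "(nat \<Rightarrow> real) \<times> (nat \<Rightarrow> real) \<times> (nat \<Rightarrow> real)"
    have "0 \<le> (\<sigma> k)\<^sup>2 / \<sigma> l * (fst x l + 1 * pad k (fst (snd x)) l)\<^sup>2" using w(2)[OF that] by (rule mult_nonneg_nonneg) simp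
    with tm[OF that, of "fst x" "fst (snd x)"] have "\<sigma> l * (fst x l + (-1) * pad k (fst (snd x)) l)\<^sup>2 \<le> storage k (fst x) (fst (snd x))"
      by linarith
    also have "\<dots> \<le> ?r x" by (simp add: sum_nonneg)
    finally show "(fst x l + (-1) * pad k (fst (snd x)) l)\<^sup>2 \<le> 1 / \<sigma> l * ?r x"
      using \<sigma>[OF that] by (simp add: field_simps)
  qed
  have dp: "dominated ?r (\<lambda>x. (fst x l + 1 * pad k (fst (snd x)) l)\<^sup>2)" if "l \<le> k" for l
  proof (rule dominated_mono)
    have k': "0 < (\<sigma> k)\<^sup>2 / \<sigma> l" using \<sigma>[OF that] \<sigma>[of k] by simp
    show "dominated ?r (\<lambda>x. 1 / ((\<sigma> k)\<^sup>2 / \<sigma> l) * ?r x)"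
      using k' by (intro dominated_cmult dominated_base) (auto simp del: divide_divide_eq_right)
    fix x :: "(nat \<Rightarrow> real) \<times> (nat \<Rightarrow> real) \<times> (nat \<Rightarrow> real)"
    have "0 \<le> \<sigma> l * (fst x l + (-1) * pad k (fst (snd x)) l)\<^sup>2" using w(1)[OF that] by (rule mult_nonneg_nonneg) simp
    with tm[OF that, of "fst x" "fst (snd x)"] have "(\<sigma> k)\<^sup>2 / \<sigma> l * (fst x l + 1 * pad k (fst (snd x)) l)\<^sup>2 \<le> storage k (fst x) (fst (snd x))"
      by linarith
    also have "\<dots> \<le> ?r x" by (simp add: sum_nonneg)
    finally show "(fst x l + 1 * pad k (fst (snd x)) l)\<^sup>2 \<le> 1 / ((\<sigma> k)\<^sup>2 / \<sigma> l) * ?r x"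
      using k' by (simp add: pos_le_divide_eq mult.commute del: divide_divide_eq_right)
  qed
  have dz: "dominated ?r (\<lambda>x. (fst x l)\<^sup>2)" if "l < Suc k" for l
    using dominated_square_cmult[OF dominated_square_add[OF dm[of l] dp[of l]], of "1/2"] that by simp
  have dy: "dominated ?r (\<lambda>x. (fst (snd x) l)\<^sup>2)" if "l < k" for l
    using dominated_square_cmult[OF dominated_square_diff[OF dp[of l] dm[of l]], of "1/2"] that by (simp add: pad_def)
  have dv: "dominated ?r (\<lambda>x. (snd (snd x) c)\<^sup>2)" if "c < m" for c
    using that st by (intro dominated_base) (auto intro!: add_increasing member_le_sum[of c _ "\<lambda>c. (snd (snd _) c)\<^sup>2"])
  have "dominated ?r (\<lambda>x. (rate (Suc k) (fst x) (snd (snd x)) l)\<^sup>2)"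
    "dominated ?r (\<lambda>x. (rate k (fst (snd x)) (snd (snd x)) l)\<^sup>2)"
    "dominated ?r (\<lambda>x. (vol (Suc k) (fst x) (snd (snd x)) i l)\<^sup>2)"
    "dominated ?r (\<lambda>x. (vol k (fst (snd x)) (snd (snd x)) i l)\<^sup>2)" for i l
    unfolding rate_def vol_def
    by (intro dominated_square_add dominated_square_sum dominated_square_cmult dz dy dv; simp)+
  note rv = this
  have ex: "dominated ?r (\<lambda>x. excess s k (fst x) (fst (snd x)) (snd (snd x)) l)" if "l < Suc k" for s l
    unfolding excess_def
    by (intro dominated_add dominated_noise_form dominated_square_add dominated_square_cmult dominated_pad_square rv dz dy that)
  have "dominated ?r (\<lambda>x. \<Sum>l<Suc k. \<sigma> l * excess (-1) k (fst x) (fst (snd x)) (snd (snd x)) l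
      + (\<sigma> k)\<^sup>2 / \<sigma> l * excess 1 k (fst x) (fst (snd x)) (snd (snd x)) l)"
    by (intro dominated_sum dominated_add dominated_cmult ex w) auto
  then show ?thesis unfolding dominated_def by force
qed

lemma defect_bound:
  assumes k: "k < n"
  shows "\<exists>c\<ge>0. \<forall>e e'. (\<Sum>l<Suc k. \<sigma> l * defect (-1) k e e' l + (\<sigma> k)\<^sup>2 / \<sigma> l * defect 1 k e e' l)
    \<le> c * (\<Sum>c<n. (e c)\<^sup>2 + (e' c)\<^sup>2)"
proof -
  let ?r = "\<lambda>x :: (nat \<Rightarrow> real) \<times> (nat \<Rightarrow> real). \<Sum>c<n. (fst x c)\<^sup>2 + (snd x c)\<^sup>2"
  have w: "0 \<le> \<sigma> l" "0 \<le> (\<sigma> k)\<^sup>2 / \<sigma> l" if "l < Suc k" for l using \<sigma>_pos[of l] that k by auto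
  have tm: "(fst x c)\<^sup>2 + (snd x c)\<^sup>2 \<le> ?r x" if "c < n" for c x
    using that by (intro member_le_sum[of c _ "\<lambda>c. (fst x c)\<^sup>2 + (snd x c)\<^sup>2"]) auto
  have d1: "dominated ?r (\<lambda>x. (fst x c)\<^sup>2)" if "c < n" for c
    by (rule dominated_base, rule order_trans[OF _ tm[OF that]]) simp
  have d2: "dominated ?r (\<lambda>x. (snd x c)\<^sup>2)" if "c < n" for c
    by (rule dominated_base, rule order_trans[OF _ tm[OF that]]) simp
  have "dominated ?r (\<lambda>x. (err (fst x) l)\<^sup>2)" "dominated ?r (\<lambda>x. (err (snd x) l)\<^sup>2)"
    "dominated ?r (\<lambda>x. (nerr (fst x) i l)\<^sup>2)" "dominated ?r (\<lambda>x. (nerr (snd x) i l)\<^sup>2)" for i l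
    unfolding err_def nerr_def by (intro dominated_square_sum dominated_square_cmult d1 d2; simp)+
  note rv = this
  have "dominated ?r (\<lambda>x. defect s k (fst x) (snd x) l)" for s l
    unfolding defect_def
    by (intro dominated_add dominated_noise_form dominated_square_add dominated_square_cmult dominated_pad_square rv)
  then have "dominated ?r (\<lambda>x. \<Sum>l<Suc k. \<sigma> l * defect (-1) k (fst x) (snd x) l + (\<sigma> k)\<^sup>2 / \<sigma> l * defect 1 k (fst x) (snd x) l)"
    by (intro dominated_sum dominated_add dominated_cmult w) auto
  then show ?thesis unfolding dominated_def by force
qed

text \<open>
  The perturbed step for coordinate \<open>l\<close> of \<open>z + s y\<close>; \<open>s = -1\<close> and \<open>s = 1\<close> are used.
\<close>

lemma grid_step_second_moment:
  assumes k: "k < n" and l: "l < Suc k" and Z: "grid_step (Suc k) a b e Z Z'" and Y: "grid_step k a b e' Y Y'"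
    and ab: "0 \<le> a" "a \<le> b" "b \<le> T" and \<theta>: "0 < \<theta>" "b - a \<le> \<theta>\<^sup>2" "\<theta> \<le> 1"
  defines "G \<equiv> \<lambda>s z. gain s k (\<lambda>c. Z c (snd z)) (\<lambda>c. Y c (snd z)) (\<lambda>c. U c z) l
     + 4 * \<theta> * excess s k (\<lambda>c. Z c (snd z)) (\<lambda>c. Y c (snd z)) (\<lambda>c. U c z) l
     + 5 / \<theta> * defect s k (\<lambda>c. e c z) (\<lambda>c. e' c z) l"
  shows "integrable (win a b) (G s)"
    and "(\<integral>\<omega>. (Z' l \<omega> + s * pad k (\<lambda>l. Y' l \<omega>) l)\<^sup>2 \<partial>\<Omega>)
      \<le> (\<integral>\<omega>. (Z l \<omega> + s * pad k (\<lambda>l. Y l \<omega>) l)\<^sup>2 \<partial>\<Omega>) + (\<integral>z. G s z \<partial>win a b)"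
proof -
  have sU: "sq_int (win a b) (U c)" if "c < m" for c using U_sq_int_win[OF that] ab by simp
  have pZ: "past a (Z c)" "past b (Z' c)" if "c < Suc k" for c using Z that by (auto simp: grid_step_def)
  have pY: "past a (Y c)" "past b (Y' c)" if "c < k" for c using Y that by (auto simp: grid_step_def)
  have sZ: "sq_int (win a b) (\<lambda>z. Z c (snd z))" if "c < Suc k" for c
    by (rule sq_int_win_const[OF past_sq_int[OF pZ(1)[OF that]] ab(2)])
  have sY: "sq_int (win a b) (\<lambda>z. Y c (snd z))" if "c < k" for c
    by (rule sq_int_win_const[OF past_sq_int[OF pY(1)[OF that]] ab(2)])
  have se: "sq_int (win a b) (e c)" "sq_int (win a b) (e' c)" if "c < n" for c
    using Z Y that by (auto simp: grid_step_def)
  have spad: "sq_int W (\<lambda>z. pad k (f z) l)" if "l < k \<Longrightarrow> sq_int W (\<lambda>z. f z l)" for W :: "'b measure" and f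
    using that by (cases "l < k") (simp_all add: pad_def)
  have ppad: "past t (\<lambda>z. pad k (f z) l)" if "l < k \<Longrightarrow> past t (\<lambda>z. f z l)" for t f
    using that by (cases "l < k") (simp_all add: pad_def past_def)
  let ?z = "\<lambda>z c. Z c (snd z)" and ?y = "\<lambda>z c. Y c (snd z)" and ?u = "\<lambda>z c. U c z"
  let ?\<alpha> = "\<lambda>z. rate (Suc k) (?z z) (?u z) l + s * pad k (rate k (?y z) (?u z)) l"
  let ?\<alpha>' = "\<lambda>z. err (\<lambda>c. e c z) l + s * pad k (err (\<lambda>c. e' c z)) l"
  let ?\<beta> = "\<lambda>i z. vol (Suc k) (?z z) (?u z) i l + s * pad k (vol k (?y z) (?u z) i) l"
  let ?\<beta>' = "\<lambda>i z. nerr (\<lambda>c. e c z) i l + s * pad k (nerr (\<lambda>c. e' c z) i) l"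
  have s1: "sq_int (win a b) (\<lambda>z. rate (Suc k) (?z z) (?u z) l)" "sq_int (win a b) (\<lambda>z. pad k (rate k (?y z) (?u z)) l)"
    by (intro sq_int_rate spad sZ sY sU; assumption)+
  have s1': "sq_int (win a b) (\<lambda>z. vol (Suc k) (?z z) (?u z) i l)" "sq_int (win a b) (\<lambda>z. pad k (vol k (?y z) (?u z) i) l)" for i
    by (intro sq_int_vol spad sZ sY sU; assumption)+
  have s2: "sq_int (win a b) (\<lambda>z. err (\<lambda>c. e c z) l)" "sq_int (win a b) (\<lambda>z. pad k (err (\<lambda>c. e' c z)) l)"
    unfolding err_def by (intro spad sq_int_sum sq_int_cmult se; simp)+
  have s2': "sq_int (win a b) (\<lambda>z. nerr (\<lambda>c. e c z) i l)" "sq_int (win a b) (\<lambda>z. pad k (nerr (\<lambda>c. e' c z) i) l)" for i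
    unfolding nerr_def by (intro spad sq_int_sum sq_int_cmult se; simp)+
  have \<alpha>: "sq_int (win a b) ?\<alpha>" "sq_int (win a b) ?\<alpha>'" by (intro sq_int_add sq_int_cmult s1 s2)+
  have \<beta>: "sq_int (win a b) (?\<beta> i)" "sq_int (win a b) (?\<beta>' i)" for i by (intro sq_int_add sq_int_cmult s1' s2')+
  let ?\<zeta> = "\<lambda>\<omega>. Z l \<omega> + s * pad k (\<lambda>l. Y l \<omega>) l"
  let ?\<zeta>' = "\<lambda>\<omega>. Z' l \<omega> + s * pad k (\<lambda>l. Y' l \<omega>) l"
  have p\<zeta>: "past a ?\<zeta>" by (intro past_add past_cmult ppad pZ pY l)
  have p\<zeta>': "past b ?\<zeta>'" by (intro past_add past_cmult ppad pZ pY l)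
  have s\<zeta>: "sq_int (win a b) (\<lambda>z. ?\<zeta> (snd z))" by (rule sq_int_win_const[OF past_sq_int[OF p\<zeta>] ab(2)])
  have G: "G s = (\<lambda>z. (2 * (?\<zeta> (snd z) * ?\<alpha> z) + noise_form (\<lambda>i. ?\<beta> i z))
        + 4 * \<theta> * ((?\<zeta> (snd z))\<^sup>2 + (?\<alpha> z)\<^sup>2 + noise_form (\<lambda>i. ?\<beta> i z))
        + 5 / \<theta> * ((?\<alpha>' z)\<^sup>2 + noise_form (\<lambda>i. ?\<beta>' i z)))"
    unfolding G_def gain_def excess_def defect_def ..
  show "integrable (win a b) (G s)"
    unfolding G
    by (intro Bochner_Integration.integrable_add integrable_mult_right integrable_sq_int_mult sq_int_integrable
      integrable_noise_form(1) s\<zeta> \<alpha> \<beta>)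
  obtain I where I: "ito a b (\<lambda>i z. vol (Suc k) (?z z) (?u z) i l + nerr (\<lambda>c. e c z) i l) I"
    and Ieq: "AE \<omega> in \<Omega>. Z' l \<omega> = Z l \<omega> + drift a b (\<lambda>z. rate (Suc k) (?z z) (?u z) l + err (\<lambda>c. e c z) l) \<omega> + I \<omega>"
    using Z l unfolding grid_step_def err_def nerr_def by blast
  have "\<exists>J. ito a b (\<lambda>i z. pad k (vol k (?y z) (?u z) i) l + pad k (nerr (\<lambda>c. e' c z) i) l) J \<and>
     (AE \<omega> in \<Omega>. pad k (\<lambda>l. Y' l \<omega>) l = pad k (\<lambda>l. Y l \<omega>) l
        + drift a b (\<lambda>z. pad k (rate k (?y z) (?u z)) l + pad k (err (\<lambda>c. e' c z)) l) \<omega> + J \<omega>)"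
  proof (cases "l < k")
    case True
    then show ?thesis using Y unfolding grid_step_def err_def nerr_def by (simp add: pad_def)
  next
    case False
    then show ?thesis using ito_zero[OF ab(1), of b] drift_const[OF ab(2), of "\<lambda>_. 0"]
      by (intro exI[of _ "\<lambda>_. 0"]) (simp add: pad_def)
  qed
  then obtain J where J: "ito a b (\<lambda>i z. pad k (vol k (?y z) (?u z) i) l + pad k (nerr (\<lambda>c. e' c z) i) l) J"
    and Jeq: "AE \<omega> in \<Omega>. pad k (\<lambda>l. Y' l \<omega>) l = pad k (\<lambda>l. Y l \<omega>) l
        + drift a b (\<lambda>z. pad k (rate k (?y z) (?u z)) l + pad k (err (\<lambda>c. e' c z)) l) \<omega> + J \<omega>" by blast
  have ito: "ito a b (\<lambda>i z. ?\<beta> i z + ?\<beta>' i z) (\<lambda>\<omega>. I \<omega> + s * J \<omega>)"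
    using ito_add[OF I ito_cmult[OF J ab(1), of s] ab(1)] by (simp add: algebra_simps)
  have D: "AE \<omega> in \<Omega>. drift a b (\<lambda>z. (rate (Suc k) (?z z) (?u z) l + err (\<lambda>c. e c z) l)
       + s * (pad k (rate k (?y z) (?u z)) l + pad k (err (\<lambda>c. e' c z)) l)) \<omega>
     = drift a b (\<lambda>z. rate (Suc k) (?z z) (?u z) l + err (\<lambda>c. e c z) l) \<omega>
       + drift a b (\<lambda>z. s * (pad k (rate k (?y z) (?u z)) l + pad k (err (\<lambda>c. e' c z)) l)) \<omega>"
    by (intro drift_add sq_int_add sq_int_cmult s1 s2 ab)
  have fn: "(\<lambda>z. (rate (Suc k) (?z z) (?u z) l + err (\<lambda>c. e c z) l)
       + s * (pad k (rate k (?y z) (?u z)) l + pad k (err (\<lambda>c. e' c z)) l)) = (\<lambda>z. ?\<alpha> z + ?\<alpha>' z)"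
    by (auto simp: algebra_simps)
  have eq: "AE \<omega> in \<Omega>. ?\<zeta>' \<omega> = ?\<zeta> \<omega> + drift a b (\<lambda>z. ?\<alpha> z + ?\<alpha>' z) \<omega> + (I \<omega> + s * J \<omega>)"
    using D[unfolded fn] Ieq Jeq unfolding drift_cmult by eventually_elim (simp add: distrib_left)
  have "?\<zeta>' \<in> borel_measurable \<Omega>" using past_sq_int[OF p\<zeta>'] by (rule sq_int_measurable)
  from second_moment_step_perturbed[OF ab(1,2) p\<zeta> ito \<alpha> \<beta> eq this \<theta>]
  show "(\<integral>\<omega>. (?\<zeta>' \<omega>)\<^sup>2 \<partial>\<Omega>) \<le> (\<integral>\<omega>. (?\<zeta> \<omega>)\<^sup>2 \<partial>\<Omega>) + (\<integral>z. G s z \<partial>win a b)"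
    unfolding G .
qed

end

section \<open>Growth of the storage function in one step\<close>

lemma discrete_gronwall:
  fixes v y g :: "nat \<Rightarrow> real"
  assumes "v 0 \<le> 0" "0 \<le> \<kappa>" "\<And>j. 0 \<le> y j" "\<And>j. 0 \<le> g j" "\<And>j. 0 \<le> v j"
    and step: "\<And>j. j < J \<Longrightarrow> v (Suc j) + y j \<le> (1 + \<kappa>) * v j + g j"
  shows "(\<Sum>j<J. y j) \<le> exp (\<kappa> * real J) * (\<Sum>j<J. g j)"
proof -
  have "i \<le> J \<Longrightarrow> v i + (\<Sum>j<i. y j) \<le> (1 + \<kappa>) ^ i * (\<Sum>j<i. g j)" for i
  proof (induction i)
    case 0
    then show ?case using assms by simp
  next
    case (Suc i)
    have "v (Suc i) + (\<Sum>j<Suc i. y j) \<le> (1 + \<kappa>) * v i + g i + (\<Sum>j<i. y j)"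
      using step[of i] Suc by simp
    also have "\<dots> \<le> (1 + \<kappa>) * (v i + (\<Sum>j<i. y j)) + g i"
      using assms by (simp add: algebra_simps sum_nonneg)
    also have "\<dots> \<le> (1 + \<kappa>) * ((1 + \<kappa>) ^ i * (\<Sum>j<i. g j)) + (1 + \<kappa>) ^ Suc i * g i"
    proof (intro add_mono mult_left_mono)
      have "1 * g i \<le> (1 + \<kappa>) ^ Suc i * g i" using assms by (intro mult_right_mono one_le_power) auto
      then show "g i \<le> (1 + \<kappa>) ^ Suc i * g i" by simp
    qed (use Suc assms in auto)
    also have "\<dots> = (1 + \<kappa>) ^ Suc i * (\<Sum>j<Suc i. g j)" by (simp add: algebra_simps)
    finally show ?case .
  qed
  from this[of J] have "(\<Sum>j<J. y j) \<le> (1 + \<kappa>) ^ J * (\<Sum>j<J. g j)" using assms(5)[of J] by simp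
  also have "\<dots> \<le> exp (\<kappa> * real J) * (\<Sum>j<J. g j)"
  proof (rule mult_right_mono)
    have "(1 + \<kappa>) ^ J \<le> exp \<kappa> ^ J" using assms by (intro power_mono exp_ge_add_one_self) auto
    then show "(1 + \<kappa>) ^ J \<le> exp (\<kappa> * real J)" by (simp add: exp_of_nat2_mult)
  qed (use assms in \<open>simp add: sum_nonneg\<close>)
  finally show ?thesis .
qed

context balanced_system
begin

definition input_energy :: "real \<Rightarrow> real \<Rightarrow> real" where
  "input_energy a b = (\<integral>z. (\<Sum>c<m. (U c z)\<^sup>2) \<partial>win a b)"

lemma storage_nonneg: "k < n \<Longrightarrow> 0 \<le> storage k z y"
  unfolding storage_def using \<sigma>_pos
  by (intro sum_nonneg add_nonneg_nonneg mult_nonneg_nonneg divide_nonneg_nonneg less_imp_le[OF \<sigma>_pos]) auto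

lemma gap_nonneg: "0 \<le> gap k z y"
  unfolding gap_def by (intro sum_nonneg) auto

lemma sq_int_pad: "(l < k \<Longrightarrow> sq_int W (\<lambda>z. f z l)) \<Longrightarrow> sq_int W (\<lambda>z. pad k (f z) l)"
  by (cases "l < k") (simp_all add: pad_def)

lemma storage_integrable:
  assumes Z: "\<And>l. l < Suc k \<Longrightarrow> sq_int W (\<lambda>z. Z z l)" and Y: "\<And>l. l < k \<Longrightarrow> sq_int W (\<lambda>z. Y z l)"
  shows "integrable W (\<lambda>z. storage k (Z z) (Y z))"
    and "(\<integral>z. storage k (Z z) (Y z) \<partial>W) = (\<Sum>l<Suc k. \<sigma> l * (\<integral>z. (Z z l + (-1) * pad k (Y z) l)\<^sup>2 \<partial>W)
       + (\<sigma> k)\<^sup>2 / \<sigma> l * (\<integral>z. (Z z l + 1 * pad k (Y z) l)\<^sup>2 \<partial>W))"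
proof -
  have i: "integrable W (\<lambda>z. (Z z l + s * pad k (Y z) l)\<^sup>2)" if "l < Suc k" for l s
    by (intro sq_int_integrable sq_int_add sq_int_cmult sq_int_pad Z Y that)
  show "integrable W (\<lambda>z. storage k (Z z) (Y z))" unfolding storage_def
    by (intro Bochner_Integration.integrable_sum Bochner_Integration.integrable_add integrable_mult_right i) auto
  have "(\<integral>z. storage k (Z z) (Y z) \<partial>W) = (\<Sum>l<Suc k. (\<integral>z. \<sigma> l * (Z z l + (-1) * pad k (Y z) l)\<^sup>2
       + (\<sigma> k)\<^sup>2 / \<sigma> l * (Z z l + 1 * pad k (Y z) l)\<^sup>2 \<partial>W))"
    unfolding storage_def
    by (intro Bochner_Integration.integral_sum Bochner_Integration.integrable_add integrable_mult_right i) auto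
  also have "\<dots> = (\<Sum>l<Suc k. \<sigma> l * (\<integral>z. (Z z l + (-1) * pad k (Y z) l)\<^sup>2 \<partial>W)
       + (\<sigma> k)\<^sup>2 / \<sigma> l * (\<integral>z. (Z z l + 1 * pad k (Y z) l)\<^sup>2 \<partial>W))"
  proof (intro sum.cong refl)
    fix l assume "l \<in> {..<Suc k}"
    then have l: "l < Suc k" by simp
    show "(\<integral>z. \<sigma> l * (Z z l + (-1) * pad k (Y z) l)\<^sup>2 + (\<sigma> k)\<^sup>2 / \<sigma> l * (Z z l + 1 * pad k (Y z) l)\<^sup>2 \<partial>W)
       = \<sigma> l * (\<integral>z. (Z z l + (-1) * pad k (Y z) l)\<^sup>2 \<partial>W) + (\<sigma> k)\<^sup>2 / \<sigma> l * (\<integral>z. (Z z l + 1 * pad k (Y z) l)\<^sup>2 \<partial>W)"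
      by (subst Bochner_Integration.integral_add) (intro integrable_mult_right i[OF l] | simp only: integral_mult_right_zero)+
  qed
  finally show "(\<integral>z. storage k (Z z) (Y z) \<partial>W) = (\<Sum>l<Suc k. \<sigma> l * (\<integral>z. (Z z l + (-1) * pad k (Y z) l)\<^sup>2 \<partial>W)
       + (\<sigma> k)\<^sup>2 / \<sigma> l * (\<integral>z. (Z z l + 1 * pad k (Y z) l)\<^sup>2 \<partial>W))" .
qed

lemma gap_integrable:
  assumes Z: "\<And>l. l < Suc k \<Longrightarrow> sq_int W (\<lambda>z. Z z l)" and Y: "\<And>l. l < k \<Longrightarrow> sq_int W (\<lambda>z. Y z l)"
  shows "integrable W (\<lambda>z. gap k (Z z) (Y z))"
  unfolding gap_def
  by (intro Bochner_Integration.integrable_sum sq_int_integrable sq_int_diff sq_int_sum sq_int_cmult Z Y) auto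

text \<open>
  The weighted sum over coordinates and over both signs of the second moment steps.  The constant is independent of
  the window and of \<open>\<theta>\<close>, hence of the grid.
\<close>

lemma storage_step:
  assumes k: "k < n"
  shows "\<exists>c\<ge>0. \<forall>a b e e' Z Z' Y Y' \<theta>. 0 \<le> a \<longrightarrow> a \<le> b \<longrightarrow> b \<le> T \<longrightarrow> 0 < \<theta> \<longrightarrow> \<theta> \<le> 1 \<longrightarrow> b - a \<le> \<theta>\<^sup>2 \<longrightarrow>
    grid_step (Suc k) a b e Z Z' \<longrightarrow> grid_step k a b e' Y Y' \<longrightarrow>
    (\<integral>\<omega>. storage k (\<lambda>l. Z' l \<omega>) (\<lambda>l. Y' l \<omega>) \<partial>\<Omega>) + (b - a) * (\<integral>\<omega>. gap k (\<lambda>l. Z l \<omega>) (\<lambda>l. Y l \<omega>) \<partial>\<Omega>)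
    \<le> (1 + c * \<theta> * (b - a)) * (\<integral>\<omega>. storage k (\<lambda>l. Z l \<omega>) (\<lambda>l. Y l \<omega>) \<partial>\<Omega>)
      + ((4 * \<gamma> * (\<sigma> k)\<^sup>2 + c * \<theta>) * input_energy a b
      + c / \<theta> * (\<integral>z. (\<Sum>c<n. (e c z)\<^sup>2 + (e' c z)\<^sup>2) \<partial>win a b))"
proof -
  obtain c1 where c1: "c1 \<ge> 0" "\<And>z y v. (\<Sum>l<Suc k. \<sigma> l * excess (-1) k z y v l + (\<sigma> k)\<^sup>2 / \<sigma> l * excess 1 k z y v l)
    \<le> c1 * (storage k z y + (\<Sum>c<m. (v c)\<^sup>2))" using excess_bound[OF k] by blast
  obtain c2 where c2: "c2 \<ge> 0" "\<And>e e'. (\<Sum>l<Suc k. \<sigma> l * defect (-1) k e e' l + (\<sigma> k)\<^sup>2 / \<sigma> l * defect 1 k e e' l)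
    \<le> c2 * (\<Sum>c<n. (e c)\<^sup>2 + (e' c)\<^sup>2)" using defect_bound[OF k] by blast
  define c where "c = 4 * c1 + 5 * c2"
  have c: "4 * c1 \<le> c" "5 * c2 \<le> c" "0 \<le> c" using c1 c2 by (auto simp: c_def)
  have w: "0 \<le> \<sigma> l" "0 \<le> (\<sigma> k)\<^sup>2 / \<sigma> l" if "l < Suc k" for l using \<sigma>_pos[of l] that k by auto
  have "(\<integral>\<omega>. storage k (\<lambda>l. Z' l \<omega>) (\<lambda>l. Y' l \<omega>) \<partial>\<Omega>) + (b - a) * (\<integral>\<omega>. gap k (\<lambda>l. Z l \<omega>) (\<lambda>l. Y l \<omega>) \<partial>\<Omega>)
    \<le> (1 + c * \<theta> * (b - a)) * (\<integral>\<omega>. storage k (\<lambda>l. Z l \<omega>) (\<lambda>l. Y l \<omega>) \<partial>\<Omega>)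
      + ((4 * \<gamma> * (\<sigma> k)\<^sup>2 + c * \<theta>) * input_energy a b
      + c / \<theta> * (\<integral>z. (\<Sum>c<n. (e c z)\<^sup>2 + (e' c z)\<^sup>2) \<partial>win a b))"
    if ab: "0 \<le> a" "a \<le> b" "b \<le> T" and \<theta>: "0 < \<theta>" "\<theta> \<le> 1" "b - a \<le> \<theta>\<^sup>2"
      and Z: "grid_step (Suc k) a b e Z Z'" and Y: "grid_step k a b e' Y Y'" for a b e e' Z Z' Y Y' \<theta>
  proof -
    have sU: "sq_int (win a b) (U c)" if "c < m" for c using U_sq_int_win[OF that] ab by simp
    have sZ: "sq_int \<Omega> (Z c)" "sq_int \<Omega> (Z' c)" if "c < Suc k" for c using Z that by (auto simp: grid_step_def past_def)
    have sY: "sq_int \<Omega> (Y c)" "sq_int \<Omega> (Y' c)" if "c < k" for c using Y that by (auto simp: grid_step_def past_def)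
    have se: "sq_int (win a b) (e c)" "sq_int (win a b) (e' c)" if "c < n" for c
      using Z Y that by (auto simp: grid_step_def)
    let ?z = "\<lambda>z c. Z c (snd z)" and ?y = "\<lambda>z c. Y c (snd z)" and ?u = "\<lambda>z c. U c z"
    let ?S = "\<lambda>\<omega>. storage k (\<lambda>l. Z l \<omega>) (\<lambda>l. Y l \<omega>)" and ?P = "\<lambda>\<omega>. gap k (\<lambda>l. Z l \<omega>) (\<lambda>l. Y l \<omega>)"
    define G where "G s l z = gain s k (?z z) (?y z) (?u z) l + 4 * \<theta> * excess s k (?z z) (?y z) (?u z) l
       + 5 / \<theta> * defect s k (\<lambda>c. e c z) (\<lambda>c. e' c z) l" for s l z
    have G: "integrable (win a b) (G s l)" "(\<integral>\<omega>. (Z' l \<omega> + s * pad k (\<lambda>l. Y' l \<omega>) l)\<^sup>2 \<partial>\<Omega>)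
      \<le> (\<integral>\<omega>. (Z l \<omega> + s * pad k (\<lambda>l. Y l \<omega>) l)\<^sup>2 \<partial>\<Omega>) + (\<integral>z. G s l z \<partial>win a b)" if "l < Suc k" for s l
      unfolding G_def[abs_def] using grid_step_second_moment[OF k that Z Y ab \<theta>(1,3,2)] by blast+
    define H where "H z = (\<Sum>l<Suc k. \<sigma> l * G (-1) l z + (\<sigma> k)\<^sup>2 / \<sigma> l * G 1 l z)" for z
    have H: "integrable (win a b) H" "(\<integral>z. H z \<partial>win a b) = (\<Sum>l<Suc k. \<sigma> l * (\<integral>z. G (-1) l z \<partial>win a b) + (\<sigma> k)\<^sup>2 / \<sigma> l * (\<integral>z. G 1 l z \<partial>win a b))"
    proof -
      show "integrable (win a b) H" unfolding H_def[abs_def]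
        by (intro Bochner_Integration.integrable_sum Bochner_Integration.integrable_add integrable_mult_right G) auto
      have "(\<integral>z. H z \<partial>win a b) = (\<Sum>l<Suc k. (\<integral>z. \<sigma> l * G (-1) l z + (\<sigma> k)\<^sup>2 / \<sigma> l * G 1 l z \<partial>win a b))"
        unfolding H_def
        by (intro Bochner_Integration.integral_sum Bochner_Integration.integrable_add integrable_mult_right G) auto
      also have "\<dots> = (\<Sum>l<Suc k. \<sigma> l * (\<integral>z. G (-1) l z \<partial>win a b) + (\<sigma> k)\<^sup>2 / \<sigma> l * (\<integral>z. G 1 l z \<partial>win a b))"
      proof (intro sum.cong refl)
        fix l assume "l \<in> {..<Suc k}"
        then have l: "l < Suc k" by simp
        show "(\<integral>z. \<sigma> l * G (-1) l z + (\<sigma> k)\<^sup>2 / \<sigma> l * G 1 l z \<partial>win a b)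
          = \<sigma> l * (\<integral>z. G (-1) l z \<partial>win a b) + (\<sigma> k)\<^sup>2 / \<sigma> l * (\<integral>z. G 1 l z \<partial>win a b)"
          by (subst Bochner_Integration.integral_add) (intro integrable_mult_right G(1)[OF l] | simp only: integral_mult_right_zero)+
      qed
      finally show "(\<integral>z. H z \<partial>win a b) = (\<Sum>l<Suc k. \<sigma> l * (\<integral>z. G (-1) l z \<partial>win a b) + (\<sigma> k)\<^sup>2 / \<sigma> l * (\<integral>z. G 1 l z \<partial>win a b))" .
    qed
    have "(\<integral>\<omega>. storage k (\<lambda>l. Z' l \<omega>) (\<lambda>l. Y' l \<omega>) \<partial>\<Omega>)
      = (\<Sum>l<Suc k. \<sigma> l * (\<integral>\<omega>. (Z' l \<omega> + (-1) * pad k (\<lambda>l. Y' l \<omega>) l)\<^sup>2 \<partial>\<Omega>)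
       + (\<sigma> k)\<^sup>2 / \<sigma> l * (\<integral>\<omega>. (Z' l \<omega> + 1 * pad k (\<lambda>l. Y' l \<omega>) l)\<^sup>2 \<partial>\<Omega>))"
      by (rule storage_integrable(2)) (intro sZ sY; assumption)+
    also have "\<dots> \<le> (\<Sum>l<Suc k. \<sigma> l * ((\<integral>\<omega>. (Z l \<omega> + (-1) * pad k (\<lambda>l. Y l \<omega>) l)\<^sup>2 \<partial>\<Omega>) + (\<integral>z. G (-1) l z \<partial>win a b))
       + (\<sigma> k)\<^sup>2 / \<sigma> l * ((\<integral>\<omega>. (Z l \<omega> + 1 * pad k (\<lambda>l. Y l \<omega>) l)\<^sup>2 \<partial>\<Omega>) + (\<integral>z. G 1 l z \<partial>win a b)))"
      by (intro sum_mono add_mono mult_left_mono G w) auto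
    also have "\<dots> = (\<Sum>l<Suc k. \<sigma> l * (\<integral>\<omega>. (Z l \<omega> + (-1) * pad k (\<lambda>l. Y l \<omega>) l)\<^sup>2 \<partial>\<Omega>)
       + (\<sigma> k)\<^sup>2 / \<sigma> l * (\<integral>\<omega>. (Z l \<omega> + 1 * pad k (\<lambda>l. Y l \<omega>) l)\<^sup>2 \<partial>\<Omega>)) + (\<integral>z. H z \<partial>win a b)"
      unfolding H(2) sum.distrib[symmetric] by (intro sum.cong refl) (simp only: distrib_left add_ac)
    also have "(\<Sum>l<Suc k. \<sigma> l * (\<integral>\<omega>. (Z l \<omega> + (-1) * pad k (\<lambda>l. Y l \<omega>) l)\<^sup>2 \<partial>\<Omega>)
       + (\<sigma> k)\<^sup>2 / \<sigma> l * (\<integral>\<omega>. (Z l \<omega> + 1 * pad k (\<lambda>l. Y l \<omega>) l)\<^sup>2 \<partial>\<Omega>)) = (\<integral>\<omega>. ?S \<omega> \<partial>\<Omega>)"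
      by (rule storage_integrable(2)[symmetric]) (intro sZ sY; assumption)+
    finally have 1: "(\<integral>\<omega>. storage k (\<lambda>l. Z' l \<omega>) (\<lambda>l. Y' l \<omega>) \<partial>\<Omega>) \<le> (\<integral>\<omega>. ?S \<omega> \<partial>\<Omega>) + (\<integral>z. H z \<partial>win a b)" .
    have pw: "H z \<le> 4 * \<gamma> * (\<sigma> k)\<^sup>2 * (\<Sum>c<m. (U c z)\<^sup>2) - ?P (snd z)
       + c * \<theta> * (?S (snd z) + (\<Sum>c<m. (U c z)\<^sup>2)) + c / \<theta> * (\<Sum>c<n. (e c z)\<^sup>2 + (e' c z)\<^sup>2)" for z
    proof -
      let ?W = "\<lambda>g. \<Sum>l<Suc k. \<sigma> l * g (-1) l + (\<sigma> k)\<^sup>2 / \<sigma> l * g 1 l"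
      have lin: "?W (\<lambda>s l. f s l + x * g s l + y * h s l) = ?W f + x * ?W g + y * ?W h"
        for f g h :: "real \<Rightarrow> nat \<Rightarrow> real" and x y
        unfolding sum_distrib_left sum.distrib[symmetric] by (intro sum.cong refl) (simp add: algebra_simps)
      have "H z = ?W (\<lambda>s l. gain s k (?z z) (?y z) (?u z) l) + (4 * \<theta>) * ?W (\<lambda>s l. excess s k (?z z) (?y z) (?u z) l)
         + (5 / \<theta>) * ?W (\<lambda>s l. defect s k (\<lambda>c. e c z) (\<lambda>c. e' c z) l)"
        unfolding H_def G_def by (rule lin)
      also have "\<dots> \<le> (4 * \<gamma> * (\<sigma> k)\<^sup>2 * (\<Sum>c<m. (U c z)\<^sup>2) - ?P (snd z))
         + (4 * \<theta>) * (c1 * (?S (snd z) + (\<Sum>c<m. (U c z)\<^sup>2)))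
         + (5 / \<theta>) * (c2 * (\<Sum>c<n. (e c z)\<^sup>2 + (e' c z)\<^sup>2))"
        using \<theta> by (intro add_mono storage_dissipation[OF k] mult_left_mono c1 c2) auto
      also have "(4 * \<theta>) * (c1 * (?S (snd z) + (\<Sum>c<m. (U c z)\<^sup>2))) = (4 * c1) * (\<theta> * (?S (snd z) + (\<Sum>c<m. (U c z)\<^sup>2)))"
        by simp
      also have "\<dots> \<le> c * (\<theta> * (?S (snd z) + (\<Sum>c<m. (U c z)\<^sup>2)))"
        using \<theta> by (intro mult_right_mono c mult_nonneg_nonneg add_nonneg_nonneg storage_nonneg[OF k] sum_nonneg) auto
      also have "(5 / \<theta>) * (c2 * (\<Sum>c<n. (e c z)\<^sup>2 + (e' c z)\<^sup>2)) = (5 * c2) * ((\<Sum>c<n. (e c z)\<^sup>2 + (e' c z)\<^sup>2) / \<theta>)"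
        by simp
      also have "\<dots> \<le> c * ((\<Sum>c<n. (e c z)\<^sup>2 + (e' c z)\<^sup>2) / \<theta>)"
        using \<theta> by (intro mult_right_mono c divide_nonneg_nonneg sum_nonneg) auto
      finally show ?thesis by (simp add: mult.assoc)
    qed
    have iS: "integrable \<Omega> ?S" by (rule storage_integrable(1)) (intro sZ sY; assumption)+
    have iP: "integrable \<Omega> ?P" by (rule gap_integrable) (intro sZ sY; assumption)+
    note iS' = integral_win_const[OF iS ab(2)] and iP' = integral_win_const[OF iP ab(2)]
    have iU: "integrable (win a b) (\<lambda>z. \<Sum>c<m. (U c z)\<^sup>2)"
      by (intro Bochner_Integration.integrable_sum sq_int_integrable sU) auto
    have ie: "integrable (win a b) (\<lambda>z. \<Sum>c<n. (e c z)\<^sup>2 + (e' c z)\<^sup>2)"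
      by (intro Bochner_Integration.integrable_sum Bochner_Integration.integrable_add sq_int_integrable se) auto
    have "(\<integral>z. H z \<partial>win a b) \<le> (\<integral>z. 4 * \<gamma> * (\<sigma> k)\<^sup>2 * (\<Sum>c<m. (U c z)\<^sup>2) - ?P (snd z)
       + c * \<theta> * (?S (snd z) + (\<Sum>c<m. (U c z)\<^sup>2)) + c / \<theta> * (\<Sum>c<n. (e c z)\<^sup>2 + (e' c z)\<^sup>2) \<partial>win a b)"
      by (rule integral_mono[OF H(1) _ pw])
        (intro Bochner_Integration.integrable_add Bochner_Integration.integrable_diff integrable_mult_right iS'(1) iP'(1) iU ie)
    also have "\<dots> = 4 * \<gamma> * (\<sigma> k)\<^sup>2 * input_energy a b - (b - a) * (\<integral>\<omega>. ?P \<omega> \<partial>\<Omega>)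
       + c * \<theta> * ((b - a) * (\<integral>\<omega>. ?S \<omega> \<partial>\<Omega>) + input_energy a b) + c / \<theta> * (\<integral>z. (\<Sum>c<n. (e c z)\<^sup>2 + (e' c z)\<^sup>2) \<partial>win a b)"
    proof -
      have gen: "(\<integral>z. x * f1 z - f2 z + y * (f3 z + f1 z) + t * f4 z \<partial>V)
         = x * (\<integral>z. f1 z \<partial>V) - (\<integral>z. f2 z \<partial>V) + y * ((\<integral>z. f3 z \<partial>V) + (\<integral>z. f1 z \<partial>V)) + t * (\<integral>z. f4 z \<partial>V)"
        if "integrable V f1" "integrable V f2" "integrable V f3" "integrable V f4"
        for x y t :: real and f1 f2 f3 f4 and V :: "(real \<times> 'w) measure"
        using that by simp
      show ?thesis
        unfolding input_energy_def gen[OF iU iP'(1) iS'(1) ie] iS'(2) iP'(2) ..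
    qed
    finally have "(\<integral>z. H z \<partial>win a b) \<le> 4 * \<gamma> * (\<sigma> k)\<^sup>2 * input_energy a b - (b - a) * (\<integral>\<omega>. ?P \<omega> \<partial>\<Omega>)
       + c * \<theta> * ((b - a) * (\<integral>\<omega>. ?S \<omega> \<partial>\<Omega>) + input_energy a b) + c / \<theta> * (\<integral>z. (\<Sum>c<n. (e c z)\<^sup>2 + (e' c z)\<^sup>2) \<partial>win a b)" .
    with 1 show ?thesis by (simp add: algebra_simps)
  qed
  with c(3) show ?thesis by blast
qed

end

section \<open>The refinement limit\<close>

lemma weighted_Cauchy_Schwarz:
  fixes x \<sigma> :: "nat \<Rightarrow> real"
  assumes "\<And>k. k \<in> I \<Longrightarrow> 0 < \<sigma> k"
  shows "(\<Sum>k\<in>I. x k)\<^sup>2 \<le> (\<Sum>k\<in>I. \<sigma> k) * (\<Sum>k\<in>I. (x k)\<^sup>2 / \<sigma> k)"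
proof -
  have "(\<Sum>k\<in>I. x k)\<^sup>2 = (\<Sum>k\<in>I. sqrt (\<sigma> k) * (x k / sqrt (\<sigma> k)))\<^sup>2"
    using assms by (intro arg_cong[of _ _ "\<lambda>s. s\<^sup>2"] sum.cong) (auto simp: less_imp_neq[symmetric])
  also have "\<dots> \<le> (\<Sum>k\<in>I. (sqrt (\<sigma> k))\<^sup>2) * (\<Sum>k\<in>I. (x k / sqrt (\<sigma> k))\<^sup>2)"
    by (rule Cauchy_Schwarz_ineq_sum)
  also have "\<dots> = (\<Sum>k\<in>I. \<sigma> k) * (\<Sum>k\<in>I. (x k)\<^sup>2 / \<sigma> k)"
    using assms by (intro arg_cong2[of _ _ _ _ "(*)"] sum.cong) (auto simp: power_divide less_imp_le)
  finally show ?thesis .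
qed

locale truncated_system = balanced_system \<Omega> F q K w n m A B N M T U p C \<sigma> \<gamma>
  for \<Omega> :: "'w measure" and F :: "real \<Rightarrow> 'w measure" and q :: nat and K :: "real mat"
    and w :: "nat \<Rightarrow> real \<Rightarrow> 'w \<Rightarrow> real" and n m :: nat and A B :: "nat \<Rightarrow> nat \<Rightarrow> real"
    and N M :: "nat \<Rightarrow> nat \<Rightarrow> nat \<Rightarrow> real" and T :: real and U :: "nat \<Rightarrow> real \<times> 'w \<Rightarrow> real"
    and p :: nat and C :: "nat \<Rightarrow> nat \<Rightarrow> real" and \<sigma> :: "nat \<Rightarrow> real" and \<gamma> :: real +
  fixes r :: nat and X Xr :: "nat \<Rightarrow> real \<times> 'w \<Rightarrow> real"
  assumes r_less: "r < n" and X: "solution n X" and Xr: "solution r Xr"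
begin

definition tm :: "nat \<Rightarrow> nat \<Rightarrow> real" where
  "tm J j = real j * T / real J"

lemma tm_facts:
  "0 \<le> tm J j" "tm J 0 = 0" "tm J j \<le> tm J (Suc j)" "tm J (Suc j) - tm J j = T / real J"
  "0 < J \<Longrightarrow> tm J J = T" "0 < J \<Longrightarrow> j \<le> J \<Longrightarrow> tm J j \<le> T"
  using T_pos by (auto simp: tm_def field_simps divide_right_mono add_divide_distrib)

abbreviation window :: "nat \<Rightarrow> nat \<Rightarrow> (real \<times> 'w) measure" where
  "window J j \<equiv> win (tm J j) (tm J (Suc j))"

lemma sum_windows:
  fixes f :: "real \<times> 'w \<Rightarrow> real"
  assumes f: "integrable (win 0 T) f" "\<And>z. 0 \<le> f z" and J: "0 < J"
  shows "(\<Sum>j<J. (\<integral>z. f z \<partial>window J j)) = (\<integral>z. f z \<partial>win 0 T)"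
proof -
  have m [measurable]: "f \<in> borel_measurable (lborel \<Otimes>\<^sub>M \<Omega>)" using borel_measurable_integrable[OF f(1)] by simp
  have "i \<le> J \<Longrightarrow> (\<Sum>j<i. (\<integral>z. f z \<partial>window J j)) = (\<integral>z. f z \<partial>win 0 (tm J i))" for i
  proof (induction i)
    case 0
    show ?case by (simp add: integral_win[OF m] tm_facts)
  next
    case (Suc i)
    have "integrable (win 0 (tm J i)) f" "integrable (window J i) f"
      using f Suc.prems tm_facts[of J] J by (auto intro!: integral_win_mono(1)[of 0 T f])
    from integral_win_combine(2)[OF tm_facts(1,3) this] Suc show ?case by simp
  qed
  from this[of J] show ?thesis using tm_facts(5)[OF J] by simp
qed

text \<open>
  The Euler scheme at level \<open>k\<close> on the grid with \<open>J\<close> steps.  At \<open>k = n\<close> the Euler increments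
  of \<open>Z\<close> and \<open>X\<close> cancel and the scheme reproduces \<open>X\<close>.
\<close>

primrec level :: "nat \<Rightarrow> nat \<Rightarrow> nat \<Rightarrow> nat \<Rightarrow> 'w \<Rightarrow> real" where
  "level J k 0 = (\<lambda>l \<omega>. X l (0, \<omega>))"
| "level J k (Suc j) = euler_step X k (tm J j) (tm J (Suc j)) (level J k j)"

lemma level_full: "l < n \<Longrightarrow> level J n j l \<omega> = X l (tm J j, \<omega>)"
proof (induction j arbitrary: l \<omega>)
  case 0
  show ?case by (simp add: tm_facts)
next
  case (Suc j)
  show ?case
    unfolding level.simps using Suc euler_step_solution[of "level J n j" X "tm J j" l] by blast
qed

lemma level_step:
  assumes k: "k \<le> n" and J: "0 < J"
  shows "j \<le> J \<Longrightarrow> l < k \<Longrightarrow> past (tm J j) (level J k j l)"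
    and "j < J \<Longrightarrow> grid_step k (tm J j) (tm J (Suc j)) (\<lambda>c z. X c z - X c (tm J j, snd z)) (level J k j) (level J k (Suc j))"
proof -
  have step: "grid_step k (tm J j) (tm J (Suc j)) (\<lambda>c z. X c z - X c (tm J j, snd z)) (level J k j) (level J k (Suc j))"
    if "j < J" "\<And>l. l < k \<Longrightarrow> past (tm J j) (level J k j l)" for j
    unfolding level.simps using that tm_facts(6)[OF J, of "Suc j"] by (intro grid_step_euler X k tm_facts) auto
  have p: "j \<le> J \<Longrightarrow> l < k \<Longrightarrow> past (tm J j) (level J k j l)" for j l
  proof (induction j arbitrary: l)
    case 0
    then show ?case using solution_past[OF X, of l 0] k T_pos by (simp add: tm_facts)
  next
    case (Suc j)
    then have "grid_step k (tm J j) (tm J (Suc j)) (\<lambda>c z. X c z - X c (tm J j, snd z)) (level J k j) (level J k (Suc j))"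
      by (intro step) auto
    with Suc.prems show ?case unfolding grid_step_def by blast
  qed
  then show "j \<le> J \<Longrightarrow> l < k \<Longrightarrow> past (tm J j) (level J k j l)" .
  show "j < J \<Longrightarrow> grid_step k (tm J j) (tm J (Suc j)) (\<lambda>c z. X c z - X c (tm J j, snd z)) (level J k j) (level J k (Suc j))"
    by (rule step) (auto intro: p)
qed

text \<open>
  The chain of levels: the reduced solution, Euler schemes in between, the full solution.
\<close>

definition stage :: "nat \<Rightarrow> nat \<Rightarrow> nat \<Rightarrow> nat \<Rightarrow> 'w \<Rightarrow> real" where
  "stage J k j = (if k = r then (\<lambda>l \<omega>. Xr l (tm J j, \<omega>)) else level J k j)"

text \<open>
  The error, in the sense of \<open>grid_step\<close>, of the step that leads from \<open>stage J k j\<close> to the next stage.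
\<close>

definition lag :: "nat \<Rightarrow> nat \<Rightarrow> nat \<Rightarrow> nat \<Rightarrow> real \<times> 'w \<Rightarrow> real" where
  "lag J k j = (if k = r then (\<lambda>c z. if c < r then Xr c z - Xr c (tm J j, snd z) else 0)
     else (\<lambda>c z. X c z - X c (tm J j, snd z)))"

abbreviation level_gap :: "nat \<Rightarrow> nat \<Rightarrow> nat \<Rightarrow> 'w \<Rightarrow> real" where
  "level_gap J k j \<omega> \<equiv> gap k (\<lambda>l. stage J (Suc k) j l \<omega>) (\<lambda>l. stage J k j l \<omega>)"

abbreviation lags :: "nat \<Rightarrow> nat \<Rightarrow> nat \<Rightarrow> nat \<Rightarrow> real \<times> 'w \<Rightarrow> real" where
  "lags J k k' j z \<equiv> \<Sum>l<n. (lag J k j l z)\<^sup>2 + (lag J k' j l z)\<^sup>2"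

lemma stage_step:
  assumes "r \<le> k" "k \<le> n" "j < J"
  shows "grid_step k (tm J j) (tm J (Suc j)) (lag J k j) (stage J k j) (stage J k (Suc j))"
proof (cases "k = r")
  case True
  then show ?thesis
    using grid_step_solution[OF Xr, of "tm J j" "tm J (Suc j)"] assms tm_facts(6)[of J "Suc j"]
    by (simp add: stage_def lag_def tm_facts)
next
  case False
  then show ?thesis
    using level_step(2)[of k J j] assms by (simp add: stage_def lag_def)
qed

definition window_energy :: "nat \<Rightarrow> nat \<Rightarrow> real" where
  "window_energy J j = energy (tm J j) (tm J (Suc j)) n X + energy (tm J j) (tm J (Suc j)) r Xr"

lemma energy_nonneg: "0 \<le> energy a b d Y"
  unfolding energy_def by (intro Bochner_Integration.integral_nonneg add_nonneg_nonneg sum_nonneg) auto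

lemma increments_bound:
  assumes Y: "solution d Y" and d: "d \<le> n"
  shows "\<exists>c\<ge>0. \<forall>a b. 0 \<le> a \<longrightarrow> a \<le> b \<longrightarrow> b \<le> T \<longrightarrow>
    (\<integral>z. (\<Sum>l<n. (if l < d then Y l z - Y l (a, snd z) else 0)\<^sup>2) \<partial>win a b) \<le> c * (b - a) * energy a b d Y"
proof -
  have "\<forall>l\<in>{..<d}. \<exists>c\<ge>0. \<forall>a b. 0 \<le> a \<longrightarrow> a \<le> b \<longrightarrow> b \<le> T \<longrightarrow>
    sq_int (win a b) (\<lambda>z. Y l z - Y l (a, snd z)) \<and>
    (\<integral>z. (Y l z - Y l (a, snd z))\<^sup>2 \<partial>win a b) \<le> c * (b - a) * energy a b d Y"
    using solution_increment_bound[OF Y] by blast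
  from bchoice[OF this] obtain f where f: "\<And>l. l < d \<Longrightarrow> 0 \<le> f l"
    "\<And>l a b. l < d \<Longrightarrow> 0 \<le> a \<Longrightarrow> a \<le> b \<Longrightarrow> b \<le> T \<Longrightarrow> sq_int (win a b) (\<lambda>z. Y l z - Y l (a, snd z))"
    "\<And>l a b. l < d \<Longrightarrow> 0 \<le> a \<Longrightarrow> a \<le> b \<Longrightarrow> b \<le> T \<Longrightarrow>
      (\<integral>z. (Y l z - Y l (a, snd z))\<^sup>2 \<partial>win a b) \<le> f l * (b - a) * energy a b d Y"
    by auto
  have "(\<integral>z. (\<Sum>l<n. (if l < d then Y l z - Y l (a, snd z) else 0)\<^sup>2) \<partial>win a b) \<le> (\<Sum>l<d. f l) * (b - a) * energy a b d Y"
    if ab: "0 \<le> a" "a \<le> b" "b \<le> T" for a b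
  proof -
    have "(\<Sum>l<n. (if l < d then Y l z - Y l (a, snd z) else 0)\<^sup>2) = (\<Sum>l<d. (Y l z - Y l (a, snd z))\<^sup>2)" for z
      using d by (intro sum.mono_neutral_cong_right) auto
    then have "(\<integral>z. (\<Sum>l<n. (if l < d then Y l z - Y l (a, snd z) else 0)\<^sup>2) \<partial>win a b)
      = (\<integral>z. (\<Sum>l<d. (Y l z - Y l (a, snd z))\<^sup>2) \<partial>win a b)" by simp
    also have "\<dots> = (\<Sum>l<d. (\<integral>z. (Y l z - Y l (a, snd z))\<^sup>2 \<partial>win a b))"
      by (intro Bochner_Integration.integral_sum sq_int_integrable f(2) ab) auto
    also have "\<dots> \<le> (\<Sum>l<d. f l * (b - a) * energy a b d Y)"
      by (intro sum_mono f(3) ab) auto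
    finally show ?thesis by (simp add: sum_distrib_right)
  qed
  then show ?thesis using f(1) by (intro exI[of _ "\<Sum>l<d. f l"]) (auto intro: sum_nonneg)
qed

lemma lag_bound:
  "\<exists>c\<ge>0. \<forall>J j k. j < J \<longrightarrow> r \<le> k \<longrightarrow> k \<le> n \<longrightarrow>
    (\<integral>z. (\<Sum>l<n. (lag J k j l z)\<^sup>2) \<partial>window J j) \<le> c * (T / real J) * window_energy J j"
proof -
  obtain c1 where c1: "0 \<le> c1" "\<And>a b. 0 \<le> a \<Longrightarrow> a \<le> b \<Longrightarrow> b \<le> T \<Longrightarrow>
    (\<integral>z. (\<Sum>l<n. (if l < n then X l z - X l (a, snd z) else 0)\<^sup>2) \<partial>win a b) \<le> c1 * (b - a) * energy a b n X"
    using increments_bound[OF X] by blast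
  obtain c2 where c2: "0 \<le> c2" "\<And>a b. 0 \<le> a \<Longrightarrow> a \<le> b \<Longrightarrow> b \<le> T \<Longrightarrow>
    (\<integral>z. (\<Sum>l<n. (if l < r then Xr l z - Xr l (a, snd z) else 0)\<^sup>2) \<partial>win a b) \<le> c2 * (b - a) * energy a b r Xr"
    using increments_bound[OF Xr] r_less by auto
  have "(\<integral>z. (\<Sum>l<n. (lag J k j l z)\<^sup>2) \<partial>window J j) \<le> (c1 + c2) * (T / real J) * window_energy J j"
    if j: "j < J" for J j k
  proof -
    let ?a = "tm J j" and ?b = "tm J (Suc j)"
    have ab: "0 \<le> ?a" "?a \<le> ?b" "?b \<le> T" using tm_facts[of J] j by auto
    note nn = energy_nonneg[of ?a ?b n X] energy_nonneg[of ?a ?b r Xr]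
    have h: "0 \<le> T / real J" using T_pos by simp
    have up: "c' * (?b - ?a) * E \<le> (c1 + c2) * (T / real J) * window_energy J j"
      if "c' \<le> c1 + c2" "0 \<le> c'" "0 \<le> E" "E \<le> window_energy J j" for c' E
      unfolding tm_facts using that h c1 c2 by (intro mult_mono mult_nonneg_nonneg) auto
    show ?thesis
    proof (cases "k = r")
      case True
      have "(\<integral>z. (\<Sum>l<n. (lag J k j l z)\<^sup>2) \<partial>win ?a ?b) \<le> c2 * (?b - ?a) * energy ?a ?b r Xr"
        using c2(2)[OF ab] True by (simp add: lag_def)
      also have "\<dots> \<le> (c1 + c2) * (T / real J) * window_energy J j"
        using nn c1 c2 by (intro up) (auto simp: window_energy_def)
      finally show ?thesis .
    next
      case False
      have "(\<integral>z. (\<Sum>l<n. (lag J k j l z)\<^sup>2) \<partial>win ?a ?b) \<le> c1 * (?b - ?a) * energy ?a ?b n X"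
        using c1(2)[OF ab] False by (simp add: lag_def)
      also have "\<dots> \<le> (c1 + c2) * (T / real J) * window_energy J j"
        using nn c1 c2 by (intro up) (auto simp: window_energy_def)
      finally show ?thesis .
    qed
  qed
  with c1(1) c2(1) show ?thesis by (intro exI[of _ "c1 + c2"]) auto
qed

definition total_energy :: real where
  "total_energy = energy 0 T n X + energy 0 T r Xr"

lemma sum_energy:
  assumes Y: "solution d Y" and J: "0 < J"
  shows "(\<Sum>j<J. energy (tm J j) (tm J (Suc j)) d Y) = energy 0 T d Y"
  unfolding energy_def
proof (rule sum_windows[OF _ _ J])
  show "integrable (win 0 T) (\<lambda>z. (\<Sum>c<d. (Y c z)\<^sup>2) + (\<Sum>c<m. (U c z)\<^sup>2))"
    using solution_sq_int[OF Y] U_sq_int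
    by (intro Bochner_Integration.integrable_add Bochner_Integration.integrable_sum sq_int_integrable) auto
qed (intro add_nonneg_nonneg sum_nonneg; simp)

lemma sum_window_energy: "0 < J \<Longrightarrow> (\<Sum>j<J. window_energy J j) = total_energy"
  by (simp add: window_energy_def total_energy_def sum.distrib sum_energy X Xr)

lemma lag_sq_int: "r \<le> k \<Longrightarrow> k \<le> n \<Longrightarrow> j < J \<Longrightarrow> c < n \<Longrightarrow> sq_int (window J j) (lag J k j c)"
  using stage_step[of k j J] by (auto simp: grid_step_def)

lemma lag_pair_bound:
  "\<exists>c\<ge>0. \<forall>J k k'. 0 < J \<longrightarrow> r \<le> k \<longrightarrow> k \<le> n \<longrightarrow> r \<le> k' \<longrightarrow> k' \<le> n \<longrightarrow>
    (\<Sum>j<J. (\<integral>z. (lags J k k' j z) \<partial>window J j)) \<le> c * (T / real J)"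
proof -
  obtain c where c: "0 \<le> c" "\<And>J j k. j < J \<Longrightarrow> r \<le> k \<Longrightarrow> k \<le> n \<Longrightarrow>
    (\<integral>z. (\<Sum>l<n. (lag J k j l z)\<^sup>2) \<partial>window J j) \<le> c * (T / real J) * window_energy J j"
    using lag_bound by blast
  have "(\<Sum>j<J. (\<integral>z. (lags J k k' j z) \<partial>window J j))
     \<le> (2 * c * total_energy) * (T / real J)" if J: "0 < J" and k: "r \<le> k" "k \<le> n" "r \<le> k'" "k' \<le> n" for J k k'
  proof -
    have "(\<integral>z. (lags J k k' j z) \<partial>window J j)
       \<le> 2 * (c * (T / real J) * window_energy J j)" if j: "j < J" for j
    proof -
      have i: "integrable (window J j) (\<lambda>z. \<Sum>l<n. (lag J i j l z)\<^sup>2)" if "r \<le> i" "i \<le> n" for i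
        using that j by (intro Bochner_Integration.integrable_sum sq_int_integrable lag_sq_int) auto
      have eq: "(\<integral>z. (lags J k k' j z) \<partial>window J j)
        = (\<integral>z. (\<Sum>l<n. (lag J k j l z)\<^sup>2) \<partial>window J j) + (\<integral>z. (\<Sum>l<n. (lag J k' j l z)\<^sup>2) \<partial>window J j)"
        unfolding sum.distrib by (rule Bochner_Integration.integral_add[OF i[OF k(1,2)] i[OF k(3,4)]])
      show ?thesis unfolding eq mult_2 by (rule add_mono[OF c(2)[OF j k(1,2)] c(2)[OF j k(3,4)]])
    qed
    then have "(\<Sum>j<J. (\<integral>z. (lags J k k' j z) \<partial>window J j))
      \<le> (\<Sum>j<J. 2 * (c * (T / real J) * window_energy J j))" by (intro sum_mono) auto
    also have "\<dots> = (2 * c * total_energy) * (T / real J)"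
      unfolding sum_window_energy[OF J, symmetric] sum_distrib_left sum_distrib_right by (simp add: mult_ac)
    finally show ?thesis .
  qed
  moreover have "0 \<le> 2 * c * total_energy" using c(1) energy_nonneg by (simp add: total_energy_def)
  ultimately show ?thesis by blast
qed

lemma stage_past: "r \<le> k \<Longrightarrow> k \<le> n \<Longrightarrow> j < J \<Longrightarrow> l < k \<Longrightarrow> sq_int \<Omega> (stage J k j l)"
  using stage_step[of k j J] by (auto simp: grid_step_def past_def)

lemma stage_initial:
  assumes "k \<le> n" "l < k"
  shows "AE \<omega> in \<Omega>. stage J k 0 l \<omega> = 0"
  using assms X Xr r_less by (auto simp: stage_def tm_facts solution_def)

text \<open>
  The discrete Gronwall inequality applied to the expected storage.  The errors are of order \<open>h = \<theta>\<^sup>2\<close> in mean square and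
  are divided by \<open>\<theta>\<close>, so they contribute \<open>O(\<theta>)\<close>.
\<close>

lemma stage_gap:
  assumes k: "r \<le> k" "k < n"
  shows "\<exists>c\<ge>0. \<forall>J \<theta>. 0 < J \<longrightarrow> 0 < \<theta> \<longrightarrow> \<theta> \<le> 1 \<longrightarrow> T / real J = \<theta>\<^sup>2 \<longrightarrow>
    (\<Sum>j<J. T / real J * (\<integral>\<omega>. level_gap J k j \<omega> \<partial>\<Omega>))
    \<le> exp (c * \<theta> * T) * ((4 * \<gamma> * (\<sigma> k)\<^sup>2 + c * \<theta>) * input_energy 0 T + c * \<theta>)"
proof -
  obtain c where c: "0 \<le> c" and step: "\<And>a b e e' Z Z' Y Y' \<theta>. 0 \<le> a \<Longrightarrow> a \<le> b \<Longrightarrow> b \<le> T \<Longrightarrow> 0 < \<theta> \<Longrightarrow> \<theta> \<le> 1 \<Longrightarrow> b - a \<le> \<theta>\<^sup>2 \<Longrightarrow>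
    grid_step (Suc k) a b e Z Z' \<Longrightarrow> grid_step k a b e' Y Y' \<Longrightarrow>
    (\<integral>\<omega>. storage k (\<lambda>l. Z' l \<omega>) (\<lambda>l. Y' l \<omega>) \<partial>\<Omega>) + (b - a) * (\<integral>\<omega>. gap k (\<lambda>l. Z l \<omega>) (\<lambda>l. Y l \<omega>) \<partial>\<Omega>)
    \<le> (1 + c * \<theta> * (b - a)) * (\<integral>\<omega>. storage k (\<lambda>l. Z l \<omega>) (\<lambda>l. Y l \<omega>) \<partial>\<Omega>)
      + ((4 * \<gamma> * (\<sigma> k)\<^sup>2 + c * \<theta>) * input_energy a b
      + c / \<theta> * (\<integral>z. (\<Sum>c<n. (e c z)\<^sup>2 + (e' c z)\<^sup>2) \<partial>win a b))"
    using storage_step[OF k(2)] by blast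
  obtain c' where c': "0 \<le> c'" "\<And>J k k'. 0 < J \<Longrightarrow> r \<le> k \<Longrightarrow> k \<le> n \<Longrightarrow> r \<le> k' \<Longrightarrow> k' \<le> n \<Longrightarrow>
    (\<Sum>j<J. (\<integral>z. (lags J k k' j z) \<partial>window J j)) \<le> c' * (T / real J)"
    using lag_pair_bound by blast
  define d where "d = c + c * c'"
  have d: "c \<le> d" "c * c' \<le> d" "0 \<le> d" using c c' by (auto simp: d_def)
  have ie: "0 \<le> input_energy a b" for a b
    unfolding input_energy_def by (intro Bochner_Integration.integral_nonneg sum_nonneg) auto
  have "(\<Sum>j<J. T / real J * (\<integral>\<omega>. level_gap J k j \<omega> \<partial>\<Omega>))
    \<le> exp (d * \<theta> * T) * ((4 * \<gamma> * (\<sigma> k)\<^sup>2 + d * \<theta>) * input_energy 0 T + d * \<theta>)"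
    if J: "0 < J" and \<theta>: "0 < \<theta>" "\<theta> \<le> 1" and h: "T / real J = \<theta>\<^sup>2" for J \<theta>
  proof -
    define v where "v j = (\<integral>\<omega>. storage k (\<lambda>l. stage J (Suc k) j l \<omega>) (\<lambda>l. stage J k j l \<omega>) \<partial>\<Omega>)" for j
    define y where "y j = T / real J * (\<integral>\<omega>. level_gap J k j \<omega> \<partial>\<Omega>)" for j
    let ?E = "\<lambda>j. (\<integral>z. (lags J (Suc k) k j z) \<partial>window J j)"
    define g where "g j = (4 * \<gamma> * (\<sigma> k)\<^sup>2 + c * \<theta>) * input_energy (tm J j) (tm J (Suc j)) + c / \<theta> * ?E j" for j
    have E: "0 \<le> ?E j" for j by (intro Bochner_Integration.integral_nonneg sum_nonneg add_nonneg_nonneg) auto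
    have "AE \<omega> in \<Omega>. \<forall>l\<in>{..<Suc k}. stage J (Suc k) 0 l \<omega> = 0"
      using k by (intro AE_finite_allI stage_initial) auto
    moreover have "AE \<omega> in \<Omega>. \<forall>l\<in>{..<k}. stage J k 0 l \<omega> = 0"
      using k by (intro AE_finite_allI stage_initial) auto
    ultimately have "AE \<omega> in \<Omega>. storage k (\<lambda>l. stage J (Suc k) 0 l \<omega>) (\<lambda>l. stage J k 0 l \<omega>) = 0"
      by eventually_elim (auto simp: storage_def pad_def intro!: sum.neutral)
    then have "v 0 = 0" unfolding v_def by (rule integral_eq_zero_AE)
    have "(\<Sum>j<J. y j) \<le> exp ((c * \<theta> * (T / real J)) * real J) * (\<Sum>j<J. g j)"
    proof (rule discrete_gronwall[of v])
      show "v 0 \<le> 0" using \<open>v 0 = 0\<close> by simp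
      show "0 \<le> c * \<theta> * (T / real J)" using c \<theta> T_pos by simp
      show "0 \<le> y j" for j
        unfolding y_def using T_pos by (intro mult_nonneg_nonneg Bochner_Integration.integral_nonneg gap_nonneg) auto
      show "0 \<le> g j" for j
        unfolding g_def using c \<theta> ie E \<gamma>_nonneg by (intro add_nonneg_nonneg mult_nonneg_nonneg) auto
      show "0 \<le> v j" for j
        unfolding v_def using k by (intro Bochner_Integration.integral_nonneg storage_nonneg) auto
      show "v (Suc j) + y j \<le> (1 + c * \<theta> * (T / real J)) * v j + g j" if j: "j < J" for j
        unfolding v_def y_def g_def tm_facts(4)[of J j, symmetric]
        using tm_facts(6)[OF J, of "Suc j"] j \<theta> h k
        by (intro step tm_facts(1,3) stage_step) (auto simp: tm_facts)
    qed
    also have "(c * \<theta> * (T / real J)) * real J = c * \<theta> * T" using J by simp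
    also have "exp (c * \<theta> * T) * (\<Sum>j<J. g j) \<le> exp (d * \<theta> * T) * ((4 * \<gamma> * (\<sigma> k)\<^sup>2 + d * \<theta>) * input_energy 0 T + d * \<theta>)"
    proof (rule mult_mono)
      show "exp (c * \<theta> * T) \<le> exp (d * \<theta> * T)" using d \<theta> T_pos by simp
      have iU: "integrable (win 0 T) (\<lambda>z. \<Sum>c<m. (U c z)\<^sup>2)"
        using U_sq_int by (intro Bochner_Integration.integrable_sum sq_int_integrable) auto
      have "(\<Sum>j<J. input_energy (tm J j) (tm J (Suc j))) = input_energy 0 T"
        unfolding input_energy_def by (intro sum_windows[OF iU _ J] sum_nonneg) auto
      then have "(\<Sum>j<J. g j) = (4 * \<gamma> * (\<sigma> k)\<^sup>2 + c * \<theta>) * input_energy 0 T + c / \<theta> * (\<Sum>j<J. ?E j)"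
        unfolding g_def sum.distrib sum_distrib_left[symmetric] by simp
      also have "\<dots> \<le> (4 * \<gamma> * (\<sigma> k)\<^sup>2 + d * \<theta>) * input_energy 0 T + c / \<theta> * (c' * (T / real J))"
        using d \<theta> c k ie by (intro add_mono mult_right_mono mult_left_mono c'(2) J) auto
      also have "c / \<theta> * (c' * (T / real J)) = c * c' * \<theta>"
        unfolding h using \<theta> by (simp add: power2_eq_square)
      also have "\<dots> \<le> d * \<theta>" using d \<theta> by (intro mult_right_mono) auto
      finally show "(\<Sum>j<J. g j) \<le> (4 * \<gamma> * (\<sigma> k)\<^sup>2 + d * \<theta>) * input_energy 0 T + d * \<theta>" by simp
      show "0 \<le> (\<Sum>j<J. g j)"
        unfolding g_def using c \<theta> ie E \<gamma>_nonneg by (intro sum_nonneg add_nonneg_nonneg mult_nonneg_nonneg) auto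
    qed simp
    finally show ?thesis by (simp add: y_def)
  qed
  with d(3) show ?thesis by blast
qed

definition output_error :: "real \<times> 'w \<Rightarrow> real" where
  "output_error z = (\<Sum>s<p. ((\<Sum>c<n. C s c * X c z) - (\<Sum>c<r. C s c * Xr c z))\<^sup>2)"

text \<open>
  At the grid point the output error telescopes over the levels.  The Cauchy-Schwarz inequality with weights
  \<open>\<sigma> k\<close> turns the square of the sum into \<open>(\<Sum>\<sigma>) \<Sum> d\<^sub>k\<^sup>2 / \<sigma>\<^sub>k\<close>, and since \<open>d\<^sub>k\<^sup>2\<close> will be bounded by
  \<open>4 \<gamma> \<sigma>\<^sub>k\<^sup>2\<close> times the input energy, these weights are the ones that give \<open>(\<Sum>\<sigma>)\<^sup>2\<close>.
\<close>

lemma output_error_window: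
  "\<exists>c\<ge>0. \<forall>J j \<theta> z. 0 < \<theta> \<longrightarrow> \<theta> \<le> 1 \<longrightarrow>
    output_error z \<le> (1 + \<theta>) * (\<Sum>k\<in>{r..<n}. (\<Sum>k\<in>{r..<n}. \<sigma> k) / \<sigma> k * level_gap J k j (snd z))
      + c / \<theta> * (lags J n r j z)"
proof -
  let ?r = "\<lambda>x :: (nat \<Rightarrow> real) \<times> (nat \<Rightarrow> real). \<Sum>c<n. (fst x c)\<^sup>2 + (snd x c)\<^sup>2"
  have tm: "(fst x c)\<^sup>2 + (snd x c)\<^sup>2 \<le> ?r x" if "c < n" for c x
    using that by (intro member_le_sum[of c _ "\<lambda>c. (fst x c)\<^sup>2 + (snd x c)\<^sup>2"]) auto
  have d1: "dominated ?r (\<lambda>x. (fst x c)\<^sup>2)" if "c < n" for c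
    by (rule dominated_base, rule order_trans[OF _ tm[OF that]]) simp
  have d2: "dominated ?r (\<lambda>x. (snd x c)\<^sup>2)" if "c < n" for c
    by (rule dominated_base, rule order_trans[OF _ tm[OF that]]) simp
  have "dominated ?r (\<lambda>x. \<Sum>s<p. 4 * ((\<Sum>c<n. C s c * fst x c)\<^sup>2 + (\<Sum>c<n. C s c * snd x c)\<^sup>2))"
    by (intro dominated_sum dominated_cmult dominated_add dominated_square_sum dominated_square_cmult d1 d2) auto
  then obtain c where c: "0 \<le> c" "\<And>e e'. (\<Sum>s<p. 4 * ((\<Sum>c<n. C s c * e c)\<^sup>2 + (\<Sum>c<n. C s c * e' c)\<^sup>2))
     \<le> c * (\<Sum>c<n. (e c)\<^sup>2 + (e' c)\<^sup>2)" unfolding dominated_def by force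
  let ?S = "\<Sum>k\<in>{r..<n}. \<sigma> k"
  have "output_error z \<le> (1 + \<theta>) * (\<Sum>k\<in>{r..<n}. ?S / \<sigma> k * level_gap J k j (snd z))
      + c / \<theta> * (lags J n r j z)" if \<theta>: "0 < \<theta>" "\<theta> \<le> 1" for J j \<theta> z
  proof -
    define f where "f s k = (\<Sum>c<k. C s c * stage J k j c (snd z))" for s k
    let ?e = "\<lambda>s. \<Sum>c<n. C s c * lag J n j c z" and ?e' = "\<lambda>s. \<Sum>c<n. C s c * lag J r j c z"
    have split: "(\<Sum>c<n. C s c * X c z) - (\<Sum>c<r. C s c * Xr c z)
      = (\<Sum>k\<in>{r..<n}. f s (Suc k) - f s k) + (?e s - ?e' s)" for s
    proof -
      have 1: "f s n = (\<Sum>c<n. C s c * X c (tm J j, snd z))"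
        unfolding f_def using r_less by (intro sum.cong refl) (simp add: stage_def level_full)
      have 2: "?e s = (\<Sum>c<n. C s c * X c z) - (\<Sum>c<n. C s c * X c (tm J j, snd z))"
        using r_less by (simp add: lag_def right_diff_distrib sum_subtractf)
      have 3: "f s r = (\<Sum>c<r. C s c * Xr c (tm J j, snd z))" by (simp add: f_def stage_def)
      have "?e' s = (\<Sum>c<r. C s c * lag J r j c z)"
        using r_less by (intro sum.mono_neutral_right) (auto simp: lag_def)
      then have 4: "?e' s = (\<Sum>c<r. C s c * Xr c z) - (\<Sum>c<r. C s c * Xr c (tm J j, snd z))"
        by (simp add: lag_def right_diff_distrib sum_subtractf)
      have "(\<Sum>k\<in>{r..<n}. f s (Suc k) - f s k) = f s n - f s r"
        using r_less by (intro sum_Suc_diff') simp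
      with 1 2 3 4 show ?thesis by simp
    qed
    have pw: "((\<Sum>c<n. C s c * X c z) - (\<Sum>c<r. C s c * Xr c z))\<^sup>2
      \<le> (1 + \<theta>) * (\<Sum>k\<in>{r..<n}. ?S / \<sigma> k * (f s (Suc k) - f s k)\<^sup>2) + 1 / \<theta> * (4 * ((?e s)\<^sup>2 + (?e' s)\<^sup>2))" for s
    proof -
      let ?D = "\<Sum>k\<in>{r..<n}. f s (Suc k) - f s k"
      \<comment> \<open>Young with \<open>\<theta>\<close>: the telescoping part must keep a constant that tends to \<open>1\<close>\<close>
      have young: "(x + y)\<^sup>2 \<le> (1 + \<theta>) * x\<^sup>2 + (1 + 1 / \<theta>) * y\<^sup>2" for x y :: real
      proof -
        have "0 \<le> (y - \<theta> * x)\<^sup>2 / \<theta>" using \<theta> by simp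
        then have "2 * (x * y) \<le> \<theta> * x\<^sup>2 + y\<^sup>2 / \<theta>" using \<theta> by (simp add: power2_diff field_simps power2_eq_square)
        then show ?thesis by (simp add: power2_eq_square algebra_simps)
      qed
      have "((\<Sum>c<n. C s c * X c z) - (\<Sum>c<r. C s c * Xr c z))\<^sup>2 \<le> (1 + \<theta>) * ?D\<^sup>2 + (1 + 1 / \<theta>) * (?e s - ?e' s)\<^sup>2"
        unfolding split by (rule young)
      also have "\<dots> \<le> (1 + \<theta>) * (?S * (\<Sum>k\<in>{r..<n}. (f s (Suc k) - f s k)\<^sup>2 / \<sigma> k)) + (2 / \<theta>) * (2 * ((?e s)\<^sup>2 + (?e' s)\<^sup>2))"
      proof (intro add_mono mult_mono)
        show "?D\<^sup>2 \<le> ?S * (\<Sum>k\<in>{r..<n}. (f s (Suc k) - f s k)\<^sup>2 / \<sigma> k)"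
          by (rule weighted_Cauchy_Schwarz) (simp add: \<sigma>_pos)
        show "1 + 1 / \<theta> \<le> 2 / \<theta>" using \<theta> by (simp add: field_simps)
        show "(?e s - ?e' s)\<^sup>2 \<le> 2 * ((?e s)\<^sup>2 + (?e' s)\<^sup>2)"
          using square_add_le[of "?e s" "- ?e' s"] by simp
      qed (use \<theta> in auto)
      finally show ?thesis by (simp add: sum_distrib_left mult_ac)
    qed
    have "output_error z \<le> (\<Sum>s<p. (1 + \<theta>) * (\<Sum>k\<in>{r..<n}. ?S / \<sigma> k * (f s (Suc k) - f s k)\<^sup>2) + 1 / \<theta> * (4 * ((?e s)\<^sup>2 + (?e' s)\<^sup>2)))"
      unfolding output_error_def by (intro sum_mono pw)
    also have "\<dots> = (1 + \<theta>) * (\<Sum>k\<in>{r..<n}. ?S / \<sigma> k * (\<Sum>s<p. (f s (Suc k) - f s k)\<^sup>2)) + 1 / \<theta> * (\<Sum>s<p. 4 * ((?e s)\<^sup>2 + (?e' s)\<^sup>2))"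
      unfolding sum.distrib sum_distrib_left[symmetric] by (subst sum.swap) (simp add: sum_distrib_left)
    also have "\<dots> \<le> (1 + \<theta>) * (\<Sum>k\<in>{r..<n}. ?S / \<sigma> k * (\<Sum>s<p. (f s (Suc k) - f s k)\<^sup>2)) + 1 / \<theta> * (c * (lags J n r j z))"
      using \<theta> by (intro add_left_mono mult_left_mono c) auto
    finally show ?thesis by (simp add: f_def gap_def del: sum.lessThan_Suc)
  qed
  with c(1) show ?thesis by blast
qed

lemma output_error_integrable: "integrable (win 0 T) output_error"
  unfolding output_error_def using solution_sq_int[OF X] solution_sq_int[OF Xr]
  by (intro Bochner_Integration.integrable_sum sq_int_integrable sq_int_diff sq_int_sum sq_int_cmult) auto

lemma output_error_nonneg: "0 \<le> output_error z"
  unfolding output_error_def by (intro sum_nonneg) auto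

text \<open>
  For each grid the error is at most \<open>R \<theta>\<close> with \<open>\<theta> = sqrt (T / J)\<close>, and \<open>R \<theta>\<close> tends to
  the claimed bound as \<open>\<theta>\<close> tends to \<open>0\<close>.
\<close>

lemma output_error_bound:
  "(\<integral>z. output_error z \<partial>win 0 T) \<le> 4 * \<gamma> * (\<Sum>k\<in>{r..<n}. \<sigma> k)\<^sup>2 * input_energy 0 T"
proof -
  let ?S = "\<Sum>k\<in>{r..<n}. \<sigma> k"
  obtain c0 where c0: "0 \<le> c0" "\<And>J j \<theta> z. 0 < \<theta> \<Longrightarrow> \<theta> \<le> 1 \<Longrightarrow>
    output_error z \<le> (1 + \<theta>) * (\<Sum>k\<in>{r..<n}. ?S / \<sigma> k * level_gap J k j (snd z))
      + c0 / \<theta> * (lags J n r j z)" using output_error_window by blast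
  obtain c1 where c1: "0 \<le> c1" "\<And>J k k'. 0 < J \<Longrightarrow> r \<le> k \<Longrightarrow> k \<le> n \<Longrightarrow> r \<le> k' \<Longrightarrow> k' \<le> n \<Longrightarrow>
    (\<Sum>j<J. (\<integral>z. (lags J k k' j z) \<partial>window J j)) \<le> c1 * (T / real J)"
    using lag_pair_bound by blast
  have "\<forall>k\<in>{r..<n}. \<exists>c\<ge>0. \<forall>J \<theta>. 0 < J \<longrightarrow> 0 < \<theta> \<longrightarrow> \<theta> \<le> 1 \<longrightarrow> T / real J = \<theta>\<^sup>2 \<longrightarrow>
    (\<Sum>j<J. T / real J * (\<integral>\<omega>. level_gap J k j \<omega> \<partial>\<Omega>))
    \<le> exp (c * \<theta> * T) * ((4 * \<gamma> * (\<sigma> k)\<^sup>2 + c * \<theta>) * input_energy 0 T + c * \<theta>)"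
    using stage_gap by auto
  from bchoice[OF this] obtain f where "\<forall>k\<in>{r..<n}. 0 \<le> f k \<and> (\<forall>J \<theta>. 0 < J \<longrightarrow> 0 < \<theta> \<longrightarrow> \<theta> \<le> 1 \<longrightarrow> T / real J = \<theta>\<^sup>2 \<longrightarrow>
    (\<Sum>j<J. T / real J * (\<integral>\<omega>. level_gap J k j \<omega> \<partial>\<Omega>))
    \<le> exp (f k * \<theta> * T) * ((4 * \<gamma> * (\<sigma> k)\<^sup>2 + f k * \<theta>) * input_energy 0 T + f k * \<theta>))" by blast
  then have f: "(\<Sum>j<J. T / real J * (\<integral>\<omega>. level_gap J k j \<omega> \<partial>\<Omega>))
    \<le> exp (f k * \<theta> * T) * ((4 * \<gamma> * (\<sigma> k)\<^sup>2 + f k * \<theta>) * input_energy 0 T + f k * \<theta>)"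
    if "r \<le> k" "k < n" "0 < J" "0 < \<theta>" "\<theta> \<le> 1" "T / real J = \<theta>\<^sup>2" for k J \<theta>
    using that by (meson atLeastLessThan_iff)
  \<comment> \<open>the sum over the grid of the bounds in \<open>output_error_window\<close>, after \<open>stage_gap\<close>\<close>
  define R where "R \<theta> = (1 + \<theta>) * (\<Sum>k\<in>{r..<n}. ?S / \<sigma> k * (exp (f k * \<theta> * T) * ((4 * \<gamma> * (\<sigma> k)\<^sup>2 + f k * \<theta>) * input_energy 0 T + f k * \<theta>)))
     + c0 * c1 * \<theta>" for \<theta>
  have S: "0 \<le> ?S" using \<sigma>_pos by (intro sum_nonneg less_imp_le) auto
  have bound: "(\<integral>z. output_error z \<partial>win 0 T) \<le> R \<theta>"
    if J: "0 < J" and \<theta>: "0 < \<theta>" "\<theta> \<le> 1" and h: "T / real J = \<theta>\<^sup>2" for J \<theta>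
  proof -
    let ?g = "\<lambda>k j \<omega>. level_gap J k j \<omega>"
    let ?L = "\<lambda>j z. lags J n r j z"
    have "(\<integral>z. output_error z \<partial>win 0 T) = (\<Sum>j<J. (\<integral>z. output_error z \<partial>window J j))"
      by (rule sum_windows[OF output_error_integrable output_error_nonneg J, symmetric])
    also have "\<dots> \<le> (\<Sum>j<J. (1 + \<theta>) * (\<Sum>k\<in>{r..<n}. ?S / \<sigma> k * (T / real J * (\<integral>\<omega>. ?g k j \<omega> \<partial>\<Omega>)))
        + c0 / \<theta> * (\<integral>z. ?L j z \<partial>window J j))"
    proof (rule sum_mono)
      fix j assume "j \<in> {..<J}"
      then have j: "j < J" by simp
      let ?W = "window J j"
      have ig: "integrable \<Omega> (?g k j)" if "k \<in> {r..<n}" for k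
        using that j stage_past[of "Suc k" j J] stage_past[of k j J] by (intro gap_integrable) auto
      note igw = integral_win_const[OF ig tm_facts(3)[of J j]]
      have iL: "integrable ?W (?L j)"
        using r_less j lag_sq_int
        by (intro Bochner_Integration.integrable_sum Bochner_Integration.integrable_add sq_int_integrable) auto
      have io: "integrable ?W output_error"
        using integral_win_mono(1)[OF output_error_integrable output_error_nonneg] tm_facts[of J] J j by simp
      have igs: "integrable ?W (\<lambda>z. (1 + \<theta>) * (\<Sum>k\<in>{r..<n}. ?S / \<sigma> k * ?g k j (snd z)))"
        by (intro integrable_mult_right Bochner_Integration.integrable_sum igw(1)) auto
      have "(\<integral>z. output_error z \<partial>?W) \<le> (\<integral>z. (1 + \<theta>) * (\<Sum>k\<in>{r..<n}. ?S / \<sigma> k * ?g k j (snd z)) + c0 / \<theta> * ?L j z \<partial>?W)"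
        by (rule integral_mono[OF io _ c0(2)[OF \<theta>]]) (intro Bochner_Integration.integrable_add igs integrable_mult_right iL)
      also have "\<dots> = (1 + \<theta>) * (\<integral>z. (\<Sum>k\<in>{r..<n}. ?S / \<sigma> k * ?g k j (snd z)) \<partial>?W) + c0 / \<theta> * (\<integral>z. ?L j z \<partial>?W)"
        by (subst Bochner_Integration.integral_add[OF igs integrable_mult_right[OF iL]]) (simp only: integral_mult_right_zero)
      also have "(\<integral>z. (\<Sum>k\<in>{r..<n}. ?S / \<sigma> k * ?g k j (snd z)) \<partial>?W) = (\<Sum>k\<in>{r..<n}. (\<integral>z. ?S / \<sigma> k * ?g k j (snd z) \<partial>?W))"
        by (intro Bochner_Integration.integral_sum integrable_mult_right igw(1)) auto
      also have "\<dots> = (\<Sum>k\<in>{r..<n}. ?S / \<sigma> k * (T / real J * (\<integral>\<omega>. ?g k j \<omega> \<partial>\<Omega>)))"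
        by (intro sum.cong refl) (simp only: integral_mult_right_zero igw(2) tm_facts(4))
      finally show "(\<integral>z. output_error z \<partial>?W) \<le> (1 + \<theta>) * (\<Sum>k\<in>{r..<n}. ?S / \<sigma> k * (T / real J * (\<integral>\<omega>. ?g k j \<omega> \<partial>\<Omega>)))
        + c0 / \<theta> * (\<integral>z. ?L j z \<partial>?W)" .
    qed
    also have "\<dots> = (1 + \<theta>) * (\<Sum>k\<in>{r..<n}. ?S / \<sigma> k * (\<Sum>j<J. T / real J * (\<integral>\<omega>. ?g k j \<omega> \<partial>\<Omega>)))
        + c0 / \<theta> * (\<Sum>j<J. (\<integral>z. ?L j z \<partial>window J j))"
      unfolding sum.distrib sum_distrib_left[symmetric] by (subst sum.swap) (simp only: sum_distrib_left)
    also have "\<dots> \<le> (1 + \<theta>) * (\<Sum>k\<in>{r..<n}. ?S / \<sigma> k * (exp (f k * \<theta> * T) * ((4 * \<gamma> * (\<sigma> k)\<^sup>2 + f k * \<theta>) * input_energy 0 T + f k * \<theta>)))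
        + c0 / \<theta> * (c1 * (T / real J))"
    proof (intro add_mono mult_left_mono sum_mono)
      fix k assume "k \<in> {r..<n}"
      then have k: "r \<le> k" "k < n" by auto
      show "(\<Sum>j<J. T / real J * (\<integral>\<omega>. ?g k j \<omega> \<partial>\<Omega>))
        \<le> exp (f k * \<theta> * T) * ((4 * \<gamma> * (\<sigma> k)\<^sup>2 + f k * \<theta>) * input_energy 0 T + f k * \<theta>)"
        by (rule f[OF k J \<theta> h])
      show "0 \<le> ?S / \<sigma> k" using S \<sigma>_pos[OF k(2)] by simp
    next
      show "(\<Sum>j<J. (\<integral>z. ?L j z \<partial>window J j)) \<le> c1 * (T / real J)"
        using r_less by (intro c1(2) J) auto
    qed (use \<theta> c0 in auto)
    also have "c0 / \<theta> * (c1 * (T / real J)) = c0 * c1 * \<theta>"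
      unfolding h using \<theta> by (simp add: power2_eq_square)
    finally show ?thesis by (simp add: R_def)
  qed
  define th where "th J = sqrt (T / real (Suc J))" for J
  have th0: "th \<longlonglongrightarrow> 0"
    using tendsto_real_sqrt[OF tendsto_divide_0[OF tendsto_const filterlim_compose[OF filterlim_real_at_infinity_sequentially filterlim_Suc], of T]]
    by (simp add: th_def[abs_def])
  have "(\<lambda>J. R (th J)) \<longlonglongrightarrow> (1 + 0) * (\<Sum>k\<in>{r..<n}. ?S / \<sigma> k * (exp (f k * 0 * T) * ((4 * \<gamma> * (\<sigma> k)\<^sup>2 + f k * 0) * input_energy 0 T + f k * 0)))
     + c0 * c1 * 0"
    unfolding R_def by (intro tendsto_intros th0)
  also have "(1 + 0) * (\<Sum>k\<in>{r..<n}. ?S / \<sigma> k * (exp (f k * 0 * T) * ((4 * \<gamma> * (\<sigma> k)\<^sup>2 + f k * 0) * input_energy 0 T + f k * 0)))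
     + c0 * c1 * 0 = (\<Sum>k\<in>{r..<n}. (4 * \<gamma> * ?S * input_energy 0 T) * \<sigma> k)"
  proof -
    have "?S / \<sigma> k * (4 * \<gamma> * (\<sigma> k)\<^sup>2 * input_energy 0 T) = (4 * \<gamma> * ?S * input_energy 0 T) * \<sigma> k" if "k \<in> {r..<n}" for k
      using \<sigma>_pos[of k] that by (simp add: power2_eq_square)
    then show ?thesis by simp
  qed
  also have "\<dots> = 4 * \<gamma> * ?S\<^sup>2 * input_energy 0 T"
    unfolding sum_distrib_left[symmetric] by (simp add: power2_eq_square)
  finally have lim: "(\<lambda>J. R (th J)) \<longlonglongrightarrow> 4 * \<gamma> * ?S\<^sup>2 * input_energy 0 T" .
  have "eventually (\<lambda>J. th J < 1) sequentially" by (rule order_tendstoD(2)[OF th0]) simp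
  then have "eventually (\<lambda>J. (\<integral>z. output_error z \<partial>win 0 T) \<le> R (th J)) sequentially"
  proof eventually_elim
    case (elim J)
    have "0 < th J" "T / real (Suc J) = (th J)\<^sup>2" using T_pos by (simp_all add: th_def)
    then show ?case using elim by (intro bound[of "Suc J"]) auto
  qed
  then show ?thesis by (rule tendsto_lowerbound[OF lim]) simp
qed

end

section \<open>Gramian inequalities as quadratic forms\<close>

lemma scalar_prod_mat_vec:
  fixes W :: "real mat"
  assumes "W \<in> carrier_mat a b" "x \<in> carrier_vec a" "v \<in> carrier_vec b"
  shows "x \<bullet> (W *\<^sub>v v) = (\<Sum>k<a. \<Sum>l<b. x $ k * (W $$ (k, l) * v $ l))"
  using assms by (simp add: scalar_prod_def lessThan_atLeast0 sum_distrib_left)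

lemma scalar_prod_transpose:
  fixes G :: "real mat"
  assumes "G \<in> carrier_mat a b" "x \<in> carrier_vec b" "y \<in> carrier_vec a"
  shows "x \<bullet> (G\<^sup>T *\<^sub>v y) = (G *\<^sub>v x) \<bullet> y"
  using transpose_vec_mult_scalar[of "G\<^sup>T" b a y x] assms by simp

text \<open>
  \<open>P\<^sup>-\<^sup>1\<close> and \<open>Q\<close> are both of the form \<open>Tb\<^sup>T diag(\<delta>) Tb\<close> (\<open>balancing_facts\<close>).
\<close>

lemma congruence_form:
  fixes \<delta> :: "nat \<Rightarrow> real"
  assumes Tb: "Tb \<in> carrier_mat n n" and x: "x \<in> carrier_vec n" and y: "y \<in> carrier_vec n"
  shows "y \<bullet> ((Tb\<^sup>T * mat_diag n \<delta> * Tb) *\<^sub>v x) = (\<Sum>l<n. \<delta> l * ((Tb *\<^sub>v y) $ l * (Tb *\<^sub>v x) $ l))"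
proof -
  let ?t = "Tb *\<^sub>v x"
  have t: "?t \<in> carrier_vec n" using Tb x by simp
  have "(Tb\<^sup>T * mat_diag n \<delta> * Tb) *\<^sub>v x = (Tb\<^sup>T * mat_diag n \<delta>) *\<^sub>v ?t"
    using Tb x by (intro assoc_mult_mat_vec[of _ n n _ n]) auto
  also have "\<dots> = Tb\<^sup>T *\<^sub>v (mat_diag n \<delta> *\<^sub>v ?t)"
    using Tb t by (intro assoc_mult_mat_vec[of _ n n _ n]) auto
  finally have "y \<bullet> ((Tb\<^sup>T * mat_diag n \<delta> * Tb) *\<^sub>v x) = (Tb *\<^sub>v y) \<bullet> (mat_diag n \<delta> *\<^sub>v ?t)"
    using scalar_prod_transpose[OF Tb y, of "mat_diag n \<delta> *\<^sub>v ?t"] mult_mat_vec_carrier[OF mat_diag_dim t] by simp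
  also have "\<dots> = (\<Sum>k<n. \<Sum>l<n. (Tb *\<^sub>v y) $ k * (mat_diag n \<delta> $$ (k, l) * ?t $ l))"
    using Tb y t by (intro scalar_prod_mat_vec) auto
  also have "\<dots> = (\<Sum>k<n. \<Sum>l<n. if l = k then (Tb *\<^sub>v y) $ k * (\<delta> k * ?t $ k) else 0)"
    by (intro sum.cong refl) (auto simp: mat_diag_def)
  also have "\<dots> = (\<Sum>l<n. \<delta> l * ((Tb *\<^sub>v y) $ l * ?t $ l))"
    by (intro sum.cong refl) (simp add: sum.delta mult_ac)
  finally show ?thesis .
qed

lemma minv_of_invertible:
  fixes X :: "real mat"
  assumes X: "X \<in> carrier_mat d d" and det: "det X \<noteq> 0"
  shows "minv X \<in> carrier_mat d d" "X * minv X = 1\<^sub>m d" "minv X * X = 1\<^sub>m d"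
proof -
  obtain Y where Y: "mat_inverse X = Some Y"
    using mat_inverse(1)[OF X, where b="()"] det_non_zero_imp_unit[OF X det, where b="()"] by (cases "mat_inverse X") auto
  show "minv X \<in> carrier_mat d d" "X * minv X = 1\<^sub>m d" "minv X * X = 1\<^sub>m d"
    using mat_inverse(2)[OF X Y] Y by auto
qed

lemma minv_eqI:
  fixes X :: "real mat"
  assumes X: "X \<in> carrier_mat d d" and Y: "Y \<in> carrier_mat d d" and det: "det X \<noteq> 0" and YX: "Y * X = 1\<^sub>m d"
  shows "minv X = Y"
proof -
  note i = minv_of_invertible[OF X det]
  have "Y = Y * (X * minv X)" using i Y by simp
  also have "\<dots> = (Y * X) * minv X" using X Y i by (intro assoc_mult_mat[symmetric, of _ d d _ d _ d]) auto
  also have "\<dots> = minv X" using YX i by simp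
  finally show ?thesis by simp
qed

lemma det_nonzero_of_positive:
  assumes "loewner_less d (0\<^sub>m d d) X"
  shows "det X \<noteq> 0"
proof
  assume 0: "det X = 0"
  have X: "X \<in> carrier_mat d d" using assms by (simp add: loewner_less_def)
  obtain v where v: "v \<in> carrier_vec d" "v \<noteq> 0\<^sub>v d" "X *\<^sub>v v = 0\<^sub>v d"
    using 0 det_0_iff_vec_prod_zero_field[OF X] by auto
  have "X - 0\<^sub>m d d = X" using X by (intro eq_matI) auto
  then have "0 < v \<bullet> (X *\<^sub>v v)" using assms v unfolding loewner_less_def by auto
  with v show False by simp
qed

lemma loewner_lessD:
  assumes "loewner_less d (0\<^sub>m d d) X" "v \<in> carrier_vec d" "v \<noteq> 0\<^sub>v d"
  shows "0 < v \<bullet> (X *\<^sub>v v)"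
proof -
  have "X \<in> carrier_mat d d" using assms by (simp add: loewner_less_def)
  then have "X - 0\<^sub>m d d = X" by (intro eq_matI) auto
  then show ?thesis using assms unfolding loewner_less_def by auto
qed

lemma loewner_le_0D:
  assumes "loewner_le d X (0\<^sub>m d d)" "v \<in> carrier_vec d"
  shows "v \<bullet> (X *\<^sub>v v) \<le> 0"
proof -
  have X: "X \<in> carrier_mat d d" using assms by (simp add: loewner_le_def)
  have "0 \<le> v \<bullet> ((0\<^sub>m d d - X) *\<^sub>v v)" using assms unfolding loewner_le_def by blast
  also have "(0\<^sub>m d d - X) *\<^sub>v v = 0\<^sub>v d - X *\<^sub>v v"
    using X assms(2) by (subst minus_mult_distrib_mat_vec[of _ d d]) auto
  also have "v \<bullet> (0\<^sub>v d - X *\<^sub>v v) = - (v \<bullet> (X *\<^sub>v v))"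
    using X assms(2) by (subst scalar_prod_minus_distrib[of _ d]) auto
  finally show ?thesis by simp
qed

text \<open>
  Complete the square at \<open>v0 = U\<^sup>-\<^sup>1 S\<^sup>T x\<close>, where the left-hand side is maximal in \<open>v\<close>.
\<close>

lemma schur_complement_bound:
  assumes U: "loewner_less m (0\<^sub>m m m) U" and S: "S \<in> carrier_mat n m"
    and x: "x \<in> carrier_vec n" and v: "v \<in> carrier_vec m"
  shows "2 * (x \<bullet> (S *\<^sub>v v)) - v \<bullet> (U *\<^sub>v v) \<le> x \<bullet> ((S * minv U * S\<^sup>T) *\<^sub>v x)"
proof -
  have Uc: "U \<in> carrier_mat m m" and Us: "U\<^sup>T = U" using U by (auto simp: loewner_less_def)
  note i = minv_of_invertible[OF Uc det_nonzero_of_positive[OF U]]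
  define s where "s = S\<^sup>T *\<^sub>v x"
  define v0 where "v0 = minv U *\<^sub>v s"
  have s: "s \<in> carrier_vec m" using S x by (simp add: s_def)
  have v0: "v0 \<in> carrier_vec m" using i s by (simp add: v0_def)
  have Uv0: "U *\<^sub>v v0 = s"
  proof -
    have "U *\<^sub>v v0 = (U * minv U) *\<^sub>v s" unfolding v0_def using Uc i s by (intro assoc_mult_mat_vec[symmetric, of _ m m _ m]) auto
    then show ?thesis using i s by simp
  qed
  have SUS: "x \<bullet> ((S * minv U * S\<^sup>T) *\<^sub>v x) = s \<bullet> v0"
  proof -
    have "(S * minv U * S\<^sup>T) *\<^sub>v x = (S * minv U) *\<^sub>v s"
      unfolding s_def using S i x by (intro assoc_mult_mat_vec[of _ n m _ n]) auto
    also have "\<dots> = S *\<^sub>v v0" unfolding v0_def using S i s by (intro assoc_mult_mat_vec[of _ n m _ m]) auto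
    finally show ?thesis
      using transpose_vec_mult_scalar[OF S v0 x] by (simp add: s_def)
  qed
  have xSv: "x \<bullet> (S *\<^sub>v v) = s \<bullet> v" using transpose_vec_mult_scalar[OF S v x] by (simp add: s_def)
  have "0 \<le> (v - v0) \<bullet> (U *\<^sub>v (v - v0))"
  proof (cases "v - v0 = 0\<^sub>v m")
    case True
    then show ?thesis using Uc by simp
  next
    case False
    then show ?thesis using loewner_lessD[OF U _ False] v v0 by simp
  qed
  also have "U *\<^sub>v (v - v0) = U *\<^sub>v v - s" using Uc v v0 Uv0 by (simp add: mult_minus_distrib_mat_vec)
  also have "(v - v0) \<bullet> (U *\<^sub>v v - s) = v \<bullet> (U *\<^sub>v v) - v \<bullet> s - (v0 \<bullet> (U *\<^sub>v v) - v0 \<bullet> s)"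
    using Uc v v0 s by (simp add: minus_scalar_prod_distrib[of _ m] scalar_prod_minus_distrib[of _ m])
  also have "v0 \<bullet> (U *\<^sub>v v) = s \<bullet> v"
    using transpose_vec_mult_scalar[OF Uc v v0] Us Uv0 by simp
  also have "v \<bullet> s = s \<bullet> v" using v s by (rule comm_scalar_prod)
  also have "v0 \<bullet> s = s \<bullet> v0" using v0 s by (rule comm_scalar_prod)
  finally show ?thesis unfolding SUS xSv by simp
qed

context wiener_process
begin

lemma noise_sum_form:
  assumes X: "X \<in> carrier_mat n n" and G: "\<And>i. i < q \<Longrightarrow> G i \<in> carrier_mat n a"
    and H: "\<And>i. i < q \<Longrightarrow> H i \<in> carrier_mat n b"
    and x: "x \<in> carrier_vec a" and v: "v \<in> carrier_vec b"
  shows "x \<bullet> (noise_sum q K a b G X H *\<^sub>v v) = (\<Sum>i<q. \<Sum>j<q. K $$ (i, j) * ((G i *\<^sub>v x) \<bullet> (X *\<^sub>v (H j *\<^sub>v v))))"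
proof -
  have t: "(G i *\<^sub>v x) \<bullet> (X *\<^sub>v (H j *\<^sub>v v)) = (\<Sum>k<a. \<Sum>l<b. x $ k * (((G i)\<^sup>T * X * H j) $$ (k, l) * v $ l))"
    if ij: "i < q" "j < q" for i j
  proof -
    note G' = G[OF ij(1)] and H' = H[OF ij(2)]
    have "((G i)\<^sup>T * X * H j) *\<^sub>v v = ((G i)\<^sup>T * X) *\<^sub>v (H j *\<^sub>v v)"
      using G' H' X v by (intro assoc_mult_mat_vec[of _ a n _ b]) auto
    also have "\<dots> = (G i)\<^sup>T *\<^sub>v (X *\<^sub>v (H j *\<^sub>v v))"
      using G' H' X v by (intro assoc_mult_mat_vec[of _ a n _ n]) auto
    finally have "(G i *\<^sub>v x) \<bullet> (X *\<^sub>v (H j *\<^sub>v v)) = x \<bullet> (((G i)\<^sup>T * X * H j) *\<^sub>v v)"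
      using scalar_prod_transpose[OF G' x, of "X *\<^sub>v (H j *\<^sub>v v)"] X H' v by simp
    also have "\<dots> = (\<Sum>k<a. \<Sum>l<b. x $ k * (((G i)\<^sup>T * X * H j) $$ (k, l) * v $ l))"
      using G' H' X x v by (intro scalar_prod_mat_vec) auto
    finally show ?thesis .
  qed
  have "x \<bullet> (noise_sum q K a b G X H *\<^sub>v v) = (\<Sum>k<a. \<Sum>l<b. x $ k * (noise_sum q K a b G X H $$ (k, l) * v $ l))"
    using x v by (intro scalar_prod_mat_vec) (auto simp: noise_sum_def)
  also have "\<dots> = (\<Sum>k<a. \<Sum>l<b. \<Sum>i<q. \<Sum>j<q. K $$ (i, j) * (x $ k * (((G i)\<^sup>T * X * H j) $$ (k, l) * v $ l)))"
    by (intro sum.cong refl) (simp add: noise_sum_def sum_distrib_left sum_distrib_right mult_ac)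
  also have "\<dots> = (\<Sum>k<a. \<Sum>i<q. \<Sum>l<b. \<Sum>j<q. K $$ (i, j) * (x $ k * (((G i)\<^sup>T * X * H j) $$ (k, l) * v $ l)))"
    by (intro sum.cong refl sum.swap)
  also have "\<dots> = (\<Sum>i<q. \<Sum>k<a. \<Sum>l<b. \<Sum>j<q. K $$ (i, j) * (x $ k * (((G i)\<^sup>T * X * H j) $$ (k, l) * v $ l)))"
    by (rule sum.swap)
  also have "\<dots> = (\<Sum>i<q. \<Sum>k<a. \<Sum>j<q. \<Sum>l<b. K $$ (i, j) * (x $ k * (((G i)\<^sup>T * X * H j) $$ (k, l) * v $ l)))"
    by (intro sum.cong refl sum.swap)
  also have "\<dots> = (\<Sum>i<q. \<Sum>j<q. \<Sum>k<a. \<Sum>l<b. K $$ (i, j) * (x $ k * (((G i)\<^sup>T * X * H j) $$ (k, l) * v $ l)))"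
    by (intro sum.cong refl sum.swap)
  also have "\<dots> = (\<Sum>i<q. \<Sum>j<q. K $$ (i, j) * ((G i *\<^sub>v x) \<bullet> (X *\<^sub>v (H j *\<^sub>v v))))"
    by (intro sum.cong refl) (simp add: t sum_distrib_left)
  finally show ?thesis .
qed

lemma noise_sum_congruence:
  assumes Tb: "Tb \<in> carrier_mat n n" and G: "\<And>i. i < q \<Longrightarrow> G i \<in> carrier_mat n a"
    and H: "\<And>i. i < q \<Longrightarrow> H i \<in> carrier_mat n b"
    and x: "x \<in> carrier_vec a" and v: "v \<in> carrier_vec b"
  shows "x \<bullet> (noise_sum q K a b G (Tb\<^sup>T * mat_diag n \<delta> * Tb) H *\<^sub>v v)
    = (\<Sum>l<n. \<delta> l * (\<Sum>i<q. \<Sum>j<q. K $$ (i, j) * ((Tb *\<^sub>v (G i *\<^sub>v x)) $ l * (Tb *\<^sub>v (H j *\<^sub>v v)) $ l)))"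
proof -
  let ?X = "Tb\<^sup>T * mat_diag n \<delta> * Tb"
  have X: "?X \<in> carrier_mat n n" using Tb by (intro mult_carrier_mat[of _ n n]) auto
  have "x \<bullet> (noise_sum q K a b G ?X H *\<^sub>v v)
    = (\<Sum>i<q. \<Sum>j<q. K $$ (i, j) * (\<Sum>l<n. \<delta> l * ((Tb *\<^sub>v (G i *\<^sub>v x)) $ l * (Tb *\<^sub>v (H j *\<^sub>v v)) $ l)))"
  proof (subst noise_sum_form[OF X _ _ x v], (simp add: G H)+, intro sum.cong refl)
    fix i j assume "i \<in> {..<q}" "j \<in> {..<q}"
    then have "G i *\<^sub>v x \<in> carrier_vec n" "H j *\<^sub>v v \<in> carrier_vec n" using G[of i] H[of j] x v by auto
    from congruence_form[OF Tb this(2,1), of \<delta>]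
    show "K $$ (i, j) * ((G i *\<^sub>v x) \<bullet> (?X *\<^sub>v (H j *\<^sub>v v)))
       = K $$ (i, j) * (\<Sum>l<n. \<delta> l * ((Tb *\<^sub>v (G i *\<^sub>v x)) $ l * (Tb *\<^sub>v (H j *\<^sub>v v)) $ l))" by simp
  qed
  also have "\<dots> = (\<Sum>i<q. \<Sum>j<q. \<Sum>l<n. \<delta> l * (K $$ (i, j) * ((Tb *\<^sub>v (G i *\<^sub>v x)) $ l * (Tb *\<^sub>v (H j *\<^sub>v v)) $ l)))"
    by (intro sum.cong refl) (simp add: sum_distrib_left mult_ac)
  also have "\<dots> = (\<Sum>i<q. \<Sum>l<n. \<Sum>j<q. \<delta> l * (K $$ (i, j) * ((Tb *\<^sub>v (G i *\<^sub>v x)) $ l * (Tb *\<^sub>v (H j *\<^sub>v v)) $ l)))"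
    by (intro sum.cong refl sum.swap)
  also have "\<dots> = (\<Sum>l<n. \<Sum>i<q. \<Sum>j<q. \<delta> l * (K $$ (i, j) * ((Tb *\<^sub>v (G i *\<^sub>v x)) $ l * (Tb *\<^sub>v (H j *\<^sub>v v)) $ l)))"
    by (rule sum.swap)
  finally show ?thesis by (simp add: sum_distrib_left)
qed

lemma op_L_form:
  assumes dims: "sys_dims n m p q S" and Tb: "Tb \<in> carrier_mat n n" and x: "x \<in> carrier_vec n"
  shows "x \<bullet> (op_L q K n S (Tb\<^sup>T * mat_diag n \<delta> * Tb) *\<^sub>v x)
    = (\<Sum>l<n. \<delta> l * (2 * ((Tb *\<^sub>v x) $ l * (Tb *\<^sub>v (coeff_A S *\<^sub>v x)) $ l)
        + noise_form (\<lambda>i. (Tb *\<^sub>v (coeff_N S i *\<^sub>v x)) $ l)))"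
proof -
  let ?X = "Tb\<^sup>T * mat_diag n \<delta> * Tb" and ?A = "coeff_A S"
  have X: "?X \<in> carrier_mat n n" using Tb by (intro mult_carrier_mat[of _ n n]) auto
  have A: "?A \<in> carrier_mat n n" and N: "\<And>i. i < q \<Longrightarrow> coeff_N S i \<in> carrier_mat n n"
    using dims by (auto simp: sys_dims_def)
  have Ax: "?A *\<^sub>v x \<in> carrier_vec n" and Xx: "?X *\<^sub>v x \<in> carrier_vec n" using A X x by auto
  have ns: "noise_sum q K n n (coeff_N S) ?X (coeff_N S) \<in> carrier_mat n n" by (simp add: noise_sum_def)
  have "op_L q K n S ?X *\<^sub>v x = ?A\<^sup>T *\<^sub>v (?X *\<^sub>v x) + ?X *\<^sub>v (?A *\<^sub>v x) + noise_sum q K n n (coeff_N S) ?X (coeff_N S) *\<^sub>v x"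
  proof -
    have c: "?A\<^sup>T * ?X \<in> carrier_mat n n" "?X * ?A \<in> carrier_mat n n" using A X by auto
    have "op_L q K n S ?X *\<^sub>v x = (?A\<^sup>T * ?X + ?X * ?A) *\<^sub>v x + noise_sum q K n n (coeff_N S) ?X (coeff_N S) *\<^sub>v x"
      unfolding op_L_def using c ns x by (intro add_mult_distrib_mat_vec[of _ n n]) auto
    also have "(?A\<^sup>T * ?X + ?X * ?A) *\<^sub>v x = (?A\<^sup>T * ?X) *\<^sub>v x + (?X * ?A) *\<^sub>v x"
      using c x by (intro add_mult_distrib_mat_vec[of _ n n]) auto
    also have "(?A\<^sup>T * ?X) *\<^sub>v x = ?A\<^sup>T *\<^sub>v (?X *\<^sub>v x)" using A X x by (intro assoc_mult_mat_vec[of _ n n _ n]) auto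
    also have "(?X * ?A) *\<^sub>v x = ?X *\<^sub>v (?A *\<^sub>v x)" using A X x by (intro assoc_mult_mat_vec[of _ n n _ n]) auto
    finally show ?thesis .
  qed
  also have "x \<bullet> (?A\<^sup>T *\<^sub>v (?X *\<^sub>v x) + ?X *\<^sub>v (?A *\<^sub>v x) + noise_sum q K n n (coeff_N S) ?X (coeff_N S) *\<^sub>v x)
    = x \<bullet> (?A\<^sup>T *\<^sub>v (?X *\<^sub>v x)) + x \<bullet> (?X *\<^sub>v (?A *\<^sub>v x)) + x \<bullet> (noise_sum q K n n (coeff_N S) ?X (coeff_N S) *\<^sub>v x)"
  proof -
    have c: "?A\<^sup>T *\<^sub>v (?X *\<^sub>v x) \<in> carrier_vec n" "?X *\<^sub>v (?A *\<^sub>v x) \<in> carrier_vec n"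
      "noise_sum q K n n (coeff_N S) ?X (coeff_N S) *\<^sub>v x \<in> carrier_vec n"
      using A X ns Ax Xx x by auto
    show ?thesis
      using scalar_prod_add_distrib[OF x add_carrier_vec[OF c(1,2)] c(3)] scalar_prod_add_distrib[OF x c(1,2)] by simp
  qed
  also have "x \<bullet> (?A\<^sup>T *\<^sub>v (?X *\<^sub>v x)) = (?A *\<^sub>v x) \<bullet> (?X *\<^sub>v x)" by (rule scalar_prod_transpose[OF A x Xx])
  also have "x \<bullet> (noise_sum q K n n (coeff_N S) ?X (coeff_N S) *\<^sub>v x)
    = (\<Sum>l<n. \<delta> l * (\<Sum>i<q. \<Sum>j<q. K $$ (i, j) * ((Tb *\<^sub>v (coeff_N S i *\<^sub>v x)) $ l * (Tb *\<^sub>v (coeff_N S j *\<^sub>v x)) $ l)))"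
    by (rule noise_sum_congruence[OF Tb _ _ x x]) (auto simp: N)
  finally show ?thesis
    unfolding congruence_form[OF Tb x Ax] congruence_form[OF Tb Ax x]
    by (simp add: sum.distrib[symmetric] noise_form_def algebra_simps)
qed

lemma op_S_form:
  assumes dims: "sys_dims n m p q S" and Tb: "Tb \<in> carrier_mat n n" and x: "x \<in> carrier_vec n" and v: "v \<in> carrier_vec m"
  shows "x \<bullet> (op_S q K n m S (Tb\<^sup>T * mat_diag n \<delta> * Tb) *\<^sub>v v)
    = (\<Sum>l<n. \<delta> l * ((Tb *\<^sub>v x) $ l * (Tb *\<^sub>v (coeff_B S *\<^sub>v v)) $ l
        + (\<Sum>i<q. \<Sum>j<q. K $$ (i, j) * ((Tb *\<^sub>v (coeff_N S i *\<^sub>v x)) $ l * (Tb *\<^sub>v (coeff_M S j *\<^sub>v v)) $ l))))"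
proof -
  let ?X = "Tb\<^sup>T * mat_diag n \<delta> * Tb" and ?B = "coeff_B S"
  have X: "?X \<in> carrier_mat n n" using Tb by (intro mult_carrier_mat[of _ n n]) auto
  have B: "?B \<in> carrier_mat n m" and N: "\<And>i. i < q \<Longrightarrow> coeff_N S i \<in> carrier_mat n n"
    and M: "\<And>i. i < q \<Longrightarrow> coeff_M S i \<in> carrier_mat n m"
    using dims by (auto simp: sys_dims_def)
  have Bv: "?B *\<^sub>v v \<in> carrier_vec n" using B v by auto
  have ns: "noise_sum q K n m (coeff_N S) ?X (coeff_M S) \<in> carrier_mat n m" by (simp add: noise_sum_def)
  have "op_S q K n m S ?X *\<^sub>v v = (?X * ?B) *\<^sub>v v + noise_sum q K n m (coeff_N S) ?X (coeff_M S) *\<^sub>v v"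
    unfolding op_S_def using X B ns v by (intro add_mult_distrib_mat_vec[of _ n m]) auto
  also have "(?X * ?B) *\<^sub>v v = ?X *\<^sub>v (?B *\<^sub>v v)" using B X v by (intro assoc_mult_mat_vec[of _ n n _ m]) auto
  also have "x \<bullet> (?X *\<^sub>v (?B *\<^sub>v v) + noise_sum q K n m (coeff_N S) ?X (coeff_M S) *\<^sub>v v)
     = x \<bullet> (?X *\<^sub>v (?B *\<^sub>v v)) + x \<bullet> (noise_sum q K n m (coeff_N S) ?X (coeff_M S) *\<^sub>v v)"
    using X Bv ns v x by (intro scalar_prod_add_distrib[of _ n]) auto
  also have "x \<bullet> (noise_sum q K n m (coeff_N S) ?X (coeff_M S) *\<^sub>v v)
    = (\<Sum>l<n. \<delta> l * (\<Sum>i<q. \<Sum>j<q. K $$ (i, j) * ((Tb *\<^sub>v (coeff_N S i *\<^sub>v x)) $ l * (Tb *\<^sub>v (coeff_M S j *\<^sub>v v)) $ l)))"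
    by (rule noise_sum_congruence[OF Tb _ _ x v]) (auto simp: N M)
  finally show ?thesis
    unfolding congruence_form[OF Tb Bv x]
    by (simp add: sum.distrib[symmetric] distrib_left)
qed

lemma op_U_form:
  assumes dims: "sys_dims n m p q S" and Tb: "Tb \<in> carrier_mat n n" and v: "v \<in> carrier_vec m"
  shows "v \<bullet> (op_U q K m \<gamma> S (Tb\<^sup>T * mat_diag n \<delta> * Tb) *\<^sub>v v)
    = \<gamma> * (v \<bullet> v) - (\<Sum>l<n. \<delta> l * noise_form (\<lambda>i. (Tb *\<^sub>v (coeff_M S i *\<^sub>v v)) $ l))"
proof -
  let ?X = "Tb\<^sup>T * mat_diag n \<delta> * Tb"
  have M: "\<And>i. i < q \<Longrightarrow> coeff_M S i \<in> carrier_mat n m" using dims by (auto simp: sys_dims_def)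
  have ns: "noise_sum q K m m (coeff_M S) ?X (coeff_M S) \<in> carrier_mat m m" by (simp add: noise_sum_def)
  have "op_U q K m \<gamma> S ?X *\<^sub>v v = (\<gamma> \<cdot>\<^sub>m 1\<^sub>m m) *\<^sub>v v - noise_sum q K m m (coeff_M S) ?X (coeff_M S) *\<^sub>v v"
    unfolding op_U_def using ns v by (intro minus_mult_distrib_mat_vec[of _ m m]) auto
  also have "(\<gamma> \<cdot>\<^sub>m 1\<^sub>m m) *\<^sub>v v = \<gamma> \<cdot>\<^sub>v v" using v by (intro eq_vecI) (auto simp: scalar_prod_def if_distrib[of "\<lambda>x. _ * x * _"] sum.delta cong: if_cong)
  also have "v \<bullet> (\<gamma> \<cdot>\<^sub>v v - noise_sum q K m m (coeff_M S) ?X (coeff_M S) *\<^sub>v v)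
    = v \<bullet> (\<gamma> \<cdot>\<^sub>v v) - v \<bullet> (noise_sum q K m m (coeff_M S) ?X (coeff_M S) *\<^sub>v v)"
    using ns v by (intro scalar_prod_minus_distrib[of _ m]) auto
  also have "v \<bullet> (noise_sum q K m m (coeff_M S) ?X (coeff_M S) *\<^sub>v v)
    = (\<Sum>l<n. \<delta> l * (\<Sum>i<q. \<Sum>j<q. K $$ (i, j) * ((Tb *\<^sub>v (coeff_M S i *\<^sub>v v)) $ l * (Tb *\<^sub>v (coeff_M S j *\<^sub>v v)) $ l)))"
    by (rule noise_sum_congruence[OF Tb _ _ v v]) (auto simp: M)
  finally show ?thesis using v by (simp add: noise_form_def)
qed

lemma noise_form_add:
  "noise_form (\<lambda>i. b i + d i) = noise_form b + 2 * (\<Sum>i<q. \<Sum>j<q. K $$ (i, j) * (b i * d j)) + noise_form d"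
proof -
  have "(\<Sum>i<q. \<Sum>j<q. K $$ (i, j) * (d i * b j)) = (\<Sum>j<q. \<Sum>i<q. K $$ (i, j) * (d i * b j))" by (rule sum.swap)
  also have "\<dots> = (\<Sum>i<q. \<Sum>j<q. K $$ (i, j) * (b i * d j))"
    using K_symmetric by (intro sum.cong refl) (simp add: mult_ac)
  finally have "(\<Sum>i<q. \<Sum>j<q. K $$ (i, j) * (b i * d j + d i * b j)) = 2 * (\<Sum>i<q. \<Sum>j<q. K $$ (i, j) * (b i * d j))"
    by (simp add: distrib_left sum.distrib)
  then show ?thesis using noise_form_combination[of 1 b 1 d] by simp
qed

text \<open>
  By the Schur complement bound the Gramian inequality implies \<open>x\<^sup>T L x + 2 x\<^sup>T S v - v\<^sup>T U v \<le> 0\<close> for all \<open>v\<close>; the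
  noise parts of the three operators combine into one noise form of \<open>N\<^sub>i x + M\<^sub>i v\<close>.
\<close>

lemma reachability_form:
  assumes dims: "sys_dims n m p q S" and Tb: "Tb \<in> carrier_mat n n"
    and inv: "minv P = Tb\<^sup>T * mat_diag n \<delta> * Tb" and gram: "reachability_gramian q K n m \<gamma> S P"
    and x: "x \<in> carrier_vec n" and v: "v \<in> carrier_vec m"
  shows "(\<Sum>l<n. \<delta> l * (2 * ((Tb *\<^sub>v x) $ l * (Tb *\<^sub>v (coeff_A S *\<^sub>v x + coeff_B S *\<^sub>v v)) $ l)
        + noise_form (\<lambda>i. (Tb *\<^sub>v (coeff_N S i *\<^sub>v x + coeff_M S i *\<^sub>v v)) $ l))) \<le> \<gamma> * (v \<bullet> v)"
proof -
  let ?X = "Tb\<^sup>T * mat_diag n \<delta> * Tb"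
  let ?L = "op_L q K n S ?X" and ?S = "op_S q K n m S ?X" and ?U = "op_U q K m \<gamma> S ?X"
  have U: "loewner_less m (0\<^sub>m m m) ?U" and R: "loewner_le n (?L + ?S * minv ?U * ?S\<^sup>T) (0\<^sub>m n n)"
    using gram by (simp_all add: reachability_gramian_def inv)
  have X: "?X \<in> carrier_mat n n" using Tb by (intro mult_carrier_mat[of _ n n]) auto
  have coeffs: "coeff_A S \<in> carrier_mat n n" "coeff_B S \<in> carrier_mat n m"
    "\<And>i. i < q \<Longrightarrow> coeff_N S i \<in> carrier_mat n n" "\<And>i. i < q \<Longrightarrow> coeff_M S i \<in> carrier_mat n m"
    using dims by (auto simp: sys_dims_def)
  have L: "?L \<in> carrier_mat n n" using coeffs X by (simp add: op_L_def noise_sum_def)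
  have S: "?S \<in> carrier_mat n m" using coeffs X by (simp add: op_S_def noise_sum_def)
  have Uc: "?U \<in> carrier_mat m m" using U by (simp add: loewner_less_def)
  note Ui = minv_of_invertible[OF Uc det_nonzero_of_positive[OF U]]
  have c: "?S * minv ?U * ?S\<^sup>T \<in> carrier_mat n n" using S Ui by (intro mult_carrier_mat[of _ n m]) auto
  have "x \<bullet> (?L *\<^sub>v x) + x \<bullet> ((?S * minv ?U * ?S\<^sup>T) *\<^sub>v x) = x \<bullet> ((?L + ?S * minv ?U * ?S\<^sup>T) *\<^sub>v x)"
    using L c x by (simp add: add_mult_distrib_mat_vec[of _ n n] scalar_prod_add_distrib[of _ n])
  also have "\<dots> \<le> 0" by (rule loewner_le_0D[OF R x])
  finally have "x \<bullet> (?L *\<^sub>v x) + 2 * (x \<bullet> (?S *\<^sub>v v)) - v \<bullet> (?U *\<^sub>v v) \<le> 0"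
    using schur_complement_bound[OF U S x v] by linarith
  note main = this
  have ab: "(Tb *\<^sub>v (coeff_A S *\<^sub>v x + coeff_B S *\<^sub>v v)) $ l = (Tb *\<^sub>v (coeff_A S *\<^sub>v x)) $ l + (Tb *\<^sub>v (coeff_B S *\<^sub>v v)) $ l"
    if "l < n" for l
    using Tb coeffs x v that by (subst mult_add_distrib_mat_vec[of _ n n]) auto
  have nm: "noise_form (\<lambda>i. (Tb *\<^sub>v (coeff_N S i *\<^sub>v x + coeff_M S i *\<^sub>v v)) $ l)
      = noise_form (\<lambda>i. (Tb *\<^sub>v (coeff_N S i *\<^sub>v x)) $ l + (Tb *\<^sub>v (coeff_M S i *\<^sub>v v)) $ l)" if "l < n" for l
    unfolding noise_form_def
  proof (intro sum.cong refl)
    fix i j assume "i \<in> {..<q}" "j \<in> {..<q}"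
    then have ij: "i < q" "j < q" by auto
    have "(Tb *\<^sub>v (coeff_N S i *\<^sub>v x + coeff_M S i *\<^sub>v v)) $ l = (Tb *\<^sub>v (coeff_N S i *\<^sub>v x)) $ l + (Tb *\<^sub>v (coeff_M S i *\<^sub>v v)) $ l"
      if "i < q" for i
      using Tb coeffs(3,4)[OF that] x v \<open>l < n\<close> by (subst mult_add_distrib_mat_vec[of _ n n]) auto
    then show "K $$ (i, j) * ((Tb *\<^sub>v (coeff_N S i *\<^sub>v x + coeff_M S i *\<^sub>v v)) $ l * (Tb *\<^sub>v (coeff_N S j *\<^sub>v x + coeff_M S j *\<^sub>v v)) $ l)
      = K $$ (i, j) * (((Tb *\<^sub>v (coeff_N S i *\<^sub>v x)) $ l + (Tb *\<^sub>v (coeff_M S i *\<^sub>v v)) $ l)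
         * ((Tb *\<^sub>v (coeff_N S j *\<^sub>v x)) $ l + (Tb *\<^sub>v (coeff_M S j *\<^sub>v v)) $ l))"
      using ij by simp
  qed
  have nm': "noise_form (\<lambda>i. (Tb *\<^sub>v (coeff_N S i *\<^sub>v x + coeff_M S i *\<^sub>v v)) $ l)
      = noise_form (\<lambda>i. (Tb *\<^sub>v (coeff_N S i *\<^sub>v x)) $ l)
        + 2 * (\<Sum>i<q. \<Sum>j<q. K $$ (i, j) * ((Tb *\<^sub>v (coeff_N S i *\<^sub>v x)) $ l * (Tb *\<^sub>v (coeff_M S j *\<^sub>v v)) $ l))
        + noise_form (\<lambda>i. (Tb *\<^sub>v (coeff_M S i *\<^sub>v v)) $ l)" if "l < n" for l
    unfolding nm[OF that] by (rule noise_form_add)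
  have "(\<Sum>l<n. \<delta> l * (2 * ((Tb *\<^sub>v x) $ l * (Tb *\<^sub>v (coeff_A S *\<^sub>v x + coeff_B S *\<^sub>v v)) $ l)
        + noise_form (\<lambda>i. (Tb *\<^sub>v (coeff_N S i *\<^sub>v x + coeff_M S i *\<^sub>v v)) $ l)))
    = x \<bullet> (?L *\<^sub>v x) + 2 * (x \<bullet> (?S *\<^sub>v v)) + (\<Sum>l<n. \<delta> l * noise_form (\<lambda>i. (Tb *\<^sub>v (coeff_M S i *\<^sub>v v)) $ l))"
    unfolding op_L_form[OF dims Tb x] op_S_form[OF dims Tb x v]
    unfolding sum_distrib_left[of 2 _ "{..<n}"] sum.distrib[symmetric]
    by (intro sum.cong refl) (simp only: ab nm' lessThan_iff distrib_left mult.assoc mult.left_commute[of 2] add_ac)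
  with main show ?thesis unfolding op_U_form[OF dims Tb v] by linarith
qed

lemma observability_form:
  assumes dims: "sys_dims n m p q S" and Tb: "Tb \<in> carrier_mat n n"
    and Q: "Q = Tb\<^sup>T * mat_diag n \<delta> * Tb" and gram: "observability_gramian q K n S Q"
    and x: "x \<in> carrier_vec n"
  shows "(\<Sum>l<n. \<delta> l * (2 * ((Tb *\<^sub>v x) $ l * (Tb *\<^sub>v (coeff_A S *\<^sub>v x)) $ l)
        + noise_form (\<lambda>i. (Tb *\<^sub>v (coeff_N S i *\<^sub>v x)) $ l))) + (coeff_C S *\<^sub>v x) \<bullet> (coeff_C S *\<^sub>v x) \<le> 0"
proof -
  let ?L = "op_L q K n S Q" and ?C = "coeff_C S"
  have X: "Q \<in> carrier_mat n n" unfolding Q using Tb by (intro mult_carrier_mat[of _ n n]) auto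
  have C: "?C \<in> carrier_mat p n" "coeff_A S \<in> carrier_mat n n" using dims by (auto simp: sys_dims_def)
  have L: "?L \<in> carrier_mat n n" using C X by (simp add: op_L_def noise_sum_def)
  have "x \<bullet> ((?C\<^sup>T * ?C) *\<^sub>v x) = (?C *\<^sub>v x) \<bullet> (?C *\<^sub>v x)"
    using scalar_prod_transpose[OF C(1) x, of "?C *\<^sub>v x"] C x by (simp add: assoc_mult_mat_vec[of _ n p _ n])
  then have "x \<bullet> (?L *\<^sub>v x) + (?C *\<^sub>v x) \<bullet> (?C *\<^sub>v x) = x \<bullet> ((?L + ?C\<^sup>T * ?C) *\<^sub>v x)"
    using L C x by (simp add: add_mult_distrib_mat_vec[of _ n n] scalar_prod_add_distrib[of _ n])
  also have "\<dots> \<le> 0" using gram by (intro loewner_le_0D[OF _ x]) (simp add: observability_gramian_def)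
  finally show ?thesis unfolding Q op_L_form[OF dims Tb x] .
qed

end

text \<open>
  \<open>\<sigma> l\<close> is the value of the positive definite form \<open>P\<close> at \<open>Tb\<^sup>T e\<^sub>l\<close>, hence positive.
\<close>

lemma balancing_facts:
  assumes bal: "balancing n P Q \<sigma> Tb" and P: "loewner_less n (0\<^sub>m n n) P" and Q: "Q \<in> carrier_mat n n"
  shows "minv Tb \<in> carrier_mat n n" "Tb * minv Tb = 1\<^sub>m n" "minv Tb * Tb = 1\<^sub>m n"
    and "l < n \<Longrightarrow> 0 < \<sigma> l"
    and "minv P = Tb\<^sup>T * mat_diag n (\<lambda>l. 1 / \<sigma> l) * Tb" and "Q = Tb\<^sup>T * mat_diag n \<sigma> * Tb"
proof -
  have Tb: "Tb \<in> carrier_mat n n" and bP: "Tb * P * Tb\<^sup>T = mat_diag n \<sigma>"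
    and bQ: "(minv Tb)\<^sup>T * Q * minv Tb = mat_diag n \<sigma>"
    using bal by (auto simp: balancing_def)
  have Pc: "P \<in> carrier_mat n n" using P by (simp add: loewner_less_def)
  obtain Y where Y: "Tb * Y = 1\<^sub>m (dim_row Tb)" "Y * Tb = 1\<^sub>m (dim_row Y)"
    using bal by (auto simp: balancing_def invertible_mat_def inverts_mat_def)
  have Yc: "Y \<in> carrier_mat n n"
    using arg_cong[OF Y(1), of dim_col] arg_cong[OF Y(2), of dim_col] Tb by auto
  have "det Tb * det Y = 1" using det_mult[OF Tb Yc] Y(1) Tb by simp
  then have "det Tb \<noteq> 0" by auto
  note Ti = minv_of_invertible[OF Tb this]
  then show "minv Tb \<in> carrier_mat n n" "Tb * minv Tb = 1\<^sub>m n" "minv Tb * Tb = 1\<^sub>m n" by auto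
  let ?Ti = "minv Tb"
  have TT: "?Ti\<^sup>T * Tb\<^sup>T = 1\<^sub>m n" "Tb\<^sup>T * ?Ti\<^sup>T = 1\<^sub>m n"
    unfolding transpose_mult[OF Tb Ti(1), symmetric] transpose_mult[OF Ti(1) Tb, symmetric] Ti(2,3) by simp_all
  have Tbt: "Tb\<^sup>T \<in> carrier_mat n n" "?Ti\<^sup>T \<in> carrier_mat n n" using Tb Ti(1) by auto
  note am = assoc_mult_mat[of _ n n _ n _ n] and mc = mult_carrier_mat[of _ n n _ n]
  show pos: "0 < \<sigma> l" if l: "l < n" for l
  proof -
    let ?e = "unit_vec n l :: real vec"
    let ?v = "Tb\<^sup>T *\<^sub>v ?e"
    have v: "?v \<in> carrier_vec n" using Tbt by simp
    have "?v \<noteq> 0\<^sub>v n"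
    proof
      assume 0: "?v = 0\<^sub>v n"
      have "?e = (?Ti\<^sup>T * Tb\<^sup>T) *\<^sub>v ?e" using TT by simp
      also have "\<dots> = ?Ti\<^sup>T *\<^sub>v ?v" using Tbt by (intro assoc_mult_mat_vec[of _ n n _ n]) auto
      also have "\<dots> = 0\<^sub>v n" unfolding 0 using Tbt by (intro eq_vecI) auto
      finally show False using l by (simp add: unit_vec_nonzero)
    qed
    then have "0 < ?v \<bullet> (P *\<^sub>v ?v)" using loewner_lessD[OF P v] by simp
    also have "?v \<bullet> (P *\<^sub>v ?v) = ?e \<bullet> (Tb *\<^sub>v (P *\<^sub>v ?v))"
      using Pc v by (intro transpose_vec_mult_scalar[OF Tb]) auto
    also have "Tb *\<^sub>v (P *\<^sub>v ?v) = (Tb * P * Tb\<^sup>T) *\<^sub>v ?e"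
      using Tb Pc Tbt by (simp add: assoc_mult_mat_vec[of _ n n _ n])
    also have "?e \<bullet> ((Tb * P * Tb\<^sup>T) *\<^sub>v ?e) = \<sigma> l"
    proof -
      have c: "mat_diag n \<sigma> *\<^sub>v ?e \<in> carrier_vec n" by (rule mult_mat_vec_carrier[OF mat_diag_dim]) simp
      show ?thesis unfolding bP scalar_prod_left_unit[OF c l] using l by (simp add: mat_diag_def)
    qed
    finally show ?thesis .
  qed
  let ?Di = "mat_diag n (\<lambda>l. 1 / \<sigma> l) :: real mat"
  have DD: "?Di * mat_diag n \<sigma> = 1\<^sub>m n"
  proof -
    have "\<sigma> l \<noteq> 0" if "l < n" for l using pos[OF that] by simp
    then show ?thesis unfolding mat_diag_diag by (intro eq_matI) (auto simp: mat_diag_def)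
  qed
  let ?Y = "Tb\<^sup>T * ?Di * Tb"
  have Dc: "?Di \<in> carrier_mat n n" "mat_diag n \<sigma> \<in> carrier_mat n n" by auto
  have "?Y * P = 1\<^sub>m n"
  proof -
    have "?Y * P = ?Y * P * (Tb\<^sup>T * ?Ti\<^sup>T)" using TT Tb Pc Tbt Dc by simp
    also have "\<dots> = Tb\<^sup>T * (?Di * (Tb * P * Tb\<^sup>T)) * ?Ti\<^sup>T"
      using Tb Pc Tbt Dc by (simp add: am mc)
    also have "\<dots> = 1\<^sub>m n" unfolding bP DD using Tbt TT by simp
    finally show ?thesis .
  qed
  moreover have "?Y \<in> carrier_mat n n" using Tb Tbt Dc by (intro mc) auto
  ultimately show "minv P = ?Y"
    using Pc by (intro minv_eqI[of _ n] det_nonzero_of_positive[OF P])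
  have "Tb\<^sup>T * mat_diag n \<sigma> * Tb = (Tb\<^sup>T * ?Ti\<^sup>T) * Q * (?Ti * Tb)"
    unfolding bQ[symmetric] using Tb Tbt Ti(1) Q by (simp add: am mc)
  then show "Q = Tb\<^sup>T * mat_diag n \<sigma> * Tb" using TT Ti Q by simp
qed

section \<open>The error bound\<close>

lemma mat_mult_entry:
  fixes G :: "real mat"
  assumes "G \<in> carrier_mat a b" "H \<in> carrier_mat b c" "l < a" "k < c"
  shows "(G * H) $$ (l, k) = (\<Sum>j<b. G $$ (l, j) * H $$ (j, k))"
  using assms by (simp add: scalar_prod_def lessThan_atLeast0)

lemma mat_mult_sum:
  fixes G :: "real mat"
  assumes G: "G \<in> carrier_mat a b" and H: "H \<in> carrier_mat b c" and l: "l < a"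
  shows "(\<Sum>j<b. G $$ (l, j) * (\<Sum>k<c. H $$ (j, k) * x k)) = (\<Sum>k<c. (G * H) $$ (l, k) * x k)"
proof -
  have "(\<Sum>j<b. G $$ (l, j) * (\<Sum>k<c. H $$ (j, k) * x k)) = (\<Sum>j<b. \<Sum>k<c. G $$ (l, j) * H $$ (j, k) * x k)"
    by (simp add: sum_distrib_left mult.assoc)
  also have "\<dots> = (\<Sum>k<c. \<Sum>j<b. G $$ (l, j) * H $$ (j, k) * x k)" by (rule sum.swap)
  also have "\<dots> = (\<Sum>k<c. (G * H) $$ (l, k) * x k)"
    by (intro sum.cong refl) (simp only: mat_mult_entry[OF G H l] lessThan_iff sum_distrib_right)
  finally show ?thesis .
qed

lemma mat_vec_vec:
  fixes G :: "real mat"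
  assumes "G \<in> carrier_mat a b" "l < a"
  shows "(G *\<^sub>v vec b z) $ l = (\<Sum>c<b. G $$ (l, c) * z c)"
  using assms by (simp add: scalar_prod_def lessThan_atLeast0)

theorem theorem3p9:
  fixes \<Omega> :: "'w measure" and F :: "real \<Rightarrow> 'w measure"
    and w :: "nat \<Rightarrow> real \<Rightarrow> 'w \<Rightarrow> real" and K :: "real mat"
    and n m p q r :: nat and S :: stoch_sys
    and \<gamma> T :: real and P Q Tb :: "real mat" and \<sigma> :: "nat \<Rightarrow> real"
    and u x x\<^sub>r y y\<^sub>r :: "real \<Rightarrow> 'w \<Rightarrow> real vec"
  assumes "wiener_process \<Omega> F q K w"
    and "sys_dims n m p q S"
    and "ms_asymptotically_stable \<Omega> F q w n m S"
    and "0 < \<gamma>"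
    and "reachability_gramian q K n m \<gamma> S P"
    and "observability_gramian q K n S Q"
    and "hankel_singular_values n P Q \<sigma>"
    and "balancing n P Q \<sigma> Tb"
    and "r < n"
    and "\<forall>i<r. \<forall>j\<in>{r..<n}. \<sigma> j \<le> \<sigma> i"
    and "0 < T"
    and "u \<in> L2T \<Omega> F m T"
    and "sde_solution \<Omega> F q w n S T (0\<^sub>v n) u x"
    and "y = sys_output S u x"
    and "sde_solution \<Omega> F q w r (truncate_sys r m p (transform_sys Tb S)) T (0\<^sub>v r) u x\<^sub>r"
    and "y\<^sub>r = sys_output (truncate_sys r m p (transform_sys Tb S)) u x\<^sub>r"
  shows "L2T_norm \<Omega> T (\<lambda>t \<omega>. y t \<omega> - y\<^sub>r t \<omega>)
           \<le> ennreal (2 * sqrt \<gamma> * (\<Sum>k\<in>{r..<n}. \<sigma> k)) * L2T_norm \<Omega> T u"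
proof -
  interpret W: wiener_process \<Omega> F q K w by fact
  note dims = assms(2) and u = assms(12) and T = assms(11) and rn = assms(9)
  let ?S' = "transform_sys Tb S" and ?Ti = "minv Tb"
  let ?Sr = "truncate_sys r m p ?S'"
  have P: "loewner_less n (0\<^sub>m n n) P" using assms(5) by (simp add: reachability_gramian_def)
  have Qc: "Q \<in> carrier_mat n n" using assms(6) by (simp add: observability_gramian_def loewner_le_def)
  note bal = balancing_facts[OF assms(8) P Qc]
  have Tb: "Tb \<in> carrier_mat n n" using assms(8) by (simp add: balancing_def)
  have c: "coeff_A S \<in> carrier_mat n n" "coeff_B S \<in> carrier_mat n m"
    "\<And>i. i < q \<Longrightarrow> coeff_N S i \<in> carrier_mat n n" "\<And>i. i < q \<Longrightarrow> coeff_M S i \<in> carrier_mat n m"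
    "coeff_C S \<in> carrier_mat p n" "coeff_D S \<in> carrier_mat p m"
    using dims by (auto simp: sys_dims_def)
  have c': "coeff_A ?S' = Tb * coeff_A S * ?Ti" "coeff_B ?S' = Tb * coeff_B S"
    "\<And>i. coeff_N ?S' i = Tb * coeff_N S i * ?Ti" "\<And>i. coeff_M ?S' i = Tb * coeff_M S i"
    "coeff_C ?S' = coeff_C S * ?Ti"
    by (simp_all add: transform_sys_def)
  have Ti: "?Ti \<in> carrier_mat n n" by (rule bal(1))
  have cc: "coeff_A ?S' \<in> carrier_mat n n" "coeff_B ?S' \<in> carrier_mat n m"
    "\<And>i. i < q \<Longrightarrow> coeff_N ?S' i \<in> carrier_mat n n" "\<And>i. i < q \<Longrightarrow> coeff_M ?S' i \<in> carrier_mat n m"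
    "coeff_C ?S' \<in> carrier_mat p n"
    unfolding c' using c Tb Ti by auto
  have conj: "Tb * G = (Tb * G * ?Ti) * Tb" if G: "G \<in> carrier_mat n n" for G
  proof -
    have "(Tb * G * ?Ti) * Tb = Tb * G * (?Ti * Tb)"
      using Tb Ti G by (intro assoc_mult_mat[of _ n n _ n _ n]) auto
    then show ?thesis using bal(3) Tb G by simp
  qed
  have out: "coeff_C ?S' * Tb = coeff_C S"
  proof -
    have "(coeff_C S * ?Ti) * Tb = coeff_C S * (?Ti * Tb)"
      using Tb Ti c(5) by (intro assoc_mult_mat[of _ p n _ n _ n]) auto
    then show ?thesis using bal(3) c(5) by (simp add: c')
  qed
  define A where "A l k = coeff_A ?S' $$ (l, k)" for l k
  define B where "B l k = coeff_B ?S' $$ (l, k)" for l k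
  define N where "N i l k = coeff_N ?S' i $$ (l, k)" for i l k
  define M where "M i l k = coeff_M ?S' i $$ (l, k)" for i l k
  define C where "C l k = coeff_C ?S' $$ (l, k)" for l k
  define U where "U k = W.ext T (\<lambda>t \<omega>. u t \<omega> $ k)" for k
  define X0 where "X0 k = W.ext T (\<lambda>t \<omega>. x t \<omega> $ k)" for k
  define X where "X l z = (\<Sum>k<n. Tb $$ (l, k) * X0 k z)" for l z
  define Xr where "Xr k = W.ext T (\<lambda>t \<omega>. x\<^sub>r t \<omega> $ k)" for k
  have U_sq: "sq_int (W.win 0 T) (U k)" if "k < m" for k
    unfolding U_def by (rule W.L2T_sq_int[OF u that])
  interpret L: linear_system \<Omega> F q K w n m A B N M T U
    by unfold_locales (use T U_sq in auto)
  have solX: "L.solution n X"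
  proof -
    have d0: "W.ito_dynamics T n X0
      (\<lambda>z l. (\<Sum>k<n. coeff_A S $$ (l, k) * X0 k z) + (\<Sum>k<m. coeff_B S $$ (l, k) * U k z))
      (\<lambda>z i l. (\<Sum>k<n. coeff_N S i $$ (l, k) * X0 k z) + (\<Sum>k<m. coeff_M S i $$ (l, k) * U k z))"
      using W.sde_dynamics[OF assms(13) u T c(1,2)] c(3,4) unfolding X0_def U_def by blast
    have sX0: "sq_int (W.win 0 T) (X0 k)" if "k < n" for k using d0 that by (simp add: W.ito_dynamics_def)
    have "sq_int (W.win 0 T) (\<lambda>z. (\<Sum>k<n. coeff_A S $$ (l, k) * X0 k z) + (\<Sum>k<m. coeff_B S $$ (l, k) * U k z))" for l
      by (intro sq_int_add sq_int_sum sq_int_cmult sX0 U_sq) auto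
    note d1 = W.ito_dynamics_transform[OF d0 this, of "\<lambda>l k. Tb $$ (l, k)", folded X_def]
    show ?thesis unfolding L.solution_eq
    proof (rule W.ito_dynamics_cong[OF d1])
      fix z l assume l: "l < n"
      have "(\<Sum>k<n. Tb $$ (l, k) * (\<Sum>j<n. coeff_A S $$ (k, j) * X0 j z)) = (\<Sum>k<n. A l k * X k z)"
        unfolding X_def A_def mat_mult_sum[OF Tb c(1) l] mat_mult_sum[OF cc(1) Tb l] unfolding c' conj[OF c(1), symmetric] ..
      moreover have "(\<Sum>k<n. Tb $$ (l, k) * (\<Sum>j<m. coeff_B S $$ (k, j) * U j z)) = (\<Sum>k<m. B l k * U k z)"
        unfolding B_def mat_mult_sum[OF Tb c(2) l] c' ..
      ultimately show "L.rate n (\<lambda>c. X c z) (\<lambda>c. U c z) l = (\<Sum>k<n. Tb $$ (l, k)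
          * ((\<Sum>j<n. coeff_A S $$ (k, j) * X0 j z) + (\<Sum>j<m. coeff_B S $$ (k, j) * U j z)))"
        by (simp add: L.rate_def distrib_left sum.distrib)
      fix i assume i: "i < q"
      have "(\<Sum>k<n. Tb $$ (l, k) * (\<Sum>j<n. coeff_N S i $$ (k, j) * X0 j z)) = (\<Sum>k<n. N i l k * X k z)"
        unfolding X_def N_def mat_mult_sum[OF Tb c(3)[OF i] l] mat_mult_sum[OF cc(3)[OF i] Tb l] unfolding c' conj[OF c(3)[OF i], symmetric] ..
      moreover have "(\<Sum>k<n. Tb $$ (l, k) * (\<Sum>j<m. coeff_M S i $$ (k, j) * U j z)) = (\<Sum>k<m. M i l k * U k z)"
        unfolding M_def mat_mult_sum[OF Tb c(4)[OF i] l] c' ..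
      ultimately show "L.vol n (\<lambda>c. X c z) (\<lambda>c. U c z) i l = (\<Sum>k<n. Tb $$ (l, k)
          * ((\<Sum>j<n. coeff_N S i $$ (k, j) * X0 j z) + (\<Sum>j<m. coeff_M S i $$ (k, j) * U j z)))"
        by (simp add: L.vol_def distrib_left sum.distrib)
    qed
  qed
  have solXr: "L.solution r Xr"
  proof -
    have cr: "coeff_A ?Sr \<in> carrier_mat r r" "coeff_B ?Sr \<in> carrier_mat r m"
      "coeff_N ?Sr i \<in> carrier_mat r r" "coeff_M ?Sr i \<in> carrier_mat r m" for i
      by (simp_all add: truncate_sys_def upper_left_def)
    note d = W.sde_dynamics[OF assms(15) u T cr, folded Xr_def U_def]
    show ?thesis unfolding L.solution_eq
      by (rule W.ito_dynamics_cong[OF d])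
        (simp_all add: L.rate_def L.vol_def A_def B_def N_def M_def truncate_sys_def upper_left_def)
  qed
  have coord: "(Tb *\<^sub>v (?Ti *\<^sub>v vec n z)) $ l = z l" if "l < n" for z l
  proof -
    have "Tb *\<^sub>v (?Ti *\<^sub>v vec n z) = (Tb * ?Ti) *\<^sub>v vec n z"
      using Tb Ti by (intro assoc_mult_mat_vec[symmetric, of _ n n _ n]) auto
    then show ?thesis using bal(2) that by simp
  qed
  have state: "(Tb *\<^sub>v (G *\<^sub>v (?Ti *\<^sub>v vec n z))) $ l = (\<Sum>k<n. (Tb * G * ?Ti) $$ (l, k) * z k)"
    if G: "G \<in> carrier_mat n n" and l: "l < n" for G z l
  proof -
    have "Tb *\<^sub>v (G *\<^sub>v (?Ti *\<^sub>v vec n z)) = (Tb * G) *\<^sub>v (?Ti *\<^sub>v vec n z)"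
      using Tb Ti G by (intro assoc_mult_mat_vec[symmetric, of _ n n _ n]) auto
    also have "\<dots> = (Tb * G * ?Ti) *\<^sub>v vec n z"
      using Tb Ti G by (intro assoc_mult_mat_vec[symmetric, of _ n n _ n]) auto
    finally show ?thesis using Tb Ti G l by (simp only: mat_vec_vec[of "Tb * G * ?Ti" n n] mult_carrier_mat[of _ n n])
  qed
  have input: "(Tb *\<^sub>v (G *\<^sub>v vec m v)) $ l = (\<Sum>k<m. (Tb * G) $$ (l, k) * v k)"
    if G: "G \<in> carrier_mat n m" and l: "l < n" for G v l
  proof -
    have "Tb *\<^sub>v (G *\<^sub>v vec m v) = (Tb * G) *\<^sub>v vec m v"
      using Tb G by (intro assoc_mult_mat_vec[symmetric, of _ n n _ m]) auto
    then show ?thesis using Tb G l by (simp only: mat_vec_vec[of "Tb * G" n m] mult_carrier_mat[of _ n n])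
  qed
  have both: "(Tb *\<^sub>v (G *\<^sub>v (?Ti *\<^sub>v vec n z) + H *\<^sub>v vec m v)) $ l
      = (\<Sum>k<n. (Tb * G * ?Ti) $$ (l, k) * z k) + (\<Sum>k<m. (Tb * H) $$ (l, k) * v k)"
    if G: "G \<in> carrier_mat n n" and H: "H \<in> carrier_mat n m" and l: "l < n" for G H z v l
  proof -
    have v: "G *\<^sub>v (?Ti *\<^sub>v vec n z) \<in> carrier_vec n" "H *\<^sub>v vec m v \<in> carrier_vec n"
      using G H Ti by auto
    show ?thesis
      unfolding mult_add_distrib_mat_vec[OF Tb v] state[OF G l, symmetric] input[OF H l, symmetric]
      using Tb v l by simp
  qed
  interpret Bs: balanced_system \<Omega> F q K w n m A B N M T U p C \<sigma> \<gamma>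
  proof unfold_locales
    show "0 < \<sigma> l" if "l < n" for l by (rule bal(4)[OF that])
    show "0 \<le> \<gamma>" using assms(4) by simp
  next
    fix z v :: "nat \<Rightarrow> real"
    let ?x = "?Ti *\<^sub>v vec n z" and ?v = "vec m v"
    have x: "?x \<in> carrier_vec n" and v: "?v \<in> carrier_vec m" using Ti by auto
    have vv: "?v \<bullet> ?v = (\<Sum>k<m. (v k)\<^sup>2)" by (simp add: scalar_prod_def lessThan_atLeast0 power2_eq_square)
    have r: "(Tb *\<^sub>v (coeff_A S *\<^sub>v ?x + coeff_B S *\<^sub>v ?v)) $ l = L.rate n z v l" if "l < n" for l
      unfolding both[OF c(1,2) that] by (simp add: L.rate_def A_def B_def c')
    have nf: "W.noise_form (\<lambda>i. (Tb *\<^sub>v (coeff_N S i *\<^sub>v ?x + coeff_M S i *\<^sub>v ?v)) $ l) = W.noise_form (\<lambda>i. L.vol n z v i l)" if "l < n" for l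
      unfolding W.noise_form_def by (intro sum.cong refl) (simp add: both[OF c(3,4) that] L.vol_def N_def M_def c')
    have "(\<Sum>l<n. 1 / \<sigma> l * (2 * (z l * L.rate n z v l) + W.noise_form (\<lambda>i. L.vol n z v i l)))
      = (\<Sum>l<n. 1 / \<sigma> l * (2 * ((Tb *\<^sub>v ?x) $ l * (Tb *\<^sub>v (coeff_A S *\<^sub>v ?x + coeff_B S *\<^sub>v ?v)) $ l)
        + W.noise_form (\<lambda>i. (Tb *\<^sub>v (coeff_N S i *\<^sub>v ?x + coeff_M S i *\<^sub>v ?v)) $ l)))"
      by (intro sum.cong refl) (simp only: lessThan_iff coord r nf)
    also have "\<dots> \<le> \<gamma> * (?v \<bullet> ?v)"
      by (rule W.reachability_form[OF dims Tb bal(5) assms(5) x v])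
    finally show "(\<Sum>l<n. 1 / \<sigma> l * (2 * (z l * L.rate n z v l) + W.noise_form (\<lambda>i. L.vol n z v i l))) \<le> \<gamma> * (\<Sum>k<m. (v k)\<^sup>2)"
      unfolding vv .
  next
    fix z :: "nat \<Rightarrow> real"
    let ?x = "?Ti *\<^sub>v vec n z"
    have x: "?x \<in> carrier_vec n" using Ti by auto
    have r: "(Tb *\<^sub>v (coeff_A S *\<^sub>v ?x)) $ l = L.rate n z (\<lambda>_. 0) l" if "l < n" for l
      unfolding state[OF c(1) that] by (simp add: L.rate_def A_def c')
    have nf: "W.noise_form (\<lambda>i. (Tb *\<^sub>v (coeff_N S i *\<^sub>v ?x)) $ l) = W.noise_form (\<lambda>i. L.vol n z (\<lambda>_. 0) i l)" if "l < n" for l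
      unfolding W.noise_form_def by (intro sum.cong refl) (simp add: state[OF c(3) that] L.vol_def N_def c')
    have "coeff_C S *\<^sub>v ?x = coeff_C ?S' *\<^sub>v vec n z"
      unfolding c' using c(5) Ti by (intro assoc_mult_mat_vec[symmetric, of _ p n _ n]) auto
    then have "(coeff_C S *\<^sub>v ?x) \<bullet> (coeff_C S *\<^sub>v ?x) = (\<Sum>s<p. (\<Sum>k<n. C s k * z k)\<^sup>2)"
      using cc(5) by (simp add: scalar_prod_def lessThan_atLeast0 power2_eq_square C_def)
    then have "(\<Sum>l<n. \<sigma> l * (2 * (z l * L.rate n z (\<lambda>_. 0) l) + W.noise_form (\<lambda>i. L.vol n z (\<lambda>_. 0) i l))) + (\<Sum>s<p. (\<Sum>k<n. C s k * z k)\<^sup>2)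
      = (\<Sum>l<n. \<sigma> l * (2 * ((Tb *\<^sub>v ?x) $ l * (Tb *\<^sub>v (coeff_A S *\<^sub>v ?x)) $ l)
        + W.noise_form (\<lambda>i. (Tb *\<^sub>v (coeff_N S i *\<^sub>v ?x)) $ l))) + (coeff_C S *\<^sub>v ?x) \<bullet> (coeff_C S *\<^sub>v ?x)"
      by (intro arg_cong2[of _ _ _ _ "(+)"] sum.cong refl) (simp_all only: lessThan_iff coord r nf)
    also have "\<dots> \<le> 0" by (rule W.observability_form[OF dims Tb bal(6) assms(6) x])
    finally show "(\<Sum>l<n. \<sigma> l * (2 * (z l * L.rate n z (\<lambda>_. 0) l) + W.noise_form (\<lambda>i. L.vol n z (\<lambda>_. 0) i l))) + (\<Sum>s<p. (\<Sum>k<n. C s k * z k)\<^sup>2) \<le> 0" .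
  qed
  interpret Tr: truncated_system \<Omega> F q K w n m A B N M T U p C \<sigma> \<gamma> r X Xr
    by unfold_locales (use rn solX solXr in auto)
  have xc: "x t \<omega> \<in> carrier_vec n" and xrc: "x\<^sub>r t \<omega> \<in> carrier_vec r" and uc: "u t \<omega> \<in> carrier_vec m"
    if "0 \<le> t" "t \<le> T" "\<omega> \<in> space \<Omega>" for t \<omega>
    using assms(12,13,15) that by (auto simp: sde_solution_def L2T_def)
  have err: "(y t \<omega> - y\<^sub>r t \<omega>) \<bullet> (y t \<omega> - y\<^sub>r t \<omega>) = Tr.output_error (t, \<omega>)"
    if t: "0 \<le> t" "t \<le> T" "\<omega> \<in> space \<Omega>" for t \<omega>
  proof -
    have Cr: "coeff_C ?Sr \<in> carrier_mat p r" "coeff_D ?Sr = coeff_D S"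
      by (simp_all add: truncate_sys_def transform_sys_def upper_left_def)
    have y: "y t \<omega> = coeff_C S *\<^sub>v x t \<omega> + coeff_D S *\<^sub>v u t \<omega>"
      "y\<^sub>r t \<omega> = coeff_C ?Sr *\<^sub>v x\<^sub>r t \<omega> + coeff_D S *\<^sub>v u t \<omega>"
      by (simp_all add: assms(14,16) sys_output_def Cr)
    have yc: "y t \<omega> \<in> carrier_vec p" "y\<^sub>r t \<omega> \<in> carrier_vec p"
      unfolding y using c Cr xc[OF t] xrc[OF t] uc[OF t] by auto
    have e: "(y t \<omega> - y\<^sub>r t \<omega>) $ s = (\<Sum>k<n. C s k * X k (t, \<omega>)) - (\<Sum>k<r. C s k * Xr k (t, \<omega>))" if s: "s < p" for s
    proof -
      have "(y t \<omega> - y\<^sub>r t \<omega>) $ s = (coeff_C S *\<^sub>v x t \<omega>) $ s - (coeff_C ?Sr *\<^sub>v x\<^sub>r t \<omega>) $ s"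
        using yc s c Cr unfolding y by simp
      also have "(coeff_C S *\<^sub>v x t \<omega>) $ s = (\<Sum>k<n. (coeff_C ?S' * Tb) $$ (s, k) * x t \<omega> $ k)"
        unfolding out by (rule W.mat_vec_index[OF c(5) xc[OF t] s])
      also have "\<dots> = (\<Sum>k<n. C s k * X k (t, \<omega>))"
        unfolding mat_mult_sum[OF cc(5) Tb s, symmetric] C_def X_def X0_def using t by (simp add: W.ext_def)
      also have "(coeff_C ?Sr *\<^sub>v x\<^sub>r t \<omega>) $ s = (\<Sum>k<r. coeff_C ?Sr $$ (s, k) * x\<^sub>r t \<omega> $ k)"
        by (rule W.mat_vec_index[OF Cr(1) xrc[OF t] s])
      also have "\<dots> = (\<Sum>k<r. C s k * Xr k (t, \<omega>))"
        using s t by (intro sum.cong refl) (simp add: C_def Xr_def W.ext_def truncate_sys_def upper_left_def)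
      finally show ?thesis .
    qed
    have "(y t \<omega> - y\<^sub>r t \<omega>) \<bullet> (y t \<omega> - y\<^sub>r t \<omega>) = (\<Sum>s<p. ((y t \<omega> - y\<^sub>r t \<omega>) $ s)\<^sup>2)"
      using yc by (simp add: scalar_prod_def lessThan_atLeast0 power2_eq_square)
    also have "\<dots> = Tr.output_error (t, \<omega>)" unfolding Tr.output_error_def by (intro sum.cong refl) (simp only: e lessThan_iff)
    finally show ?thesis .
  qed
  have inp: "u t \<omega> \<bullet> u t \<omega> = (\<Sum>k<m. (U k (t, \<omega>))\<^sup>2)" if t: "0 \<le> t" "t \<le> T" "\<omega> \<in> space \<Omega>" for t \<omega>
    using uc[OF t] t by (simp add: scalar_prod_def lessThan_atLeast0 power2_eq_square U_def W.ext_def)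
  have ny: "L2T_norm \<Omega> T (\<lambda>t \<omega>. y t \<omega> - y\<^sub>r t \<omega>) = ennreal (sqrt (\<integral>z. Tr.output_error z \<partial>W.win 0 T))"
    by (rule W.L2T_norm_eq[OF Tr.output_error_integrable Tr.output_error_nonneg err])
  have iU: "integrable (W.win 0 T) (\<lambda>z. \<Sum>k<m. (U k z)\<^sup>2)"
    by (intro Bochner_Integration.integrable_sum sq_int_integrable U_sq) auto
  have nu: "L2T_norm \<Omega> T u = ennreal (sqrt (Bs.input_energy 0 T))"
    unfolding Bs.input_energy_def by (rule W.L2T_norm_eq[OF iU _ inp]) (auto intro: sum_nonneg)
  let ?s = "\<Sum>k\<in>{r..<n}. \<sigma> k"
  have s: "0 \<le> ?s" using bal(4) by (intro sum_nonneg less_imp_le) auto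
  have "sqrt (\<integral>z. Tr.output_error z \<partial>W.win 0 T) \<le> sqrt (4 * \<gamma> * ?s\<^sup>2 * Bs.input_energy 0 T)"
    by (intro real_sqrt_le_mono Tr.output_error_bound)
  also have "\<dots> = 2 * sqrt \<gamma> * ?s * sqrt (Bs.input_energy 0 T)"
    using s by (simp add: real_sqrt_mult)
  finally have "ennreal (sqrt (\<integral>z. Tr.output_error z \<partial>W.win 0 T)) \<le> ennreal (2 * sqrt \<gamma> * ?s * sqrt (Bs.input_energy 0 T))"
    by (rule ennreal_leI)
  also have "\<dots> = ennreal (2 * sqrt \<gamma> * ?s) * ennreal (sqrt (Bs.input_energy 0 T))"
    using s assms(4) by (intro ennreal_mult') auto
  finally show ?thesis unfolding ny nu .
qed

end
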